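(* Let $\varphi$ be a $G_2$-structure on a $7$-manifold with torsion $T$. From the $G_2$-Bianchi identity $$G_{pij}:=\nabla_iT_{jp}-\nabla_jT_{ip}-T_{ia}T_{jb}\varphi_{abp}-\tfrac12R_{ijab}\varphi_{abp}=0$$ one can extract the following independent relations between the Riemann curvature $\mathrm{Rm}$ and $\nabla T$: $$\begin{aligned} (\mathbf{G1})\quad& R=(\mathrm{tr}\,T)^2-\langle T,T^t\rangle-\langle T,\mathsf{P}T\rangle-2\,\mathrm{div}(\mathsf{V}T),\\ (\mathbf{G7_a})\quad& \mathrm{div}\,T^t-\nabla(\mathrm{tr}\,T)-T(\mathsf{V}T)=0,\\ (\mathbf{G7_b})\quad& \langle\nabla T,\psi\rangle-(\mathrm{tr}\,T)\mathsf{V}T+\mathsf{V}(T^2)+T^t(\mathsf{V}T)=0,\\ (\mathbf{G14})\quad& \pi_{14}({}_3K)=-(\mathrm{tr}\,T)T_{14}+(T^2)_{14}+((\mathsf{P}T)T)_{14},\\ (\mathbf{G27_a})\quad& ({}_3K)_{27}=\tfrac12(T\circledcirc T)_{27}+\tfrac14F_{27},\\ (\mathbf{G27_b})\quad& ({}_2K)_{27}=-\tfrac12(\mathcal{L}_{\mathsf{V}T}g)_{27}+(\mathrm{tr}\,T)T_{27}-(T^2)_{27}-\mathrm{Rc}_{27}. \end{aligned}$$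
   Context: A $G_2$-structure on a smooth $7$-manifold $M$ is a smooth $3$-form $\varphi$ which is nondegenerate: it determines a Riemannian metric $g$ and volume form $\mathrm{vol}$ by $(X\lrcorner\varphi)\wedge(Y\lrcorner\varphi)\wedge\varphi=-6\,g(X,Y)\,\mathrm{vol}$. Let $\nabla$ be the Levi-Civita connection of $g$ and $\psi=\star\varphi$. Indices refer to a local $g$-orthonormal frame, repeated indices are summed, and $\varphi_{ijk}\varphi_{abk}=g_{ia}g_{jb}-g_{ib}g_{ja}-\psi_{ijab}$. Vector fields and $1$-forms are identified by $g$; $\langle A,B\rangle=A_{ij}B_{ij}$. The torsion is the unique $2$-tensor $T$ with $\nabla_m\varphi_{ijk}=T_{mp}\psi_{pijk}$; the identity $G_{pij}=0$ holds for every $G_2$-structure. For $2$-tensors: $(A^t)_{ij}=A_{ji}$, $\mathrm{tr}\,A=A_{ii}$, $(AB)_{ij}=A_{ip}B_{pj}$, $A^2=AA$, $(A(Y))_i=A_{ij}Y_j$, $(\mathsf{P}A)_{ab}=A_{ij}\psi_{ijab}$, $(\mathsf{V}A)_k=A_{ij}\varphi_{ijk}$, $(A\circledcirc A)_{pq}=A_{im}A_{jn}\varphi_{ijp}\varphi_{mnq}$. For any $2$-tensor $A$, $A_{27}$ is its traceless symmetric part, and $A_{14}=\pi_{14}(A)$ is the component of its skew part in $\Omega^2_{14}=\{\beta\in\Omega^2:\mathsf{P}\beta=2\beta\}$, with respect to the orthogonal splitting $\Omega^2=\Omega^2_7\oplus\Omega^2_{14}$, $\Omega^2_7=\{\mathsf{P}\beta=-4\beta\}$.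 Further: $(\mathrm{div}\,T^t)_k=\nabla_iT_{ki}$, $\mathrm{div}\,Y=\nabla_kY_k$ for a vector field $Y$, $\langle\nabla T,\psi\rangle_m=\nabla_iT_{jk}\psi_{ijkm}$, ${}_2K_{ab}=\nabla_pT_{aq}\varphi_{pbq}$, ${}_3K_{ab}=\nabla_pT_{qa}\varphi_{pqb}$. Curvature: $R_{ijkl}=g(\nabla_{e_i}\nabla_{e_j}e_k-\nabla_{e_j}\nabla_{e_i}e_k-\nabla_{[e_i,e_j]}e_k,e_l)$, $\mathrm{Rc}_{jk}=R_{ljkl}$, $R=\mathrm{Rc}_{jj}$, $F_{pq}=R_{ijkl}\varphi_{ijp}\varphi_{klq}$. "Independent" refers to the fact that the relations express the vanishing of linearly independent $G_2$-irreducible components (one of dimension $1$, two of dimension $7$, one of dimension $14$, two of dimension $27$) of the tensor $G_{pij}$, which is skew in $i,j$. *)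

theory Defs
  imports "HOL-Analysis.Analysis" "HOL-Combinatorics.Permutations"
begin

text \<open>
  A chart is a pair of its domain and its coordinate map. A covariant tensor at a point is given by
  its components, indexed by lists of indices; for a tensor of rank \<open>k\<close> only the values on lists of
  length \<open>k\<close> are meaningful. A tensor field assigns to every chart the coordinate components, as
  functions on the image of the chart in \<open>real^7\<close>.
\<close>

type_synonym 'a chart = "'a set \<times> ('a \<Rightarrow> real^7)"
type_synonym tensor = "7 list \<Rightarrow> real"
type_synonym local_tensor = "real^7 \<Rightarrow> tensor"
type_synonym 'a tensor_field = "'a chart \<Rightarrow> local_tensor"
type_synonym vfield = "real^7 \<Rightarrow> real^7"
type_synonym frame = "7 \<Rightarrow> vfield"

definition chart_image :: "'a chart \<Rightarrow> (real^7) set" where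
  "chart_image C = snd C ` fst C"

definition pderiv_at :: "7 \<Rightarrow> (real^7 \<Rightarrow> real) \<Rightarrow> real^7 \<Rightarrow> real" where
  "pderiv_at i f u = frechet_derivative f (at u) (axis i 1)"

primrec C_diff :: "nat \<Rightarrow> (real^7) set \<Rightarrow> (real^7 \<Rightarrow> real) \<Rightarrow> bool" where
  "C_diff 0 V f \<longleftrightarrow> continuous_on V f"
| "C_diff (Suc n) V f \<longleftrightarrow> f differentiable_on V \<and> (\<forall>i. C_diff n V (pderiv_at i f))"

definition smooth_fun :: "(real^7) set \<Rightarrow> (real^7 \<Rightarrow> real) \<Rightarrow> bool" where
  "smooth_fun V f \<longleftrightarrow> (\<forall>n. C_diff n V f)"

definition transition :: "'a chart \<Rightarrow> 'a chart \<Rightarrow> real^7 \<Rightarrow> real^7" where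
  "transition C D u = snd D (inv_into (fst C) (snd C) u)"

definition smooth_manifold :: "'a topology \<Rightarrow> 'a chart set \<Rightarrow> bool" where
  "smooth_manifold M atlas \<longleftrightarrow>
     Hausdorff_space M \<and> second_countable M \<and> (\<Union>C\<in>atlas. fst C) = topspace M \<and>
     (\<forall>C\<in>atlas. openin M (fst C) \<and> open (chart_image C) \<and>
        homeomorphic_map (subtopology M (fst C)) (top_of_set (chart_image C)) (snd C)) \<and>
     (\<forall>C\<in>atlas. \<forall>D\<in>atlas. \<forall>i.
        smooth_fun (snd C ` (fst C \<inter> fst D)) (\<lambda>u. transition C D u $ i))"

definition tensor_field :: "'a chart set \<Rightarrow> nat \<Rightarrow> 'a tensor_field \<Rightarrow> bool" where
  "tensor_field atlas k t \<longleftrightarrow>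
     (\<forall>C\<in>atlas. \<forall>is. length is = k \<longrightarrow> smooth_fun (chart_image C) (\<lambda>u. t C u is)) \<and>
     (\<forall>C\<in>atlas. \<forall>D\<in>atlas. \<forall>p \<in> fst C \<inter> fst D. \<forall>is. length is = k \<longrightarrow>
        t C (snd C p) is =
          (\<Sum>js | length js = k.
             (\<Prod>r<k. pderiv_at (is ! r) (\<lambda>u. transition C D u $ (js ! r)) (snd C p))
             * t D (snd D p) js))"

definition alternating :: "nat \<Rightarrow> tensor \<Rightarrow> bool" where
  "alternating k a \<longleftrightarrow>
     (\<forall>is r s. length is = k \<and> r < s \<and> s < k \<longrightarrow> a (is[r := is ! s, s := is ! r]) = - a is)"

definition wedge :: "nat \<Rightarrow> nat \<Rightarrow> tensor \<Rightarrow> tensor \<Rightarrow> tensor" where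
  "wedge k l a b is =
     (\<Sum>\<sigma> | \<sigma> permutes {..<k + l}.
        of_int (sign \<sigma>) * a (map (\<lambda>r. is ! \<sigma> r) [0..<k]) * b (map (\<lambda>r. is ! \<sigma> r) [k..<k + l]))
     / (fact k * fact l)"

definition interior_prod :: "real^7 \<Rightarrow> tensor \<Rightarrow> tensor" where
  "interior_prod X a is = (\<Sum>i\<in>UNIV. X $ i * a (i # is))"

text \<open>Evaluation of a tensor on the vectors \<open>e\<close> (all frame indices, coordinates summed).\<close>

definition comps :: "(7 \<Rightarrow> real^7) \<Rightarrow> tensor \<Rightarrow> tensor" where
  "comps e t is = (\<Sum>js | length js = length is. (\<Prod>r<length is. e (is ! r) $ (js ! r)) * t js)"

text \<open>
  Hodge star of a \<open>k\<close>-form, all components being taken in an orthonormal basis in which the volume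
  form has components \<open>vol\<close>; the basis need not be positively oriented.
\<close>

definition hodge_star :: "tensor \<Rightarrow> nat \<Rightarrow> tensor \<Rightarrow> tensor" where
  "hodge_star vol k a js = (\<Sum>is | length is = k. a is * vol (is @ js)) / fact k"

definition ginner :: "tensor \<Rightarrow> real^7 \<Rightarrow> real^7 \<Rightarrow> real" where
  "ginner \<gamma> X Y = (\<Sum>i\<in>UNIV. \<Sum>j\<in>UNIV. \<gamma> [i, j] * X $ i * Y $ j)"

definition gmatrix :: "tensor \<Rightarrow> real^7^7" where
  "gmatrix \<gamma> = (\<chi> i j. \<gamma> [i, j])"

definition riemannian_metric :: "'a chart set \<Rightarrow> 'a tensor_field \<Rightarrow> bool" where
  "riemannian_metric atlas g \<longleftrightarrow> tensor_field atlas 2 g \<and>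
     (\<forall>C\<in>atlas. \<forall>u\<in>chart_image C.
        (\<forall>i j. g C u [i, j] = g C u [j, i]) \<and> (\<forall>X. X \<noteq> 0 \<longrightarrow> ginner (g C u) X X > 0))"

definition diff_form :: "'a chart set \<Rightarrow> nat \<Rightarrow> 'a tensor_field \<Rightarrow> bool" where
  "diff_form atlas k a \<longleftrightarrow> tensor_field atlas k a \<and>
     (\<forall>C\<in>atlas. \<forall>u\<in>chart_image C. alternating k (a C u))"

text \<open>A volume form of \<open>g\<close> (for one of the orientations): \<open>\<plusminus> sqrt (det g)\<close> in coordinates.\<close>

definition volume_form :: "'a chart set \<Rightarrow> 'a tensor_field \<Rightarrow> 'a tensor_field \<Rightarrow> bool" where
  "volume_form atlas g vol \<longleftrightarrow> diff_form atlas 7 vol \<and>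
     (\<forall>C\<in>atlas. \<forall>u\<in>chart_image C. \<forall>is. length is = 7 \<and> distinct is \<longrightarrow>
        (vol C u is)\<^sup>2 = det (gmatrix (g C u)))"

definition christoffel :: "local_tensor \<Rightarrow> real^7 \<Rightarrow> 7 \<Rightarrow> 7 \<Rightarrow> 7 \<Rightarrow> real" where
  "christoffel \<gamma> u k i j = (1/2) * (\<Sum>l\<in>UNIV. matrix_inv (gmatrix (\<gamma> u)) $ k $ l *
     (pderiv_at i (\<lambda>v. \<gamma> v [j, l]) u + pderiv_at j (\<lambda>v. \<gamma> v [i, l]) u
      - pderiv_at l (\<lambda>v. \<gamma> v [i, j]) u))"

text \<open>Levi-Civita connection \<open>\<nabla>\<^sub>X Y\<close> of the metric \<open>\<gamma>\<close>, in a chart.\<close>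

definition nabla :: "local_tensor \<Rightarrow> vfield \<Rightarrow> vfield \<Rightarrow> vfield" where
  "nabla \<gamma> X Y u = frechet_derivative Y (at u) (X u) +
     (\<chi> k. \<Sum>i\<in>UNIV. \<Sum>j\<in>UNIV. christoffel \<gamma> u k i j * X u $ i * Y u $ j)"

definition lie_bracket :: "vfield \<Rightarrow> vfield \<Rightarrow> vfield" where
  "lie_bracket X Y u = frechet_derivative Y (at u) (X u) - frechet_derivative X (at u) (Y u)"

definition orthonormal_frame ::
    "'a chart \<Rightarrow> 'a tensor_field \<Rightarrow> (real^7) set \<Rightarrow> frame \<Rightarrow> bool" where
  "orthonormal_frame C g W E \<longleftrightarrow> open W \<and> W \<subseteq> chart_image C \<and>
     (\<forall>i k. smooth_fun W (\<lambda>u. E i u $ k)) \<and>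
     (\<forall>u\<in>W. \<forall>i j. ginner (g C u) (E i u) (E j u) = (if i = j then 1 else 0))"

definition frame_tensor :: "frame \<Rightarrow> local_tensor \<Rightarrow> local_tensor" where
  "frame_tensor E t u = comps (\<lambda>i. E i u) (t u)"

definition conn_coeff :: "local_tensor \<Rightarrow> frame \<Rightarrow> real^7 \<Rightarrow> 7 \<Rightarrow> 7 \<Rightarrow> 7 \<Rightarrow> real" where
  "conn_coeff \<gamma> E u m i a = ginner (\<gamma> u) (nabla \<gamma> (E m) (E i) u) (E a u)"

text \<open>
  Frame components of \<open>\<nabla>t\<close>, where \<open>t\<close> has the frame components \<open>t v is\<close> and the first index of the
  result is the direction of differentiation:
  \<open>(\<nabla>\<^sub>m t)(e_i, e_j, \<dots>) = e_m (t(e_i, e_j, \<dots>)) - t(\<nabla>\<^sub>m e_i, e_j, \<dots>) - t(e_i, \<nabla>\<^sub>m e_j, \<dots>) - \<dots>\<close>.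
\<close>

primrec cov_deriv :: "local_tensor \<Rightarrow> frame \<Rightarrow> local_tensor \<Rightarrow> real^7 \<Rightarrow> tensor" where
  "cov_deriv \<gamma> E t u [] = 0"
| "cov_deriv \<gamma> E t u (m # is) =
     frechet_derivative (\<lambda>v. t v is) (at u) (E m u)
     - (\<Sum>r<length is. \<Sum>a\<in>UNIV. conn_coeff \<gamma> E u m (is ! r) a * t u (is[r := a]))"

definition riemann :: "local_tensor \<Rightarrow> frame \<Rightarrow> real^7 \<Rightarrow> real^7^7^7^7" where
  "riemann \<gamma> E u = (\<chi> i j k l. ginner (\<gamma> u)
     (nabla \<gamma> (E i) (nabla \<gamma> (E j) (E k)) u - nabla \<gamma> (E j) (nabla \<gamma> (E i) (E k)) u
      - nabla \<gamma> (lie_bracket (E i) (E j)) (E k) u) (E l u))"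

definition lie_metric :: "local_tensor \<Rightarrow> frame \<Rightarrow> vfield \<Rightarrow> real^7 \<Rightarrow> real^7^7" where
  "lie_metric \<gamma> E Y u = (\<chi> a b.
     frechet_derivative (\<lambda>v. ginner (\<gamma> v) (E a v) (E b v)) (at u) (Y u)
     - ginner (\<gamma> u) (lie_bracket Y (E a) u) (E b u)
     - ginner (\<gamma> u) (E a u) (lie_bracket Y (E b) u))"

definition g2_structure ::
    "'a chart set \<Rightarrow> 'a tensor_field \<Rightarrow> 'a tensor_field \<Rightarrow> 'a tensor_field \<Rightarrow> bool" where
  "g2_structure atlas \<phi> g vol \<longleftrightarrow>
     diff_form atlas 3 \<phi> \<and> riemannian_metric atlas g \<and> volume_form atlas g vol \<and>
     (\<forall>C\<in>atlas. \<forall>u\<in>chart_image C. \<forall>X Y is. length is = 7 \<longrightarrow>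
        wedge 4 3 (wedge 2 2 (interior_prod X (\<phi> C u)) (interior_prod Y (\<phi> C u))) (\<phi> C u) is
        = - 6 * ginner (g C u) X Y * vol C u is)"

definition psi_frame :: "frame \<Rightarrow> local_tensor \<Rightarrow> local_tensor \<Rightarrow> local_tensor" where
  "psi_frame E \<phi> vol u = hodge_star (frame_tensor E vol u) 3 (frame_tensor E \<phi> u)"

definition torsion_of ::
    "'a chart set \<Rightarrow> 'a tensor_field \<Rightarrow> 'a tensor_field \<Rightarrow> 'a tensor_field \<Rightarrow> 'a tensor_field
     \<Rightarrow> bool" where
  "torsion_of atlas \<phi> g vol T \<longleftrightarrow> tensor_field atlas 2 T \<and>
     (\<forall>C\<in>atlas. \<forall>W E. orthonormal_frame C g W E \<longrightarrow>
        (\<forall>u\<in>W. \<forall>m i j k.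
           cov_deriv (g C) E (frame_tensor E (\<phi> C)) u [m, i, j, k] =
           (\<Sum>p\<in>UNIV. frame_tensor E (T C) u [m, p] * psi_frame E (\<phi> C) (vol C) u [p, i, j, k])))"

text \<open>
  From here on all components refer to an orthonormal basis, \<open>\<phi>\<close> and \<open>\<psi>\<close> are the components of the
  3-form and of its Hodge dual, 2-tensors are matrices (so that the library's matrix operations and
  inner product apply), \<open>D\<close> stands for \<open>\<nabla>T\<close> with \<open>D $ m $ i $ j = \<nabla>\<^sub>m T\<^sub>i\<^sub>j\<close>, and \<open>Rm\<close> for the Riemann
  tensor.
\<close>

definition PP :: "tensor \<Rightarrow> real^7^7 \<Rightarrow> real^7^7" where
  "PP \<psi> A = (\<chi> a b. \<Sum>i\<in>UNIV. \<Sum>j\<in>UNIV. A $ i $ j * \<psi> [i, j, a, b])"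

definition VV :: "tensor \<Rightarrow> real^7^7 \<Rightarrow> real^7" where
  "VV \<phi> A = (\<chi> k. \<Sum>i\<in>UNIV. \<Sum>j\<in>UNIV. A $ i $ j * \<phi> [i, j, k])"

definition circ_prod :: "tensor \<Rightarrow> real^7^7 \<Rightarrow> real^7^7 \<Rightarrow> real^7^7" where
  "circ_prod \<phi> A B = (\<chi> p q. \<Sum>i\<in>UNIV. \<Sum>j\<in>UNIV. \<Sum>m\<in>UNIV. \<Sum>n\<in>UNIV.
     A $ i $ m * B $ j $ n * \<phi> [i, j, p] * \<phi> [m, n, q])"

definition skew_part :: "real^7^7 \<Rightarrow> real^7^7" where
  "skew_part A = (1/2) *\<^sub>R (A - transpose A)"

definition Omega7 :: "tensor \<Rightarrow> (real^7^7) set" where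
  "Omega7 \<psi> = {B. transpose B = - B \<and> PP \<psi> B = - 4 *\<^sub>R B}"

definition Omega14 :: "tensor \<Rightarrow> (real^7^7) set" where
  "Omega14 \<psi> = {B. transpose B = - B \<and> PP \<psi> B = 2 *\<^sub>R B}"

definition part14 :: "tensor \<Rightarrow> real^7^7 \<Rightarrow> real^7^7" where
  "part14 \<psi> A = (THE B. B \<in> Omega14 \<psi> \<and> skew_part A - B \<in> Omega7 \<psi>)"

definition Sym0 :: "(real^7^7) set" where
  "Sym0 = {B. transpose B = B \<and> trace B = 0}"

definition part27 :: "real^7^7 \<Rightarrow> real^7^7" where
  "part27 A = (1/2) *\<^sub>R (A + transpose A) - (trace A / 7) *\<^sub>R mat 1"

definition div_transp :: "real^7^7^7 \<Rightarrow> real^7" where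
  "div_transp D = (\<chi> k. \<Sum>i\<in>UNIV. D $ i $ k $ i)"

definition nabla_psi :: "tensor \<Rightarrow> real^7^7^7 \<Rightarrow> real^7" where
  "nabla_psi \<psi> D = (\<chi> m. \<Sum>i\<in>UNIV. \<Sum>j\<in>UNIV. \<Sum>k\<in>UNIV. D $ i $ j $ k * \<psi> [i, j, k, m])"

definition K2 :: "tensor \<Rightarrow> real^7^7^7 \<Rightarrow> real^7^7" where
  "K2 \<phi> D = (\<chi> a b. \<Sum>p\<in>UNIV. \<Sum>q\<in>UNIV. D $ p $ a $ q * \<phi> [p, b, q])"

definition K3 :: "tensor \<Rightarrow> real^7^7^7 \<Rightarrow> real^7^7" where
  "K3 \<phi> D = (\<chi> a b. \<Sum>p\<in>UNIV. \<Sum>q\<in>UNIV. D $ p $ q $ a * \<phi> [p, q, b])"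

definition Rc :: "real^7^7^7^7 \<Rightarrow> real^7^7" where
  "Rc Rm = (\<chi> j k. \<Sum>l\<in>UNIV. Rm $ l $ j $ k $ l)"

definition F_tensor :: "tensor \<Rightarrow> real^7^7^7^7 \<Rightarrow> real^7^7" where
  "F_tensor \<phi> Rm = (\<chi> p q. \<Sum>i\<in>UNIV. \<Sum>j\<in>UNIV. \<Sum>k\<in>UNIV. \<Sum>l\<in>UNIV.
     Rm $ i $ j $ k $ l * \<phi> [i, j, p] * \<phi> [k, l, q])"

definition bianchi_G :: "tensor \<Rightarrow> real^7^7 \<Rightarrow> real^7^7^7 \<Rightarrow> real^7^7^7^7 \<Rightarrow> real^7^7^7" where
  "bianchi_G \<phi> T D Rm = (\<chi> p i j. D $ i $ j $ p - D $ j $ i $ p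
     - (\<Sum>a\<in>UNIV. \<Sum>b\<in>UNIV. T $ i $ a * T $ j $ b * \<phi> [a, b, p])
     - (1/2) * (\<Sum>a\<in>UNIV. \<Sum>b\<in>UNIV. Rm $ i $ j $ a $ b * \<phi> [a, b, p]))"

definition G2_group :: "tensor \<Rightarrow> (real^7^7) set" where
  "G2_group \<phi> = {A. invertible A \<and> (\<forall>i j k. comps (\<lambda>m. column m A) \<phi> [i, j, k] = \<phi> [i, j, k])}"

text \<open>
  The group acts on covariant tensors by pull-back. (This is a right action, which makes no
  difference for invariant subspaces and equivariant maps.)
\<close>

definition act1 :: "real^7^7 \<Rightarrow> real^7 \<Rightarrow> real^7" where
  "act1 A v = transpose A *v v"

definition act2 :: "real^7^7 \<Rightarrow> real^7^7 \<Rightarrow> real^7^7" where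
  "act2 A B = transpose A ** B ** A"

definition act3 :: "real^7^7 \<Rightarrow> real^7^7^7 \<Rightarrow> real^7^7^7" where
  "act3 A H = (\<chi> p i j. \<Sum>a\<in>UNIV. \<Sum>b\<in>UNIV. \<Sum>c\<in>UNIV.
     A $ a $ p * A $ b $ i * A $ c $ j * H $ a $ b $ c)"

text \<open>The space of tensors \<open>H\<^sub>p\<^sub>i\<^sub>j\<close> that are skew in \<open>i\<close>, \<open>j\<close>, in which \<open>bianchi_G\<close> takes its values.\<close>

definition skew_tensors :: "(real^7^7^7) set" where
  "skew_tensors = {H. \<forall>p i j. H $ p $ i $ j = - H $ p $ j $ i}"

definition G2_irreducible ::
    "tensor \<Rightarrow> (real^7^7 \<Rightarrow> 'v::euclidean_space \<Rightarrow> 'v) \<Rightarrow> 'v set \<Rightarrow> bool" where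
  "G2_irreducible \<phi> act V \<longleftrightarrow>
     subspace V \<and> V \<noteq> {0} \<and> (\<forall>A\<in>G2_group \<phi>. act A ` V \<subseteq> V) \<and>
     (\<forall>S. subspace S \<and> S \<subseteq> V \<and> (\<forall>A\<in>G2_group \<phi>. act A ` S \<subseteq> S) \<longrightarrow> S = {0} \<or> S = V)"

definition G2_component ::
    "tensor \<Rightarrow> (real^7^7 \<Rightarrow> 'v::euclidean_space \<Rightarrow> 'v) \<Rightarrow> 'v set \<Rightarrow> nat \<Rightarrow> (real^7^7^7 \<Rightarrow> 'v) \<Rightarrow> bool"
  where
  "G2_component \<phi> act V d L \<longleftrightarrow>
     linear L \<and> L ` skew_tensors = V \<and> G2_irreducible \<phi> act V \<and> dim V = d \<and>
     (\<forall>A\<in>G2_group \<phi>. \<forall>H\<in>skew_tensors. L (act3 A H) = act A (L H))"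

definition algebraic_curvature :: "real^7^7^7^7 \<Rightarrow> bool" where
  "algebraic_curvature Rm \<longleftrightarrow> (\<forall>i j k l.
     Rm $ i $ j $ k $ l = - Rm $ j $ i $ k $ l \<and> Rm $ i $ j $ k $ l = - Rm $ i $ j $ l $ k \<and>
     Rm $ i $ j $ k $ l + Rm $ j $ k $ i $ l + Rm $ k $ i $ j $ l = 0)"

text \<open>
  \<open>\<nabla>\<^sub>m (VV T)\<^sub>k\<close> in terms of \<open>T\<close> and \<open>\<nabla>T\<close>, expanded by the product rule and
  \<open>\<nabla>\<^sub>m \<phi>\<^sub>i\<^sub>j\<^sub>k = T\<^sub>m\<^sub>p \<psi>\<^sub>p\<^sub>i\<^sub>j\<^sub>k\<close>.
\<close>

definition nabla_VV :: "tensor \<Rightarrow> tensor \<Rightarrow> real^7^7 \<Rightarrow> real^7^7^7 \<Rightarrow> real^7^7" where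
  "nabla_VV \<phi> \<psi> T D = (\<chi> m k. \<Sum>i\<in>UNIV. \<Sum>j\<in>UNIV. D $ m $ i $ j * \<phi> [i, j, k]
     + T $ i $ j * (\<Sum>p\<in>UNIV. T $ m $ p * \<psi> [p, i, j, k]))"

text \<open>
  Since \<open>bianchi_G\<close> vanishes for every actual \<open>G\<^sub>2\<close>-structure, it is for arbitrary algebraic values of
  \<open>T\<close>, \<open>\<nabla>T\<close>, \<open>Rm\<close> at a point (\<open>Rm\<close> with the symmetries of a curvature tensor) that one can say that a
  relation is the vanishing of a component of \<open>bianchi_G\<close>: the difference of the two sides of each
  relation is the value at \<open>bianchi_G\<close> of an equivariant linear map onto an irreducible space.
  Independence of the components is joint surjectivity of these maps. In the relations,
  \<open>\<nabla>\<^sub>k (tr T) = \<nabla>\<^sub>k T\<^sub>i\<^sub>i\<close>, and \<open>L\<^sub>Y g\<close> is \<open>\<nabla>Y\<close> plus its transpose.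
\<close>

definition independent_relations :: "tensor \<Rightarrow> tensor \<Rightarrow> bool" where
  "independent_relations \<phi> \<psi> \<longleftrightarrow> (\<exists>L1 L7a L7b L14 L27a L27b.
     G2_component \<phi> (\<lambda>A x. x) (UNIV :: real set) 1 L1 \<and>
     G2_component \<phi> act1 UNIV 7 L7a \<and>
     G2_component \<phi> act1 UNIV 7 L7b \<and>
     G2_component \<phi> act2 (Omega14 \<psi>) 14 L14 \<and>
     G2_component \<phi> act2 Sym0 27 L27a \<and>
     G2_component \<phi> act2 Sym0 27 L27b \<and>
     (\<lambda>H. (L1 H, L7a H, L7b H, L14 H, L27a H, L27b H)) ` skew_tensors
       = UNIV \<times> UNIV \<times> UNIV \<times> Omega14 \<psi> \<times> Sym0 \<times> Sym0 \<and>
     (\<forall>T D Rm. algebraic_curvature Rm \<longrightarrow>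
       (let H = bianchi_G \<phi> T D Rm; Y = VV \<phi> T; dY = nabla_VV \<phi> \<psi> T D;
            dtr = (\<chi> k. trace (D $ k))
        in
          L1 H = trace (Rc Rm)
            - ((trace T)\<^sup>2 - T \<bullet> transpose T - T \<bullet> PP \<psi> T - 2 * trace dY) \<and>
          L7a H = div_transp D - dtr - T *v Y \<and>
          L7b H = nabla_psi \<psi> D - trace T *\<^sub>R Y + VV \<phi> (T ** T) + transpose T *v Y \<and>
          L14 H = part14 \<psi> (K3 \<phi> D)
            - (- trace T *\<^sub>R part14 \<psi> T + part14 \<psi> (T ** T) + part14 \<psi> (PP \<psi> T ** T)) \<and>
          L27a H = part27 (K3 \<phi> D)
            - ((1/2) *\<^sub>R part27 (circ_prod \<phi> T T) + (1/4) *\<^sub>R part27 (F_tensor \<phi> Rm)) \<and>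
          L27b H = part27 (K2 \<phi> D)
            - (- (1/2) *\<^sub>R part27 (dY + transpose dY) + trace T *\<^sub>R part27 T
               - part27 (T ** T) - part27 (Rc Rm)))))"

end

theory Submission
  imports Defs
begin

text \<open>
  Pointwise part. Maximising \<open>\<phi>\<close> over triples of unit vectors yields orthonormal \<open>e\<^sub>0, e\<^sub>1, e\<^sub>3\<close> with
  \<open>\<phi>(e\<^sub>0, e\<^sub>1, \<cdot>) = l e\<^sub>3\<close> and cyclically. The rest of \<open>\<phi>\<close> consists of three 2-forms and a 3-form on the
  complementary 4-space; the equation that determines the metric makes the 3-form vanish and the 2-forms
  self-dual, with \<open>l = 1\<close>. Hence \<open>\<phi>\<close> is orthogonally equivalent to the form of the Fano plane, for which
  the contraction identities and the irreducibility of the representations of dimension 7, 14 and 27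
  (by means of signed permutations and one rotation in the stabiliser) are finite computations.
  The relations are then contractions of \<open>G\<^sub>p\<^sub>i\<^sub>j\<close> with \<open>g\<close>, \<open>\<phi>\<close> and \<open>\<psi>\<close>.

  Analytic part. In an orthonormal frame the connection coefficients act on tensors by derivations, and
  \<open>\<psi> = g g - g g - \<phi>\<phi>\<close> determines \<open>\<nabla>\<psi>\<close> from \<open>\<nabla>\<phi>\<close>. Contracting the Ricci identity for \<open>\<phi>\<close>
  with \<open>\<psi>\<close> gives \<open>G = 0\<close>.
\<close>

subsection \<open>Contraction identities\<close>

text \<open>The relations are first proved off the manifold: for arbitrary \<open>T\<close>,
  \<open>D\<close> and any \<open>Rm\<close> with the curvature symmetries, the difference of the
  two sides of each one is a fixed linear map applied to \<open>bianchi_G\<close>. The same maps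
  witness independence, and for a torsion tensor only their value at 0 matters.

  The contraction identity for \<phi>\<phi> is nowhere assumed. A \<open>g2_structure\<close>
  provides one cubic equation between form, metric and volume, so everything pointwise has to pass
  through the normal form. As \<psi> is built from the volume form in that equation, and the
  equation fixes its sign, frames of either orientation give the same identities.

  The stubborn relation is the one of dimension 14. Contraction produces the projection of
  \<open>circ_prod\<close>, whereas the relation contains \<open>T ** T\<close> and
  \<open>PP \<psi> T ** T\<close>. The bridge is that \<open>Omega14\<close> is the Lie algebra of
  the stabiliser of \<phi>, so that its elements can be moved across \<phi> as derivations.\<close>

definition kd :: "7 \<Rightarrow> 7 \<Rightarrow> real" where
  "kd i j = (if i = j then 1 else 0)"

lemma kd_sym: "kd i j = kd j i"
  by (simp add: kd_def)

lemma kd_same [simp]: "kd i i = 1"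
  by (simp add: kd_def)

lemma if_mult_zero:
  fixes x y :: real
  shows "(if P then x else 0) * y = (if P then x * y else 0)"
    and "y * (if P then x else 0) = (if P then y * x else 0)"
  by auto

lemma sum_kd [simp]:
  fixes f :: "7 \<Rightarrow> real"
  shows "(\<Sum>i\<in>UNIV. kd i j * f i) = f j" "(\<Sum>i\<in>UNIV. kd j i * f i) = f j"
    "(\<Sum>i\<in>UNIV. f i * kd i j) = f j" "(\<Sum>i\<in>UNIV. f i * kd j i) = f j"
  by (simp_all add: kd_def if_mult_zero sum.delta sum.delta')

text \<open>Skewness and one contraction identity: all other contractions of \<phi> and \<psi>, with
  their constants 6, -4 and 24, follow from these. Nothing here refers to an explicit form, so the
  relations can be derived in any orthonormal basis.\<close>

locale g2_alg =
  fixes \<phi> \<psi> :: tensor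
  assumes phi_skew1: "\<phi> [j, i, k] = - \<phi> [i, j, k]"
    and phi_skew2: "\<phi> [i, k, j] = - \<phi> [i, j, k]"
    and psi_skew1: "\<psi> [j, i, k, l] = - \<psi> [i, j, k, l]"
    and psi_skew2: "\<psi> [i, k, j, l] = - \<psi> [i, j, k, l]"
    and psi_skew3: "\<psi> [i, j, l, k] = - \<psi> [i, j, k, l]"
    and phi_phi: "(\<Sum>k\<in>UNIV. \<phi> [i, j, k] * \<phi> [a, b, k]) =
       kd i a * kd j b - kd i b * kd j a - \<psi> [i, j, a, b]"
begin

lemmas phi_skew = phi_skew1 phi_skew2

lemma phi_cyc: "\<phi> [j, k, i] = \<phi> [i, j, k]"
  using phi_skew1[of j i k] phi_skew2[of j k i] by linarith

lemma psi_cyc3: "\<psi> [c, a, b, k] = \<psi> [a, b, c, k]"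
  using psi_skew1[of c a b k] psi_skew2[of a c b k] by linarith

lemma psi_pair: "\<psi> [a, b, i, j] = \<psi> [i, j, a, b]"
  using psi_skew1[of a i b j] psi_skew2[of a i b j] psi_skew3[of i a b j] psi_skew3[of i j a b] psi_skew2[of i a j b]
   psi_skew2[of i j a b] psi_cyc3[of i a b j] by linarith

lemma phi_zero [simp]: "\<phi> [i, i, k] = 0" "\<phi> [i, k, i] = 0" "\<phi> [k, i, i] = 0"
  using phi_skew1[of i i k] phi_skew2[of k i i] phi_skew1[of i k i] phi_skew2[of i i k] by linarith+

lemma psi_zero [simp]: "\<psi> [i, i, k, l] = 0" "\<psi> [k, i, i, l] = 0" "\<psi> [k, l, i, i] = 0"
   "\<psi> [i, k, i, l] = 0" "\<psi> [k, i, l, i] = 0" "\<psi> [i, k, l, i] = 0"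
  using psi_skew1[of i i k l] psi_skew2[of k i i l] psi_skew3[of k l i i]
    psi_skew2[of i i k l] psi_skew3[of k i i l] psi_skew2[of i k i l] psi_skew3[of i k i l]
  by linarith+

lemma phi_phi2: "(\<Sum>j\<in>UNIV. \<Sum>k\<in>UNIV. \<phi> [i, j, k] * \<phi> [a, j, k]) = 6 * kd i a"
  by (simp add: phi_phi sum_subtractf kd_sym[of _ a])

text \<open>Replacing \<psi> by \<open>phi_phi\<close> and contracting the triple product of \<phi>
  in the other order gives, with cyclicity in the last three indices, the sum of \<open>C\<close> at
  a five-tuple and at its rotation by two places. As five is odd, the alternating sum over the five
  rotations leaves twice a single \<open>C\<close>.\<close>

lemma phi_psi:
  "(\<Sum>k\<in>UNIV. \<phi> [i, j, k] * \<psi> [a, b, c, k]) =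
     kd i a * \<phi> [j, b, c] + kd i b * \<phi> [a, j, c] + kd i c * \<phi> [a, b, j]
     - kd a j * \<phi> [i, b, c] - kd b j * \<phi> [a, i, c] - kd c j * \<phi> [a, b, i]"
proof -
  define C where "C i j a b c = (\<Sum>k\<in>UNIV. \<phi> [i, j, k] * \<psi> [a, b, c, k])" for i j a b c
  have cyc: "C i j a b c = C i j c a b" for i j a b c
    unfolding C_def by (simp only: psi_cyc3[of c a b])
  have S: "C i j a b c + C a b i j c =
     kd a c * \<phi> [i, j, b] - kd b c * \<phi> [i, j, a]
     - \<phi> [a, b, i] * kd c j + \<phi> [a, b, j] * kd c i" for i j a b c
  proof -
    have "C i j a b c = (\<Sum>k\<in>UNIV. \<phi> [i, j, k] * (kd a c * kd b k - kd a k * kd b c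
              - (\<Sum>m\<in>UNIV. \<phi> [a, b, m] * \<phi> [c, k, m])))"
      unfolding C_def phi_phi by simp
    also have "\<dots> = kd a c * \<phi> [i, j, b] - kd b c * \<phi> [i, j, a]
        - (\<Sum>k\<in>UNIV. \<Sum>m\<in>UNIV. \<phi> [a, b, m] * (\<phi> [m, c, k] * \<phi> [i, j, k]))"
    proof -
      have "(\<Sum>k\<in>UNIV. \<phi> [i, j, k] * (kd a c * kd b k)) = kd a c * \<phi> [i, j, b]"
        using sum_kd(4)[of "\<lambda>k. \<phi> [i, j, k] * kd a c" b] by (simp add: mult_ac)
      moreover have "(\<Sum>k\<in>UNIV. \<phi> [i, j, k] * (kd a k * kd b c)) = kd b c * \<phi> [i, j, a]"
        using sum_kd(4)[of "\<lambda>k. \<phi> [i, j, k] * kd b c" a] by (simp add: mult_ac)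
      moreover have "\<phi> [c, k, m] = \<phi> [m, c, k]" for k m
        by (rule phi_cyc)
      ultimately show ?thesis
        by (simp add: right_diff_distrib sum_subtractf sum_distrib_left mult_ac)
    qed
    \<comment> \<open>Contracting over \<open>k\<close> first turns the triple product of \<phi>
      back into \<phi>\<psi>, now with the pairs \<open>i j\<close> and \<open>a b\<close>
      exchanged.\<close>
    also have "(\<Sum>k\<in>UNIV. \<Sum>m\<in>UNIV. \<phi> [a, b, m] * (\<phi> [m, c, k] * \<phi> [i, j, k])) =
       (\<Sum>m\<in>UNIV. \<phi> [a, b, m] * (kd m i * kd c j - kd m j * kd c i - \<psi> [m, c, i, j]))"
      by (subst sum.swap) (simp add: sum_distrib_left[symmetric] phi_phi)
    also have "\<dots> = \<phi> [a, b, i] * kd c j - \<phi> [a, b, j] * kd c i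
        - (\<Sum>m\<in>UNIV. \<phi> [a, b, m] * \<psi> [m, c, i, j])"
    proof -
      have "(\<Sum>m\<in>UNIV. \<phi> [a, b, m] * (kd m i * kd c j)) = \<phi> [a, b, i] * kd c j"
        using sum_kd(3)[of "\<lambda>m. \<phi> [a, b, m] * kd c j" i] by (simp add: mult_ac)
      moreover have "(\<Sum>m\<in>UNIV. \<phi> [a, b, m] * (kd m j * kd c i)) = \<phi> [a, b, j] * kd c i"
        using sum_kd(3)[of "\<lambda>m. \<phi> [a, b, m] * kd c i" j] by (simp add: mult_ac)
      ultimately show ?thesis
        by (simp add: right_diff_distrib sum_subtractf)
    qed
    also have "(\<Sum>m\<in>UNIV. \<phi> [a, b, m] * \<psi> [m, c, i, j]) = - C a b i j c"
    proof -
      have "\<psi> [m, c, i, j] = - \<psi> [i, j, c, m]" for m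
        using psi_pair[of m c i j] psi_skew3[of i j m c] by linarith
      thus ?thesis by (simp add: C_def sum_negf)
    qed
    finally show ?thesis by simp
  qed
  have 1: "C i j a b c + C a b c i j = kd a c * \<phi> [i, j, b] - kd b c * \<phi> [i, j, a]
     - \<phi> [a, b, i] * kd c j + \<phi> [a, b, j] * kd c i" for i j a b c
    using S[of i j a b c] cyc[of a b i j c] by simp
  have k: "kd b a = kd a b" "kd c a = kd a c" "kd i a = kd a i" "kd j a = kd a j" "kd c b = kd b c"
    "kd i b = kd b i" "kd j b = kd b j" "kd i c = kd c i" "kd j c = kd c j" "kd j i = kd i j"
    by (simp_all add: kd_sym)
  have p: "\<phi> [x, z, y] = - \<phi> [x, y, z]" "\<phi> [y, x, z] = - \<phi> [x, y, z]" "\<phi> [y, z, x] = \<phi> [x, y, z]"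
     "\<phi> [z, x, y] = \<phi> [x, y, z]" "\<phi> [z, y, x] = - \<phi> [x, y, z]" for x y z
    using phi_skew1[of y x z] phi_skew2[of x z y] phi_cyc[of x y z] phi_cyc[of z x y] phi_skew1[of z y x] phi_skew2[of y z x]
      phi_skew2[of z x y] phi_cyc[of y z x]
    by linarith+
  note P = p[where x = i and y = j and z = a]
    p[where x = i and y = j and z = b]
    p[where x = i and y = j and z = c]
    p[where x = i and y = a and z = b]
    p[where x = i and y = a and z = c]
    p[where x = i and y = b and z = c]
    p[where x = j and y = a and z = b]
    p[where x = j and y = a and z = c]
    p[where x = j and y = b and z = c]
    p[where x = a and y = b and z = c]
  show ?thesis
    unfolding C_def[symmetric]
    using 1[of i j a b c] 1[of a b c i j] 1[of c i j a b] 1[of j a b c i] 1[of b c i j a]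
    unfolding k P mult_minus_right mult_minus_left by (simp add: algebra_simps)
qed

end

section \<open>Reordering and contracting finite sums\<close>

lemma sum_rot3: "(\<Sum>a\<in>A. \<Sum>b\<in>B. \<Sum>c\<in>C. f a b c) = (\<Sum>b\<in>B. \<Sum>c\<in>C. \<Sum>a\<in>A. f a b c)"
proof -
  have "(\<Sum>a\<in>A. \<Sum>b\<in>B. \<Sum>c\<in>C. f a b c) = (\<Sum>b\<in>B. \<Sum>a\<in>A. \<Sum>c\<in>C. f a b c)"
    by (rule sum.swap)
  also have "\<dots> = (\<Sum>b\<in>B. \<Sum>c\<in>C. \<Sum>a\<in>A. f a b c)"
    by (intro sum.cong refl sum.swap)
  finally show ?thesis .
qed

lemma sum_swap23: "(\<Sum>a\<in>A. \<Sum>b\<in>B. \<Sum>c\<in>C. f a b c) = (\<Sum>a\<in>A. \<Sum>c\<in>C. \<Sum>b\<in>B. f a b c)"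
  by (intro sum.cong refl sum.swap)

lemma sum_contract:
  fixes g :: "'a \<Rightarrow> 'b::comm_semiring_0"
  shows "(\<Sum>p\<in>P. (\<Sum>a\<in>A. \<Sum>b\<in>B. X a b * f a b p) * g p) =
     (\<Sum>a\<in>A. \<Sum>b\<in>B. X a b * (\<Sum>p\<in>P. f a b p * g p))"
  unfolding sum_distrib_left sum_distrib_right mult.assoc by (rule sum_rot3)

lemma sum2_kd:
  fixes f :: "7 \<Rightarrow> 7 \<Rightarrow> real"
  shows "(\<Sum>a\<in>UNIV. \<Sum>b\<in>UNIV. f a b * (kd a i * kd b j)) = f i j"
proof -
  have "(\<Sum>a\<in>UNIV. \<Sum>b\<in>UNIV. f a b * (kd a i * kd b j)) = (\<Sum>a\<in>UNIV. (\<Sum>b\<in>UNIV. f a b * kd b j) * kd a i)"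
    by (simp only: sum_distrib_left sum_distrib_right mult_ac)
  thus ?thesis by simp
qed

lemma sum2_kd':
  fixes f :: "7 \<Rightarrow> 7 \<Rightarrow> real"
  shows "(\<Sum>a\<in>UNIV. \<Sum>b\<in>UNIV. f a b * (kd b i * kd a j)) = f j i"
  using sum2_kd[of f j i] by (simp add: mult.commute)

lemma sum2_kd1:
  fixes f g :: "7 \<Rightarrow> 7 \<Rightarrow> real"
  shows "(\<Sum>a\<in>UNIV. \<Sum>b\<in>UNIV. f a b * (kd a i * g a b)) = (\<Sum>b\<in>UNIV. f i b * g i b)"
    "(\<Sum>a\<in>UNIV. \<Sum>b\<in>UNIV. f a b * (kd b i * g a b)) = (\<Sum>a\<in>UNIV. f a i * g a i)"
proof -
  have "(\<Sum>a\<in>UNIV. \<Sum>b\<in>UNIV. f a b * (kd a i * g a b)) = (\<Sum>a\<in>UNIV. (\<Sum>b\<in>UNIV. f a b * g a b) * kd a i)"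
    by (simp only: sum_distrib_left sum_distrib_right mult_ac)
  thus "(\<Sum>a\<in>UNIV. \<Sum>b\<in>UNIV. f a b * (kd a i * g a b)) = (\<Sum>b\<in>UNIV. f i b * g i b)" by simp
  have "(\<Sum>a\<in>UNIV. \<Sum>b\<in>UNIV. f a b * (kd b i * g a b)) = (\<Sum>a\<in>UNIV. \<Sum>b\<in>UNIV. (f a b * g a b) * kd b i)"
    by (simp only: mult_ac)
  thus "(\<Sum>a\<in>UNIV. \<Sum>b\<in>UNIV. f a b * (kd b i * g a b)) = (\<Sum>a\<in>UNIV. f a i * g a i)" by simp
qed

lemma sum2_skew_sym:
  fixes f g :: "'a::finite \<Rightarrow> 'a \<Rightarrow> real"
  assumes "\<And>a b. f b a = - f a b" "\<And>a b. g b a = g a b"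
  shows "(\<Sum>a\<in>UNIV. \<Sum>b\<in>UNIV. f a b * g a b) = 0"
proof -
  have "(\<Sum>a\<in>UNIV. \<Sum>b\<in>UNIV. f a b * g a b) = (\<Sum>b\<in>UNIV. \<Sum>a\<in>UNIV. f a b * g a b)"
    by (rule sum.swap)
  also have "\<dots> = (\<Sum>b\<in>UNIV. \<Sum>a\<in>UNIV. - (f b a * g b a))"
    using assms by (intro sum.cong refl) (metis mult_minus_left)
  finally show ?thesis by (simp add: sum_negf)
qed

lemma inner_matrix: "A \<bullet> B = (\<Sum>i\<in>UNIV. \<Sum>j\<in>UNIV. A $ i $ j * B $ i $ j)" for A B :: "real^'n^'m"
  by (simp add: inner_vec_def)

lemma inner_transpose: "transpose A \<bullet> transpose B = A \<bullet> B" for A B :: "real^'n^'m"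
  by (simp add: inner_matrix transpose_def) (rule sum.swap)

lemma linear_part27: "linear part27"
  by (intro linearI)
    (simp_all add: part27_def vec_eq_iff transpose_def trace_def sum.distrib sum_distrib_left[symmetric]
       algebra_simps add_divide_distrib)

lemma part27_transpose: "part27 (transpose A) = part27 A"
  by (simp add: part27_def trace_def transpose_def vec_eq_iff)

lemma part27_in_Sym0: "part27 A \<in> Sym0"
  by (simp add: Sym0_def part27_def vec_eq_iff transpose_def trace_def sum.distrib sum_subtractf
      sum_distrib_left[symmetric] mat_def sum_divide_distrib[symmetric] add_divide_distrib[symmetric] algebra_simps)

lemma part27_Sym0: "A \<in> Sym0 \<Longrightarrow> part27 A = A"
  by (simp add: Sym0_def part27_def scaleR_2[symmetric])

lemma part27_skew: "transpose A = - A \<Longrightarrow> part27 A = 0"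
proof -
  assume a: "transpose A = - A"
  hence "A $ i $ i = - A $ i $ i" for i
    by (metis (no_types, lifting) transpose_def vec_lambda_beta vector_uminus_component)
  hence "A $ i $ i = 0" for i by (metis equal_neg_zero)
  thus ?thesis by (simp add: part27_def a trace_def)
qed

context
  fixes Rm :: "real^7^7^7^7"
  assumes R: "algebraic_curvature Rm"
begin

lemma curv_skew1: "Rm $ j $ i $ k $ l = - Rm $ i $ j $ k $ l"
  and curv_skew2: "Rm $ i $ j $ l $ k = - Rm $ i $ j $ k $ l"
  and curv_bianchi: "Rm $ i $ j $ k $ l + Rm $ j $ k $ i $ l + Rm $ k $ i $ j $ l = 0"
  using R unfolding algebraic_curvature_def by (metis minus_minus)+

text \<open>The octahedron argument: the four cyclic identities, one for each index kept in the last
  slot, combine so that everything except the two pairs cancels.\<close>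

lemma curv_pair: "Rm $ k $ l $ i $ j = Rm $ i $ j $ k $ l"
proof -
  note b = curv_bianchi
  show ?thesis
    using b[of i j k l] b[of j k l i] b[of k l i j] b[of l i j k]
      curv_skew1[of i k j l] curv_skew2[of i k j l] curv_skew1[of i l j k] curv_skew2[of i l j k]
      curv_skew1[of j l i k] curv_skew2[of j l i k] curv_skew1[of j k i l] curv_skew2[of j k i l]
      curv_skew1[of i j k l] curv_skew2[of i j k l] curv_skew1[of k l i j] curv_skew2[of k l i j]
      curv_skew2[of k j i l] curv_skew2[of k i j l] curv_skew2[of l i j k] curv_skew2[of l j i k]
    by linarith
qed

text \<open>Three times the sum is its sum over the rotations of \<open>i j k\<close>; since
  \<open>h\<close> is invariant, the rotation falls on the curvature and gives the first Bianchi
  identity. Both \<phi> and \<psi> with one index fixed have this invariance.\<close>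

lemma curv_cyc_zero:
  assumes "\<And>i j k. h j k i = h i j k"
  shows "(\<Sum>i\<in>UNIV. \<Sum>j\<in>UNIV. \<Sum>k\<in>UNIV. Rm $ i $ j $ k $ l * h i j k) = 0"
proof -
  let ?S = "\<lambda>f. \<Sum>i\<in>UNIV. \<Sum>j\<in>UNIV. \<Sum>k\<in>UNIV. f i j k * h i j k :: real"
  have 1: "?S (\<lambda>i j k. Rm $ i $ j $ k $ l) = ?S (\<lambda>i j k. Rm $ k $ i $ j $ l)"
    by (subst sum_rot3) (simp add: assms)
  have 2: "?S (\<lambda>i j k. Rm $ k $ i $ j $ l) = ?S (\<lambda>i j k. Rm $ j $ k $ i $ l)"
    by (subst sum_rot3) (simp add: assms)
  have "?S (\<lambda>i j k. Rm $ i $ j $ k $ l) + ?S (\<lambda>i j k. Rm $ j $ k $ i $ l) + ?S (\<lambda>i j k. Rm $ k $ i $ j $ l) = 0"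
    by (simp add: sum.distrib[symmetric] distrib_right[symmetric] curv_bianchi)
  thus ?thesis using 1 2 by simp
qed

lemma Rc_sym: "Rc Rm $ k $ j = Rc Rm $ j $ k"
  unfolding Rc_def vec_lambda_beta
  by (intro sum.cong refl) (metis curv_pair curv_skew1 curv_skew2 minus_minus)

end

section \<open>Splitting of 2-tensors by the 3-form\<close>

context g2_alg
begin

lemma PP_eq: "PP \<psi> A $ a $ b = A $ a $ b - A $ b $ a - (\<Sum>k\<in>UNIV. VV \<phi> A $ k * \<phi> [a, b, k])"
proof -
  have "PP \<psi> A $ a $ b = (\<Sum>i\<in>UNIV. \<Sum>j\<in>UNIV. A $ i $ j * (kd i a * kd j b) - A $ i $ j * (kd j a * kd i b)
      - A $ i $ j * (\<Sum>k\<in>UNIV. \<phi> [i, j, k] * \<phi> [a, b, k]))"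
    unfolding PP_def phi_phi by (simp add: algebra_simps)
  also have "\<dots> = A $ a $ b - A $ b $ a
     - (\<Sum>i\<in>UNIV. \<Sum>j\<in>UNIV. A $ i $ j * (\<Sum>k\<in>UNIV. \<phi> [i, j, k] * \<phi> [a, b, k]))"
    by (simp only: sum_subtractf sum2_kd sum2_kd')
  finally show ?thesis
    by (simp add: VV_def sum_contract)
qed

text \<open>An isomorphism from vectors to \<open>Omega7\<close>, inverse to \<open>VV\<close> there
  up to the factor 6 of \<open>VV_WW\<close>.\<close>

definition WW :: "real^7 \<Rightarrow> real^7^7" where
  "WW X = (\<chi> a b. \<Sum>k\<in>UNIV. X $ k * \<phi> [a, b, k])"

lemma VV_WW: "VV \<phi> (WW X) = 6 *\<^sub>R X"
proof -
  have "VV \<phi> (WW X) $ m = (\<Sum>i\<in>UNIV. \<Sum>j\<in>UNIV. \<Sum>k\<in>UNIV. X $ k * (\<phi> [k, i, j] * \<phi> [m, i, j]))" for m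
    by (simp add: VV_def WW_def sum_distrib_left sum_distrib_right mult_ac phi_cyc[symmetric])
  also have "\<dots> m = (\<Sum>k\<in>UNIV. X $ k * (\<Sum>i\<in>UNIV. \<Sum>j\<in>UNIV. \<phi> [k, i, j] * \<phi> [m, i, j]))" for m
    by (subst sum_rot3[symmetric]) (simp add: sum_distrib_left)
  finally have "VV \<phi> (WW X) $ m = (\<Sum>k\<in>UNIV. 6 * X $ k * kd k m)" for m
    by (simp add: phi_phi2 mult_ac kd_sym)
  thus ?thesis by (simp add: vec_eq_iff)
qed

lemma transpose_WW: "transpose (WW X) = - WW X"
proof -
  have eq: "(\<Sum>k\<in>UNIV. X $ k * \<phi> [b, a, k]) = - (\<Sum>k\<in>UNIV. X $ k * \<phi> [a, b, k])" for a b
    unfolding phi_skew1[of b a] mult_minus_right sum_negf ..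
  show ?thesis
    unfolding vec_eq_iff WW_def transpose_def vector_uminus_component vec_lambda_beta by (intro allI eq)
qed

text \<open>Eliminates \<psi> from the splitting. On skew \<open>B\<close> the right side is
  \<open>2 *\<^sub>R B - WW (VV \<phi> B)\<close>, and \<open>VV\<close> after \<open>WW\<close> is
  multiplication by 6. Hence the eigenvalue is 2 on the kernel of \<open>VV\<close> and 2 - 6 = -4
  on the range of \<open>WW\<close>.\<close>

lemma PP_alt: "PP \<psi> A = A - transpose A - WW (VV \<phi> A)"
  by (simp add: vec_eq_iff PP_eq WW_def transpose_def)

lemma linear_VV: "linear (VV \<phi>)"
  by (intro linearI) (simp_all add: VV_def vec_eq_iff sum.distrib sum_distrib_left algebra_simps)

lemma linear_WW: "linear WW"
  by (intro linearI) (simp_all add: WW_def vec_eq_iff sum.distrib sum_distrib_left algebra_simps)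

lemma VV_transpose: "VV \<phi> (transpose A) = - VV \<phi> A"
proof -
  have "VV \<phi> (transpose A) $ k = (\<Sum>i\<in>UNIV. \<Sum>j\<in>UNIV. A $ i $ j * \<phi> [j, i, k])" for k
    unfolding VV_def transpose_def vec_lambda_beta by (rule sum.swap)
  also have "\<dots> k = - VV \<phi> A $ k" for k
    unfolding VV_def vec_lambda_beta sum_negf[symmetric] mult_minus_right[symmetric] phi_skew1[symmetric] ..
  finally show ?thesis by (simp add: vec_eq_iff)
qed

lemma WW_inj: "WW X = 0 \<Longrightarrow> X = 0"
  using VV_WW[of X] linear_0[OF linear_VV] by simp

lemma Omega14_iff: "B \<in> Omega14 \<psi> \<longleftrightarrow> transpose B = - B \<and> VV \<phi> B = 0"
proof
  assume "B \<in> Omega14 \<psi>"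
  hence s: "transpose B = - B" and "PP \<psi> B = 2 *\<^sub>R B" by (auto simp: Omega14_def)
  hence "WW (VV \<phi> B) = 0" by (simp add: PP_alt scaleR_2)
  thus "transpose B = - B \<and> VV \<phi> B = 0" using s WW_inj by blast
next
  assume "transpose B = - B \<and> VV \<phi> B = 0"
  thus "B \<in> Omega14 \<psi>" by (simp add: Omega14_def PP_alt linear_0[OF linear_WW] scaleR_2)
qed

lemma Omega7_iff: "B \<in> Omega7 \<psi> \<longleftrightarrow> transpose B = - B \<and> 6 *\<^sub>R B = WW (VV \<phi> B)"
proof -
  have "transpose B = - B \<Longrightarrow> PP \<psi> B = - 4 *\<^sub>R B \<longleftrightarrow> 6 *\<^sub>R B = WW (VV \<phi> B)"
    by (auto simp add: PP_alt vec_eq_iff algebra_simps)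
  thus ?thesis by (auto simp: Omega7_def)
qed

text \<open>The subtracted term is the component in \<open>Omega7\<close>: the factor 1/6 turns
  \<open>WW\<close> after \<open>VV\<close> into a projection. This closed form replaces the
  definite description in \<open>part14\<close>.\<close>

definition pi14 :: "real^7^7 \<Rightarrow> real^7^7" where
  "pi14 A = skew_part A - (1/6) *\<^sub>R WW (VV \<phi> A)"

lemma transpose_scaleR: "transpose (c *\<^sub>R A) = c *\<^sub>R transpose A" for A :: "real^'n^'m"
  by (simp add: vec_eq_iff transpose_def)

lemma transpose_minus: "transpose (A - B) = transpose A - transpose B" for A :: "real^'n^'m"
  by (simp add: vec_eq_iff transpose_def)

lemma linear_skew_part: "linear skew_part"
  by (intro linearI) (simp_all add: skew_part_def vec_eq_iff transpose_def algebra_simps)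

lemma linear_pi14: "linear pi14"
  unfolding pi14_def
  by (intro linear_compose_sub linear_skew_part linear_compose_scale_right
      linear_compose[OF linear_VV linear_WW, unfolded o_def])

lemma VV_skew_part: "VV \<phi> (skew_part A) = VV \<phi> A"
  by (simp add: skew_part_def linear_cmul[OF linear_VV] linear_diff[OF linear_VV] VV_transpose scaleR_2[symmetric])

lemma transpose_skew_part: "transpose (skew_part A) = - skew_part A"
  by (simp add: skew_part_def transpose_scaleR transpose_minus scaleR_minus_right[symmetric])

lemma pi14_Omega14: "pi14 A \<in> Omega14 \<psi>"
  by (simp add: Omega14_iff pi14_def transpose_minus transpose_scaleR transpose_WW transpose_skew_part
      linear_diff[OF linear_VV] linear_cmul[OF linear_VV] VV_WW VV_skew_part)

lemma subspace_Omega14: "subspace (Omega14 \<psi>)"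
proof -
  have "transpose (A + B) = transpose A + transpose B" "transpose (0 :: real^7^7) = 0" for A B :: "real^7^7"
    by (simp_all add: vec_eq_iff transpose_def)
  thus ?thesis
    unfolding subspace_def
    by (auto simp add: Omega14_iff linear_0[OF linear_VV] linear_add[OF linear_VV] linear_cmul[OF linear_VV] transpose_scaleR)
qed

lemma part14_eq: "part14 \<psi> A = pi14 A"
  unfolding part14_def
proof (rule the_equality)
  have "skew_part A - pi14 A = (1/6) *\<^sub>R WW (VV \<phi> A)" by (simp add: pi14_def)
  thus "pi14 A \<in> Omega14 \<psi> \<and> skew_part A - pi14 A \<in> Omega7 \<psi>"
    using pi14_Omega14 by (simp add: Omega7_iff transpose_scaleR transpose_WW linear_cmul[OF linear_VV] VV_WW)
next
  fix B assume B: "B \<in> Omega14 \<psi> \<and> skew_part A - B \<in> Omega7 \<psi>"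
  hence "6 *\<^sub>R (skew_part A - B) = WW (VV \<phi> (skew_part A - B))" "VV \<phi> B = 0"
    by (auto simp: Omega7_iff Omega14_iff)
  hence "6 *\<^sub>R (skew_part A - B) = WW (VV \<phi> A)"
    by (simp add: linear_diff[OF linear_VV] VV_skew_part)
  hence "skew_part A - B = (1/6) *\<^sub>R WW (VV \<phi> A)"
    by (metis (no_types, lifting) divide_inverse mult_1 pth_1 right_inverse scaleR_scaleR zero_neq_numeral mult.commute)
  thus "B = pi14 A" by (simp add: pi14_def algebra_simps)
qed

lemma inner_WW: "B \<bullet> WW X = VV \<phi> B \<bullet> X"
proof -
  have "B \<bullet> WW X = (\<Sum>a\<in>UNIV. \<Sum>b\<in>UNIV. \<Sum>k\<in>UNIV. B $ a $ b * \<phi> [a, b, k] * X $ k)"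
    by (simp only: inner_matrix WW_def vec_lambda_beta sum_distrib_left mult_ac)
  also have "\<dots> = (\<Sum>k\<in>UNIV. \<Sum>a\<in>UNIV. \<Sum>b\<in>UNIV. B $ a $ b * \<phi> [a, b, k] * X $ k)"
    by (rule sum_rot3[symmetric])
  also have "\<dots> = VV \<phi> B \<bullet> X"
    by (simp only: inner_vec_def VV_def vec_lambda_beta sum_distrib_right inner_real_def)
  finally show ?thesis .
qed

lemma inner_pi14: "B \<in> Omega14 \<psi> \<Longrightarrow> B \<bullet> pi14 A = B \<bullet> A"
proof -
  assume B: "B \<in> Omega14 \<psi>"
  hence "B \<bullet> transpose A = - (B \<bullet> A)"
    using inner_transpose[of B "transpose A"] by (simp add: Omega14_iff)
  thus ?thesis using B
    by (simp add: pi14_def inner_diff_right inner_WW Omega14_iff skew_part_def)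
qed

text \<open>The projection of the difference can itself serve as test element, so its norm is zero.
  Equations in \<open>Omega14\<close> thereby become scalar equations, in which a test element can
  be moved across \<phi>.\<close>

lemma pi14_eqI: "(\<And>B. B \<in> Omega14 \<psi> \<Longrightarrow> B \<bullet> X = B \<bullet> Y) \<Longrightarrow> pi14 X = pi14 Y"
proof -
  assume a: "\<And>B. B \<in> Omega14 \<psi> \<Longrightarrow> B \<bullet> X = B \<bullet> Y"
  let ?B = "pi14 (X - Y)"
  have "?B \<bullet> ?B = 0"
    using a[OF pi14_Omega14] by (simp add: inner_pi14[OF pi14_Omega14] inner_diff_right)
  thus ?thesis by (simp add: linear_diff[OF linear_pi14])
qed

lemma pi14_Omega14_id: "B \<in> Omega14 \<psi> \<Longrightarrow> pi14 B = B"
  by (simp add: Omega14_iff pi14_def skew_part_def linear_0[OF linear_WW] scaleR_2[symmetric])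

lemma pi14_transpose: "pi14 (transpose A) = - pi14 A"
  by (simp add: pi14_def VV_transpose linear_neg[OF linear_WW] skew_part_def algebra_simps)

lemma pi14_sym: "transpose A = A \<Longrightarrow> pi14 A = 0"
  using pi14_transpose[of A] by (simp add: eq_neg_iff_add_eq_0 scaleR_2[symmetric] del: mult_2)

text \<open>\<open>Omega14\<close> is the Lie algebra of the stabiliser of \<phi>. Contracting
  \<open>phi_psi\<close> with \<open>B\<close> gives \<open>VV \<phi> B\<close>, hence 0, on one
  side; on the other, skewness of \<open>B\<close> pairs the six terms into a multiple of the
  derivation.\<close>

lemma Omega14_derivation:
  assumes "B \<in> Omega14 \<psi>"
  shows "(\<Sum>p\<in>UNIV. B $ p $ i * \<phi> [p, j, k]) + (\<Sum>p\<in>UNIV. B $ p $ j * \<phi> [i, p, k])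
     + (\<Sum>p\<in>UNIV. B $ p $ k * \<phi> [i, j, p]) = 0"
proof -
  have V: "VV \<phi> B = 0" and t: "transpose B = - B"
    using assms unfolding Omega14_iff by simp_all
  have s: "B $ a $ b = - B $ b $ a" for a b
    using arg_cong[OF t, of "\<lambda>A. A $ b $ a"] by (simp add: transpose_def)
  have "0 = (\<Sum>m\<in>UNIV. VV \<phi> B $ m * \<psi> [i, j, k, m])" by (simp add: V)
  also have "\<dots> = (\<Sum>a\<in>UNIV. \<Sum>b\<in>UNIV. B $ a $ b * (\<Sum>m\<in>UNIV. \<phi> [a, b, m] * \<psi> [i, j, k, m]))"
    by (simp add: VV_def sum_contract)
  also have "\<dots> = (\<Sum>b\<in>UNIV. B $ i $ b * \<phi> [b, j, k]) + (\<Sum>b\<in>UNIV. B $ j $ b * \<phi> [i, b, k])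
     + (\<Sum>b\<in>UNIV. B $ k $ b * \<phi> [i, j, b]) - (\<Sum>a\<in>UNIV. B $ a $ i * \<phi> [a, j, k])
     - (\<Sum>a\<in>UNIV. B $ a $ j * \<phi> [i, a, k]) - (\<Sum>a\<in>UNIV. B $ a $ k * \<phi> [i, j, a])"
    unfolding phi_psi kd_sym[of i] kd_sym[of j] kd_sym[of k]
    by (simp add: distrib_left right_diff_distrib sum.distrib sum_subtractf sum2_kd1)
  finally show ?thesis
    unfolding s[of i] s[of j] s[of k] by (simp add: sum_negf)
qed

end

subsection \<open>Components of the Bianchi tensor\<close>

lemma sum_rot4: "(\<Sum>a\<in>A. \<Sum>b\<in>B. \<Sum>c\<in>C. \<Sum>d\<in>D. f a b c d) = (\<Sum>d\<in>D. \<Sum>a\<in>A. \<Sum>b\<in>B. \<Sum>c\<in>C. f a b c d)"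
proof -
  have "(\<Sum>a\<in>A. \<Sum>b\<in>B. \<Sum>c\<in>C. \<Sum>d\<in>D. f a b c d) = (\<Sum>a\<in>A. \<Sum>d\<in>D. \<Sum>b\<in>B. \<Sum>c\<in>C. f a b c d)"
    by (rule sum.cong[OF refl], rule sum_rot3[symmetric])
  also have "\<dots> = (\<Sum>d\<in>D. \<Sum>a\<in>A. \<Sum>b\<in>B. \<Sum>c\<in>C. f a b c d)"
    by (rule sum.swap)
  finally show ?thesis .
qed

lemma sum_swap_pairs: "(\<Sum>a\<in>A. \<Sum>b\<in>B. \<Sum>c\<in>C. \<Sum>d\<in>D. f a b c d) = (\<Sum>c\<in>C. \<Sum>d\<in>D. \<Sum>a\<in>A. \<Sum>b\<in>B. f a b c d)"
proof -
  have "(\<Sum>a\<in>A. \<Sum>b\<in>B. \<Sum>c\<in>C. \<Sum>d\<in>D. f a b c d) = (\<Sum>d\<in>D. \<Sum>a\<in>A. \<Sum>b\<in>B. \<Sum>c\<in>C. f a b c d)"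
    by (rule sum_rot4)
  also have "\<dots> = (\<Sum>c\<in>C. \<Sum>d\<in>D. \<Sum>a\<in>A. \<Sum>b\<in>B. f a b c d)"
    by (rule sum_rot4)
  finally show ?thesis .
qed

lemma skew_component: "transpose B = - B \<Longrightarrow> B $ j $ i = - B $ i $ j" for B :: "real^'n^'n"
  by (drule arg_cong[where f = "\<lambda>A. A $ i $ j"]) (simp add: transpose_def)

lemma matrix_diff_left: "(A - B) ** C = A ** C - B ** C" for A :: "real^'n^'m"
  by (simp add: vec_eq_iff matrix_matrix_mult_def sum_subtractf algebra_simps)

lemma matrix_diff_right: "C ** (A - B) = C ** A - C ** B" for A :: "real^'n^'m"
  by (simp add: vec_eq_iff matrix_matrix_mult_def sum_subtractf algebra_simps)

lemma inner_skew_sym: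
  fixes A B :: "real^'n^'n"
  assumes "transpose B = - B" "transpose A = A"
  shows "B \<bullet> A = 0"
  using inner_transpose[of B A] assms by simp

context g2_alg
begin

definition c1 :: "real^7^7^7 \<Rightarrow> real" where
  "c1 H = (\<Sum>i\<in>UNIV. \<Sum>j\<in>UNIV. \<Sum>p\<in>UNIV. H $ p $ i $ j * \<phi> [i, j, p])"
definition c7a :: "real^7^7^7 \<Rightarrow> real^7" where
  "c7a H = (\<chi> k. \<Sum>i\<in>UNIV. H $ i $ i $ k)"
text \<open>The two derivative terms of \<open>bianchi_G\<close> contribute equally, because \<psi>
  is skew in \<open>i\<close> and \<open>j\<close>; the factor 1/2 undoes this doubling.\<close>

definition c7b :: "real^7^7^7 \<Rightarrow> real^7" where
  "c7b H = (\<chi> m. (1/2) * (\<Sum>i\<in>UNIV. \<Sum>j\<in>UNIV. \<Sum>p\<in>UNIV. H $ p $ i $ j * \<psi> [i, j, p, m]))"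
text \<open>\<open>M3\<close> contracts the skew pair of \<open>H\<close> with \<phi> and leads to
  \<open>K3\<close>; \<open>M2\<close> below contracts the first index and one index of the pair and
  leads to \<open>K2\<close>. Every matrix-valued component is a projection of one of them.\<close>

definition M3 :: "real^7^7^7 \<Rightarrow> real^7^7" where
  "M3 H = (\<chi> a b. \<Sum>p\<in>UNIV. \<Sum>q\<in>UNIV. H $ a $ p $ q * \<phi> [p, q, b])"
definition M2 :: "real^7^7^7 \<Rightarrow> real^7^7" where
  "M2 H = (\<chi> a b. \<Sum>p\<in>UNIV. \<Sum>q\<in>UNIV. H $ q $ p $ a * \<phi> [p, b, q])"

text \<open>The quadratic and the curvature term of \<open>bianchi_G\<close> meet \<phi> in the same
  way, so each relation contracts their common coefficient once and separates the two parts only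
  afterwards.\<close>

definition ZZ :: "real^7^7 \<Rightarrow> real^7^7^7^7 \<Rightarrow> 7 \<Rightarrow> 7 \<Rightarrow> 7 \<Rightarrow> 7 \<Rightarrow> real" where
  "ZZ T Rm i j a b = T $ i $ a * T $ j $ b + (1/2) * Rm $ i $ j $ a $ b"

lemma bianchi_G_ZZ:
  "bianchi_G \<phi> T D Rm $ p $ i $ j =
     D $ i $ j $ p - D $ j $ i $ p - (\<Sum>a\<in>UNIV. \<Sum>b\<in>UNIV. ZZ T Rm i j a b * \<phi> [a, b, p])"
  by (simp add: bianchi_G_def ZZ_def distrib_right sum.distrib sum_distrib_left mult.assoc)

lemma trace_mult: "(\<Sum>i\<in>UNIV. \<Sum>j\<in>UNIV. T $ i $ i * T $ j $ j) = (trace T)\<^sup>2" for T :: "real^'n^'n"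
  by (simp add: trace_def power2_eq_square sum_product)

lemma T_PP_T:
  "(\<Sum>i\<in>UNIV. \<Sum>j\<in>UNIV. \<Sum>a\<in>UNIV. \<Sum>b\<in>UNIV. T $ i $ a * T $ j $ b * \<psi> [a, b, i, j]) = - (T \<bullet> PP \<psi> T)"
proof -
  have p: "\<psi> [a, b, i, j] = - \<psi> [j, b, i, a]" for a b i j
    using psi_skew1[of a b i j] psi_skew2[of b a i j] psi_skew3[of b i a j]
      psi_skew1[of j b i a] psi_skew2[of b j i a] psi_skew3[of b i j a] by linarith
  have "(\<Sum>i\<in>UNIV. \<Sum>j\<in>UNIV. \<Sum>a\<in>UNIV. \<Sum>b\<in>UNIV. T $ i $ a * T $ j $ b * \<psi> [a, b, i, j]) =
     (\<Sum>i\<in>UNIV. \<Sum>a\<in>UNIV. \<Sum>j\<in>UNIV. \<Sum>b\<in>UNIV. - (T $ i $ a * (T $ j $ b * \<psi> [j, b, i, a])))"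
    by (rule trans[OF sum_swap23], intro sum.cong refl, subst p, simp)
  thus ?thesis by (simp add: inner_matrix PP_def sum_negf sum_distrib_left)
qed

lemma nabla_VV_split:
  "nabla_VV \<phi> \<psi> T D $ m $ k = (\<Sum>i\<in>UNIV. \<Sum>j\<in>UNIV. D $ m $ i $ j * \<phi> [i, j, k])
     + (\<Sum>i\<in>UNIV. \<Sum>j\<in>UNIV. \<Sum>p\<in>UNIV. T $ i $ j * T $ m $ p * \<psi> [p, i, j, k])"
  by (simp add: nabla_VV_def sum.distrib sum_distrib_left mult.assoc)

lemma trace_nabla_VV:
  "trace (nabla_VV \<phi> \<psi> T D) = (\<Sum>k\<in>UNIV. \<Sum>i\<in>UNIV. \<Sum>j\<in>UNIV. D $ k $ i $ j * \<phi> [i, j, k]) - T \<bullet> PP \<psi> T"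
proof -
  have p: "\<psi> [p, i, j, k] = - \<psi> [i, j, k, p]" for p i j k
    using psi_skew1[of p i j k] psi_skew2[of i p j k] psi_skew3[of i j p k] by linarith
  have "(\<Sum>k\<in>UNIV. \<Sum>i\<in>UNIV. \<Sum>j\<in>UNIV. \<Sum>p\<in>UNIV. T $ i $ j * T $ k $ p * \<psi> [p, i, j, k]) =
    (\<Sum>k\<in>UNIV. \<Sum>p\<in>UNIV. \<Sum>i\<in>UNIV. \<Sum>j\<in>UNIV. - (T $ k $ p * (T $ i $ j * \<psi> [i, j, k, p])))"
    by (rule sum.cong[OF refl], rule trans[OF sum_rot3[symmetric]], intro sum.cong refl, subst p, simp)
  thus ?thesis
    by (simp add: trace_def nabla_VV_split sum.distrib inner_matrix PP_def sum_negf sum_distrib_left)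
qed

text \<open>By \<open>phi_phi\<close> the zeroth-order part becomes two double traces and one
  contraction with \<psi>. On the curvature, the traces give the scalar curvature and the
  \<psi>-term dies by the first Bianchi identity. On \<open>T\<close> the \<psi>-term is
  \<open>T \<bullet> PP \<psi> T\<close> up to sign; it occurs again in the divergence of
  \<open>VV \<phi> T\<close> through the derivative of \<phi>, which accounts for its final
  coefficient.\<close>

lemma rel1:
  assumes R: "algebraic_curvature Rm"
  shows "c1 (bianchi_G \<phi> T D Rm) = trace (Rc Rm)
     - ((trace T)\<^sup>2 - T \<bullet> transpose T - T \<bullet> PP \<psi> T - 2 * trace (nabla_VV \<phi> \<psi> T D))"
proof -
  define d where "d = (\<Sum>k\<in>UNIV. \<Sum>i\<in>UNIV. \<Sum>j\<in>UNIV. D $ k $ i $ j * \<phi> [i, j, k])"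
  define Z where "Z = ZZ T Rm"
  have 1: "(\<Sum>i\<in>UNIV. \<Sum>j\<in>UNIV. \<Sum>p\<in>UNIV. D $ i $ j $ p * \<phi> [i, j, p]) = d"
    unfolding d_def by (simp add: phi_cyc)
  have 2: "(\<Sum>i\<in>UNIV. \<Sum>j\<in>UNIV. \<Sum>p\<in>UNIV. D $ j $ i $ p * \<phi> [i, j, p]) = - d"
    unfolding 1[symmetric] sum_negf[symmetric] mult_minus_right[symmetric] phi_skew1[symmetric]
    by (rule sum.swap)
  have 3: "(\<Sum>i\<in>UNIV. \<Sum>j\<in>UNIV. \<Sum>p\<in>UNIV. (\<Sum>a\<in>UNIV. \<Sum>b\<in>UNIV. Z i j a b * \<phi> [a, b, p]) * \<phi> [i, j, p]) =
     (\<Sum>i\<in>UNIV. \<Sum>j\<in>UNIV. Z i j i j) - (\<Sum>i\<in>UNIV. \<Sum>j\<in>UNIV. Z i j j i)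
     - (\<Sum>i\<in>UNIV. \<Sum>j\<in>UNIV. \<Sum>a\<in>UNIV. \<Sum>b\<in>UNIV. Z i j a b * \<psi> [a, b, i, j])"
    by (simp add: sum_contract phi_phi right_diff_distrib sum_subtractf sum2_kd sum2_kd')
  have 4: "(\<Sum>i\<in>UNIV. \<Sum>j\<in>UNIV. Rm $ i $ j $ j $ i) = trace (Rc Rm)"
    unfolding Rc_def trace_def vec_lambda_beta by (rule sum.swap)
  have 5: "(\<Sum>i\<in>UNIV. \<Sum>j\<in>UNIV. Rm $ i $ j $ i $ j) = - trace (Rc Rm)"
    unfolding 4[symmetric] sum_negf[symmetric] curv_skew2[OF R, symmetric] ..
  have cyc: "\<psi> [i, b, j, a] = \<psi> [a, b, i, j]" for a b i j
    using psi_skew1[of b i j a] psi_skew1[of a b i j] psi_cyc3[of b i j a] psi_skew2[of b a i j]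
      psi_skew3[of b i a j] by linarith
  have 6: "(\<Sum>i\<in>UNIV. \<Sum>j\<in>UNIV. \<Sum>a\<in>UNIV. \<Sum>b\<in>UNIV. Rm $ i $ j $ a $ b * \<psi> [a, b, i, j]) = 0"
    by (subst sum_rot4) (simp add: curv_cyc_zero[OF R, of "\<lambda>i j a. \<psi> [a, _, i, j]", OF cyc])
  have 7: "(\<Sum>i\<in>UNIV. \<Sum>j\<in>UNIV. T $ i $ j * T $ j $ i) = T \<bullet> transpose T"
    by (simp add: inner_matrix transpose_def)
  have "c1 (bianchi_G \<phi> T D Rm) = d - (- d) - ((\<Sum>i\<in>UNIV. \<Sum>j\<in>UNIV. Z i j i j) - (\<Sum>i\<in>UNIV. \<Sum>j\<in>UNIV. Z i j j i)
     - (\<Sum>i\<in>UNIV. \<Sum>j\<in>UNIV. \<Sum>a\<in>UNIV. \<Sum>b\<in>UNIV. Z i j a b * \<psi> [a, b, i, j]))"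
    unfolding c1_def bianchi_G_ZZ left_diff_distrib sum_subtractf Z_def[symmetric] 1 2 3 ..
  also have "(\<Sum>i\<in>UNIV. \<Sum>j\<in>UNIV. Z i j i j) = (trace T)\<^sup>2 - (1/2) * trace (Rc Rm)"
    by (simp add: Z_def ZZ_def sum.distrib trace_mult sum_divide_distrib[symmetric] 5)
  also have "(\<Sum>i\<in>UNIV. \<Sum>j\<in>UNIV. Z i j j i) = T \<bullet> transpose T + (1/2) * trace (Rc Rm)"
    by (simp add: Z_def ZZ_def sum.distrib sum_divide_distrib[symmetric] 4 7)
  also have "(\<Sum>i\<in>UNIV. \<Sum>j\<in>UNIV. \<Sum>a\<in>UNIV. \<Sum>b\<in>UNIV. Z i j a b * \<psi> [a, b, i, j]) = - (T \<bullet> PP \<psi> T)"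
    using T_PP_T[of T] 6
    by (simp add: Z_def ZZ_def sum.distrib distrib_right sum_divide_distrib[symmetric])
  finally show ?thesis
    unfolding trace_nabla_VV d_def[symmetric] by (simp add: algebra_simps)
qed

text \<open>Contracting with the metric leaves the curvature only in a trace against \<phi>, which
  pair symmetry brings into the form of \<open>curv_cyc_zero\<close>.\<close>

lemma rel7a:
  assumes R: "algebraic_curvature Rm"
  shows "c7a (bianchi_G \<phi> T D Rm) = div_transp D - (\<chi> k. trace (D $ k)) - T *v VV \<phi> T"
proof -
  have 1: "(\<Sum>i\<in>UNIV. \<Sum>a\<in>UNIV. \<Sum>b\<in>UNIV. Rm $ i $ k $ a $ b * \<phi> [a, b, i]) = 0" for k
  proof -
    have "(\<Sum>i\<in>UNIV. \<Sum>a\<in>UNIV. \<Sum>b\<in>UNIV. Rm $ i $ k $ a $ b * \<phi> [a, b, i]) =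
      (\<Sum>a\<in>UNIV. \<Sum>b\<in>UNIV. \<Sum>i\<in>UNIV. Rm $ a $ b $ i $ k * \<phi> [a, b, i])"
      unfolding curv_pair[OF R, of _ k] by (rule sum_rot3)
    thus ?thesis by (simp add: curv_cyc_zero[OF R] phi_cyc)
  qed
  have 2: "(\<Sum>i\<in>UNIV. \<Sum>a\<in>UNIV. \<Sum>b\<in>UNIV. T $ i $ a * T $ k $ b * \<phi> [a, b, i]) = (T *v VV \<phi> T) $ k" for k
  proof -
    have "(\<Sum>i\<in>UNIV. \<Sum>a\<in>UNIV. \<Sum>b\<in>UNIV. T $ i $ a * T $ k $ b * \<phi> [a, b, i]) =
      (\<Sum>b\<in>UNIV. \<Sum>i\<in>UNIV. \<Sum>a\<in>UNIV. T $ i $ a * T $ k $ b * \<phi> [a, b, i])"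
      by (rule sum_rot3[symmetric])
    also have "\<dots> = (T *v VV \<phi> T) $ k"
      by (simp add: matrix_vector_mult_def VV_def sum_distrib_left mult_ac phi_cyc)
    finally show ?thesis .
  qed
  show ?thesis
    using 1 2 by (simp add: vec_eq_iff c7a_def bianchi_G_ZZ ZZ_def distrib_right sum.distrib sum_subtractf
      div_transp_def trace_def sum_divide_distrib[symmetric])
qed

text \<open>Valid for whole matrices; only its traceless symmetric part is used later. The
  derivative of \<phi> inside \<open>nabla_VV\<close> supplies exactly the quadratic \<psi>-term
  that the contraction leaves over, so that no separate \<psi>-term survives.\<close>

lemma rel2_matrix:
  assumes R: "algebraic_curvature Rm"
  shows "M2 (bianchi_G \<phi> T D Rm) =
     K2 \<phi> D + nabla_VV \<phi> \<psi> T D - trace T *\<^sub>R T + T ** T + Rc Rm"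
proof -
  define Z where "Z = ZZ T Rm"
  have "M2 (bianchi_G \<phi> T D Rm) $ a $ b =
     (K2 \<phi> D + nabla_VV \<phi> \<psi> T D - trace T *\<^sub>R T + T ** T + Rc Rm) $ a $ b" for a b
  proof -
    have 1: "(\<Sum>p\<in>UNIV. \<Sum>q\<in>UNIV. D $ a $ p $ q * \<phi> [p, b, q]) = - (\<Sum>p\<in>UNIV. \<Sum>q\<in>UNIV. D $ a $ p $ q * \<phi> [p, q, b])"
      unfolding sum_negf[symmetric] mult_minus_right[symmetric] phi_skew2[symmetric] ..
    have 2: "(\<Sum>p\<in>UNIV. \<Sum>q\<in>UNIV. (\<Sum>m\<in>UNIV. \<Sum>n\<in>UNIV. Z p a m n * \<phi> [m, n, q]) * \<phi> [p, b, q]) =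
       (\<Sum>p\<in>UNIV. Z p a p b) - (\<Sum>p\<in>UNIV. Z p a b p) - (\<Sum>p\<in>UNIV. \<Sum>m\<in>UNIV. \<Sum>n\<in>UNIV. Z p a m n * \<psi> [m, n, p, b])"
      by (simp add: sum_contract phi_phi right_diff_distrib sum_subtractf sum2_kd sum2_kd')
    have 3: "(\<Sum>p\<in>UNIV. Z p a p b) = trace T * T $ a $ b - (1/2) * Rc Rm $ a $ b"
    proof -
      have "(\<Sum>p\<in>UNIV. Rm $ p $ a $ p $ b) = - Rc Rm $ a $ b"
        unfolding Rc_def vec_lambda_beta sum_negf[symmetric] curv_skew2[OF R, symmetric] ..
      thus ?thesis
        by (simp add: Z_def ZZ_def sum.distrib sum_divide_distrib[symmetric] trace_def sum_distrib_right)
    qed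
    have 4: "(\<Sum>p\<in>UNIV. Z p a b p) = (T ** T) $ a $ b + (1/2) * Rc Rm $ a $ b"
      by (simp add: Z_def ZZ_def sum.distrib sum_divide_distrib[symmetric] Rc_def matrix_matrix_mult_def mult.commute)
    have 5: "(\<Sum>p\<in>UNIV. \<Sum>m\<in>UNIV. \<Sum>n\<in>UNIV. Rm $ p $ a $ m $ n * \<psi> [m, n, p, b]) = 0"
    proof -
      have "(\<Sum>p\<in>UNIV. \<Sum>m\<in>UNIV. \<Sum>n\<in>UNIV. Rm $ p $ a $ m $ n * \<psi> [m, n, p, b]) =
        (\<Sum>m\<in>UNIV. \<Sum>n\<in>UNIV. \<Sum>p\<in>UNIV. Rm $ m $ n $ p $ a * \<psi> [m, n, p, b])"
        unfolding curv_pair[OF R, of _ a] by (rule sum_rot3)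
      thus ?thesis by (simp add: curv_cyc_zero[OF R, of "\<lambda>m n p. \<psi> [m, n, p, b]"] psi_cyc3[symmetric])
    qed
    have 6: "(\<Sum>p\<in>UNIV. \<Sum>m\<in>UNIV. \<Sum>n\<in>UNIV. Z p a m n * \<psi> [m, n, p, b]) =
      (\<Sum>i\<in>UNIV. \<Sum>j\<in>UNIV. \<Sum>p\<in>UNIV. T $ i $ j * T $ a $ p * \<psi> [p, i, j, b])"
    proof -
      have "(\<Sum>p\<in>UNIV. \<Sum>m\<in>UNIV. \<Sum>n\<in>UNIV. Z p a m n * \<psi> [m, n, p, b]) =
        (\<Sum>p\<in>UNIV. \<Sum>m\<in>UNIV. \<Sum>n\<in>UNIV. T $ p $ m * T $ a $ n * \<psi> [m, n, p, b])"
        using 5 by (simp add: Z_def ZZ_def distrib_right sum.distrib sum_divide_distrib[symmetric])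
      also have "\<dots> = (\<Sum>i\<in>UNIV. \<Sum>j\<in>UNIV. \<Sum>p\<in>UNIV. T $ i $ j * T $ a $ p * \<psi> [p, i, j, b])"
        by (intro sum.cong refl arg_cong[where f = "(*) _"] trans[OF psi_cyc3[symmetric] psi_cyc3[symmetric]])
      finally show ?thesis .
    qed
    have "M2 (bianchi_G \<phi> T D Rm) $ a $ b = K2 \<phi> D $ a $ b + (\<Sum>p\<in>UNIV. \<Sum>q\<in>UNIV. D $ a $ p $ q * \<phi> [p, q, b])
        - ((\<Sum>p\<in>UNIV. Z p a p b) - (\<Sum>p\<in>UNIV. Z p a b p) - (\<Sum>p\<in>UNIV. \<Sum>m\<in>UNIV. \<Sum>n\<in>UNIV. Z p a m n * \<psi> [m, n, p, b]))"
      unfolding M2_def vec_lambda_beta bianchi_G_ZZ left_diff_distrib sum_subtractf Z_def[symmetric] 1 2 K2_def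
      by simp
    thus ?thesis
      unfolding 3 4 6 by (simp add: nabla_VV_split)
  qed
  thus ?thesis by (simp add: vec_eq_iff)
qed

text \<open>Both relations for \<open>K3\<close> come from this one matrix identity: its symmetric
  traceless part is the first relation of dimension 27, and its projection to \<open>Omega14\<close>
  loses the curvature because \<open>F_tensor\<close> is symmetric.\<close>

lemma rel3_matrix:
  "M3 (bianchi_G \<phi> T D Rm) =
     2 *\<^sub>R K3 \<phi> D - transpose (circ_prod \<phi> T T) - (1/2) *\<^sub>R transpose (F_tensor \<phi> Rm)"
proof -
  have "M3 (bianchi_G \<phi> T D Rm) $ a $ b =
     (2 *\<^sub>R K3 \<phi> D - transpose (circ_prod \<phi> T T) - (1/2) *\<^sub>R transpose (F_tensor \<phi> Rm)) $ a $ b" for a b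
  proof -
    have 1: "(\<Sum>p\<in>UNIV. \<Sum>q\<in>UNIV. D $ q $ p $ a * \<phi> [p, q, b]) = - K3 \<phi> D $ a $ b"
      unfolding K3_def vec_lambda_beta sum_negf[symmetric] mult_minus_right[symmetric] phi_skew1[symmetric]
      by (rule sum.swap)
    have 2: "(\<Sum>p\<in>UNIV. \<Sum>q\<in>UNIV. (\<Sum>m\<in>UNIV. \<Sum>n\<in>UNIV. ZZ T Rm p q m n * \<phi> [m, n, a]) * \<phi> [p, q, b]) =
       circ_prod \<phi> T T $ b $ a + (1/2) * F_tensor \<phi> Rm $ b $ a"
      by (simp add: circ_prod_def F_tensor_def ZZ_def sum_distrib_right sum_distrib_left ring_distribs sum.distrib
         sum_divide_distrib mult_ac)
    show ?thesis
      unfolding M3_def vec_lambda_beta bianchi_G_ZZ left_diff_distrib sum_subtractf 1 2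
      by (simp add: K3_def transpose_def)
  qed
  thus ?thesis by (simp add: vec_eq_iff)
qed

lemma F_tensor_sym: "algebraic_curvature Rm \<Longrightarrow> transpose (F_tensor \<phi> Rm) = F_tensor \<phi> Rm"
  unfolding vec_eq_iff transpose_def F_tensor_def vec_lambda_beta
  by (intro allI, subst sum_swap_pairs) (simp only: curv_pair mult_ac)

text \<open>Contract the derivation identity of \<open>B\<close> with \<open>VV \<phi> L\<close> and
  \<open>L\<close>. Its first two terms each give the inner product in question; the third pairs the
  skew \<open>B\<close> with the symmetric square of the vector \<open>VV \<phi> L\<close> and
  vanishes.\<close>

lemma inner_WW_mult:
  assumes B: "B \<in> Omega14 \<psi>" and L: "transpose L = - L"
  shows "B \<bullet> (WW (VV \<phi> L) ** L) = 0"
proof -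
  define v where "v = VV \<phi> L"
  have sB: "B $ a $ b = - B $ b $ a" and sL: "L $ a $ b = - L $ b $ a" for a b
    using B L skew_component unfolding Omega14_iff by blast+
  have W: "WW v $ a $ c = (\<Sum>k\<in>UNIV. v $ k * \<phi> [a, c, k])" for a c by (simp add: WW_def)
  have sW: "WW v $ a $ b = - WW v $ b $ a" for a b
    using transpose_WW skew_component by blast
  have 1: "(\<Sum>b\<in>UNIV. \<Sum>c\<in>UNIV. \<Sum>p\<in>UNIV. B $ p $ b * WW v $ p $ c * L $ c $ b) = B \<bullet> (WW v ** L)"
    by (simp add: inner_matrix matrix_matrix_mult_def sum_distrib_left mult.assoc)
      (subst sum_rot3[symmetric], rule refl)
  have 2: "(\<Sum>b\<in>UNIV. \<Sum>c\<in>UNIV. \<Sum>p\<in>UNIV. B $ p $ c * WW v $ b $ p * L $ c $ b) = B \<bullet> (WW v ** L)"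
  proof -
    have "(\<Sum>b\<in>UNIV. \<Sum>c\<in>UNIV. \<Sum>p\<in>UNIV. B $ p $ c * WW v $ b $ p * L $ c $ b) =
       (\<Sum>b\<in>UNIV. \<Sum>c\<in>UNIV. \<Sum>p\<in>UNIV. B $ p $ c * WW v $ p $ b * L $ b $ c)"
      by (intro sum.cong refl, subst sW, subst sL, simp)
    also have "\<dots> = (\<Sum>c\<in>UNIV. \<Sum>b\<in>UNIV. \<Sum>p\<in>UNIV. B $ p $ c * WW v $ p $ b * L $ b $ c)"
      by (rule sum.swap)
    finally show ?thesis using 1 by simp
  qed
  have 3: "(\<Sum>b\<in>UNIV. \<Sum>c\<in>UNIV. \<Sum>k\<in>UNIV. v $ k * (\<Sum>p\<in>UNIV. B $ p $ k * \<phi> [b, c, p]) * L $ c $ b) = 0"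
  proof -
    have "(\<Sum>b\<in>UNIV. \<Sum>c\<in>UNIV. \<Sum>k\<in>UNIV. v $ k * (\<Sum>p\<in>UNIV. B $ p $ k * \<phi> [b, c, p]) * L $ c $ b) =
       (\<Sum>k\<in>UNIV. \<Sum>b\<in>UNIV. \<Sum>c\<in>UNIV. \<Sum>p\<in>UNIV. v $ k * B $ p $ k * (\<phi> [b, c, p] * L $ c $ b))"
      by (subst sum_rot3[symmetric]) (simp add: sum_distrib_left sum_distrib_right mult.assoc)
    also have "\<dots> = (\<Sum>k\<in>UNIV. \<Sum>p\<in>UNIV. \<Sum>b\<in>UNIV. \<Sum>c\<in>UNIV. v $ k * B $ p $ k * (\<phi> [b, c, p] * L $ c $ b))"
      by (rule sum.cong[OF refl], rule sum_rot3[symmetric])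
    also have "\<dots> = (\<Sum>k\<in>UNIV. \<Sum>p\<in>UNIV. B $ p $ k * (- (v $ p * v $ k)))"
    proof -
      have "(\<Sum>b\<in>UNIV. \<Sum>c\<in>UNIV. \<phi> [b, c, p] * L $ c $ b) = - v $ p" for p
        unfolding v_def VV_def vec_lambda_beta sum_negf[symmetric]
        by (intro sum.cong refl, subst sL, simp)
      thus ?thesis by (simp add: sum_distrib_left[symmetric] mult_ac)
    qed
    also have "\<dots> = 0"
      by (rule sum2_skew_sym, rule sB, simp)
    finally show ?thesis .
  qed
  have "0 = (\<Sum>b\<in>UNIV. \<Sum>c\<in>UNIV. \<Sum>k\<in>UNIV. v $ k * ((\<Sum>p\<in>UNIV. B $ p $ b * \<phi> [p, c, k])
     + (\<Sum>p\<in>UNIV. B $ p $ c * \<phi> [b, p, k]) + (\<Sum>p\<in>UNIV. B $ p $ k * \<phi> [b, c, p])) * L $ c $ b)"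
    by (simp add: Omega14_derivation[OF B])
  also have "\<dots> = (\<Sum>b\<in>UNIV. \<Sum>c\<in>UNIV. \<Sum>k\<in>UNIV. v $ k * (\<Sum>p\<in>UNIV. B $ p $ b * \<phi> [p, c, k]) * L $ c $ b)
     + (\<Sum>b\<in>UNIV. \<Sum>c\<in>UNIV. \<Sum>k\<in>UNIV. v $ k * (\<Sum>p\<in>UNIV. B $ p $ c * \<phi> [b, p, k]) * L $ c $ b)
     + (\<Sum>b\<in>UNIV. \<Sum>c\<in>UNIV. \<Sum>k\<in>UNIV. v $ k * (\<Sum>p\<in>UNIV. B $ p $ k * \<phi> [b, c, p]) * L $ c $ b)"
    by (simp only: distrib_left distrib_right sum.distrib)
  also have "(\<Sum>b\<in>UNIV. \<Sum>c\<in>UNIV. \<Sum>k\<in>UNIV. v $ k * (\<Sum>p\<in>UNIV. B $ p $ b * \<phi> [p, c, k]) * L $ c $ b) = B \<bullet> (WW v ** L)"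
  proof -
    have "(\<Sum>k\<in>UNIV. v $ k * (\<Sum>p\<in>UNIV. B $ p $ b * \<phi> [p, c, k]) * L $ c $ b) =
       (\<Sum>p\<in>UNIV. B $ p $ b * WW v $ p $ c * L $ c $ b)" for b c
      unfolding W sum_distrib_left sum_distrib_right by (subst sum.swap) (simp only: mult_ac)
    thus ?thesis using 1 by simp
  qed
  also have "(\<Sum>b\<in>UNIV. \<Sum>c\<in>UNIV. \<Sum>k\<in>UNIV. v $ k * (\<Sum>p\<in>UNIV. B $ p $ c * \<phi> [b, p, k]) * L $ c $ b) = B \<bullet> (WW v ** L)"
  proof -
    have "(\<Sum>k\<in>UNIV. v $ k * (\<Sum>p\<in>UNIV. B $ p $ c * \<phi> [b, p, k]) * L $ c $ b) =
       (\<Sum>p\<in>UNIV. B $ p $ c * WW v $ b $ p * L $ c $ b)" for b c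
      unfolding W sum_distrib_left sum_distrib_right by (subst sum.swap) (simp only: mult_ac)
    thus ?thesis using 2 by simp
  qed
  finally show ?thesis using 3 by (simp add: v_def)
qed

text \<open>With \<open>L\<close> the difference of \<open>T\<close> and its transpose,
  \<open>PP \<psi> T ** L\<close> equals \<open>L ** L - WW (VV \<phi> T) ** L\<close>. The first
  product is symmetric and the second is covered by \<open>inner_WW_mult\<close>, so neither is seen
  by \<open>Omega14\<close>.\<close>

lemma inner_PP_transpose:
  assumes B: "B \<in> Omega14 \<psi>"
  shows "B \<bullet> (PP \<psi> T ** transpose T) = B \<bullet> (PP \<psi> T ** T)"
proof -
  define L where "L = T - transpose T"
  have L: "transpose L = - L" by (simp add: L_def transpose_minus)
  have V: "VV \<phi> L = 2 *\<^sub>R VV \<phi> T"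
    by (simp add: L_def linear_diff[OF linear_VV] VV_transpose scaleR_2)
  have "transpose (L ** L) = L ** L"
    by (simp add: matrix_transpose_mul L)  (simp add: matrix_matrix_mult_def vec_eq_iff)
  hence 1: "B \<bullet> (L ** L) = 0" using B inner_skew_sym Omega14_iff by blast
  have "B \<bullet> (WW (VV \<phi> L) ** L) = 0" by (rule inner_WW_mult[OF B L])
  hence 2: "B \<bullet> (WW (VV \<phi> T) ** L) = 0"
    by (simp add: V linear_cmul[OF linear_WW] scalar_matrix_assoc[symmetric])
  have "PP \<psi> T = L - WW (VV \<phi> T)" by (simp add: PP_alt L_def)
  hence "B \<bullet> (PP \<psi> T ** L) = 0"
    using 1 2 by (simp add: matrix_diff_left inner_diff_right)
  thus ?thesis
    by (simp add: L_def matrix_diff_right inner_diff_right)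
qed

text \<open>Converts \<open>circ_prod\<close> into the products that occur in the relation of
  dimension 14. The derivation identity moves \<open>B\<close> off the index contracted with one
  \<phi>; the remaining \<phi>\<phi> is then removed by \<open>phi_phi\<close>. The two resulting
  \<psi>-terms contain the transpose of \<open>T\<close>, which \<open>inner_PP_transpose\<close>
  removes.\<close>

lemma inner_circ_prod:
  assumes B: "B \<in> Omega14 \<psi>"
  shows "B \<bullet> circ_prod \<phi> T T = 2 * trace T * (B \<bullet> T) - 2 * (B \<bullet> (T ** T)) - 2 * (B \<bullet> (PP \<psi> T ** T))"
proof -
  have sB: "B $ a $ b = - B $ b $ a" for a b
    using B skew_component unfolding Omega14_iff by blast
  let ?S = "\<lambda>f. \<Sum>i\<in>UNIV. \<Sum>j\<in>UNIV. \<Sum>m\<in>UNIV. \<Sum>n\<in>UNIV. T $ i $ m * T $ j $ n * (f i j m n :: real)"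
  have b: "(\<Sum>q\<in>UNIV. (\<Sum>p\<in>UNIV. B $ p $ q * \<phi> [i, j, p]) * \<phi> [m, n, q]) =
     - (B $ m $ i * kd j n) + B $ n $ i * kd j m + (\<Sum>p\<in>UNIV. B $ p $ i * \<psi> [p, j, m, n])
     - (B $ n $ j * kd i m) + B $ m $ j * kd i n + (\<Sum>p\<in>UNIV. B $ p $ j * \<psi> [i, p, m, n])" for i j m n
  proof -
    have d: "(\<Sum>p\<in>UNIV. B $ p $ q * \<phi> [i, j, p]) =
       - (\<Sum>p\<in>UNIV. B $ p $ i * \<phi> [p, j, q]) - (\<Sum>p\<in>UNIV. B $ p $ j * \<phi> [i, p, q])" for q
      using Omega14_derivation[OF B, of i j q] by linarith
    have s: "(\<Sum>q\<in>UNIV. (\<Sum>p\<in>UNIV. B $ p $ k * f p q) * \<phi> [m, n, q]) =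
       (\<Sum>p\<in>UNIV. B $ p $ k * (\<Sum>q\<in>UNIV. f p q * \<phi> [m, n, q]))" for f :: "7 \<Rightarrow> 7 \<Rightarrow> real" and k
      unfolding sum_distrib_left sum_distrib_right mult.assoc by (rule sum.swap)
    have k: "(\<Sum>p\<in>UNIV. B $ p $ k * (kd p a * x)) = B $ a $ k * x" for k a x
      using sum_kd(3)[of "\<lambda>p. B $ p $ k * x" a] by (simp add: mult_ac)
    have k': "(\<Sum>p\<in>UNIV. B $ p $ k * (x * kd p a)) = B $ a $ k * x" for k a x
      using k by (simp add: mult.commute[of x])
    show ?thesis
      unfolding d left_diff_distrib sum_subtractf mult_minus_left sum_negf s phi_phi right_diff_distrib k k' by simp
  qed
  have "B \<bullet> circ_prod \<phi> T T = (\<Sum>p\<in>UNIV. \<Sum>q\<in>UNIV. \<Sum>i\<in>UNIV. \<Sum>j\<in>UNIV. \<Sum>m\<in>UNIV. \<Sum>n\<in>UNIV.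
      T $ i $ m * T $ j $ n * (B $ p $ q * \<phi> [i, j, p] * \<phi> [m, n, q]))"
    by (simp add: inner_matrix circ_prod_def sum_distrib_left mult_ac)
  also have "\<dots> = (\<Sum>i\<in>UNIV. \<Sum>j\<in>UNIV. \<Sum>p\<in>UNIV. \<Sum>q\<in>UNIV. \<Sum>m\<in>UNIV. \<Sum>n\<in>UNIV. T $ i $ m * T $ j $ n * (B $ p $ q * \<phi> [i, j, p] * \<phi> [m, n, q]))"
    by (rule sum_swap_pairs)
  also have "\<dots> = (\<Sum>i\<in>UNIV. \<Sum>j\<in>UNIV. \<Sum>m\<in>UNIV. \<Sum>n\<in>UNIV. \<Sum>p\<in>UNIV. \<Sum>q\<in>UNIV. T $ i $ m * T $ j $ n * (B $ p $ q * \<phi> [i, j, p] * \<phi> [m, n, q]))"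
    by (rule sum.cong[OF refl], rule sum.cong[OF refl], rule sum_swap_pairs)
  also have "\<dots> = (\<Sum>i\<in>UNIV. \<Sum>j\<in>UNIV. \<Sum>m\<in>UNIV. \<Sum>n\<in>UNIV. \<Sum>q\<in>UNIV. \<Sum>p\<in>UNIV. T $ i $ m * T $ j $ n * (B $ p $ q * \<phi> [i, j, p] * \<phi> [m, n, q]))"
    by (rule sum.cong[OF refl], rule sum.cong[OF refl], rule sum.cong[OF refl], rule sum.cong[OF refl], rule sum.swap)
  also have "\<dots> = ?S (\<lambda>i j m n. \<Sum>q\<in>UNIV. (\<Sum>p\<in>UNIV. B $ p $ q * \<phi> [i, j, p]) * \<phi> [m, n, q])"
    by (simp only: sum_distrib_left sum_distrib_right)
  also have "\<dots> = - ?S (\<lambda>i j m n. B $ m $ i * kd j n) + ?S (\<lambda>i j m n. B $ n $ i * kd j m)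
     + ?S (\<lambda>i j m n. \<Sum>p\<in>UNIV. B $ p $ i * \<psi> [p, j, m, n])
     - ?S (\<lambda>i j m n. B $ n $ j * kd i m) + ?S (\<lambda>i j m n. B $ m $ j * kd i n)
     + ?S (\<lambda>i j m n. \<Sum>p\<in>UNIV. B $ p $ j * \<psi> [i, p, m, n])"
    unfolding b by (simp only: distrib_left right_diff_distrib sum.distrib sum_subtractf mult_minus_right sum_negf)
  also have "?S (\<lambda>i j m n. B $ m $ i * kd j n) = - (trace T * (B \<bullet> T))"
  proof -
    have "?S (\<lambda>i j m n. B $ m $ i * kd j n) = (\<Sum>i\<in>UNIV. \<Sum>j\<in>UNIV. \<Sum>m\<in>UNIV. T $ i $ m * T $ j $ j * B $ m $ i)"
      by (simp only: mult.assoc[symmetric] sum_kd)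
    also have "\<dots> = (\<Sum>i\<in>UNIV. \<Sum>m\<in>UNIV. \<Sum>j\<in>UNIV. T $ i $ m * T $ j $ j * B $ m $ i)"
      by (rule sum_swap23)
    also have "\<dots> = (\<Sum>i\<in>UNIV. \<Sum>m\<in>UNIV. \<Sum>j\<in>UNIV. - (B $ i $ m * T $ i $ m * T $ j $ j))"
      by (intro sum.cong refl, subst sB, simp)
    finally show ?thesis
      by (simp add: inner_matrix trace_def sum_negf sum_product sum_distrib_left sum_distrib_right mult_ac)
  qed
  also have "?S (\<lambda>i j m n. B $ n $ i * kd j m) = - (B \<bullet> (T ** T))"
  proof -
    have "(\<Sum>m\<in>UNIV. \<Sum>n\<in>UNIV. T $ i $ m * T $ j $ n * (B $ n $ i * kd j m)) = (\<Sum>n\<in>UNIV. T $ i $ j * T $ j $ n * B $ n $ i)" for i j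
      by (subst sum.swap) (simp only: mult.assoc[symmetric] sum_kd)
    hence "?S (\<lambda>i j m n. B $ n $ i * kd j m) = (\<Sum>i\<in>UNIV. \<Sum>j\<in>UNIV. \<Sum>n\<in>UNIV. T $ i $ j * T $ j $ n * B $ n $ i)"
      by simp
    also have "\<dots> = (\<Sum>i\<in>UNIV. \<Sum>n\<in>UNIV. \<Sum>j\<in>UNIV. T $ i $ j * T $ j $ n * B $ n $ i)"
      by (rule sum_swap23)
    also have "\<dots> = (\<Sum>i\<in>UNIV. \<Sum>n\<in>UNIV. \<Sum>j\<in>UNIV. - (B $ i $ n * (T $ i $ j * T $ j $ n)))"
      by (intro sum.cong refl, subst sB, simp)
    finally show ?thesis
      by (simp add: inner_matrix matrix_matrix_mult_def sum_negf sum_distrib_left)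
  qed
  also have "?S (\<lambda>i j m n. \<Sum>p\<in>UNIV. B $ p $ i * \<psi> [p, j, m, n]) = - (B \<bullet> (PP \<psi> T ** transpose T))"
  proof -
    have p: "\<psi> [p, j, m, n] = - \<psi> [j, n, p, m]" for p j m n
      using psi_skew1[of p j m n] psi_skew2[of j p m n] psi_skew3[of j m p n] psi_skew2[of j m n p]
        psi_skew3[of j n m p] by linarith
    have "?S (\<lambda>i j m n. \<Sum>p\<in>UNIV. B $ p $ i * \<psi> [p, j, m, n]) =
       (\<Sum>i\<in>UNIV. \<Sum>j\<in>UNIV. \<Sum>m\<in>UNIV. \<Sum>n\<in>UNIV. \<Sum>p\<in>UNIV. T $ i $ m * T $ j $ n * (B $ p $ i * \<psi> [p, j, m, n]))"
      by (simp only: sum_distrib_left)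
    also have "\<dots> = (\<Sum>i\<in>UNIV. \<Sum>p\<in>UNIV. \<Sum>j\<in>UNIV. \<Sum>m\<in>UNIV. \<Sum>n\<in>UNIV. T $ i $ m * T $ j $ n * (B $ p $ i * \<psi> [p, j, m, n]))"
      by (rule sum.cong[OF refl], rule sum_rot4)
    also have "\<dots> = (\<Sum>p\<in>UNIV. \<Sum>i\<in>UNIV. \<Sum>j\<in>UNIV. \<Sum>m\<in>UNIV. \<Sum>n\<in>UNIV. T $ i $ m * T $ j $ n * (B $ p $ i * \<psi> [p, j, m, n]))"
      by (rule sum.swap)
    also have "\<dots> = (\<Sum>p\<in>UNIV. \<Sum>i\<in>UNIV. \<Sum>m\<in>UNIV. \<Sum>j\<in>UNIV. \<Sum>n\<in>UNIV. T $ i $ m * T $ j $ n * (B $ p $ i * \<psi> [p, j, m, n]))"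
      by (rule sum.cong[OF refl], rule sum.cong[OF refl], rule sum.swap)
    also have "\<dots> = (\<Sum>p\<in>UNIV. \<Sum>i\<in>UNIV. \<Sum>m\<in>UNIV. \<Sum>j\<in>UNIV. \<Sum>n\<in>UNIV. - (B $ p $ i * (T $ j $ n * \<psi> [j, n, p, m] * T $ i $ m)))"
      by (intro sum.cong refl, subst p, simp)
    finally show ?thesis
      by (simp add: inner_matrix matrix_matrix_mult_def PP_def transpose_def sum_negf sum_distrib_left sum_distrib_right)
  qed
  also have "?S (\<lambda>i j m n. B $ n $ j * kd i m) = - (trace T * (B \<bullet> T))"
  proof -
    have "(\<Sum>m\<in>UNIV. \<Sum>n\<in>UNIV. T $ i $ m * T $ j $ n * (B $ n $ j * kd i m)) = (\<Sum>n\<in>UNIV. T $ i $ i * T $ j $ n * B $ n $ j)" for i j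
      by (subst sum.swap) (simp only: mult.assoc[symmetric] sum_kd)
    hence "?S (\<lambda>i j m n. B $ n $ j * kd i m) = (\<Sum>i\<in>UNIV. \<Sum>j\<in>UNIV. \<Sum>n\<in>UNIV. T $ i $ i * T $ j $ n * B $ n $ j)"
      by simp
    also have "\<dots> = (\<Sum>j\<in>UNIV. \<Sum>n\<in>UNIV. \<Sum>i\<in>UNIV. T $ i $ i * T $ j $ n * B $ n $ j)"
      by (rule sum_rot3)
    also have "\<dots> = (\<Sum>j\<in>UNIV. \<Sum>n\<in>UNIV. \<Sum>i\<in>UNIV. - (T $ i $ i * (B $ j $ n * T $ j $ n)))"
      by (intro sum.cong refl, subst sB, simp)
    finally show ?thesis
      by (simp add: inner_matrix trace_def sum_negf sum_product sum_distrib_left sum_distrib_right mult_ac)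
  qed
  also have "?S (\<lambda>i j m n. B $ m $ j * kd i n) = - (B \<bullet> (T ** T))"
  proof -
    have "?S (\<lambda>i j m n. B $ m $ j * kd i n) = (\<Sum>i\<in>UNIV. \<Sum>j\<in>UNIV. \<Sum>m\<in>UNIV. T $ i $ m * T $ j $ i * B $ m $ j)"
      by (simp only: mult.assoc[symmetric] sum_kd)
    also have "\<dots> = (\<Sum>j\<in>UNIV. \<Sum>m\<in>UNIV. \<Sum>i\<in>UNIV. T $ i $ m * T $ j $ i * B $ m $ j)"
      by (rule sum_rot3)
    also have "\<dots> = (\<Sum>j\<in>UNIV. \<Sum>m\<in>UNIV. \<Sum>i\<in>UNIV. - (B $ j $ m * (T $ j $ i * T $ i $ m)))"
      by (intro sum.cong refl, subst sB, simp)
    finally show ?thesis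
      by (simp add: inner_matrix matrix_matrix_mult_def sum_negf sum_distrib_left)
  qed
  also have "?S (\<lambda>i j m n. \<Sum>p\<in>UNIV. B $ p $ j * \<psi> [i, p, m, n]) = - (B \<bullet> (PP \<psi> T ** transpose T))"
  proof -
    have "?S (\<lambda>i j m n. \<Sum>p\<in>UNIV. B $ p $ j * \<psi> [i, p, m, n]) =
       (\<Sum>i\<in>UNIV. \<Sum>j\<in>UNIV. \<Sum>m\<in>UNIV. \<Sum>n\<in>UNIV. \<Sum>p\<in>UNIV. T $ i $ m * T $ j $ n * (B $ p $ j * \<psi> [i, p, m, n]))"
      by (simp only: sum_distrib_left)
    also have "\<dots> = (\<Sum>j\<in>UNIV. \<Sum>i\<in>UNIV. \<Sum>m\<in>UNIV. \<Sum>n\<in>UNIV. \<Sum>p\<in>UNIV. T $ i $ m * T $ j $ n * (B $ p $ j * \<psi> [i, p, m, n]))"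
      by (rule sum.swap)
    also have "\<dots> = (\<Sum>j\<in>UNIV. \<Sum>n\<in>UNIV. \<Sum>p\<in>UNIV. \<Sum>i\<in>UNIV. \<Sum>m\<in>UNIV. T $ i $ m * T $ j $ n * (B $ p $ j * \<psi> [i, p, m, n]))"
      by (rule sum.cong[OF refl], rule sum_swap_pairs)
    also have "\<dots> = (\<Sum>j\<in>UNIV. \<Sum>p\<in>UNIV. \<Sum>n\<in>UNIV. \<Sum>i\<in>UNIV. \<Sum>m\<in>UNIV. T $ i $ m * T $ j $ n * (B $ p $ j * \<psi> [i, p, m, n]))"
      by (rule sum.cong[OF refl], rule sum.swap)
    also have "\<dots> = (\<Sum>p\<in>UNIV. \<Sum>j\<in>UNIV. \<Sum>n\<in>UNIV. \<Sum>i\<in>UNIV. \<Sum>m\<in>UNIV. T $ i $ m * T $ j $ n * (B $ p $ j * \<psi> [i, p, m, n]))"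
      by (rule sum.swap)
    also have "\<dots> = (\<Sum>p\<in>UNIV. \<Sum>j\<in>UNIV. \<Sum>n\<in>UNIV. \<Sum>i\<in>UNIV. \<Sum>m\<in>UNIV. - (B $ p $ j * (T $ i $ m * \<psi> [i, m, p, n] * T $ j $ n)))"
      by (intro sum.cong refl, subst psi_skew2, simp)
    finally show ?thesis
      by (simp add: inner_matrix matrix_matrix_mult_def PP_def transpose_def sum_negf sum_distrib_left sum_distrib_right)
  qed
  finally show ?thesis
    by (simp add: inner_PP_transpose[OF B] algebra_simps)
qed

end

section \<open>Sums over index lists and dimensions of the target spaces\<close>

lemma finite_lists_length [simp]: "finite {js :: 'a::finite list. length js = n}"
  using finite_lists_length_eq[of "UNIV :: 'a set" n] by simp

lemma sum_lists_Suc: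
  "(\<Sum>js :: 'a::finite list | length js = Suc n. f js) = (\<Sum>a\<in>UNIV. \<Sum>js | length js = n. f (a # js))"
proof -
  have "{js :: 'a list. length js = Suc n} = (\<lambda>(a, js). a # js) ` (UNIV \<times> {js. length js = n})"
    by (auto simp: length_Suc_conv image_iff)
  moreover have "inj_on (\<lambda>(a, js). a # js) (UNIV \<times> {js :: 'a list. length js = n})"
    by (auto simp: inj_on_def)
  ultimately show ?thesis
    by (simp add: sum.reindex sum.cartesian_product[symmetric] case_prod_beta' sum.cartesian_product)
qed

lemma comps_Nil: "comps e t [] = t []"
  by (simp add: comps_def)

lemma comps_Cons: "comps e t (i # is) = (\<Sum>a\<in>UNIV. e i $ a * comps e (\<lambda>js. t (a # js)) is)"
  by (simp add: comps_def sum_lists_Suc prod.lessThan_Suc_shift sum_distrib_left mult.assoc del: prod.lessThan_Suc)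

lemmas comps_simps = comps_Nil comps_Cons

lemma transpose_add: "transpose (A + B) = transpose A + transpose B" for A :: "real^'n^'m"
  by (simp add: vec_eq_iff transpose_def)

lemma transpose_zero: "transpose 0 = (0 :: real^'n^'m)"
  by (simp add: vec_eq_iff transpose_def)

text \<open>Index pairs are written as \<open>(i, i + d)\<close>. The set {1, 2, 4} contains exactly
  one of \<open>d\<close> and \<open>- d\<close> for each nonzero residue mod 7, so it yields 21
  orthogonal skew matrices, and together with 0 it yields 28 symmetric ones. The two spaces are
  orthogonal in dimension 49, so both lower bounds are attained.\<close>

lemma dim_transpose_parts:
  shows "dim {B :: real^7^7. transpose B = - B} = 21" "dim {B :: real^7^7. transpose B = B} = 28"
proof -
  let ?Sk = "{B :: real^7^7. transpose B = - B}" and ?Sy = "{B :: real^7^7. transpose B = B}"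
  define U where "U s i j = (\<chi> a b. kd a i * kd b j + s * (kd a j * kd b i))" for s i j
  have U: "U s i j \<bullet> U s k l = (1 + s * s) * (kd i k * kd j l) + 2 * s * (kd i l * kd j k)" for s i j k l
    by (simp add: U_def inner_matrix algebra_simps sum.distrib sum_distrib_left[symmetric] kd_sym)
  have tr: "transpose (U s i j) = s *\<^sub>R U s i j" if "s * s = 1" for s i j
    using that by (simp add: U_def transpose_def vec_eq_iff algebra_simps)
  have sub: "subspace ?Sk" "subspace ?Sy"
    by (auto simp: subspace_def transpose_add transpose_scalar transpose_zero)
  have ge: "dim {B :: real^7^7. transpose B = s *\<^sub>R B} \<ge> 7 * card J"
    if s: "s * s = 1" and J: "\<And>d e :: 7. d \<in> J \<Longrightarrow> e \<in> J \<Longrightarrow> d + e = 0 \<Longrightarrow> d = 0 \<and> e = 0" "0 \<in> J \<Longrightarrow> s = 1" for s J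
  proof -
    let ?f = "\<lambda>(i, d). U s i (i + d)"
    have nz: "U s i (i + d) \<bullet> U s i (i + d) \<noteq> 0" if "d \<in> J" for i d
      using that s J(2) by (auto simp: U kd_def)
    have orth: "U s i (i + d) \<bullet> U s k (k + e) = 0" if "d \<in> J" "e \<in> J" "(i, d) \<noteq> (k, e)" for i d k e
    proof -
      have "\<not> (i = k + e \<and> i + d = k)" if "\<not> (i = k \<and> d = e)"
      proof
        assume a: "i = k + e \<and> i + d = k"
        hence "e + d = 0" by (metis add.assoc add_cancel_left_right)
        hence "d = 0 \<and> e = 0" using J(1) \<open>d \<in> J\<close> \<open>e \<in> J\<close> by (metis add.commute)
        thus False using that a by simp
      qed
      thus ?thesis using that(3) by (auto simp: U kd_def)
    qed
    have inj: "inj_on ?f (UNIV \<times> J)"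
    proof (rule inj_onI, rule ccontr)
      fix x y assume a: "x \<in> UNIV \<times> J" "y \<in> UNIV \<times> J" "?f x = ?f y" "x \<noteq> y"
      have "?f x \<bullet> ?f y = 0" using orth a(1,2,4) by (auto simp: case_prod_beta prod_eq_iff)
      moreover have "?f x \<bullet> ?f x \<noteq> 0" using nz a(1) by (auto simp: case_prod_beta)
      ultimately show False using a(3) by simp
    qed
    have "pairwise orthogonal (?f ` (UNIV \<times> J))"
      by (rule pairwise_imageI) (auto simp: orthogonal_def case_prod_beta prod_eq_iff intro!: orth)
    moreover have "0 \<notin> ?f ` (UNIV \<times> J)"
    proof
      assume "0 \<in> ?f ` (UNIV \<times> J)"
      then obtain i d where "d \<in> J" "U s i (i + d) = 0" by auto
      thus False using nz[of d i] by simp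
    qed
    ultimately have "independent (?f ` (UNIV \<times> J))"
      by (rule pairwise_orthogonal_independent)
    moreover have "?f ` (UNIV \<times> J) \<subseteq> {B. transpose B = s *\<^sub>R B}"
      using tr[OF s] by auto
    ultimately have "card (?f ` (UNIV \<times> J)) \<le> dim {B :: real^7^7. transpose B = s *\<^sub>R B}"
      by (rule independent_card_le_dim[rotated])
    thus ?thesis using inj by (simp add: card_image card_cartesian_product)
  qed
  have J: "d + e \<noteq> 0" if "d \<in> {1, 2, 4}" "e \<in> {1, 2, 4}" for d e :: 7
    using that by auto
  have 1: "dim ?Sk \<ge> 21"
    using ge[of "-1" "{1, 2, 4}"] J by simp
  have J0: "d = 0 \<and> e = 0" if "d \<in> {0, 1, 2, 4}" "e \<in> {0, 1, 2, 4}" "d + e = 0" for d e :: 7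
    using that J[of d e] by (cases "d = 0"; cases "e = 0") simp_all
  have 2: "dim ?Sy \<ge> 28"
  proof -
    have "7 * card {0, 1, 2, 4 :: 7} \<le> dim {B :: real^7^7. transpose B = 1 *\<^sub>R B}"
      by (rule ge, simp, rule J0, assumption+, simp)
    thus ?thesis by simp
  qed
  have "dim {y \<in> UNIV. \<forall>x\<in>?Sk. orthogonal x y} + dim ?Sk = dim (UNIV :: (real^7^7) set)"
    by (rule dim_subspace_orthogonal_to_vectors[OF sub(1) subspace_UNIV]) simp
  moreover have "?Sy \<subseteq> {y \<in> UNIV. \<forall>x\<in>?Sk. orthogonal x y}"
    by (auto simp: orthogonal_def intro!: inner_skew_sym)
  ultimately have "dim ?Sy + dim ?Sk \<le> 49"
    using dim_subset[of ?Sy "{y \<in> UNIV. \<forall>x\<in>?Sk. orthogonal x y}"] by simp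
  thus "dim ?Sk = 21" "dim ?Sy = 28" using 1 2 by linarith+
qed

lemma dim_Sym0: "dim Sym0 = 27"
proof -
  let ?Sy = "{B :: real^7^7. transpose B = B}"
  have "dim {y \<in> ?Sy. \<forall>x\<in>span {mat 1}. orthogonal x y} + dim (span {mat 1 :: real^7^7}) = dim ?Sy"
    by (rule dim_subspace_orthogonal_to_vectors, rule subspace_span,
      auto simp: subspace_def transpose_add transpose_scalar transpose_zero, auto simp: span_singleton transpose_scalar)
  moreover have "{y \<in> ?Sy. \<forall>x\<in>span {mat 1}. orthogonal x y} = Sym0"
  proof -
    have i: "mat 1 \<bullet> B = trace B" for B :: "real^7^7"
      by (simp add: inner_matrix mat_def trace_def if_distrib[of "\<lambda>x. x * _"] cong: if_cong)
    have "(\<forall>x\<in>span {mat 1}. orthogonal x y) \<longleftrightarrow> trace y = 0" for y :: "real^7^7"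
      by (auto simp: orthogonal_def span_singleton i dest: spec[of _ "1::real"])
    thus ?thesis by (auto simp: Sym0_def)
  qed
  moreover have "dim (span {mat 1 :: real^7^7}) = 1"
    by (simp add: dim_insert) (simp add: mat_def vec_eq_iff)
  ultimately show ?thesis using dim_transpose_parts(2) by simp
qed

lemma subspace_Sym0: "subspace Sym0"
  by (auto simp: subspace_def Sym0_def trace_def transpose_add transpose_scalar transpose_zero sum.distrib
      sum_distrib_left[symmetric])

lemma sum_swap_2_3: "(\<Sum>p\<in>P. \<Sum>q\<in>Q. \<Sum>a\<in>A. \<Sum>b\<in>B. \<Sum>c\<in>C. f p q a b c) =
   (\<Sum>a\<in>A. \<Sum>b\<in>B. \<Sum>c\<in>C. \<Sum>p\<in>P. \<Sum>q\<in>Q. f p q a b c)"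
proof -
  have "(\<Sum>p\<in>P. \<Sum>q\<in>Q. \<Sum>a\<in>A. \<Sum>b\<in>B. \<Sum>c\<in>C. f p q a b c) =
    (\<Sum>a\<in>A. \<Sum>b\<in>B. \<Sum>p\<in>P. \<Sum>q\<in>Q. \<Sum>c\<in>C. f p q a b c)"
    by (rule sum_swap_pairs)
  also have "\<dots> = (\<Sum>a\<in>A. \<Sum>b\<in>B. \<Sum>c\<in>C. \<Sum>p\<in>P. \<Sum>q\<in>Q. f p q a b c)"
    by (rule sum.cong[OF refl], rule sum.cong[OF refl], rule sum_rot3[symmetric])
  finally show ?thesis .
qed

context g2_alg
begin

text \<open>\<open>VV\<close> and \<open>WW\<close> are adjoint, so \<open>Omega14\<close> is the
  orthogonal complement of the range of the injective \<open>WW\<close> among the skew matrices: 21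
  - 7.\<close>

lemma dim_Omega14: "dim (Omega14 \<psi>) = 14"
proof -
  let ?Sk = "{B :: real^7^7. transpose B = - B}"
  have "dim {y \<in> ?Sk. \<forall>x\<in>range WW. orthogonal x y} + dim (range WW) = dim ?Sk"
    by (rule dim_subspace_orthogonal_to_vectors)
      (auto simp: transpose_WW linear_subspace_image[OF linear_WW subspace_UNIV],
        auto simp: subspace_def transpose_add transpose_scalar transpose_zero)
  moreover have "{y \<in> ?Sk. \<forall>x\<in>range WW. orthogonal x y} = Omega14 \<psi>"
  proof -
    have "(\<forall>x\<in>range WW. orthogonal x y) \<longleftrightarrow> VV \<phi> y = 0" for y
      by (auto simp: orthogonal_def inner_commute[of _ y] inner_WW dest: spec[of _ "VV \<phi> y"])
    thus ?thesis by (auto simp: Omega14_iff)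
  qed
  moreover have "dim (range WW) = 7"
  proof -
    have "inj WW" using WW_inj linear_WW by (metis linear_injective_0)
    thus ?thesis using dim_image_eq[of WW UNIV] linear_WW by (simp add: inj_on_def)
  qed
  ultimately show ?thesis using dim_transpose_parts(1) by simp
qed

lemma c1_eq: "c1 H = trace (M3 H)"
  unfolding c1_def trace_def M3_def vec_lambda_beta by (rule sum_rot3[symmetric])

text \<open>The contraction with \<psi> carries nothing beyond \<open>c7a\<close> and
  \<open>M3\<close>. All six components are thus functions of \<open>c7a\<close>, \<open>M3\<close>
  and the traceless symmetric part of \<open>M2\<close>, and only these three must be prescribed for
  joint surjectivity.\<close>

lemma c7b_eq:
  assumes "H \<in> skew_tensors"
  shows "c7b H = c7a H + (1/2) *\<^sub>R VV \<phi> (M3 H)"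
proof -
  have s: "H $ p $ i $ j = - H $ p $ j $ i" for p i j
    using assms unfolding skew_tensors_def by blast
  have "(\<Sum>i\<in>UNIV. \<Sum>j\<in>UNIV. \<Sum>p\<in>UNIV. H $ p $ i $ j * \<psi> [i, j, p, m]) =
     2 * c7a H $ m + VV \<phi> (M3 H) $ m" for m
  proof -
    have "(\<Sum>i\<in>UNIV. \<Sum>j\<in>UNIV. \<Sum>p\<in>UNIV. H $ p $ i $ j * \<psi> [i, j, p, m]) =
       (\<Sum>p\<in>UNIV. \<Sum>i\<in>UNIV. \<Sum>j\<in>UNIV. H $ p $ i $ j * \<psi> [i, j, p, m])"
      by (rule sum_rot3[symmetric])
    also have "\<dots> = (\<Sum>p\<in>UNIV. \<Sum>i\<in>UNIV. \<Sum>j\<in>UNIV. H $ p $ i $ j * (kd i p * kd j m)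
       - H $ p $ i $ j * (kd j p * kd i m) - H $ p $ i $ j * (\<Sum>k\<in>UNIV. \<phi> [i, j, k] * \<phi> [p, m, k]))"
    proof -
      have "\<psi> [i, j, p, m] = kd i p * kd j m - kd j p * kd i m - (\<Sum>k\<in>UNIV. \<phi> [i, j, k] * \<phi> [p, m, k])" for i j p
        unfolding phi_phi by (simp add: mult.commute)
      thus ?thesis by (simp only: right_diff_distrib)
    qed
    also have "\<dots> = (\<Sum>p\<in>UNIV. H $ p $ p $ m - H $ p $ m $ p)
        - (\<Sum>p\<in>UNIV. \<Sum>k\<in>UNIV. M3 H $ p $ k * \<phi> [p, m, k])"
      by (simp add: sum_subtractf sum2_kd sum2_kd' M3_def sum_contract)
    also have "(\<Sum>p\<in>UNIV. H $ p $ p $ m - H $ p $ m $ p) = 2 * c7a H $ m"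
      unfolding c7a_def vec_lambda_beta sum_distrib_left
      by (intro sum.cong refl) (subst (2) s, simp)
    also have "(\<Sum>p\<in>UNIV. \<Sum>k\<in>UNIV. M3 H $ p $ k * \<phi> [p, m, k]) = - VV \<phi> (M3 H) $ m"
      unfolding VV_def vec_lambda_beta sum_negf[symmetric] mult_minus_right[symmetric] phi_skew2[symmetric] ..
    finally show ?thesis by simp
  qed
  thus ?thesis by (simp add: vec_eq_iff c7b_def)
qed

section \<open>Prescribing the components independently\<close>

lemma linear_c7a: "linear c7a"
  by (intro linearI) (simp_all add: c7a_def vec_eq_iff sum.distrib sum_distrib_left)
lemma linear_M3: "linear M3"
  by (intro linearI) (simp_all add: M3_def vec_eq_iff sum.distrib sum_distrib_left algebra_simps)
lemma linear_M2: "linear M2"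
  by (intro linearI) (simp_all add: M2_def vec_eq_iff sum.distrib sum_distrib_left algebra_simps)
lemma linear_c1: "linear c1"
  by (intro linearI) (simp_all add: c1_def sum.distrib sum_distrib_left algebra_simps)
lemma linear_c7b: "linear c7b"
  by (intro linearI) (simp_all add: c7b_def vec_eq_iff sum.distrib sum_distrib_left algebra_simps)

text \<open>Natural ways to build a tensor skew in its last two indices from a matrix, a vector and
  a traceless symmetric matrix. The contractions below act on them by scalars or by
  \<open>VV\<close> and \<open>WW\<close>, so that preimages can be found by solving a triangular
  system.\<close>

definition ins1 :: "real^7^7 \<Rightarrow> real^7^7^7" where
  "ins1 Q = (\<chi> p i j. \<Sum>k\<in>UNIV. Q $ p $ k * \<phi> [i, j, k])"
definition ins2 :: "real^7 \<Rightarrow> real^7^7^7" where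
  "ins2 X = (\<chi> p i j. kd p i * X $ j - kd p j * X $ i)"
definition ins3 :: "real^7^7 \<Rightarrow> real^7^7^7" where
  "ins3 S = (\<chi> p i j. \<Sum>m\<in>UNIV. S $ i $ m * \<phi> [m, j, p] - S $ j $ m * \<phi> [m, i, p])"

lemma M3_ins1: "M3 (ins1 Q) = 6 *\<^sub>R Q"
proof -
  have "M3 (ins1 Q) $ a $ b = (\<Sum>p\<in>UNIV. \<Sum>q\<in>UNIV. \<Sum>k\<in>UNIV. Q $ a $ k * (\<phi> [k, p, q] * \<phi> [b, p, q]))" for a b
    by (simp add: M3_def ins1_def sum_distrib_right mult.assoc phi_cyc[symmetric, of _ _ b] phi_cyc[symmetric] )
  also have "\<dots> a b = (\<Sum>k\<in>UNIV. Q $ a $ k * (\<Sum>p\<in>UNIV. \<Sum>q\<in>UNIV. \<phi> [k, p, q] * \<phi> [b, p, q]))" for a b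
    unfolding sum_distrib_left by (rule sum_rot3[symmetric])
  finally have "M3 (ins1 Q) $ a $ b = (\<Sum>k\<in>UNIV. 6 * Q $ a $ k * kd k b)" for a b
    by (simp add: phi_phi2 mult_ac)
  thus ?thesis by (simp add: vec_eq_iff)
qed

lemma c7a_ins1: "c7a (ins1 Q) = - VV \<phi> Q"
  unfolding c7a_def ins1_def VV_def vec_eq_iff vector_uminus_component vec_lambda_beta
    sum_negf[symmetric] mult_minus_right[symmetric] phi_skew2[symmetric] by simp

lemma M3_ins2: "M3 (ins2 X) = - 2 *\<^sub>R WW X"
proof -
  have "M3 (ins2 X) $ a $ b = - 2 * WW X $ a $ b" for a b
  proof -
    have "M3 (ins2 X) $ a $ b = (\<Sum>p\<in>UNIV. \<Sum>q\<in>UNIV. kd a p * (X $ q * \<phi> [p, q, b]))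
       - (\<Sum>p\<in>UNIV. \<Sum>q\<in>UNIV. kd a q * (X $ p * \<phi> [p, q, b]))"
      by (simp only: M3_def ins2_def vec_lambda_beta left_diff_distrib sum_subtractf mult.assoc)
    also have "\<dots> = (\<Sum>q\<in>UNIV. X $ q * \<phi> [a, q, b]) - (\<Sum>p\<in>UNIV. X $ p * \<phi> [p, a, b])"
      by (simp only: sum_kd sum_distrib_left[symmetric])
    also have "\<dots> = - 2 * WW X $ a $ b"
    proof -
      have p: "\<phi> [a, q, b] = - \<phi> [a, b, q]" "\<phi> [q, a, b] = \<phi> [a, b, q]" for q
        using phi_skew2[of a q b] phi_cyc[of q a b] phi_cyc[of a b q] by simp_all
      show ?thesis by (simp add: p WW_def sum_negf)
    qed
    finally show ?thesis .
  qed
  thus ?thesis by (simp add: vec_eq_iff)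
qed

lemma c7a_ins2: "c7a (ins2 X) = 6 *\<^sub>R X"
  by (simp add: c7a_def ins2_def vec_eq_iff sum_subtractf)

lemma sum_sym_psi:
  fixes S :: "real^7^7"
  assumes "\<And>p m. S $ m $ p = S $ p $ m" "\<And>p m. h m p = - h p m"
  shows "(\<Sum>p\<in>UNIV. \<Sum>m\<in>UNIV. S $ p $ m * h p m) = (0::real)"
proof -
  have "(\<Sum>p\<in>UNIV. \<Sum>m\<in>UNIV. h p m * S $ p $ m) = 0"
    by (rule sum2_skew_sym[of h]) (rule assms(2), rule assms(1))
  thus ?thesis by (simp only: mult.commute)
qed

context
  fixes S :: "real^7^7"
  assumes S: "S \<in> Sym0"
begin

lemma S_sym: "S $ j $ i = S $ i $ j"
proof -
  have "transpose S $ i $ j = S $ i $ j" using S by (simp add: Sym0_def)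
  thus ?thesis by (simp add: transpose_def)
qed

lemma S_trace: "(\<Sum>i\<in>UNIV. S $ i $ i) = 0"
  using S by (simp add: Sym0_def trace_def)

text \<open>Of the three terms of \<open>phi_phi\<close>, one is killed by the vanishing trace of
  \<open>S\<close> and the \<psi>-term by its symmetry; a single entry of \<open>S\<close>
  remains.\<close>

lemma S_phi_phi:
  assumes "\<And>p m. h m p = - h p m"
    and "\<And>p m. (\<Sum>q\<in>UNIV. f p m q) = kd a b * kd m p - kd a p * kd m b - h p m"
  shows "(\<Sum>p\<in>UNIV. \<Sum>m\<in>UNIV. S $ p $ m * (\<Sum>q\<in>UNIV. f p m q)) = - S $ a $ b"
proof -
  have "(\<Sum>p\<in>UNIV. \<Sum>m\<in>UNIV. S $ p $ m * h p m) = 0"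
    by (rule sum_sym_psi[OF S_sym assms(1)])
  moreover have "(\<Sum>p\<in>UNIV. \<Sum>m\<in>UNIV. S $ p $ m * (kd a b * kd m p)) = 0"
  proof -
    have "(\<Sum>p\<in>UNIV. \<Sum>m\<in>UNIV. S $ p $ m * (kd a b * kd m p)) = (\<Sum>p\<in>UNIV. (\<Sum>m\<in>UNIV. S $ p $ m * kd m p) * kd a b)"
      by (simp only: sum_distrib_left sum_distrib_right mult_ac)
    thus ?thesis by (simp only: sum_kd sum_distrib_right[symmetric] S_trace mult_zero_left)
  qed
  moreover have "(\<Sum>p\<in>UNIV. \<Sum>m\<in>UNIV. S $ p $ m * (kd a p * kd m b)) = S $ a $ b"
    using sum2_kd[of "\<lambda>p m. S $ p $ m" a b] by (simp add: kd_sym[of a])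
  ultimately show ?thesis
    by (simp add: assms(2) right_diff_distrib sum_subtractf)
qed

lemma M3_ins3: "M3 (ins3 S) = - 2 *\<^sub>R S"
proof -
  have "M3 (ins3 S) $ a $ b = - 2 * S $ a $ b" for a b
  proof -
    define g where "g = (\<Sum>p\<in>UNIV. \<Sum>q\<in>UNIV. \<Sum>m\<in>UNIV. S $ p $ m * (\<phi> [m, q, a] * \<phi> [p, q, b]))"
    have "M3 (ins3 S) $ a $ b = g
       - (\<Sum>p\<in>UNIV. \<Sum>q\<in>UNIV. \<Sum>m\<in>UNIV. S $ q $ m * (\<phi> [m, p, a] * \<phi> [p, q, b]))"
      by (simp only: M3_def ins3_def g_def vec_lambda_beta sum_distrib_right left_diff_distrib sum_subtractf mult.assoc)
    also have "(\<Sum>p\<in>UNIV. \<Sum>q\<in>UNIV. \<Sum>m\<in>UNIV. S $ q $ m * (\<phi> [m, p, a] * \<phi> [p, q, b])) = - g"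
      unfolding g_def sum_negf[symmetric] mult_minus_right[symmetric] phi_skew1[symmetric]
      by (rule sum.swap)
    also have "g = (\<Sum>p\<in>UNIV. \<Sum>m\<in>UNIV. S $ p $ m * (\<Sum>q\<in>UNIV. \<phi> [a, m, q] * \<phi> [b, p, q]))"
      unfolding g_def sum_distrib_left phi_cyc[of _ _ a] phi_cyc[of _ _ b]
      by (rule sum_swap23)
    also have "\<dots> = - S $ a $ b"
    proof (rule S_phi_phi[where h = "\<lambda>p m. \<psi> [a, m, b, p]"])
      show "\<psi> [a, p, b, m] = - \<psi> [a, m, b, p]" for p m
        using psi_skew2[of a b p m] psi_skew3[of a b p m] psi_skew2[of a b m p] by linarith
    qed (rule phi_phi)
    finally show ?thesis by simp
  qed
  thus ?thesis by (simp add: vec_eq_iff)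
qed

lemma c7a_ins3: "c7a (ins3 S) = 0"
proof -
  have "c7a (ins3 S) $ k = (\<Sum>i\<in>UNIV. \<Sum>m\<in>UNIV. S $ i $ m * \<phi> [m, k, i])" for k
    by (simp add: c7a_def ins3_def)
  also have "\<dots> k = 0" for k
  proof (rule sum_sym_psi[OF S_sym])
    show "\<phi> [p, k, m] = - \<phi> [m, k, p]" for p m
      using phi_skew1[of p k m] phi_cyc[of k p m] by linarith
  qed
  finally show ?thesis by (simp add: vec_eq_iff)
qed

lemma VV_S: "VV \<phi> S = 0"
proof -
  have "(\<Sum>i\<in>UNIV. \<Sum>j\<in>UNIV. S $ i $ j * \<phi> [i, j, k]) = 0" for k
    by (rule sum_sym_psi[OF S_sym]) (rule phi_skew1)
  thus ?thesis by (simp add: VV_def vec_eq_iff)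
qed

lemma M2_ins3: "M2 (ins3 S) = 5 *\<^sub>R S"
proof -
  have "M2 (ins3 S) $ a $ b = 5 * S $ a $ b" for a b
  proof -
    have "M2 (ins3 S) $ a $ b =
       (\<Sum>p\<in>UNIV. \<Sum>q\<in>UNIV. \<Sum>m\<in>UNIV. S $ p $ m * (\<phi> [m, a, q] * \<phi> [p, b, q]))
       - (\<Sum>p\<in>UNIV. \<Sum>q\<in>UNIV. \<Sum>m\<in>UNIV. S $ a $ m * (\<phi> [m, p, q] * \<phi> [p, b, q]))"
      by (simp only: M2_def ins3_def vec_lambda_beta sum_distrib_right left_diff_distrib sum_subtractf mult.assoc)
    also have "(\<Sum>p\<in>UNIV. \<Sum>q\<in>UNIV. \<Sum>m\<in>UNIV. S $ p $ m * (\<phi> [m, a, q] * \<phi> [p, b, q])) =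
       (\<Sum>p\<in>UNIV. \<Sum>m\<in>UNIV. S $ p $ m * (\<Sum>q\<in>UNIV. \<phi> [m, a, q] * \<phi> [p, b, q]))"
      unfolding sum_distrib_left by (rule sum_swap23)
    also have "\<dots> = - S $ a $ b"
    proof (rule S_phi_phi[where h = "\<lambda>p m. \<psi> [m, a, p, b]"])
      show "\<psi> [p, a, m, b] = - \<psi> [m, a, p, b]" for p m
        using psi_skew1[of p a m b] psi_skew2[of a p m b] psi_skew1[of m a p b] by linarith
      show "(\<Sum>q\<in>UNIV. \<phi> [m, a, q] * \<phi> [p, b, q]) = kd a b * kd m p - kd a p * kd m b - \<psi> [m, a, p, b]" for p m
        unfolding phi_phi by (simp add: mult.commute)
    qed
    also have "(\<Sum>p\<in>UNIV. \<Sum>q\<in>UNIV. \<Sum>m\<in>UNIV. S $ a $ m * (\<phi> [m, p, q] * \<phi> [p, b, q])) =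
       (\<Sum>m\<in>UNIV. S $ a $ m * (- (\<Sum>p\<in>UNIV. \<Sum>q\<in>UNIV. \<phi> [m, p, q] * \<phi> [b, p, q])))"
      unfolding sum_distrib_left sum_negf[symmetric] mult_minus_right[symmetric] phi_skew1[symmetric]
      by (rule sum_rot3[symmetric])
    also have "\<dots> = (\<Sum>m\<in>UNIV. (- 6 * S $ a $ m) * kd m b)"
      by (simp only: phi_phi2 mult_minus_right mult_minus_left mult_ac)
    also have "\<dots> = - 6 * S $ a $ b"
      by (rule sum_kd)
    finally show ?thesis by simp
  qed
  thus ?thesis by (simp add: vec_eq_iff)
qed

lemma M2_ins1_sym: "M2 (ins1 S) = - S"
proof -
  have "M2 (ins1 S) $ a $ b = - S $ a $ b" for a b
  proof -
    have "M2 (ins1 S) $ a $ b = (\<Sum>p\<in>UNIV. \<Sum>q\<in>UNIV. \<Sum>k\<in>UNIV. S $ q $ k * (\<phi> [a, k, p] * \<phi> [b, q, p]))"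
      by (simp only: M2_def ins1_def vec_lambda_beta sum_distrib_right mult.assoc phi_cyc[of a] phi_cyc[of b])
    also have "\<dots> = (\<Sum>q\<in>UNIV. \<Sum>k\<in>UNIV. S $ q $ k * (\<Sum>p\<in>UNIV. \<phi> [a, k, p] * \<phi> [b, q, p]))"
      unfolding sum_distrib_left by (rule sum_rot3)
    also have "\<dots> = - S $ a $ b"
    proof (rule S_phi_phi[where h = "\<lambda>p m. \<psi> [a, m, b, p]"])
      show "\<psi> [a, p, b, m] = - \<psi> [a, m, b, p]" for p m
        using psi_skew2[of a b p m] psi_skew3[of a b p m] psi_skew2[of a b m p] by linarith
    qed (rule phi_phi)
    finally show ?thesis .
  qed
  thus ?thesis by (simp add: vec_eq_iff)
qed

end

lemma ins_skew: "ins1 Q \<in> skew_tensors" "ins2 X \<in> skew_tensors" "ins3 S \<in> skew_tensors"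
proof -
  show "ins1 Q \<in> skew_tensors"
    unfolding skew_tensors_def ins1_def mem_Collect_eq vec_lambda_beta sum_negf[symmetric]
      mult_minus_right[symmetric] phi_skew1[symmetric] by simp
  show "ins2 X \<in> skew_tensors" "ins3 S \<in> skew_tensors"
    by (simp_all add: skew_tensors_def ins2_def ins3_def sum_subtractf)
qed

lemma subspace_skew_tensors: "subspace skew_tensors"
proof -
  have "skew_tensors = {H. \<forall>p i j. H $ p $ i $ j + H $ p $ j $ i = 0}"
    by (simp add: skew_tensors_def eq_neg_iff_add_eq_0)
  moreover have "subspace {H :: real^7^7^7. \<forall>p i j. H $ p $ i $ j + H $ p $ j $ i = 0}"
  proof (rule subspaceI; clarsimp)
    fix x y :: "real^7^7^7" and p i j
    assume "\<forall>p i j. x $ p $ i $ j + x $ p $ j $ i = 0" "\<forall>p i j. y $ p $ i $ j + y $ p $ j $ i = 0"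
    hence "x $ p $ i $ j + x $ p $ j $ i = 0" "y $ p $ i $ j + y $ p $ j $ i = 0" by blast+
    thus "x $ p $ i $ j + y $ p $ i $ j + (x $ p $ j $ i + y $ p $ j $ i) = 0" by linarith
  next
    fix c and x :: "real^7^7^7" and p i j
    assume "\<forall>p i j. x $ p $ i $ j + x $ p $ j $ i = 0"
    hence "c * (x $ p $ i $ j + x $ p $ j $ i) = 0" by simp
    thus "c * x $ p $ i $ j + c * x $ p $ j $ i = 0" by (simp add: distrib_left)
  qed
  ultimately show ?thesis by simp
qed

text \<open>\<open>ins1\<close> prescribes \<open>M3\<close>; then \<open>E\<close> adjusts
  \<open>c7a\<close> without changing \<open>M3\<close>; finally \<open>N\<close> adjusts
  \<open>M2\<close> without changing either of them.\<close>

lemma joint_surj: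
  assumes S: "S \<in> Sym0"
  obtains H where "H \<in> skew_tensors" "M3 H = Q" "c7a H = X" "part27 (M2 H) = S"
proof -
  note lin = linear_add[OF linear_M3] linear_cmul[OF linear_M3] linear_diff[OF linear_M3]
     linear_add[OF linear_c7a] linear_cmul[OF linear_c7a] linear_diff[OF linear_c7a]
     linear_add[OF linear_M2] linear_cmul[OF linear_M2] linear_diff[OF linear_M2]
     linear_add[OF linear_part27] linear_cmul[OF linear_part27] linear_diff[OF linear_part27]
     linear_cmul[OF linear_VV]
  \<comment> \<open>\<open>M3\<close> is -2 \<open>WW Y\<close> on the first summand and 6
    \<open>WW Y\<close> on \<open>ins1 (WW Y)\<close>, hence the 1/3. \<open>c7a\<close> then gives
    6 - 2 = 4.\<close>
  define E where "E Y = ins2 Y + (1/3) *\<^sub>R ins1 (WW Y)" for Y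
  have E: "E Y \<in> skew_tensors" "M3 (E Y) = 0" "c7a (E Y) = 4 *\<^sub>R Y" for Y
  proof -
    show "E Y \<in> skew_tensors" unfolding E_def
      by (intro subspace_add[OF subspace_skew_tensors] subspace_scale[OF subspace_skew_tensors] ins_skew)
    show "M3 (E Y) = 0" by (simp add: E_def lin M3_ins1 M3_ins2)
    have "c7a (E Y) = 6 *\<^sub>R Y - 2 *\<^sub>R Y" by (simp add: E_def lin c7a_ins1 c7a_ins2 VV_WW)
    thus "c7a (E Y) = 4 *\<^sub>R Y" by (simp add: scaleR_left_diff_distrib[symmetric])
  qed
  \<comment> \<open>Again 1/3 balances -2 against 6 in \<open>M3\<close>. \<open>M2\<close> has the
    factor 5 - 1/3 = 14/3, whose inverse is 3/14.\<close>
  define N where "N U = (3/14) *\<^sub>R (ins3 U + (1/3) *\<^sub>R ins1 U)" for U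
  have N: "N U \<in> skew_tensors" "M3 (N U) = 0" "c7a (N U) = 0" "M2 (N U) = U" if "U \<in> Sym0" for U
  proof -
    show "N U \<in> skew_tensors" unfolding N_def
      by (intro subspace_add[OF subspace_skew_tensors] subspace_scale[OF subspace_skew_tensors] ins_skew)
    show "M3 (N U) = 0" "c7a (N U) = 0"
      by (simp_all add: N_def lin M3_ins1 M3_ins3[OF that] c7a_ins1 c7a_ins3[OF that] VV_S[OF that])
    have "M2 (N U) = (3/14) *\<^sub>R (5 *\<^sub>R U - (1/3) *\<^sub>R U)"
      by (simp add: N_def lin M2_ins3[OF that] M2_ins1_sym[OF that])
    thus "M2 (N U) = U" by (simp add: vec_eq_iff)
  qed
  \<comment> \<open>\<open>(1/6) *\<^sub>R ins1 Q\<close> already contributes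
    \<open>- (1/6) *\<^sub>R VV \<phi> Q\<close> to \<open>c7a\<close>; adding this back and
    dividing by the 4 of \<open>E\<close> leaves \<open>X\<close>.\<close>
  define Y where "Y = (1/4) *\<^sub>R (X + (1/6) *\<^sub>R VV \<phi> Q)"
  define H0 where "H0 = (1/6) *\<^sub>R ins1 Q + E Y"
  have H0: "H0 \<in> skew_tensors" unfolding H0_def
      by (intro subspace_add[OF subspace_skew_tensors] subspace_scale[OF subspace_skew_tensors] ins_skew E)
  define U where "U = S - part27 (M2 H0)"
  have U: "U \<in> Sym0" unfolding U_def by (intro subspace_diff subspace_Sym0 S part27_in_Sym0)
  show thesis
  proof (rule that)
    show "H0 + N U \<in> skew_tensors" by (intro subspace_add[OF subspace_skew_tensors] H0 N U)
    show "M3 (H0 + N U) = Q" by (simp add: lin H0_def E N[OF U] M3_ins1)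
    show "c7a (H0 + N U) = X" by (simp add: lin H0_def E N[OF U] c7a_ins1 Y_def)
    show "part27 (M2 (H0 + N U)) = S"
      by (simp add: linear_add[OF linear_M2] linear_add[OF linear_part27] N[OF U] part27_Sym0[OF U]) (simp add: U_def)
  qed
qed

end

section \<open>Equivariance of the contractions\<close>

lemma orthogonal_matrix_sums:
  fixes A :: "real^7^7"
  assumes "orthogonal_matrix A"
  shows "(\<Sum>a\<in>UNIV. A $ a $ i * A $ a $ j) = kd i j" "(\<Sum>k\<in>UNIV. A $ i $ k * A $ j $ k) = kd i j"
proof -
  have "(transpose A ** A) $ i $ j = kd i j" "(A ** transpose A) $ i $ j = kd i j"
    using assms by (simp_all add: orthogonal_matrix_def mat_def kd_def)
  thus "(\<Sum>a\<in>UNIV. A $ a $ i * A $ a $ j) = kd i j" "(\<Sum>k\<in>UNIV. A $ i $ k * A $ j $ k) = kd i j"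
    by (simp_all add: matrix_matrix_mult_def transpose_def)
qed

lemma act2_component:
  "act2 A B $ i $ j = (\<Sum>a\<in>UNIV. \<Sum>b\<in>UNIV. A $ a $ i * A $ b $ j * B $ a $ b)"
  unfolding act2_def matrix_matrix_mult_def transpose_def vec_lambda_beta sum_distrib_right
  by (subst sum.swap) (simp only: mult_ac)

lemma transpose_act2: "transpose (act2 A B) = act2 A (transpose B)"
  by (simp add: act2_def matrix_transpose_mul matrix_mul_assoc)

lemma linear_act2: "linear (act2 A)"
  by (intro linearI) (simp_all add: act2_component vec_eq_iff sum.distrib sum_distrib_left algebra_simps)

text \<open>Taking a trace uses the metric, so this rests on orthogonality; for the stabiliser of
  the form, \<open>g2_group_orthogonal\<close> supplies it.\<close>

lemma act2_orthogonal:
  assumes A: "orthogonal_matrix A"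
  shows trace_act2: "trace (act2 A B) = trace B"
    and act2_part27: "part27 (act2 A B) = act2 A (part27 B)"
proof -
  have "trace (act2 A B) = trace (B ** (A ** transpose A))"
    unfolding act2_def by (metis trace_mul_sym matrix_mul_assoc)
  thus t: "trace (act2 A B) = trace B" using A by (simp add: orthogonal_matrix_def)
  have m: "act2 A (mat 1) = mat 1" using A by (simp add: act2_def orthogonal_matrix_def)
  show "part27 (act2 A B) = act2 A (part27 B)"
    by (simp add: part27_def t transpose_act2 linear_add[OF linear_act2]
        linear_diff[OF linear_act2] linear_cmul[OF linear_act2] m)
qed

context g2_alg
begin

definition preserves :: "real^7^7 \<Rightarrow> bool" where
  "preserves A \<longleftrightarrow> orthogonal_matrix A \<and>
     (\<forall>i j k. (\<Sum>a\<in>UNIV. \<Sum>b\<in>UNIV. \<Sum>c\<in>UNIV. A $ a $ i * A $ b $ j * A $ c $ k * \<phi> [a, b, c]) = \<phi> [i, j, k])"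

lemma G2_group_preserves:
  assumes "A \<in> G2_group \<phi>" "orthogonal_matrix A"
  shows "preserves A"
  using assms unfolding preserves_def G2_group_def
  by (simp add: comps_simps column_def sum_distrib_left mult.assoc)

context
  fixes A :: "real^7^7"
  assumes A: "preserves A"
begin

lemma A_orth: "orthogonal_matrix A" using A by (simp add: preserves_def)

lemmas A_rows = orthogonal_matrix_sums(2)[OF A_orth]

text \<open>Invariance of \<phi> involves three factors \<open>A\<close>; orthogonality of the rows
  moves one of them to the other side. In this form it slides a pair of factors through a
  contraction with \<phi>.\<close>

lemma push1: "(\<Sum>a\<in>UNIV. \<Sum>b\<in>UNIV. A $ a $ i * A $ b $ j * \<phi> [a, b, c]) = (\<Sum>k\<in>UNIV. A $ c $ k * \<phi> [i, j, k])"
proof -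
  have "(\<Sum>k\<in>UNIV. A $ c $ k * \<phi> [i, j, k]) = (\<Sum>k\<in>UNIV. A $ c $ k *
     (\<Sum>a\<in>UNIV. \<Sum>b\<in>UNIV. \<Sum>d\<in>UNIV. A $ a $ i * A $ b $ j * A $ d $ k * \<phi> [a, b, d]))"
    using A by (simp add: preserves_def)
  also have "\<dots> = (\<Sum>k\<in>UNIV. \<Sum>a\<in>UNIV. \<Sum>b\<in>UNIV. \<Sum>d\<in>UNIV. A $ a $ i * A $ b $ j * \<phi> [a, b, d] * (A $ c $ k * A $ d $ k))"
    by (simp only: sum_distrib_left mult_ac)
  also have "\<dots> = (\<Sum>a\<in>UNIV. \<Sum>b\<in>UNIV. \<Sum>d\<in>UNIV. \<Sum>k\<in>UNIV. A $ a $ i * A $ b $ j * \<phi> [a, b, d] * (A $ c $ k * A $ d $ k))"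
    by (rule sum_rot4[symmetric])
  also have "\<dots> = (\<Sum>a\<in>UNIV. \<Sum>b\<in>UNIV. A $ a $ i * A $ b $ j * \<phi> [a, b, c])"
    by (simp only: sum_distrib_left[symmetric] A_rows sum_kd)
  finally show ?thesis ..
qed

lemma push2: "(\<Sum>i\<in>UNIV. \<Sum>k\<in>UNIV. A $ a $ i * A $ c $ k * \<phi> [i, j, k]) = (\<Sum>b\<in>UNIV. A $ b $ j * \<phi> [a, b, c])"
proof -
  have "(\<Sum>i\<in>UNIV. \<Sum>k\<in>UNIV. A $ a $ i * A $ c $ k * \<phi> [i, j, k]) =
     (\<Sum>i\<in>UNIV. A $ a $ i * (\<Sum>d\<in>UNIV. \<Sum>b\<in>UNIV. A $ d $ i * A $ b $ j * \<phi> [d, b, c]))"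
    by (unfold push1, simp only: sum_distrib_left mult.assoc)
  also have "\<dots> = (\<Sum>i\<in>UNIV. \<Sum>d\<in>UNIV. \<Sum>b\<in>UNIV. A $ b $ j * \<phi> [d, b, c] * (A $ a $ i * A $ d $ i))"
    by (simp only: sum_distrib_left mult_ac)
  also have "\<dots> = (\<Sum>d\<in>UNIV. \<Sum>b\<in>UNIV. \<Sum>i\<in>UNIV. A $ b $ j * \<phi> [d, b, c] * (A $ a $ i * A $ d $ i))"
    by (rule sum_rot3)
  also have "\<dots> = (\<Sum>d\<in>UNIV. \<Sum>b\<in>UNIV. A $ b $ j * \<phi> [d, b, c] * kd a d)"
    by (simp only: sum_distrib_left[symmetric] A_rows)
  also have "\<dots> = (\<Sum>b\<in>UNIV. A $ b $ j * \<phi> [a, b, c])"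
    by (subst sum.swap) (simp only: sum_kd)
  finally show ?thesis .
qed

lemma push3: "(\<Sum>i\<in>UNIV. \<Sum>k\<in>UNIV. A $ a $ i * A $ c $ k * \<phi> [i, k, j]) = (\<Sum>b\<in>UNIV. A $ b $ j * \<phi> [a, c, b])"
  using push2[of a c j] unfolding phi_skew2[of _ j] phi_skew2[of a _ c] by (simp add: sum_negf)

lemma VV_act2: "VV \<phi> (act2 A B) = act1 A (VV \<phi> B)"
proof -
  have "VV \<phi> (act2 A B) $ k = act1 A (VV \<phi> B) $ k" for k
  proof -
    have "VV \<phi> (act2 A B) $ k = (\<Sum>i\<in>UNIV. \<Sum>j\<in>UNIV. \<Sum>a\<in>UNIV. \<Sum>b\<in>UNIV. B $ a $ b * (A $ a $ i * A $ b $ j * \<phi> [i, j, k]))"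
      by (simp only: VV_def act2_component vec_lambda_beta sum_distrib_left sum_distrib_right mult_ac)
    also have "\<dots> = (\<Sum>a\<in>UNIV. \<Sum>b\<in>UNIV. \<Sum>i\<in>UNIV. \<Sum>j\<in>UNIV. B $ a $ b * (A $ a $ i * A $ b $ j * \<phi> [i, j, k]))"
      by (rule sum_swap_pairs)
    also have "\<dots> = (\<Sum>a\<in>UNIV. \<Sum>b\<in>UNIV. \<Sum>c\<in>UNIV. A $ c $ k * (B $ a $ b * \<phi> [a, b, c]))"
      by (simp only: sum_distrib_left[symmetric] push3) (simp only: sum_distrib_left mult_ac)
    also have "\<dots> = (\<Sum>c\<in>UNIV. \<Sum>a\<in>UNIV. \<Sum>b\<in>UNIV. A $ c $ k * (B $ a $ b * \<phi> [a, b, c]))"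
      by (rule sum_rot3[symmetric])
    also have "\<dots> = act1 A (VV \<phi> B) $ k"
      by (simp add: act1_def VV_def matrix_vector_mult_def transpose_def sum_distrib_left)
    finally show ?thesis .
  qed
  thus ?thesis by (simp add: vec_eq_iff)
qed

lemma WW_act1: "WW (act1 A X) = act2 A (WW X)"
proof -
  have "WW (act1 A X) $ i $ j = act2 A (WW X) $ i $ j" for i j
  proof -
    have "act2 A (WW X) $ i $ j = (\<Sum>a\<in>UNIV. \<Sum>b\<in>UNIV. \<Sum>c\<in>UNIV. X $ c * (A $ a $ i * A $ b $ j * \<phi> [a, b, c]))"
      by (simp only: WW_def act2_component vec_lambda_beta sum_distrib_left mult_ac)
    also have "\<dots> = (\<Sum>c\<in>UNIV. \<Sum>a\<in>UNIV. \<Sum>b\<in>UNIV. X $ c * (A $ a $ i * A $ b $ j * \<phi> [a, b, c]))"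
      by (rule sum_rot3[symmetric])
    also have "\<dots> = (\<Sum>c\<in>UNIV. \<Sum>k\<in>UNIV. X $ c * (A $ c $ k * \<phi> [i, j, k]))"
      by (simp only: sum_distrib_left[symmetric] push1)
    also have "\<dots> = (\<Sum>k\<in>UNIV. \<Sum>c\<in>UNIV. X $ c * (A $ c $ k * \<phi> [i, j, k]))"
      by (rule sum.swap)
    also have "\<dots> = WW (act1 A X) $ i $ j"
      by (simp add: act1_def WW_def matrix_vector_mult_def transpose_def sum_distrib_left sum_distrib_right mult_ac)
    finally show ?thesis ..
  qed
  thus ?thesis by (simp add: vec_eq_iff)
qed

lemma pi14_act2: "pi14 (act2 A B) = act2 A (pi14 B)"
  by (simp add: pi14_def skew_part_def VV_act2 WW_act1 transpose_act2 linear_diff[OF linear_act2] linear_cmul[OF linear_act2])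

lemma c7a_act3: "c7a (act3 A H) = act1 A (c7a H)"
proof -
  have "c7a (act3 A H) $ k = act1 A (c7a H) $ k" for k
  proof -
    have "c7a (act3 A H) $ k = (\<Sum>i\<in>UNIV. \<Sum>a\<in>UNIV. \<Sum>b\<in>UNIV. \<Sum>c\<in>UNIV. A $ c $ k * H $ a $ b $ c * (A $ a $ i * A $ b $ i))"
      by (simp only: c7a_def act3_def vec_lambda_beta mult_ac)
    also have "\<dots> = (\<Sum>a\<in>UNIV. \<Sum>b\<in>UNIV. \<Sum>c\<in>UNIV. \<Sum>i\<in>UNIV. A $ c $ k * H $ a $ b $ c * (A $ a $ i * A $ b $ i))"
      by (rule sum_rot4[symmetric])
    also have "\<dots> = (\<Sum>a\<in>UNIV. \<Sum>b\<in>UNIV. \<Sum>c\<in>UNIV. A $ c $ k * H $ a $ b $ c * kd a b)"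
      by (simp only: sum_distrib_left[symmetric] A_rows)
    also have "\<dots> = (\<Sum>a\<in>UNIV. \<Sum>c\<in>UNIV. \<Sum>b\<in>UNIV. A $ c $ k * H $ a $ b $ c * kd a b)"
      by (rule sum_swap23)
    also have "\<dots> = (\<Sum>c\<in>UNIV. \<Sum>a\<in>UNIV. A $ c $ k * H $ a $ a $ c)"
      by (simp only: sum_kd) (rule sum.swap)
    also have "\<dots> = act1 A (c7a H) $ k"
      by (simp add: act1_def c7a_def matrix_vector_mult_def transpose_def sum_distrib_left)
    finally show ?thesis .
  qed
  thus ?thesis by (simp add: vec_eq_iff)
qed

lemma M3_act3: "M3 (act3 A H) = act2 A (M3 H)"
proof -
  have "M3 (act3 A H) $ x $ y = act2 A (M3 H) $ x $ y" for x y
  proof -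
    have "M3 (act3 A H) $ x $ y = (\<Sum>p\<in>UNIV. \<Sum>q\<in>UNIV. \<Sum>a\<in>UNIV. \<Sum>b\<in>UNIV. \<Sum>c\<in>UNIV.
        A $ a $ x * H $ a $ b $ c * (A $ b $ p * A $ c $ q * \<phi> [p, q, y]))"
      by (simp only: M3_def act3_def vec_lambda_beta sum_distrib_left sum_distrib_right mult_ac)
    also have "\<dots> = (\<Sum>a\<in>UNIV. \<Sum>b\<in>UNIV. \<Sum>c\<in>UNIV. \<Sum>p\<in>UNIV. \<Sum>q\<in>UNIV.
        A $ a $ x * H $ a $ b $ c * (A $ b $ p * A $ c $ q * \<phi> [p, q, y]))"
      by (rule sum_swap_2_3)
    also have "\<dots> = (\<Sum>a\<in>UNIV. \<Sum>b\<in>UNIV. \<Sum>c\<in>UNIV. \<Sum>d\<in>UNIV.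
        A $ a $ x * H $ a $ b $ c * (A $ d $ y * \<phi> [b, c, d]))"
      by (simp only: sum_distrib_left[symmetric] push3)
    also have "\<dots> = (\<Sum>a\<in>UNIV. \<Sum>d\<in>UNIV. \<Sum>b\<in>UNIV. \<Sum>c\<in>UNIV.
        A $ a $ x * H $ a $ b $ c * (A $ d $ y * \<phi> [b, c, d]))"
      by (rule sum.cong[OF refl], rule sum_rot3[symmetric])
    also have "\<dots> = act2 A (M3 H) $ x $ y"
      by (simp only: act2_component M3_def vec_lambda_beta sum_distrib_left mult_ac)
    finally show ?thesis .
  qed
  thus ?thesis by (simp add: vec_eq_iff)
qed

lemma M2_act3: "M2 (act3 A H) = act2 A (M2 H)"
proof -
  have "M2 (act3 A H) $ x $ y = act2 A (M2 H) $ x $ y" for x y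
  proof -
    have "M2 (act3 A H) $ x $ y = (\<Sum>p\<in>UNIV. \<Sum>q\<in>UNIV. \<Sum>a\<in>UNIV. \<Sum>b\<in>UNIV. \<Sum>c\<in>UNIV.
        A $ c $ x * H $ a $ b $ c * (A $ b $ p * A $ a $ q * \<phi> [p, y, q]))"
      by (simp only: M2_def act3_def vec_lambda_beta sum_distrib_left sum_distrib_right mult_ac)
    also have "\<dots> = (\<Sum>a\<in>UNIV. \<Sum>b\<in>UNIV. \<Sum>c\<in>UNIV. \<Sum>p\<in>UNIV. \<Sum>q\<in>UNIV.
        A $ c $ x * H $ a $ b $ c * (A $ b $ p * A $ a $ q * \<phi> [p, y, q]))"
      by (rule sum_swap_2_3)
    also have "\<dots> = (\<Sum>a\<in>UNIV. \<Sum>b\<in>UNIV. \<Sum>c\<in>UNIV. \<Sum>d\<in>UNIV.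
        A $ c $ x * H $ a $ b $ c * (A $ d $ y * \<phi> [b, d, a]))"
      by (simp only: sum_distrib_left[symmetric] push2)
    also have "\<dots> = (\<Sum>c\<in>UNIV. \<Sum>d\<in>UNIV. \<Sum>a\<in>UNIV. \<Sum>b\<in>UNIV.
        A $ c $ x * H $ a $ b $ c * (A $ d $ y * \<phi> [b, d, a]))"
      by (rule sum_swap_pairs)
    also have "\<dots> = (\<Sum>c\<in>UNIV. \<Sum>d\<in>UNIV. \<Sum>b\<in>UNIV. \<Sum>a\<in>UNIV.
        A $ c $ x * H $ a $ b $ c * (A $ d $ y * \<phi> [b, d, a]))"
      by (rule sum.cong[OF refl], rule sum.cong[OF refl], rule sum.swap)
    also have "\<dots> = act2 A (M2 H) $ x $ y"
      by (simp only: act2_component M2_def vec_lambda_beta sum_distrib_left mult_ac)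
    finally show ?thesis .
  qed
  thus ?thesis by (simp add: vec_eq_iff)
qed

lemma act3_skew: "H \<in> skew_tensors \<Longrightarrow> act3 A H \<in> skew_tensors"
proof -
  assume H: "H \<in> skew_tensors"
  have "act3 A H $ p $ i $ j = - act3 A H $ p $ j $ i" for p i j
  proof -
    have "act3 A H $ p $ i $ j = (\<Sum>a\<in>UNIV. \<Sum>b\<in>UNIV. \<Sum>c\<in>UNIV. A $ a $ p * A $ b $ i * A $ c $ j * (- H $ a $ c $ b))"
      using H unfolding act3_def vec_lambda_beta skew_tensors_def mem_Collect_eq
      by (intro sum.cong refl arg_cong[where f = "(*) _"]) blast
    also have "\<dots> = (\<Sum>a\<in>UNIV. \<Sum>c\<in>UNIV. \<Sum>b\<in>UNIV. A $ a $ p * A $ b $ i * A $ c $ j * (- H $ a $ c $ b))"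
      by (rule sum_swap23)
    finally show ?thesis by (simp add: act3_def sum_negf mult_ac)
  qed
  thus ?thesis unfolding skew_tensors_def by blast
qed

end

lemma irreducible_line: "G2_irreducible \<phi> (\<lambda>A x. x) (UNIV :: real set)"
proof -
  have "S = {0} \<or> S = UNIV" if sub: "subspace S" for S :: "real set"
  proof (cases "S = {0}")
    case False
    then obtain x where x: "x \<in> S" "x \<noteq> 0" using subspace_0[OF sub] by blast
    have "y \<in> S" for y using subspace_scale[OF sub x(1), of "y / x"] x(2) by simp
    thus ?thesis by blast
  qed simp
  moreover have "UNIV \<noteq> {0 :: real}" by (metis UNIV_I singletonD zero_neq_one)
  ultimately show ?thesis by (simp add: G2_irreducible_def)
qed

text \<open>The six delta terms of \<open>phi_psi\<close> paired with a coefficient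
  \<open>Z\<close>. Being linear in \<open>Z\<close>, the expression can be evaluated separately on
  the quadratic and on the curvature part of \<open>ZZ\<close>.\<close>

definition six_terms :: "(7 \<Rightarrow> 7 \<Rightarrow> 7 \<Rightarrow> 7 \<Rightarrow> real) \<Rightarrow> 7 \<Rightarrow> real" where
  "six_terms Z m = (\<Sum>i\<in>UNIV. \<Sum>j\<in>UNIV. \<Sum>b\<in>UNIV. Z i j i b * \<phi> [b, j, m]) + (\<Sum>i\<in>UNIV. \<Sum>j\<in>UNIV. \<Sum>b\<in>UNIV. Z i j j b * \<phi> [i, b, m])
      + (\<Sum>i\<in>UNIV. \<Sum>j\<in>UNIV. \<Sum>b\<in>UNIV. Z i j m b * \<phi> [i, j, b]) - (\<Sum>i\<in>UNIV. \<Sum>j\<in>UNIV. \<Sum>a\<in>UNIV. Z i j a i * \<phi> [a, j, m])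
      - (\<Sum>i\<in>UNIV. \<Sum>j\<in>UNIV. \<Sum>a\<in>UNIV. Z i j a j * \<phi> [i, a, m]) - (\<Sum>i\<in>UNIV. \<Sum>j\<in>UNIV. \<Sum>a\<in>UNIV. Z i j a m * \<phi> [i, j, a])"

lemma six_terms_eq:
  "(\<Sum>i\<in>UNIV. \<Sum>j\<in>UNIV. \<Sum>a\<in>UNIV. \<Sum>b\<in>UNIV. Z i j a b * (\<Sum>p\<in>UNIV. \<phi> [a, b, p] * \<psi> [i, j, m, p])) = six_terms Z m"
proof -
  have k: "kd i b = kd b i" "kd j b = kd b j" "kd m b = kd b m" for i j b by (rule kd_sym)+
  have "(\<Sum>p\<in>UNIV. \<phi> [a, b, p] * \<psi> [i, j, m, p]) = kd a i * \<phi> [b, j, m] + kd a j * \<phi> [i, b, m]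
     + kd a m * \<phi> [i, j, b] - kd b i * \<phi> [a, j, m] - kd b j * \<phi> [i, a, m] - kd b m * \<phi> [i, j, a]" for a b i j
    unfolding phi_psi by (simp add: k)
  thus ?thesis
    by (simp only: six_terms_def distrib_left right_diff_distrib sum.distrib sum_subtractf sum2_kd1)
qed

text \<open>Four of the terms pair the symmetric Ricci tensor with \<phi>, which is skew; the third
  and the sixth vanish by the first Bianchi identity.\<close>

lemma six_terms_curv:
  assumes R: "algebraic_curvature Rm"
  shows "six_terms (\<lambda>i j a b. Rm $ i $ j $ a $ b) m = 0"
proof -
  note sk = curv_skew1[OF R] curv_skew2[OF R]
  have R1: "(\<Sum>i\<in>UNIV. Rm $ i $ j $ i $ b) = - Rc Rm $ j $ b" for j b
    unfolding Rc_def vec_lambda_beta sum_negf[symmetric] by (intro sum.cong refl sk)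
  have R2: "(\<Sum>j\<in>UNIV. Rm $ i $ j $ j $ b) = Rc Rm $ b $ i" for i b
    unfolding Rc_def vec_lambda_beta by (intro sum.cong refl curv_pair[OF R])
  have R4: "(\<Sum>i\<in>UNIV. Rm $ i $ j $ a $ i) = Rc Rm $ j $ a" for j a
    by (simp add: Rc_def)
  have R5: "(\<Sum>j\<in>UNIV. Rm $ i $ j $ a $ j) = - Rc Rm $ i $ a" for i a
    unfolding Rc_def vec_lambda_beta sum_negf[symmetric]
    by (intro sum.cong refl) (subst sk(1), rule refl)
  have z: "(\<Sum>j\<in>UNIV. \<Sum>b\<in>UNIV. f j b * Rc Rm $ j $ b) = 0" if "\<And>j b. f b j = - f j b" for f
    by (rule sum2_skew_sym[of f, OF that Rc_sym[OF R]])
  have p: "\<phi> [j, b, m] = - \<phi> [b, j, m]" for j b by (rule phi_skew1)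
  have "(\<Sum>i\<in>UNIV. \<Sum>j\<in>UNIV. \<Sum>b\<in>UNIV. Rm $ i $ j $ i $ b * \<phi> [b, j, m]) = (\<Sum>j\<in>UNIV. \<Sum>b\<in>UNIV. \<Sum>i\<in>UNIV. Rm $ i $ j $ i $ b * \<phi> [b, j, m])"
    by (rule sum_rot3)
  also have "\<dots> = (\<Sum>j\<in>UNIV. \<Sum>b\<in>UNIV. (- \<phi> [b, j, m]) * Rc Rm $ j $ b)"
    by (simp only: sum_distrib_right[symmetric] R1) (simp add: mult.commute)
  also have "\<dots> = 0" by (rule z) (subst p, simp)
  finally have 1: "(\<Sum>i\<in>UNIV. \<Sum>j\<in>UNIV. \<Sum>b\<in>UNIV. Rm $ i $ j $ i $ b * \<phi> [b, j, m]) = 0" .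
  have "(\<Sum>i\<in>UNIV. \<Sum>j\<in>UNIV. \<Sum>b\<in>UNIV. Rm $ i $ j $ j $ b * \<phi> [i, b, m]) = (\<Sum>i\<in>UNIV. \<Sum>b\<in>UNIV. \<Sum>j\<in>UNIV. Rm $ i $ j $ j $ b * \<phi> [i, b, m])"
    by (rule sum_swap23)
  also have "\<dots> = (\<Sum>i\<in>UNIV. \<Sum>b\<in>UNIV. \<phi> [i, b, m] * Rc Rm $ i $ b)"
    by (simp only: sum_distrib_right[symmetric] R2) (simp only: Rc_sym[OF R] mult.commute)
  also have "\<dots> = 0" by (rule z) (rule phi_skew1)
  finally have 2: "(\<Sum>i\<in>UNIV. \<Sum>j\<in>UNIV. \<Sum>b\<in>UNIV. Rm $ i $ j $ j $ b * \<phi> [i, b, m]) = 0" .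
  have "(\<Sum>i\<in>UNIV. \<Sum>j\<in>UNIV. \<Sum>b\<in>UNIV. Rm $ i $ j $ m $ b * \<phi> [i, j, b]) = - (\<Sum>i\<in>UNIV. \<Sum>j\<in>UNIV. \<Sum>b\<in>UNIV. Rm $ i $ j $ b $ m * \<phi> [i, j, b])"
    unfolding sum_negf[symmetric] by (intro sum.cong refl, subst sk(2), simp)
  also have "\<dots> = 0" by (simp add: curv_cyc_zero[OF R] phi_cyc)
  finally have 3: "(\<Sum>i\<in>UNIV. \<Sum>j\<in>UNIV. \<Sum>b\<in>UNIV. Rm $ i $ j $ m $ b * \<phi> [i, j, b]) = 0" .
  have "(\<Sum>i\<in>UNIV. \<Sum>j\<in>UNIV. \<Sum>a\<in>UNIV. Rm $ i $ j $ a $ i * \<phi> [a, j, m]) = (\<Sum>j\<in>UNIV. \<Sum>a\<in>UNIV. \<Sum>i\<in>UNIV. Rm $ i $ j $ a $ i * \<phi> [a, j, m])"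
    by (rule sum_rot3)
  also have "\<dots> = (\<Sum>j\<in>UNIV. \<Sum>a\<in>UNIV. \<phi> [a, j, m] * Rc Rm $ j $ a)"
    by (simp only: sum_distrib_right[symmetric] R4) (simp only: mult.commute)
  also have "\<dots> = 0" by (rule z) (rule phi_skew1)
  finally have 4: "(\<Sum>i\<in>UNIV. \<Sum>j\<in>UNIV. \<Sum>a\<in>UNIV. Rm $ i $ j $ a $ i * \<phi> [a, j, m]) = 0" .
  have "(\<Sum>i\<in>UNIV. \<Sum>j\<in>UNIV. \<Sum>a\<in>UNIV. Rm $ i $ j $ a $ j * \<phi> [i, a, m]) = (\<Sum>i\<in>UNIV. \<Sum>a\<in>UNIV. \<Sum>j\<in>UNIV. Rm $ i $ j $ a $ j * \<phi> [i, a, m])"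
    by (rule sum_swap23)
  also have "\<dots> = (\<Sum>i\<in>UNIV. \<Sum>a\<in>UNIV. (- \<phi> [i, a, m]) * Rc Rm $ i $ a)"
    by (simp only: sum_distrib_right[symmetric] R5) (simp add: mult.commute)
  also have "\<dots> = 0" by (rule z) (subst phi_skew1, simp)
  finally have 5: "(\<Sum>i\<in>UNIV. \<Sum>j\<in>UNIV. \<Sum>a\<in>UNIV. Rm $ i $ j $ a $ j * \<phi> [i, a, m]) = 0" .
  have 6: "(\<Sum>i\<in>UNIV. \<Sum>j\<in>UNIV. \<Sum>a\<in>UNIV. Rm $ i $ j $ a $ m * \<phi> [i, j, a]) = 0"
    by (simp add: curv_cyc_zero[OF R] phi_cyc)
  show ?thesis unfolding six_terms_def 1 2 3 4 5 6 by simp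
qed

text \<open>The terms agree in the pairs 1 and 5, 2 and 4, 3 and 6. The resulting factor 2 cancels
  against the 1/2 in \<open>c7b\<close>.\<close>

lemma six_terms_T:
  "six_terms (\<lambda>i j a b. T $ i $ a * T $ j $ b) m =
     2 * (- trace T *\<^sub>R VV \<phi> T + VV \<phi> (T ** T) + transpose T *v VV \<phi> T) $ m"
proof -
  have s: "\<phi> [b, j, m] = - \<phi> [j, b, m]" for j b by (rule phi_skew1)
  have 5: "(\<Sum>i\<in>UNIV. \<Sum>j\<in>UNIV. \<Sum>a\<in>UNIV. T $ i $ a * T $ j $ j * \<phi> [i, a, m]) = trace T * VV \<phi> T $ m"
  proof -
    have "(\<Sum>i\<in>UNIV. \<Sum>j\<in>UNIV. \<Sum>a\<in>UNIV. T $ i $ a * T $ j $ j * \<phi> [i, a, m]) = (\<Sum>j\<in>UNIV. \<Sum>i\<in>UNIV. \<Sum>a\<in>UNIV. T $ j $ j * (T $ i $ a * \<phi> [i, a, m]))"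
      by (subst sum.swap) (simp only: mult_ac)
    thus ?thesis unfolding trace_def sum_distrib_right by (simp add: VV_def sum_distrib_left)
  qed
  have 1: "(\<Sum>i\<in>UNIV. \<Sum>j\<in>UNIV. \<Sum>b\<in>UNIV. T $ i $ i * T $ j $ b * \<phi> [b, j, m]) = - (trace T * VV \<phi> T $ m)"
  proof -
    have "(\<Sum>i\<in>UNIV. \<Sum>j\<in>UNIV. \<Sum>b\<in>UNIV. T $ i $ i * T $ j $ b * \<phi> [b, j, m]) = (\<Sum>i\<in>UNIV. \<Sum>j\<in>UNIV. \<Sum>b\<in>UNIV. - (T $ i $ i * (T $ j $ b * \<phi> [j, b, m])))"
      by (intro sum.cong refl, subst s, simp)
    thus ?thesis unfolding trace_def sum_distrib_right by (simp add: VV_def sum_distrib_left sum_negf)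
  qed
  have 2: "(\<Sum>i\<in>UNIV. \<Sum>j\<in>UNIV. \<Sum>b\<in>UNIV. T $ i $ j * T $ j $ b * \<phi> [i, b, m]) = VV \<phi> (T ** T) $ m"
    by (subst sum_swap23) (simp add: VV_def matrix_matrix_mult_def sum_distrib_right)
  have 4: "(\<Sum>i\<in>UNIV. \<Sum>j\<in>UNIV. \<Sum>a\<in>UNIV. T $ i $ a * T $ j $ i * \<phi> [a, j, m]) = - VV \<phi> (T ** T) $ m"
  proof -
    have "(\<Sum>i\<in>UNIV. \<Sum>j\<in>UNIV. \<Sum>a\<in>UNIV. T $ i $ a * T $ j $ i * \<phi> [a, j, m]) = (\<Sum>j\<in>UNIV. \<Sum>a\<in>UNIV. \<Sum>i\<in>UNIV. T $ i $ a * T $ j $ i * \<phi> [a, j, m])"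
      by (rule sum_rot3)
    also have "\<dots> = (\<Sum>j\<in>UNIV. \<Sum>a\<in>UNIV. \<Sum>i\<in>UNIV. - (T $ j $ i * T $ i $ a * \<phi> [j, a, m]))"
      by (intro sum.cong refl, subst s, simp)
    finally show ?thesis by (simp add: VV_def matrix_matrix_mult_def sum_distrib_right sum_negf)
  qed
  have 3: "(\<Sum>i\<in>UNIV. \<Sum>j\<in>UNIV. \<Sum>b\<in>UNIV. T $ i $ m * T $ j $ b * \<phi> [i, j, b]) = (transpose T *v VV \<phi> T) $ m"
    by (simp add: matrix_vector_mult_def transpose_def VV_def sum_distrib_left mult.assoc phi_cyc)
  have 6: "(\<Sum>i\<in>UNIV. \<Sum>j\<in>UNIV. \<Sum>a\<in>UNIV. T $ i $ a * T $ j $ m * \<phi> [i, j, a]) = - (transpose T *v VV \<phi> T) $ m"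
  proof -
    have "(\<Sum>i\<in>UNIV. \<Sum>j\<in>UNIV. \<Sum>a\<in>UNIV. T $ i $ a * T $ j $ m * \<phi> [i, j, a]) = (\<Sum>j\<in>UNIV. \<Sum>i\<in>UNIV. \<Sum>a\<in>UNIV. T $ i $ a * T $ j $ m * \<phi> [i, j, a])"
      by (rule sum.swap)
    also have "\<dots> = (\<Sum>j\<in>UNIV. \<Sum>i\<in>UNIV. \<Sum>a\<in>UNIV. - (T $ j $ m * (T $ i $ a * \<phi> [i, a, j])))"
      by (intro sum.cong refl, subst phi_skew2, simp)
    finally show ?thesis
      by (simp add: matrix_vector_mult_def transpose_def VV_def sum_distrib_left sum_negf)
  qed
  show ?thesis unfolding six_terms_def 1 2 3 4 5 6 by simp
qed

lemma six_terms_add: "six_terms (\<lambda>i j a b. f i j a b + c * g i j a b) m = six_terms f m + c * six_terms g m"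
  by (simp add: six_terms_def distrib_right sum.distrib sum_distrib_left right_diff_distrib distrib_left mult.assoc)

lemma rel7b:
  assumes R: "algebraic_curvature Rm"
  shows "c7b (bianchi_G \<phi> T D Rm) =
     nabla_psi \<psi> D - trace T *\<^sub>R VV \<phi> T + VV \<phi> (T ** T) + transpose T *v VV \<phi> T"
proof -
  have "c7b (bianchi_G \<phi> T D Rm) $ m =
     (nabla_psi \<psi> D - trace T *\<^sub>R VV \<phi> T + VV \<phi> (T ** T) + transpose T *v VV \<phi> T) $ m" for m
  proof -
    have 1: "(\<Sum>i\<in>UNIV. \<Sum>j\<in>UNIV. \<Sum>p\<in>UNIV. D $ j $ i $ p * \<psi> [i, j, p, m]) = - nabla_psi \<psi> D $ m"
      unfolding nabla_psi_def vec_lambda_beta sum_negf[symmetric] mult_minus_right[symmetric] psi_skew1[symmetric]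
      by (rule sum.swap)
    have 2: "(\<Sum>i\<in>UNIV. \<Sum>j\<in>UNIV. \<Sum>p\<in>UNIV. (\<Sum>a\<in>UNIV. \<Sum>b\<in>UNIV. ZZ T Rm i j a b * \<phi> [a, b, p]) * \<psi> [i, j, p, m]) =
       - six_terms (ZZ T Rm) m"
      unfolding six_terms_eq[symmetric] sum_contract psi_skew3[of _ _ m] by (simp add: sum_negf)
    have "six_terms (ZZ T Rm) m = 2 * (- trace T *\<^sub>R VV \<phi> T + VV \<phi> (T ** T) + transpose T *v VV \<phi> T) $ m"
      unfolding ZZ_def[abs_def] six_terms_add six_terms_T six_terms_curv[OF R] by simp
    thus ?thesis
      unfolding c7b_def vec_lambda_beta bianchi_G_ZZ left_diff_distrib sum_subtractf 1 2
      by (simp add: nabla_psi_def)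
  qed
  thus ?thesis by (simp add: vec_eq_iff)
qed

text \<open>What remains for a concrete form: its stabiliser is orthogonal and the three
  representations of dimension above 1 are irreducible. Neither follows from the contraction
  identities by linear algebra alone, so both are left to the normal form.\<close>

theorem independent_relationsI:
  assumes orth: "\<And>A. A \<in> G2_group \<phi> \<Longrightarrow> orthogonal_matrix A"
    and irr7: "G2_irreducible \<phi> act1 UNIV"
    and irr14: "G2_irreducible \<phi> act2 (Omega14 \<psi>)"
    and irr27: "G2_irreducible \<phi> act2 Sym0"
  shows "independent_relations \<phi> \<psi>"
proof -
  \<comment> \<open>\<open>rel3_matrix\<close> contains twice \<open>K3\<close>, hence the 1/2 here
    and in \<open>L27a\<close>.\<close>
  define L14 where "L14 H = (1/2) *\<^sub>R pi14 (M3 H)" for H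
  define L27a where "L27a H = (1/2) *\<^sub>R part27 (M3 H)" for H
  define L27b where "L27b H = part27 (M2 H)" for H
  define c7 where "c7 H = c7a H + (1/2) *\<^sub>R VV \<phi> (M3 H)" for H
  have pres: "preserves A" if "A \<in> G2_group \<phi>" for A
    using G2_group_preserves orth that by blast
  have surj: "(\<lambda>H. (c1 H, c7a H, c7b H, L14 H, L27a H, L27b H)) ` skew_tensors
       = UNIV \<times> UNIV \<times> UNIV \<times> Omega14 \<psi> \<times> Sym0 \<times> Sym0" (is "?f ` _ = ?V")
  proof (intro equalityI subsetI)
    fix y assume "y \<in> ?f ` skew_tensors"
    thus "y \<in> ?V"
      by (auto simp: L14_def L27a_def L27b_def subspace_scale subspace_Omega14 subspace_Sym0 pi14_Omega14 part27_in_Sym0)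
  next
    fix y assume "y \<in> ?V"
    then obtain x X Y B S S' where y: "y = (x, X, Y, B, S, S')" "B \<in> Omega14 \<psi>" "S \<in> Sym0" "S' \<in> Sym0"
      by auto
    \<comment> \<open>By \<open>c7b_eq\<close> the two vector components differ by half of
      \<open>VV \<phi> Q\<close>. Only \<open>WW V\<close> contributes to that, with factor 6, so
      the difference is three times \<open>V\<close>.\<close>
    define V where "V = (1/3) *\<^sub>R (Y - X)"
    \<comment> \<open>One summand per component of \<open>M3\<close>: trace, \<open>Omega14\<close>,
      \<open>Sym0\<close> and \<open>Omega7\<close>. The sevenths normalise the trace of the
      identity, and the factors 2 cancel the 1/2 in \<open>L14\<close> and
      \<open>L27a\<close>.\<close>
    define Q where "Q = (x / 7) *\<^sub>R mat 1 + 2 *\<^sub>R B + 2 *\<^sub>R S + WW V"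
    obtain H where H: "H \<in> skew_tensors" "M3 H = Q" "c7a H = X" "part27 (M2 H) = S'"
      using joint_surj[OF y(4)] by blast
    have sB: "transpose B = - B" "VV \<phi> B = 0" using y(2) by (simp_all add: Omega14_iff)
    have tr0: "trace C = 0" if "transpose C = - C" for C :: "real^7^7"
    proof -
      have "C $ i $ i = 0" for i using skew_component[OF that, of i i] by simp
      thus ?thesis by (simp add: trace_def)
    qed
    have tr: "trace Q = x"
    proof -
      have "trace (WW V) = 0" "trace B = 0" "trace S = 0"
        using tr0 transpose_WW sB y(3) by (auto simp: Sym0_def)
      thus ?thesis by (simp add: Q_def trace_def sum.distrib sum_distrib_left[symmetric] mat_def)
    qed
    have S: "transpose S = S" using y(3) by (simp add: Sym0_def)
    have mt: "transpose (mat 1 :: real^7^7) = mat 1" by simp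
    have VVs: "VV \<phi> C = 0" if "transpose C = C" for C
      using VV_transpose[of C] that by (simp add: vec_eq_iff)
    have VQ: "VV \<phi> Q = 6 *\<^sub>R V"
      by (simp add: Q_def linear_add[OF linear_VV] linear_cmul[OF linear_VV] VVs[OF mt] VVs[OF S] sB VV_WW)
    have "pi14 (WW V) = 0"
      by (simp add: pi14_def skew_part_def transpose_WW VV_WW linear_cmul[OF linear_WW] scaleR_2[symmetric])
    hence pQ: "pi14 Q = 2 *\<^sub>R B"
      by (simp add: Q_def linear_add[OF linear_pi14] linear_cmul[OF linear_pi14] pi14_sym[OF mt] pi14_sym[OF S]
          pi14_Omega14_id[OF y(2)])
    have "part27 (mat 1) = 0" by (simp add: part27_def trace_def mat_def vec_eq_iff transpose_def)
    hence sQ: "part27 Q = 2 *\<^sub>R S"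
      by (simp add: Q_def linear_add[OF linear_part27] linear_cmul[OF linear_part27] part27_Sym0[OF y(3)]
           part27_skew sB transpose_WW)
    have "?f H = y"
      using H by (simp add: y L14_def L27a_def L27b_def c1_eq c7b_eq pQ sQ tr VQ V_def)
    thus "y \<in> ?f ` skew_tensors" using H(1) by blast
  qed
  have ne: "Omega14 \<psi> \<noteq> {}" "Sym0 \<noteq> {}"
    using subspace_Omega14 subspace_Sym0 subspace_0 by blast+
  have surjs: "c1 ` skew_tensors = UNIV" "c7a ` skew_tensors = UNIV" "c7b ` skew_tensors = UNIV"
    "L14 ` skew_tensors = Omega14 \<psi>" "L27a ` skew_tensors = Sym0" "L27b ` skew_tensors = Sym0"
  proof -
    have "c1 ` skew_tensors = fst ` (?f ` skew_tensors)" by (simp add: image_image)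
    thus "c1 ` skew_tensors = UNIV" unfolding surj using ne by simp
    have "c7a ` skew_tensors = fst ` snd ` (?f ` skew_tensors)" by (simp add: image_image)
    thus "c7a ` skew_tensors = UNIV" unfolding surj using ne by simp
    have "c7b ` skew_tensors = fst ` snd ` snd ` (?f ` skew_tensors)" by (simp add: image_image)
    thus "c7b ` skew_tensors = UNIV" unfolding surj using ne by simp
    have "L14 ` skew_tensors = fst ` snd ` snd ` snd ` (?f ` skew_tensors)" by (simp add: image_image)
    thus "L14 ` skew_tensors = Omega14 \<psi>" unfolding surj using ne by simp
    have "L27a ` skew_tensors = fst ` snd ` snd ` snd ` snd ` (?f ` skew_tensors)" by (simp add: image_image)
    thus "L27a ` skew_tensors = Sym0" unfolding surj using ne by simp
    have "L27b ` skew_tensors = snd ` snd ` snd ` snd ` snd ` (?f ` skew_tensors)" by (simp add: image_image)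
    thus "L27b ` skew_tensors = Sym0" unfolding surj using ne by simp
  qed
  have lin: "linear L14" "linear L27a" "linear L27b"
    unfolding L14_def L27a_def L27b_def
    by (intro linear_compose_scale_right linear_compose[OF linear_M3 linear_pi14, unfolded o_def]
        linear_compose[OF linear_M3 linear_part27, unfolded o_def]
        linear_compose[OF linear_M2 linear_part27, unfolded o_def])+
  have comp1: "G2_component \<phi> (\<lambda>A x. x) (UNIV :: real set) 1 c1"
    unfolding G2_component_def
    using surjs linear_c1 irreducible_line pres by (auto simp: c1_eq M3_act3 trace_act2 A_orth)
  have eq7: "c7a (act3 A H) = act1 A (c7a H)" "c7b (act3 A H) = act1 A (c7b H)"
    if "A \<in> G2_group \<phi>" "H \<in> skew_tensors" for A H
  proof -
    show a: "c7a (act3 A H) = act1 A (c7a H)" using c7a_act3 pres that by blast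
    show "c7b (act3 A H) = act1 A (c7b H)"
      using that pres[OF that(1)]
      by (simp add: c7b_eq act3_skew a M3_act3 VV_act2 act1_def matrix_vector_right_distrib matrix_vector_mult_scaleR)
  qed
  have comp7: "G2_component \<phi> act1 UNIV 7 c7a" "G2_component \<phi> act1 UNIV 7 c7b"
    unfolding G2_component_def using surjs linear_c7a linear_c7b irr7 eq7 by auto
  have comp14: "G2_component \<phi> act2 (Omega14 \<psi>) 14 L14"
    unfolding G2_component_def using surjs lin irr14 dim_Omega14 pres
    by (auto simp: L14_def M3_act3 pi14_act2 linear_cmul[OF linear_act2])
  have comp27: "G2_component \<phi> act2 Sym0 27 L27a" "G2_component \<phi> act2 Sym0 27 L27b"
    unfolding G2_component_def using surjs lin irr27 dim_Sym0 pres
    by (auto simp: L27a_def L27b_def M3_act3 M2_act3 act2_part27 A_orth linear_cmul[OF linear_act2])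
  have rel14: "L14 (bianchi_G \<phi> T D Rm) = part14 \<psi> (K3 \<phi> D)
        - (- trace T *\<^sub>R part14 \<psi> T + part14 \<psi> (T ** T) + part14 \<psi> (PP \<psi> T ** T))"
    if R: "algebraic_curvature Rm" for T D Rm
  proof -
    have "pi14 (circ_prod \<phi> T T) = pi14 ((2 * trace T) *\<^sub>R T - 2 *\<^sub>R (T ** T) - 2 *\<^sub>R (PP \<psi> T ** T))"
      by (rule pi14_eqI) (simp add: inner_circ_prod inner_diff_right)
    hence pc: "pi14 (circ_prod \<phi> T T) = (2 * trace T) *\<^sub>R pi14 T - 2 *\<^sub>R pi14 (T ** T) - 2 *\<^sub>R pi14 (PP \<psi> T ** T)"
      by (simp add: linear_diff[OF linear_pi14] linear_cmul[OF linear_pi14])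
    show ?thesis
      unfolding L14_def part14_eq rel3_matrix linear_diff[OF linear_pi14] linear_cmul[OF linear_pi14]
          pi14_transpose pi14_sym[OF F_tensor_sym[OF R]] pc by (simp add: algebra_simps)
  qed
  have rel27a: "L27a (bianchi_G \<phi> T D Rm) = part27 (K3 \<phi> D)
            - ((1/2) *\<^sub>R part27 (circ_prod \<phi> T T) + (1/4) *\<^sub>R part27 (F_tensor \<phi> Rm))" for T D Rm
    unfolding L27a_def rel3_matrix linear_diff[OF linear_part27] linear_cmul[OF linear_part27]
      part27_transpose by (simp add: algebra_simps)
  have rel27b: "L27b (bianchi_G \<phi> T D Rm) = part27 (K2 \<phi> D)
            - (- (1/2) *\<^sub>R part27 (nabla_VV \<phi> \<psi> T D + transpose (nabla_VV \<phi> \<psi> T D)) + trace T *\<^sub>R part27 T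
               - part27 (T ** T) - part27 (Rc Rm))" if R: "algebraic_curvature Rm" for T D Rm
    unfolding L27b_def rel2_matrix[OF R] linear_diff[OF linear_part27] linear_cmul[OF linear_part27]
      linear_add[OF linear_part27] part27_transpose by (simp add: scaleR_2[symmetric])
  show ?thesis
    unfolding independent_relations_def Let_def
    by (rule exI[of _ c1], rule exI[of _ c7a], rule exI[of _ c7b], rule exI[of _ L14], rule exI[of _ L27a],
        rule exI[of _ L27b]) (intro conjI allI impI comp1 comp7 comp14 comp27 surj rel1 rel7a rel7b rel14 rel27a rel27b)
qed

end

subsection \<open>Irreducible representations in the Fano model\<close>

lemma UNIV_7: "(UNIV :: 7 set) = {0, 1, 2, 3, 4, 5, 6}"
proof -
  have "x \<in> {0, 1, 2, 3, 4, 5, 6}" for x :: 7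
  proof (cases x)
    case (of_int z)
    hence "z = 0 \<or> z = 1 \<or> z = 2 \<or> z = 3 \<or> z = 4 \<or> z = 5 \<or> z = 6" by auto
    thus ?thesis using of_int by auto
  qed
  thus ?thesis by auto
qed

lemma forall_7: "(\<forall>x :: 7. P x) \<longleftrightarrow> P 0 \<and> P 1 \<and> P 2 \<and> P 3 \<and> P 4 \<and> P 5 \<and> P 6"
  by (metis UNIV_7 UNIV_I insertE singletonD)

lemma sum_7: "sum f (UNIV :: 7 set) = f 0 + f 1 + f 2 + f 3 + f 4 + f 5 + f 6"
  unfolding UNIV_7 by (simp add: add_ac)

lemma mod7: "(7::7) = 0" "(8::7) = 1" "(9::7) = 2" "(10::7) = 3" "(11::7) = 4" "(12::7) = 5" "(16::7) = 2" "(20::7) = 6" "(24::7) = 3"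
  by simp_all

lemma diff7: "x - 1 = x + 6" "x - 2 = x + 5" "x - 4 = x + 3" for x :: 7
  by (simp_all add: diff_eq_eq add.assoc)

text \<open>4 is the inverse of 2 modulo 7; doubling is the symmetry of order 3 of the Fano
  plane.\<close>

lemma double7: "2 * a = i \<longleftrightarrow> a = 4 * i" "4 * a = 4 * i \<longleftrightarrow> a = i" for a i :: 7
proof -
  have "\<forall>a i :: 7. (2 * a = i \<longleftrightarrow> a = 4 * i) \<and> (4 * a = 4 * i \<longleftrightarrow> a = i)"
    by (simp add: forall_7)
  thus "2 * a = i \<longleftrightarrow> a = 4 * i" "4 * a = 4 * i \<longleftrightarrow> a = i" by blast+
qed

section \<open>Change of basis for covariant components\<close>

lemma comps_linear:
  "comps f (\<lambda>js. \<Sum>b\<in>B. c b * u b js) is = (\<Sum>b\<in>B. c b * comps f (u b) is)"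
  unfolding comps_def sum_distrib_left by (subst sum.swap) (simp only: mult_ac)

lemma column_component: "column m A $ i = A $ i $ m"
  by (simp add: column_def)

lemma comps_comps:
  "comps (\<lambda>m. column m B) (comps (\<lambda>m. column m A) t) is = comps (\<lambda>m. column m (A ** B)) t is"
proof (induction "is" arbitrary: t)
  case Nil
  show ?case by (simp add: comps_Nil)
next
  case (Cons i "is")
  have "comps (\<lambda>m. column m B) (comps (\<lambda>m. column m A) t) (i # is) =
    (\<Sum>a\<in>UNIV. \<Sum>b\<in>UNIV. B $ a $ i * (A $ b $ a * comps (\<lambda>m. column m (A ** B)) (\<lambda>ks. t (b # ks)) is))"
    by (simp add: comps_Cons comps_linear Cons column_component sum_distrib_left)
  also have "\<dots> = (\<Sum>b\<in>UNIV. \<Sum>a\<in>UNIV. B $ a $ i * (A $ b $ a * comps (\<lambda>m. column m (A ** B)) (\<lambda>ks. t (b # ks)) is))"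
    by (rule sum.swap)
  also have "\<dots> = comps (\<lambda>m. column m (A ** B)) t (i # is)"
    by (simp add: comps_Cons column_component sum_distrib_left sum_distrib_right mult_ac)
       (simp add: matrix_matrix_mult_def sum_distrib_right mult_ac)
  finally show ?case .
qed

lemma comps_mat1: "comps (\<lambda>m. column m (mat 1)) t is = t is"
proof (induction "is" arbitrary: t)
  case (Cons i "is")
  show ?case
    by (simp add: comps_Cons Cons column_component) (simp add: mat_def if_mult_zero)
qed (simp add: comps_Nil)

lemma comps_cong:
  assumes "\<And>js. length js = length is \<Longrightarrow> t js = t' js"
  shows "comps e t is = comps e t' is"
  unfolding comps_def using assms by (intro sum.cong refl) auto

lemma length3: "length js = 3 \<Longrightarrow> \<exists>i j k. js = [i, j, k]"
  by (auto simp: numeral_3_eq_3 length_Suc_conv)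

lemma comps_cong3:
  assumes "\<And>i j k. t [i, j, k] = t' [i, j, k]"
  shows "comps e t [i, j, k] = comps e t' [i, j, k]"
proof (rule comps_cong)
  fix js :: "7 list" assume "length js = length [i, j, k]"
  hence "length js = 3" by simp
  then obtain a b c where "js = [a, b, c]" using length3 by blast
  thus "t js = t' js" by (simp add: assms)
qed

lemma comps3: "comps e t [i, j, k] = (\<Sum>a\<in>UNIV. \<Sum>b\<in>UNIV. \<Sum>c\<in>UNIV. e i $ a * e j $ b * e k $ c * t [a, b, c])"
  by (simp add: comps_simps sum_distrib_left mult.assoc)

lemma comps_skew3:
  assumes "\<And>a b c. t [b, a, c] = - t [a, b, c]" "\<And>a b c. t [a, c, b] = - t [a, b, c]"
  shows "comps e t [j, i, k] = - comps e t [i, j, k]" "comps e t [i, k, j] = - comps e t [i, j, k]"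
proof -
  have "comps e t [j, i, k] = (\<Sum>b\<in>UNIV. \<Sum>a\<in>UNIV. \<Sum>c\<in>UNIV. e j $ a * e i $ b * e k $ c * t [a, b, c])"
    unfolding comps3 by (rule sum.swap)
  also have "\<dots> = (\<Sum>a\<in>UNIV. \<Sum>b\<in>UNIV. \<Sum>c\<in>UNIV. - (e i $ a * e j $ b * e k $ c * t [a, b, c]))"
    by (intro sum.cong refl, subst assms(1), simp)
  finally show "comps e t [j, i, k] = - comps e t [i, j, k]" by (simp add: comps3 sum_negf)
  have "comps e t [i, k, j] = (\<Sum>a\<in>UNIV. \<Sum>c\<in>UNIV. \<Sum>b\<in>UNIV. e i $ a * e k $ b * e j $ c * t [a, b, c])"
    unfolding comps3 by (rule sum_swap23)
  also have "\<dots> = (\<Sum>a\<in>UNIV. \<Sum>b\<in>UNIV. \<Sum>c\<in>UNIV. - (e i $ a * e j $ b * e k $ c * t [a, b, c]))"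
    by (intro sum.cong refl, subst assms(2), simp)
  finally show "comps e t [i, k, j] = - comps e t [i, j, k]" by (simp add: comps3 sum_negf)
qed

text \<open>Sorting the indices by transpositions reduces a claim about 343 components to the 35
  increasing triples listed in \<open>forall_less_7\<close>.\<close>

lemma skew3_zeroI:
  fixes f :: "'a::linorder \<Rightarrow> 'a \<Rightarrow> 'a \<Rightarrow> real"
  assumes f: "\<And>i j k. f j i k = - f i j k" "\<And>i j k. f i k j = - f i j k"
    and eq: "\<And>i j k. i < j \<Longrightarrow> j < k \<Longrightarrow> f i j k = 0"
  shows "f i j k = 0"
proof -
  have z: "f i i k = 0" "f i k k = 0" "f i k i = 0" for i k
    using f(1)[of i i k] f(2)[of i k k] f(1)[of i k i] f(2)[of k i i] by linarith+
  have e: "f i j k = 0" if "i < j" for i j k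
  proof -
    consider "j < k" | "k < i" | "i < k \<and> k < j" | "k = i" | "k = j" by fastforce
    thus ?thesis
    proof cases
      case 2 thus ?thesis using eq[of k i j] f(1)[of k i j] f(2)[of i k j] that by linarith
    next
      case 3 thus ?thesis using eq[of i k j] f(2)[of i k j] by linarith
    qed (use eq that z in auto)
  qed
  consider "i < j" | "i = j" | "j < i" by fastforce
  thus ?thesis
    using e f(1)[of j i k] z by cases auto
qed

lemma skew3_eqI:
  fixes f g :: "'a::linorder \<Rightarrow> 'a \<Rightarrow> 'a \<Rightarrow> real"
  assumes f: "\<And>i j k. f j i k = - f i j k" "\<And>i j k. f i k j = - f i j k"
    and g: "\<And>i j k. g j i k = - g i j k" "\<And>i j k. g i k j = - g i j k"
    and eq: "\<And>i j k. i < j \<Longrightarrow> j < k \<Longrightarrow> f i j k = g i j k"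
  shows "f i j k = g i j k"
proof -
  have "f i j k - g i j k = 0"
  proof (rule skew3_zeroI[of "\<lambda>i j k. f i j k - g i j k"])
    fix i j k
    show "f j i k - g j i k = - (f i j k - g i j k)" using f(1)[of j i k] g(1)[of j i k] by linarith
    show "f i k j - g i k j = - (f i j k - g i j k)" using f(2)[of i k j] g(2)[of i k j] by linarith
  qed (use eq in simp)
  thus ?thesis by simp
qed

lemma less_7:
  "(0::7) < 1" "(0::7) < numeral n \<longleftrightarrow> (numeral n :: int) mod 7 > 0" "(1::7) < numeral n \<longleftrightarrow> (numeral n :: int) mod 7 > 1"
  "(numeral m :: 7) < numeral n \<longleftrightarrow> (numeral m :: int) mod 7 < numeral n mod 7"
  "(numeral n :: 7) < 1 \<longleftrightarrow> (numeral n :: int) mod 7 < 1" "\<not> (numeral n :: 7) < 0" "\<not> (1::7) < 0"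
proof -
  show "\<not> (numeral n :: 7) < 0"
    by (simp only: less_bit1_def bit1.Rep_numeral bit1.Rep_0 not_less) (rule pos_mod_sign, simp)
qed (auto simp: less_bit1_def bit1.Rep_numeral bit1.Rep_0 bit1.Rep_1)

lemma forall_less_7:
  "(\<forall>i j k :: 7. i < j \<longrightarrow> j < k \<longrightarrow> P i j k) \<longleftrightarrow>
     P 0 1 2 \<and> P 0 1 3 \<and> P 0 1 4 \<and> P 0 1 5 \<and> P 0 1 6 \<and> P 0 2 3 \<and> P 0 2 4 \<and> P 0 2 5 \<and> P 0 2 6 \<and>
     P 0 3 4 \<and> P 0 3 5 \<and> P 0 3 6 \<and> P 0 4 5 \<and> P 0 4 6 \<and> P 0 5 6 \<and>
     P 1 2 3 \<and> P 1 2 4 \<and> P 1 2 5 \<and> P 1 2 6 \<and> P 1 3 4 \<and> P 1 3 5 \<and> P 1 3 6 \<and> P 1 4 5 \<and> P 1 4 6 \<and> P 1 5 6 \<and>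
     P 2 3 4 \<and> P 2 3 5 \<and> P 2 3 6 \<and> P 2 4 5 \<and> P 2 4 6 \<and> P 2 5 6 \<and> P 3 4 5 \<and> P 3 4 6 \<and> P 3 5 6 \<and> P 4 5 6"
  by (simp add: forall_7 less_7 conj_ac)

text \<open>If \<open>w\<close> spans the fixed line of a subgroup, then its components in an invariant subspace and in the
  orthogonal complement are fixed, hence multiples of \<open>w\<close>: one of the two spaces contains \<open>w\<close>.\<close>

lemma irreducible_by_stabiliser:
  fixes act :: "real^7^7 \<Rightarrow> 'v::euclidean_space \<Rightarrow> 'v"
  assumes V: "subspace V" and w: "w \<in> V" "w \<noteq> 0"
    and lin: "\<And>A. linear (act A)"
    and inv: "\<And>A. A \<in> G2_group \<phi> \<Longrightarrow> act A ` V \<subseteq> V"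
    and G: "G \<subseteq> G2_group \<phi>" and adj: "\<And>A. A \<in> G \<Longrightarrow> \<exists>A'\<in>G. \<forall>x y. act A x \<bullet> y = x \<bullet> act A' y"
    and H: "H \<subseteq> G" "\<And>A. A \<in> H \<Longrightarrow> act A w = w"
    and fixed: "\<And>x. x \<in> V \<Longrightarrow> (\<And>A. A \<in> H \<Longrightarrow> act A x = x) \<Longrightarrow> \<exists>c. x = c *\<^sub>R w"
    and cyclic: "\<And>S. subspace S \<Longrightarrow> w \<in> S \<Longrightarrow> (\<And>A x. A \<in> G \<Longrightarrow> x \<in> S \<Longrightarrow> act A x \<in> S) \<Longrightarrow> V \<subseteq> S"
  shows "G2_irreducible \<phi> act V"
  unfolding G2_irreducible_def
proof (intro conjI ballI allI impI)
  show "V \<noteq> {0}" using w by auto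
next
  fix S assume "subspace S \<and> S \<subseteq> V \<and> (\<forall>A\<in>G2_group \<phi>. act A ` S \<subseteq> S)"
  hence S: "subspace S" "S \<subseteq> V" and iS: "\<And>A x. A \<in> G \<Longrightarrow> x \<in> S \<Longrightarrow> act A x \<in> S" using G by blast+
  define N where "N = {y. \<forall>s\<in>S. y \<bullet> s = 0}"
  have N: "subspace N" unfolding N_def by (auto simp: subspace_def inner_add_left)
  have iN: "act A y \<in> N" if "A \<in> G" "y \<in> N" for A y
    using adj[OF that(1)] iS that(2) unfolding N_def by fastforce
  obtain p q where pq: "w = p + q" "p \<in> S" "q \<in> N"
  proof -
    obtain y z where "y \<in> span S" "\<And>x. x \<in> span S \<Longrightarrow> orthogonal z x" "w = y + z"
      using orthogonal_subspace_decomp_exists[of S w] by blast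
    thus ?thesis using that[of y z] S(1) by (auto simp: span_eq_iff[THEN iffD2] orthogonal_def N_def)
  qed
  \<comment> \<open>The change of \<open>p\<close> under \<open>A\<close> is minus the change of
    \<open>q\<close>; it lies in \<open>S\<close> and in its orthogonal complement, so it is
    zero.\<close>
  have "act A p = p" if "A \<in> H" for A
  proof -
    have "A \<in> G" using H that by blast
    have "p + q = act A p + act A q" using H(2)[OF that] pq(1) linear_add[OF lin] by metis
    hence "act A p - p = q - act A q" by (simp add: algebra_simps)
    moreover have "act A p - p \<in> S" using iS[OF \<open>A \<in> G\<close> pq(2)] pq(2) subspace_diff[OF S(1)] by blast
    moreover have "q - act A q \<in> N" using iN[OF \<open>A \<in> G\<close> pq(3)] pq(3) subspace_diff[OF N] by blast
    ultimately have "(act A p - p) \<bullet> (act A p - p) = 0" unfolding N_def by fastforce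
    thus ?thesis by simp
  qed
  then obtain c where c: "p = c *\<^sub>R w" using fixed S(2) pq(2) by blast
  show "S = {0} \<or> S = V"
  proof (cases "c = 0")
    case True
    hence "w \<in> N" using c pq by simp
    hence "V \<subseteq> N" using cyclic[OF N] iN by blast
    hence "x \<bullet> x = 0" if "x \<in> S" for x using that S(2) unfolding N_def by blast
    thus ?thesis using subspace_0[OF S(1)] by auto
  next
    case False
    hence "w = (1 / c) *\<^sub>R p" using c by simp
    hence "w \<in> S" using subspace_scale[OF S(1) pq(2)] by simp
    thus ?thesis using cyclic[OF S(1)] iS S(2) by blast
  qed
qed (use V inv in auto)

text \<open>The lines are {i, i+1, i+3} mod 7. The three positive alternatives describe the same
  oriented line read from its first, second and third point. Invariance under translation is then
  evident, and each pair of points lies on exactly one line.\<close>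

definition fano :: "7 \<Rightarrow> 7 \<Rightarrow> 7 \<Rightarrow> real" where
  "fano i j k =
    (if j = i + 1 \<and> k = i + 3 \<or> j = i + 2 \<and> k = i + 6 \<or> j = i + 4 \<and> k = i + 5 then 1
     else if j = i + 3 \<and> k = i + 1 \<or> j = i + 6 \<and> k = i + 2 \<or> j = i + 5 \<and> k = i + 4 then -1 else 0)"

lemma fano_shift: "fano (i + c) (j + c) (k + c) = fano i j k"
  by (simp add: fano_def add.assoc add.left_commute)

lemma fano_0: "fano i j k = fano 0 (j - i) (k - i)"
  using fano_shift[of 0 i "j - i" "k - i"] by simp

lemma fano_skew: "fano j i k = - fano i j k" "fano i k j = - fano i j k"
proof -
  have "\<forall>d e. fano 0 (- d) (e - d) = - fano 0 d e" "\<forall>d e. fano 0 e d = - fano 0 d e"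
    by (simp_all add: forall_7 fano_def)
  from this(1)[rule_format, of "j - i" "k - i"] this(2)[rule_format, of "k - i" "j - i"]
  show "fano j i k = - fano i j k" "fano i k j = - fano i j k"
    by (simp_all add: fano_0[of i] fano_0[of j])
qed

definition spmat :: "(7 \<Rightarrow> real) \<Rightarrow> (7 \<Rightarrow> 7) \<Rightarrow> real^7^7" where
  "spmat s \<pi> = (\<chi> i m. s m * kd i (\<pi> m))"

lemma comps_spmat: "comps (\<lambda>m. column m (spmat s \<pi>)) t [i, j, k] = s i * s j * s k * t [\<pi> i, \<pi> j, \<pi> k]"
proof -
  have c: "(\<Sum>a\<in>UNIV. x * (kd a b * f a)) = x * f b" for x b and f :: "7 \<Rightarrow> real"
    by (simp add: sum_distrib_left[symmetric])
  show ?thesis by (simp add: comps_simps column_component spmat_def c mult.assoc)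
qed

lemma act1_spmat: "act1 (spmat s \<pi>) v $ m = s m * v $ \<pi> m"
  by (simp add: act1_def matrix_vector_mult_def transpose_def spmat_def mult.assoc sum_distrib_left[symmetric])

lemma act2_spmat: "act2 (spmat s \<pi>) B $ i $ j = s i * s j * B $ \<pi> i $ \<pi> j"
proof -
  have "act2 (spmat s \<pi>) B $ i $ j = (\<Sum>a\<in>UNIV. kd a (\<pi> i) * (\<Sum>b\<in>UNIV. kd b (\<pi> j) * (s i * s j * B $ a $ b)))"
    by (simp only: act2_component spmat_def vec_lambda_beta sum_distrib_left mult_ac)
  thus ?thesis by simp
qed

lemma orthogonal_spmat:
  assumes "\<And>m. s m * s m = 1" "inj \<pi>"
  shows "orthogonal_matrix (spmat s \<pi>)"
proof -
  have "(\<Sum>a\<in>UNIV. (s i * kd a (\<pi> i)) * (s j * kd a (\<pi> j))) = s i * s j * kd (\<pi> i) (\<pi> j)" for i j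
    using sum_kd(3)[of "\<lambda>a. s i * s j * kd a (\<pi> i)" "\<pi> j"] by (simp add: mult_ac kd_sym)
  moreover have "s i * s j * kd (\<pi> i) (\<pi> j) = (if i = j then 1 else 0)" for i j
    using assms by (simp add: kd_def inj_eq)
  ultimately have "transpose (spmat s \<pi>) ** spmat s \<pi> = mat 1"
    by (simp add: vec_eq_iff matrix_matrix_mult_def transpose_def spmat_def mat_def)
  thus ?thesis by (simp add: orthogonal_matrix)
qed

locale fano_tensor =
  fixes \<phi> :: tensor
  assumes fano: "\<phi> [i, j, k] = fano i j k"
begin

text \<open>For an orthogonal stabiliser element the transpose is the inverse, hence again in the
  stabiliser; this provides the adjoints required by
  \<open>irreducible_by_stabiliser\<close>.\<close>

definition G :: "(real^7^7) set" where
  "G = {A \<in> G2_group \<phi>. orthogonal_matrix A}"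

lemma transpose_G: "A \<in> G \<Longrightarrow> transpose A \<in> G"
proof -
  assume "A \<in> G"
  hence o: "orthogonal_matrix A" and p: "\<And>i j k. comps (\<lambda>m. column m A) \<phi> [i, j, k] = \<phi> [i, j, k]"
    by (auto simp: G_def G2_group_def)
  have "comps (\<lambda>m. column m (transpose A)) \<phi> [i, j, k] = \<phi> [i, j, k]" for i j k
  proof -
    have "comps (\<lambda>m. column m (transpose A)) \<phi> [i, j, k] =
      comps (\<lambda>m. column m (transpose A)) (comps (\<lambda>m. column m A) \<phi>) [i, j, k]"
      by (rule comps_cong3) (simp add: p)
    also have "\<dots> = \<phi> [i, j, k]"
      using o by (simp only: comps_comps orthogonal_matrix_def comps_mat1)
    finally show ?thesis .
  qed
  moreover have "orthogonal_matrix (transpose A)" using o by simp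
  moreover have "invertible (transpose A)" using o by (auto simp: orthogonal_matrix_def invertible_def)
  ultimately show ?thesis by (simp add: G_def G2_group_def)
qed

lemma adj1: "A \<in> G \<Longrightarrow> \<exists>A'\<in>G. \<forall>x y. act1 A x \<bullet> y = x \<bullet> act1 A' y"
  by (rule bexI[OF _ transpose_G]) (simp_all add: act1_def dot_lmul_matrix)

lemma adj2: "A \<in> G \<Longrightarrow> \<exists>A'\<in>G. \<forall>x y. act2 A x \<bullet> y = x \<bullet> act2 A' y"
proof (rule bexI[OF _ transpose_G])
  have "act2 A x \<bullet> y = x \<bullet> act2 (transpose A) y" for x y
  proof -
    have "act2 A x \<bullet> y = (\<Sum>i\<in>UNIV. \<Sum>j\<in>UNIV. \<Sum>a\<in>UNIV. \<Sum>b\<in>UNIV. x $ a $ b * (A $ a $ i * A $ b $ j * y $ i $ j))"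
      by (simp only: inner_matrix act2_component sum_distrib_left sum_distrib_right mult_ac)
    also have "\<dots> = (\<Sum>a\<in>UNIV. \<Sum>b\<in>UNIV. \<Sum>i\<in>UNIV. \<Sum>j\<in>UNIV. x $ a $ b * (A $ a $ i * A $ b $ j * y $ i $ j))"
      by (rule sum_swap_pairs)
    also have "\<dots> = x \<bullet> act2 (transpose A) y"
      by (simp only: inner_matrix act2_component transpose_def vec_lambda_beta sum_distrib_left mult_ac)
    finally show ?thesis .
  qed
  thus "\<forall>x y. act2 A x \<bullet> y = x \<bullet> act2 (transpose A) y" by blast
qed

lemma phi_skew: "\<phi> [j, i, k] = - \<phi> [i, j, k]" "\<phi> [i, k, j] = - \<phi> [i, j, k]"
  unfolding fano by (rule fano_skew)+

lemma orthogonal_G: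
  assumes o: "orthogonal_matrix A"
    and "\<forall>i j k. i < j \<longrightarrow> j < k \<longrightarrow> comps (\<lambda>m. column m A) \<phi> [i, j, k] = \<phi> [i, j, k]"
  shows "A \<in> G"
proof -
  have "comps (\<lambda>m. column m A) \<phi> [i, j, k] = \<phi> [i, j, k]" for i j k
    by (rule skew3_eqI[of "\<lambda>i j k. comps (\<lambda>m. column m A) \<phi> [i, j, k]" "\<lambda>i j k. \<phi> [i, j, k]",
          OF comps_skew3[of \<phi> "\<lambda>m. column m A", OF phi_skew] phi_skew]) (use assms(2) in blast)
  moreover have "invertible A" using o by (auto simp: orthogonal_matrix_def invertible_def)
  ultimately show ?thesis using o by (simp add: G_def G2_group_def)
qed

lemma spmat_G:
  assumes "\<And>m. s m * s m = 1" "inj \<pi>"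
    "\<forall>i j k. i < j \<longrightarrow> j < k \<longrightarrow> s i * s j * s k * fano (\<pi> i) (\<pi> j) (\<pi> k) = fano i j k"
  shows "spmat s \<pi> \<in> G"
  using assms by (intro orthogonal_G orthogonal_spmat) (auto simp: comps_spmat fano)

text \<open>Symmetries of the oriented plane up to signs. \<open>shift\<close> and
  \<open>mul2\<close> permute the lines without signs; each \<open>flip\<close> is +1 on one line
  through 0 and -1 off it; \<open>turn\<close> and \<open>swap\<close> fix the point 0 up to sign
  and permute the other points of the lines through 0.\<close>

definition shift :: "7 \<Rightarrow> real^7^7" where "shift c = spmat (\<lambda>m. 1) (\<lambda>m. m + c)"
definition mul2 :: "real^7^7" where "mul2 = spmat (\<lambda>m. 1) (\<lambda>m. 2 * m)"
definition flip1 :: "real^7^7" where "flip1 = spmat (\<lambda>m. if m \<in> {0, 1, 3} then 1 else -1) (\<lambda>m. m)"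
definition flip2 :: "real^7^7" where "flip2 = spmat (\<lambda>m. if m \<in> {0, 2, 6} then 1 else -1) (\<lambda>m. m)"
definition turn :: "real^7^7" where
  "turn = spmat (\<lambda>m. if m \<in> {2, 3} then -1 else 1)
    (\<lambda>m. if m = 1 then 3 else if m = 3 then 1 else if m = 2 then 6 else if m = 6 then 2 else m)"
definition swap :: "real^7^7" where
  "swap = spmat (\<lambda>m. if m \<in> {1, 3} then -1 else 1)
    (\<lambda>m. if m = 2 then 4 else if m = 4 then 2 else if m = 5 then 6 else if m = 6 then 5 else m)"
text \<open>Rotation by opposite angles in the oriented planes (1,3) and (2,6), which complete 0 to
  lines. Its generator is a multiple of a difference of two of the three planes through 0 and so
  lies in the Lie algebra. The angle of the 3-4-5 triangle keeps the entries rational.\<close>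

definition rot :: "real^7^7" where
  "rot = (\<chi> i m. if i = m then (if m \<in> {1, 2, 3, 6} then 3/5 else 1)
     else if (i, m) = (3, 1) \<or> (i, m) = (2, 6) then 4/5
     else if (i, m) = (1, 3) \<or> (i, m) = (6, 2) then -4/5 else 0)"

lemma shift_G: "shift c \<in> G"
  unfolding shift_def by (rule spmat_G) (simp_all add: inj_def fano_def add_ac)

lemma mul2_G: "mul2 \<in> G"
  unfolding mul2_def
proof (rule spmat_G)
  have "x = 4 * (2 * x)" for x :: 7
    using forall_7[of "\<lambda>x. x = 4 * (2 * x)"] by simp
  thus "inj (\<lambda>m :: 7. 2 * m)" by (metis injI)
qed (simp, unfold forall_less_7, simp add: fano_def)

lemma flips_G: "flip1 \<in> G" "flip2 \<in> G"
  unfolding flip1_def flip2_def by (rule spmat_G, simp, simp, unfold forall_less_7, simp add: fano_def)+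

lemma turn_G: "turn \<in> G"
  unfolding turn_def
proof (rule spmat_G)
  show "inj (\<lambda>m :: 7. if m = 1 then 3 else if m = 3 then 1 else if m = 2 then 6 else if m = 6 then 2 else m)"
    by (simp add: inj_def forall_7)
qed (simp, unfold forall_less_7, simp add: fano_def)

lemma swap_G: "swap \<in> G"
  unfolding swap_def
proof (rule spmat_G)
  show "inj (\<lambda>m :: 7. if m = 2 then 4 else if m = 4 then 2 else if m = 5 then 6 else if m = 6 then 5 else m)"
    by (simp add: inj_def forall_7)
qed (simp, unfold forall_less_7, simp add: fano_def)

lemma rot_G: "rot \<in> G"
proof -
  have "transpose rot ** rot = mat 1"
    by (simp add: vec_eq_iff matrix_matrix_mult_def transpose_def mat_def forall_7 sum_7 rot_def)
  hence o: "orthogonal_matrix rot" by (simp add: orthogonal_matrix)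
  have c: "(\<Sum>a\<in>UNIV. rot $ a $ 0 * f a) = f 0" "(\<Sum>a\<in>UNIV. rot $ a $ 4 * f a) = f 4"
    "(\<Sum>a\<in>UNIV. rot $ a $ 5 * f a) = f 5"
    "(\<Sum>a\<in>UNIV. rot $ a $ 1 * f a) = 3/5 * f 1 + 4/5 * f 3"
    "(\<Sum>a\<in>UNIV. rot $ a $ 3 * f a) = 3/5 * f 3 - 4/5 * f 1"
    "(\<Sum>a\<in>UNIV. rot $ a $ 2 * f a) = 3/5 * f 2 - 4/5 * f 6"
    "(\<Sum>a\<in>UNIV. rot $ a $ 6 * f a) = 3/5 * f 6 + 4/5 * f 2"
    for f :: "7 \<Rightarrow> real"
    by (simp_all add: sum_7 rot_def)
  show ?thesis
    by (rule orthogonal_G[OF o]) (unfold forall_less_7, simp only: comps_simps column_component c fano, simp add: fano_def)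
qed

lemma linear_act1: "linear (act1 A)"
  unfolding act1_def by (rule matrix_vector_mul_linear)

text \<open>The lines {0, 1, 3} and {0, 2, 6} of the two sign changes meet only in 0, so the joint
  fixed space is spanned by the first basis vector; the translations carry it to all others.\<close>

lemma irreducible7: "G2_irreducible \<phi> act1 UNIV"
proof (rule irreducible_by_stabiliser[where w = "axis 0 1" and G = G and H = "{flip1, flip2}"])
  have "act1 flip1 (axis 0 1) = axis 0 1" "act1 flip2 (axis 0 1) = axis 0 1"
    by (auto simp: vec_eq_iff act1_spmat flip1_def flip2_def axis_def)
  thus "act1 A (axis 0 1) = axis 0 1" if "A \<in> {flip1, flip2}" for A
    using that by blast
  show "\<exists>c. x = c *\<^sub>R axis 0 1" if "\<And>A. A \<in> {flip1, flip2} \<Longrightarrow> act1 A x = x" for x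
  proof -
    have "act1 flip1 x $ m = x $ m" "act1 flip2 x $ m = x $ m" for m using that by auto
    note this[unfolded act1_spmat flip1_def flip2_def]
    from this[of 1] this[of 2] this[of 3] this[of 4] this[of 5] this[of 6]
    have "x = x $ 0 *\<^sub>R axis 0 1"
      by (simp add: vec_eq_iff forall_7 axis_def)
    thus ?thesis by blast
  qed
  fix S :: "(real^7) set" assume S: "subspace S" "axis 0 1 \<in> S" "\<And>A x. A \<in> G \<Longrightarrow> x \<in> S \<Longrightarrow> act1 A x \<in> S"
  have a: "axis c 1 \<in> S" for c
  proof -
    have "act1 (shift (- c)) (axis 0 1) = axis c 1"
      by (auto simp: vec_eq_iff act1_spmat shift_def axis_def)
    thus ?thesis using S(3)[OF shift_G S(2), of "- c"] by simp
  qed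
  have "x \<in> S" for x
  proof -
    have "x = (\<Sum>c\<in>UNIV. x $ c *\<^sub>R axis c 1)"
      by (simp add: vec_eq_iff axis_def if_distrib cong: if_cong)
    moreover have "(\<Sum>c\<in>UNIV. x $ c *\<^sub>R axis c 1) \<in> S"
      by (intro subspace_sum[OF S(1)] subspace_scale[OF S(1)] a)
    ultimately show ?thesis by metis
  qed
  thus "UNIV \<subseteq> S" by blast
qed (use flips_G adj1 linear_act1 in \<open>auto simp: axis_eq_0_iff G_def\<close>)

lemma act2_Sym0: "orthogonal_matrix A \<Longrightarrow> B \<in> Sym0 \<Longrightarrow> act2 A B \<in> Sym0"
  by (simp add: Sym0_def transpose_act2 trace_act2)

lemma act2_G_Sym0: "A \<in> G2_group \<phi> \<Longrightarrow> orthogonal_matrix A \<Longrightarrow> act2 A ` Sym0 \<subseteq> Sym0"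
  using act2_Sym0 by blast

text \<open>\<open>Y i j\<close> is the traceless part of the symmetrised matrix unit, and the fixed
  line is that of \<open>Y 0 0\<close>. Starting from \<open>Y 0 0\<close>, translations reach all
  diagonal \<open>Y i i\<close>; \<open>rot\<close> is needed to leave the diagonal matrices, which
  every signed permutation preserves.\<close>

lemma irreducible27:
  assumes orth: "\<And>A. A \<in> G2_group \<phi> \<Longrightarrow> orthogonal_matrix A"
  shows "G2_irreducible \<phi> act2 Sym0"
proof -
  define Y where "Y i j = (\<chi> a b. (kd i a * kd j b + kd j a * kd i b) / 2 - kd i j * kd a b / 7)" for i j
  have Y: "Y i j $ a $ b = (kd i a * kd j b + kd j a * kd i b) / 2 - kd i j * kd a b / 7" for i j a b
    by (simp add: Y_def)
  have Y_Sym0: "Y i j \<in> Sym0" for i j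
    by (simp add: Sym0_def vec_eq_iff transpose_def trace_def Y kd_sym sum_subtractf sum.distrib
        sum_divide_distrib[symmetric] sum_distrib_left[symmetric])
  have Y_shift: "act2 (shift c) (Y i j) = Y (i - c) (j - c)" for c i j
    by (auto simp: vec_eq_iff act2_spmat shift_def Y kd_def algebra_simps)
  have Y_mul2: "act2 mul2 (Y i j) = Y (4 * i) (4 * j)" for i j
    by (auto simp: vec_eq_iff act2_spmat mul2_def Y kd_def double7 mod7)
  let ?H = "{flip1, flip2, turn, mul2}"
  show ?thesis
  proof (rule irreducible_by_stabiliser[where w = "Y 0 0" and G = G and H = ?H])
    show "Y 0 0 \<noteq> 0"
      by (simp add: vec_eq_iff Y) (rule exI[of _ 0], simp add: forall_7 kd_def)
    show "act2 A ` Sym0 \<subseteq> Sym0" if "A \<in> G2_group \<phi>" for A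
      using act2_G_Sym0 orth that by blast
    have "act2 flip1 (Y 0 0) = Y 0 0" "act2 flip2 (Y 0 0) = Y 0 0" "act2 turn (Y 0 0) = Y 0 0"
      by (auto simp: vec_eq_iff act2_spmat flip1_def flip2_def turn_def Y kd_def)
    moreover have "act2 mul2 (Y 0 0) = Y 0 0" by (simp add: Y_mul2)
    ultimately show "act2 A (Y 0 0) = Y 0 0" if "A \<in> ?H" for A
      using that by blast
    show "\<exists>c. x = c *\<^sub>R Y 0 0" if x: "x \<in> Sym0" and H: "\<And>A. A \<in> ?H \<Longrightarrow> act2 A x = x" for x
    proof -
      have sym: "x $ i $ j = x $ j $ i" for i j
        using x by (auto simp: Sym0_def transpose_def vec_eq_iff)
      have tr: "x $ 0 $ 0 + x $ 1 $ 1 + x $ 2 $ 2 + x $ 3 $ 3 + x $ 4 $ 4 + x $ 5 $ 5 + x $ 6 $ 6 = 0"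
        using x by (simp add: Sym0_def trace_def sum_7)
      have "act2 flip1 x $ i $ j = x $ i $ j" "act2 flip2 x $ i $ j = x $ i $ j"
         "act2 turn x $ i $ j = x $ i $ j" "act2 mul2 x $ i $ j = x $ i $ j" for i j using H by auto
      note fx = this[unfolded act2_spmat flip1_def flip2_def turn_def mul2_def]
      \<comment> \<open>The two sign changes leave, off the diagonal, only the pairs (1,3), (2,6)
        and (4,5). \<open>turn\<close> negates the first of these, and \<open>mul2\<close> carries
        that to the other two.\<close>
      have off: "x $ 0 $ 1 = 0" "x $ 0 $ 2 = 0" "x $ 0 $ 3 = 0" "x $ 0 $ 4 = 0" "x $ 0 $ 5 = 0" "x $ 0 $ 6 = 0"
        "x $ 1 $ 2 = 0" "x $ 1 $ 4 = 0" "x $ 1 $ 5 = 0" "x $ 1 $ 6 = 0" "x $ 2 $ 3 = 0" "x $ 2 $ 4 = 0"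
        "x $ 2 $ 5 = 0" "x $ 3 $ 4 = 0" "x $ 3 $ 5 = 0" "x $ 3 $ 6 = 0" "x $ 4 $ 6 = 0" "x $ 5 $ 6 = 0"
        using fx(1)[of 0 2] fx(1)[of 0 4] fx(1)[of 0 5] fx(1)[of 0 6] fx(2)[of 0 1] fx(2)[of 0 3]
          fx(1)[of 1 2] fx(1)[of 1 4] fx(1)[of 1 5] fx(1)[of 1 6] fx(1)[of 2 3] fx(2)[of 2 4] fx(2)[of 2 5]
          fx(1)[of 3 4] fx(1)[of 3 5] fx(1)[of 3 6] fx(2)[of 4 6] fx(2)[of 5 6] by simp_all
      have "x $ 1 $ 3 = 0" using fx(3)[of 1 3] sym[of 3 1] by simp
      hence off2: "x $ 1 $ 3 = 0" "x $ 2 $ 6 = 0" "x $ 4 $ 5 = 0"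
        using fx(4)[of 1 3] fx(4)[of 2 6] by (simp_all add: mod7)
      have diag: "x $ 3 $ 3 = x $ 1 $ 1" "x $ 2 $ 2 = x $ 1 $ 1" "x $ 4 $ 4 = x $ 1 $ 1"
         "x $ 6 $ 6 = x $ 1 $ 1" "x $ 5 $ 5 = x $ 1 $ 1"
        using fx(3)[of 1 1] fx(4)[of 1 1] fx(4)[of 2 2] fx(4)[of 3 3] fx(4)[of 6 6] by (simp_all add: mod7)
      have "x $ 0 $ 0 = - 6 * x $ 1 $ 1" using tr diag by simp
      hence "x = (- 7 * x $ 1 $ 1) *\<^sub>R Y 0 0"
        by (simp add: vec_eq_iff forall_7 Y kd_def off off2 diag sym[of 1 0] sym[of 2 0] sym[of 3 0] sym[of 4 0]
          sym[of 5 0] sym[of 6 0] sym[of 2 1] sym[of 3 1] sym[of 4 1] sym[of 5 1] sym[of 6 1] sym[of 3 2] sym[of 4 2]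
          sym[of 5 2] sym[of 6 2] sym[of 4 3] sym[of 5 3] sym[of 6 3] sym[of 5 4] sym[of 6 4] sym[of 6 5])
      thus ?thesis by blast
    qed
    fix S :: "(real^7^7) set"
    assume S: "subspace S" "Y 0 0 \<in> S" and inv: "\<And>A x. A \<in> G \<Longrightarrow> x \<in> S \<Longrightarrow> act2 A x \<in> S"
    have Yd: "Y i i \<in> S" for i
      using inv[OF shift_G S(2), of "- i"] by (simp add: Y_shift)
    \<comment> \<open>Row 1 of \<open>rot\<close> is 3/5 and -4/5 in the columns 1 and 3; squaring
      it gives two diagonal terms and the cross term that isolates \<open>Y 1 3\<close>.\<close>
    have "act2 rot (Y 1 1) = (9/25) *\<^sub>R Y 1 1 + (16/25) *\<^sub>R Y 3 3 - (24/25) *\<^sub>R Y 1 3"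
    proof -
      have r1: "rot $ 1 $ m = (if m = 1 then 3/5 else if m = 3 then -4/5 else 0)" for m
        by (simp add: rot_def)
      have o: "(\<Sum>a\<in>UNIV. rot $ a $ i * rot $ a $ j) = kd i j" for i j
        using rot_G orthogonal_matrix_sums(1) by (simp add: G_def)
      have "act2 rot (Y 1 1) $ i $ j = rot $ 1 $ i * rot $ 1 $ j - kd i j / 7" for i j
      proof -
        have "act2 rot (Y 1 1) $ i $ j = (\<Sum>a\<in>UNIV. \<Sum>b\<in>UNIV. rot $ a $ i * rot $ b $ j * (kd a 1 * kd b 1))
            - (\<Sum>a\<in>UNIV. \<Sum>b\<in>UNIV. rot $ a $ i * rot $ b $ j * kd a b / 7)"
          unfolding act2_component Y by (simp add: right_diff_distrib sum_subtractf kd_sym[of 1])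
        also have "\<dots> = rot $ 1 $ i * rot $ 1 $ j - kd i j / 7"
          by (simp add: sum2_kd sum_divide_distrib[symmetric] o)
        finally show ?thesis .
      qed
      thus ?thesis
        by (simp add: vec_eq_iff Y r1) (simp add: kd_def)
    qed
    hence "Y 1 3 = (25/24) *\<^sub>R ((9/25) *\<^sub>R Y 1 1 + (16/25) *\<^sub>R Y 3 3 - act2 rot (Y 1 1))"
      by simp
    hence "Y 1 3 \<in> S"
      using Yd inv[OF rot_G Yd] S(1) by (metis subspace_add subspace_diff subspace_scale)
    hence Y1: "Y 1 3 \<in> S" "Y 4 5 \<in> S" "Y 2 6 \<in> S"
      using inv[OF mul2_G, of "Y 1 3"] inv[OF mul2_G, of "Y 4 5"] by (simp_all add: Y_mul2 mod7)
    have Yij: "Y i j \<in> S" for i j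
    proof -
      have s: "Y (a + c) (b + c) \<in> S" "Y (b + c) (a + c) \<in> S" if "Y a b \<in> S" for a b c
      proof -
        show "Y (a + c) (b + c) \<in> S" using inv[OF shift_G that, of "- c"] by (simp add: Y_shift)
        moreover have "Y p q = Y q p" for p q by (simp add: vec_eq_iff Y kd_sym add.commute)
        ultimately show "Y (b + c) (a + c) \<in> S" by metis
      qed
      \<comment> \<open>The pairs (1,3), (4,5) and (2,6) have differences 2, 1 and 4. With their
        negatives these are all nonzero residues, so translations and symmetry of \<open>Y\<close>
        reach every pair.\<close>
      have "\<forall>d. Y i (i + d) \<in> S"
        using s[OF Y1(1), of "i - 1"] s[OF Y1(2), of "i - 4"] s[OF Y1(3), of "i - 2"] Yd[of i]
           s(2)[OF Y1(1), of "i - 3"] s(2)[OF Y1(2), of "i - 5"] s(2)[OF Y1(3), of "i - 6"]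
        by (simp add: forall_7 algebra_simps diff7 mod7)
      hence "Y i (i + (j - i)) \<in> S" by blast
      thus ?thesis by simp
    qed
    show "Sym0 \<subseteq> S"
    proof
      fix x assume x: "x \<in> Sym0"
      have sym: "x $ i $ j = x $ j $ i" for i j
        using x by (auto simp: Sym0_def transpose_def vec_eq_iff)
      have "(\<Sum>i\<in>UNIV. \<Sum>j\<in>UNIV. x $ i $ j * Y i j $ a $ b) = x $ a $ b" for a b
      proof -
        have "(\<Sum>i\<in>UNIV. \<Sum>j\<in>UNIV. x $ i $ j * Y i j $ a $ b) =
          (\<Sum>i\<in>UNIV. \<Sum>j\<in>UNIV. (1/2) * (x $ i $ j * (kd i a * kd j b)) + (1/2) * (x $ i $ j * (kd j a * kd i b))
             - (kd a b / 7) * (x $ i $ j * kd i j))"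
          unfolding Y by (intro sum.cong refl) (simp add: field_simps)
        also have "\<dots> = (1/2) * (\<Sum>i\<in>UNIV. \<Sum>j\<in>UNIV. x $ i $ j * (kd i a * kd j b))
          + (1/2) * (\<Sum>i\<in>UNIV. \<Sum>j\<in>UNIV. x $ i $ j * (kd j a * kd i b))
          - (kd a b / 7) * (\<Sum>i\<in>UNIV. \<Sum>j\<in>UNIV. x $ i $ j * kd i j)"
          by (simp only: sum_subtractf sum.distrib sum_distrib_left)
        also have "\<dots> = x $ a $ b"
          using x sym[of a b] by (simp add: sum2_kd sum2_kd' Sym0_def trace_def)
        finally show ?thesis .
      qed
      hence "x = (\<Sum>i\<in>UNIV. \<Sum>j\<in>UNIV. x $ i $ j *\<^sub>R Y i j)" by (simp add: vec_eq_iff)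
      thus "x \<in> S" using Yij S(1) by (metis (no_types, lifting) subspace_scale subspace_sum)
    qed
  qed (use Y_Sym0 flips_G turn_G mul2_G adj2 linear_act2 subspace_Sym0 in \<open>auto simp: G_def\<close>)
qed

text \<open>\<open>Omega14\<close> in the form of \<open>Omega14_iff\<close>, which refers only to
  the 3-form and so does not require a volume form for the model.\<close>

definition Lie14 :: "(real^7^7) set" where
  "Lie14 = {B. transpose B = - B \<and> VV \<phi> B = 0}"

lemma VV_fano: "VV \<phi> B $ k = B $ (k + 1) $ (k + 3) - B $ (k + 3) $ (k + 1) + B $ (k + 2) $ (k + 6) - B $ (k + 6) $ (k + 2)
    + B $ (k + 4) $ (k + 5) - B $ (k + 5) $ (k + 4)"
proof -
  have s: "(\<Sum>i\<in>UNIV. f i) = (\<Sum>i\<in>UNIV. f (k + i))" for f :: "7 \<Rightarrow> real"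
    by (rule sum.reindex_bij_witness[of _ "\<lambda>i. k + i" "\<lambda>i. i - k"]) auto
  have c: "fano (k + i) (k + j) k = fano i j 0" for i j
    using fano_shift[of i k j 0] by (simp add: add.commute)
  have "VV \<phi> B $ k = (\<Sum>i\<in>UNIV. \<Sum>j\<in>UNIV. B $ (k + i) $ j * fano (k + i) j k)"
    unfolding VV_def vec_lambda_beta fano by (rule s)
  also have "\<dots> = (\<Sum>i\<in>UNIV. \<Sum>j\<in>UNIV. B $ (k + i) $ (k + j) * fano (k + i) (k + j) k)"
    by (rule sum.cong[OF refl], rule s)
  also have "\<dots> = B $ (k + 1) $ (k + 3) - B $ (k + 3) $ (k + 1) + B $ (k + 2) $ (k + 6) - B $ (k + 6) $ (k + 2)
    + B $ (k + 4) $ (k + 5) - B $ (k + 5) $ (k + 4)"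
    by (simp add: c) (simp add: sum_7 fano_def)
  finally show ?thesis .
qed

text \<open>Grouping the 21 pairs of points by the third point \<open>k\<close> of their line, the
  condition on \<open>VV\<close> says that the three entries of each group add up to zero. The
  vector \<open>w\<close> lies in the group of 0; \<open>swap\<close> makes its last two entries
  equal, so that the fixed space is a line. Its image \<open>w1\<close> under \<open>mul2\<close>
  completes a basis of this group, and translations reach the other six.\<close>

lemma irreducible14:
  assumes inv: "\<And>A. A \<in> G2_group \<phi> \<Longrightarrow> act2 A ` Lie14 \<subseteq> Lie14" and sub: "subspace Lie14"
  shows "G2_irreducible \<phi> act2 Lie14"
proof -
  define X where "X i j = (\<chi> a b. kd a i * kd b j - kd a j * kd b i)" for i j
  have X: "X i j $ a $ b = kd a i * kd b j - kd a j * kd b i" for i j a b by (simp add: X_def)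
  define w where "w = 2 *\<^sub>R X 1 3 - X 2 6 - X 4 5"
  have X_shift: "act2 (shift c) (X i j) = X (i - c) (j - c)" for c i j
    by (auto simp: vec_eq_iff act2_spmat shift_def X kd_def algebra_simps)
  have X_mul2: "act2 mul2 (X i j) = X (4 * i) (4 * j)" for i j
    by (auto simp: vec_eq_iff act2_spmat mul2_def X kd_def double7 mod7)
  note lin2 = linear_add[OF linear_act2] linear_diff[OF linear_act2] linear_cmul[OF linear_act2]
  let ?H = "{flip1, flip2, swap}"
  show ?thesis
  proof (rule irreducible_by_stabiliser[where w = w and G = G and H = ?H])
    show "w \<noteq> 0"
    proof
      assume "w = 0"
      hence "w $ 1 $ 3 = 0" by simp
      thus False by (simp add: w_def X kd_def)
    qed
    show "w \<in> Lie14"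
      by (simp add: Lie14_def vec_eq_iff transpose_def VV_fano) (simp add: w_def X forall_7 kd_def)
    have "act2 flip1 w = w" "act2 flip2 w = w" "act2 swap w = w"
      unfolding vec_eq_iff forall_7
      by (simp_all add: act2_spmat flip1_def flip2_def swap_def w_def X kd_def)
    thus "act2 A w = w" if "A \<in> ?H" for A
      using that by blast
    show "\<exists>c. x = c *\<^sub>R w" if x: "x \<in> Lie14" and H: "\<And>A. A \<in> ?H \<Longrightarrow> act2 A x = x" for x
    proof -
      have skew: "x $ j $ i = - x $ i $ j" for i j
        using x skew_component unfolding Lie14_def by blast
      have d: "x $ i $ i = 0" for i using skew[of i i] by simp
      have "VV \<phi> x $ 0 = 0" using x by (simp add: Lie14_def)
      hence v: "x $ 1 $ 3 + x $ 2 $ 6 + x $ 4 $ 5 = 0"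
        using skew[of 3 1] skew[of 6 2] skew[of 5 4] by (simp add: VV_fano)
      have "act2 flip1 x $ i $ j = x $ i $ j" "act2 flip2 x $ i $ j = x $ i $ j"
         "act2 swap x $ i $ j = x $ i $ j" for i j using H by auto
      note fx = this[unfolded act2_spmat flip1_def flip2_def swap_def]
      have off: "x $ 0 $ 1 = 0" "x $ 0 $ 2 = 0" "x $ 0 $ 3 = 0" "x $ 0 $ 4 = 0" "x $ 0 $ 5 = 0" "x $ 0 $ 6 = 0"
        "x $ 1 $ 2 = 0" "x $ 1 $ 4 = 0" "x $ 1 $ 5 = 0" "x $ 1 $ 6 = 0" "x $ 2 $ 3 = 0" "x $ 2 $ 4 = 0"
        "x $ 2 $ 5 = 0" "x $ 3 $ 4 = 0" "x $ 3 $ 5 = 0" "x $ 3 $ 6 = 0" "x $ 4 $ 6 = 0" "x $ 5 $ 6 = 0"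
        using fx(1)[of 0 2] fx(1)[of 0 4] fx(1)[of 0 5] fx(1)[of 0 6] fx(2)[of 0 1] fx(2)[of 0 3]
          fx(1)[of 1 2] fx(1)[of 1 4] fx(1)[of 1 5] fx(1)[of 1 6] fx(1)[of 2 3] fx(2)[of 2 4] fx(2)[of 2 5]
          fx(1)[of 3 4] fx(1)[of 3 5] fx(1)[of 3 6] fx(2)[of 4 6] fx(2)[of 5 6] by simp_all
      have e: "x $ 4 $ 5 = x $ 2 $ 6" using fx(3)[of 2 6] by simp
      hence e2: "x $ 1 $ 3 = - 2 * x $ 2 $ 6" using v by simp
      have "x = (- x $ 2 $ 6) *\<^sub>R w"
        by (simp add: vec_eq_iff forall_7 w_def X kd_def off d e e2 skew[of 1 0] skew[of 2 0] skew[of 3 0] skew[of 4 0]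
          skew[of 5 0] skew[of 6 0] skew[of 2 1] skew[of 3 1] skew[of 4 1] skew[of 5 1] skew[of 6 1] skew[of 3 2] skew[of 4 2]
          skew[of 5 2] skew[of 6 2] skew[of 4 3] skew[of 5 3] skew[of 6 3] skew[of 5 4] skew[of 6 4] skew[of 6 5])
      thus ?thesis by blast
    qed
    fix S :: "(real^7^7) set"
    assume S: "subspace S" "w \<in> S" and inv: "\<And>A x. A \<in> G \<Longrightarrow> x \<in> S \<Longrightarrow> act2 A x \<in> S"
    note Sc = subspace_add[OF S(1)] subspace_diff[OF S(1)] subspace_scale[OF S(1)]
    define w1 where "w1 = 2 *\<^sub>R X 4 5 - X 1 3 - X 2 6"
    have "act2 mul2 w = w1"
      by (simp add: w_def w1_def lin2 X_mul2 mod7)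
    hence w1: "w1 \<in> S" using inv[OF mul2_G S(2)] by simp
    define P where "P a b c k = a *\<^sub>R X (k + 1) (k + 3) + b *\<^sub>R X (k + 2) (k + 6) + c *\<^sub>R X (k + 4) (k + 5)" for a b c k
    have P: "P a b c k \<in> S" if "a + b + c = 0" for a b c k
    proof -
      have c: "c = - a - b" using that by simp
      \<comment> \<open>The coefficients solve the linear system that expresses (a, b, -a-b) by (2,
        -1, -1) and (-1, -1, 2).\<close>
      have "P a b c 0 = ((a - b) / 3) *\<^sub>R w + ((- a - 2 * b) / 3) *\<^sub>R w1"
        unfolding P_def w_def w1_def c by (simp add: vec_eq_iff field_simps)
      hence "P a b c 0 \<in> S" using Sc S(2) w1 by simp
      hence "act2 (shift (- k)) (P a b c 0) \<in> S" by (rule inv[OF shift_G])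
      thus ?thesis by (simp add: P_def lin2 X_shift add.commute)
    qed
    show "Lie14 \<subseteq> S"
    proof
      fix x assume x: "x \<in> Lie14"
      have skew: "x $ j $ i = - x $ i $ j" for i j
        using x skew_component unfolding Lie14_def by blast
      have d: "x $ i $ i = 0" for i using skew[of i i] by simp
      \<comment> \<open>The part of \<open>x\<close> in the group of \<open>k\<close>. Summing over
        \<open>k\<close> recovers \<open>x\<close>, since every pair of points lies on exactly one
        line.\<close>
      define Q where "Q k = P (x $ (k + 1) $ (k + 3)) (x $ (k + 2) $ (k + 6)) (x $ (k + 4) $ (k + 5)) k" for k
      have "Q k \<in> S" for k
      proof -
        have "VV \<phi> x $ k = 0" using x by (simp add: Lie14_def)
        hence "x $ (k + 1) $ (k + 3) + x $ (k + 2) $ (k + 6) + x $ (k + 4) $ (k + 5) = 0"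
          using skew[of "k + 3" "k + 1"] skew[of "k + 6" "k + 2"] skew[of "k + 5" "k + 4"] by (simp add: VV_fano)
        thus ?thesis unfolding Q_def by (rule P)
      qed
      hence "(\<Sum>k\<in>UNIV. Q k) \<in> S" by (rule subspace_sum[OF S(1)])
      moreover have "x $ i $ j = (\<Sum>k\<in>UNIV. Q k) $ i $ j" for i j
      proof -
        have "\<forall>i j. x $ i $ j = (\<Sum>k\<in>UNIV. Q k $ i $ j)"
          unfolding forall_7 sum_7
          by (simp add: Q_def P_def X kd_def d mod7 skew[of 1 0] skew[of 2 0] skew[of 3 0] skew[of 4 0]
          skew[of 5 0] skew[of 6 0] skew[of 2 1] skew[of 3 1] skew[of 4 1] skew[of 5 1] skew[of 6 1] skew[of 3 2] skew[of 4 2]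
          skew[of 5 2] skew[of 6 2] skew[of 4 3] skew[of 5 3] skew[of 6 3] skew[of 5 4] skew[of 6 4] skew[of 6 5])
        thus ?thesis by simp
      qed
      ultimately show "x \<in> S" by (metis (no_types, lifting) vec_eq_iff)
    qed
  qed (use flips_G swap_G adj2 linear_act2 sub inv in \<open>auto simp: G_def\<close>)
qed

end

subsection \<open>Exterior algebra in components\<close>

lemma alternating_swap:
  assumes "alternating k a" "length is = k" "i < k" "j < k" "i \<noteq> j"
  shows "a (is[i := is ! j, j := is ! i]) = - a is"
proof (cases "i < j")
  case True
  thus ?thesis using assms unfolding alternating_def by blast
next
  case False
  hence "j < i" using assms by simp
  moreover have "is[i := is ! j, j := is ! i] = is[j := is ! i, i := is ! j]"
    using assms by (simp add: list_update_swap)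
  ultimately show ?thesis using assms unfolding alternating_def by metis
qed

lemma alternating_perm:
  assumes a: "alternating k a" and p: "\<sigma> permutes {..<k}" and l: "length is = k"
  shows "a (map (\<lambda>r. is ! \<sigma> r) [0..<k]) = of_int (sign \<sigma>) * a is"
proof -
  have "\<forall>is. length is = k \<longrightarrow> a (map (\<lambda>r. is ! \<sigma> r) [0..<k]) = of_int (sign \<sigma>) * a is"
    using p finite_lessThan
  proof (induction rule: permutes_induct)
    case id
    have "map (\<lambda>r. is ! r) [0..<k] = is" if "length is = k" for "is" :: "7 list"
      using that map_nth by metis
    thus ?case by simp
  next
    case (swap i j p)
    show ?case
    proof (intro allI impI)
      fix "is" :: "7 list" assume l: "length is = k"
      let ?is' = "is[i := is ! j, j := is ! i]"
      have ij: "i < k" "j < k" using swap by auto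
      have "map (\<lambda>r. is ! (Transposition.transpose i j \<circ> p) r) [0..<k] = map (\<lambda>r. ?is' ! p r) [0..<k]"
      proof (rule map_cong[OF refl])
        fix r assume "r \<in> set [0..<k]"
        hence "p r < k" using permutes_in_image[OF \<open>p permutes {..<k}\<close>] by auto
        thus "is ! (Transposition.transpose i j \<circ> p) r = ?is' ! p r"
          using ij l by (auto simp: Transposition.transpose_def nth_list_update)
      qed
      also have "a \<dots> = of_int (sign p) * a ?is'" using swap.IH l by simp
      also have "a ?is' = - a is" by (rule alternating_swap[OF a l ij swap(3)])
      also have "sign (Transposition.transpose i j \<circ> p) = - sign p"
        using swap by (simp add: sign_compose sign_swap_id permutation_swap_id permutes_imp_permutation[of "{..<k}"])
      ultimately show "a (map (\<lambda>r. is ! (Transposition.transpose i j \<circ> p) r) [0..<k]) = of_int (sign (Transposition.transpose i j \<circ> p)) * a is"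
        by simp
    qed
  qed
  thus ?thesis using l by blast
qed

definition wterm :: "nat \<Rightarrow> nat \<Rightarrow> tensor \<Rightarrow> tensor \<Rightarrow> 7 list \<Rightarrow> (nat \<Rightarrow> nat) \<Rightarrow> real" where
  "wterm k l a b ys \<sigma> = of_int (sign \<sigma>) * a (map (\<lambda>r. ys ! \<sigma> r) [0..<k]) * b (map (\<lambda>r. ys ! \<sigma> r) [k..<k + l])"

lemma wedge_wterm: "wedge k l a b ys = (\<Sum>\<sigma> | \<sigma> permutes {..<k + l}. wterm k l a b ys \<sigma>) / (fact k * fact l)"
  by (simp add: wedge_def wterm_def)

lemma sign_compose_transpose:
  fixes n :: nat
  assumes "\<sigma> permutes {..<n}" "i \<noteq> j"
  shows "sign (\<sigma> \<circ> Transposition.transpose i j) = - sign \<sigma>"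
  using assms by (simp add: sign_compose sign_swap_id permutation_swap_id permutes_imp_permutation[of "{..<n}"])

text \<open>A transposition inside one block changes the sign of the permutation and that of the
  alternating factor belonging to the block; the two cancel.\<close>

lemma wterm_swap:
  assumes p: "\<sigma> permutes {..<k + l}" and a: "alternating k a" and b: "alternating l b" and ne: "i \<noteq> j"
    and ij: "i < k \<and> j < k \<or> k \<le> i \<and> i < k + l \<and> k \<le> j \<and> j < k + l"
  shows "wterm k l a b ys (\<sigma> \<circ> Transposition.transpose i j) = wterm k l a b ys \<sigma>"
proof -
  define L where "L = map (\<lambda>r. ys ! \<sigma> r) [0..<k]"
  define M where "M = map (\<lambda>r. ys ! \<sigma> r) [k..<k + l]"
  have s: "sign (\<sigma> \<circ> Transposition.transpose i j) = - sign \<sigma>" by (rule sign_compose_transpose[OF p ne])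
  show ?thesis
  proof (cases "i < k")
    case True
    hence ij: "i < k" "j < k" using ij by auto
    have e1: "map (\<lambda>r. ys ! (\<sigma> \<circ> Transposition.transpose i j) r) [0..<k] = L[i := L ! j, j := L ! i]"
      by (rule nth_equalityI) (use ij in \<open>auto simp: L_def nth_list_update Transposition.transpose_def\<close>)
    have e2: "map (\<lambda>r. ys ! (\<sigma> \<circ> Transposition.transpose i j) r) [k..<k + l] = M"
      unfolding M_def using ij by (intro map_cong refl) (auto simp: Transposition.transpose_def)
    have e3: "a (L[i := L ! j, j := L ! i]) = - a L"
      by (rule alternating_swap[OF a _ ij ne]) (simp add: L_def)
    show ?thesis unfolding wterm_def s e1 e2 e3 L_def[symmetric] M_def[symmetric] by simp
  next
    case False
    hence ij: "k \<le> i" "i < k + l" "k \<le> j" "j < k + l" using ij by auto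
    have e1: "map (\<lambda>r. ys ! (\<sigma> \<circ> Transposition.transpose i j) r) [k..<k + l] = M[i - k := M ! (j - k), j - k := M ! (i - k)]"
      by (rule nth_equalityI) (use ij in \<open>auto simp: M_def nth_list_update Transposition.transpose_def\<close>)
    have e2: "map (\<lambda>r. ys ! (\<sigma> \<circ> Transposition.transpose i j) r) [0..<k] = L"
      unfolding L_def using ij by (intro map_cong refl) (auto simp: Transposition.transpose_def)
    have e3: "b (M[i - k := M ! (j - k), j - k := M ! (i - k)]) = - b M"
      by (rule alternating_swap[OF b]) (use ij ne in \<open>auto simp: M_def\<close>)
    show ?thesis unfolding wterm_def s e1 e2 e3 L_def[symmetric] M_def[symmetric] by simp
  qed
qed

text \<open>Permutations fixing 0 are permutations of the remaining positions, renumbered by one.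
  This matches the removal of the head of an index list.\<close>

definition lift_perm :: "(nat \<Rightarrow> nat) \<Rightarrow> nat \<Rightarrow> nat" where
  "lift_perm \<tau> i = (case i of 0 \<Rightarrow> 0 | Suc j \<Rightarrow> Suc (\<tau> j))"

lemma lift_perm_simps [simp]: "lift_perm \<tau> 0 = 0" "lift_perm \<tau> (Suc j) = Suc (\<tau> j)"
  by (simp_all add: lift_perm_def)

lemma lift_perm_eq:
  assumes "\<tau> permutes {..<n}"
  shows "lift_perm \<tau> = map_permutation {..<n} Suc \<tau>"
proof
  fix i
  show "lift_perm \<tau> i = map_permutation {..<n} Suc \<tau> i"
  proof (cases "i \<in> Suc ` {..<n}")
    case True
    then obtain j where "i = Suc j" "j < n" by auto
    thus ?thesis by (simp add: map_permutation_apply)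
  next
    case False
    hence "map_permutation {..<n} Suc \<tau> i = i"
      by (simp add: map_permutation_def restrict_id_def)
    moreover have "lift_perm \<tau> i = i"
    proof (cases i)
      case (Suc j)
      hence "j \<notin> {..<n}" using False by auto
      thus ?thesis using assms Suc by (simp add: permutes_not_in)
    qed simp
    ultimately show ?thesis by simp
  qed
qed

lemma lift_perm_permutes: "\<tau> permutes {..<n} \<Longrightarrow> lift_perm \<tau> permutes {..<Suc n}"
proof -
  assume t: "\<tau> permutes {..<n}"
  have "bij_betw Suc {..<n} {1..<Suc n}"
    by (rule bij_betwI[of _ _ _ "\<lambda>i. i - 1"]) auto
  hence "lift_perm \<tau> permutes {1..<Suc n}"
    unfolding lift_perm_eq[OF t] using t by (rule map_permutation_permutes)
  thus ?thesis by (rule permutes_subset) auto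
qed

lemma sign_lift_perm: "\<tau> permutes {..<n} \<Longrightarrow> sign (lift_perm \<tau>) = sign \<tau>"
  by (simp add: lift_perm_eq) (subst sign_map_permutation; simp)

lemma lift_perm_bij: "bij_betw lift_perm {\<tau>. \<tau> permutes {..<n}} {\<sigma>. \<sigma> permutes {..<Suc n} \<and> \<sigma> 0 = 0}"
proof (rule bij_betwI[of _ _ _ "\<lambda>\<sigma> i. \<sigma> (Suc i) - 1"])
  show "lift_perm \<in> {\<tau>. \<tau> permutes {..<n}} \<rightarrow> {\<sigma>. \<sigma> permutes {..<Suc n} \<and> \<sigma> 0 = 0}"
    using lift_perm_permutes by auto
  show "(\<lambda>\<sigma> i. \<sigma> (Suc i) - 1) \<in> {\<sigma>. \<sigma> permutes {..<Suc n} \<and> \<sigma> 0 = 0} \<rightarrow> {\<tau>. \<tau> permutes {..<n}}"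
  proof (clarsimp)
    fix \<sigma> assume s: "\<sigma> permutes {..<Suc n}" "\<sigma> 0 = 0"
    have pos: "\<sigma> (Suc i) \<noteq> 0" for i
      using permutes_inj[OF s(1)] s(2) by (metis injD nat.distinct(1))
    show "(\<lambda>i. \<sigma> (Suc i) - Suc 0) permutes {..<n}"
    proof (rule bij_imp_permutes)
      have "inj_on (\<lambda>i. \<sigma> (Suc i) - Suc 0) {..<n}"
      proof (rule inj_onI)
        fix x y assume "\<sigma> (Suc x) - Suc 0 = \<sigma> (Suc y) - Suc 0"
        hence "\<sigma> (Suc x) = \<sigma> (Suc y)" using pos[of x] pos[of y] by simp
        thus "x = y" using permutes_inj[OF s(1)] by (metis injD nat.inject)
      qed
      moreover have sub: "(\<lambda>i. \<sigma> (Suc i) - Suc 0) ` {..<n} \<subseteq> {..<n}"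
      proof clarsimp
        fix i assume "i < n"
        hence "\<sigma> (Suc i) < Suc n" using permutes_in_image[OF s(1), of "Suc i"] by simp
        thus "\<sigma> (Suc i) - Suc 0 < n" using pos[of i] by simp
      qed
      ultimately show "bij_betw (\<lambda>i. \<sigma> (Suc i) - Suc 0) {..<n} {..<n}"
        unfolding bij_betw_def using endo_inj_surj[OF finite_lessThan sub] by simp
      fix i assume "i \<notin> {..<n}"
      hence "Suc i \<notin> {..<Suc n}" by simp
      hence "\<sigma> (Suc i) = Suc i" by (rule permutes_not_in[OF s(1)])
      thus "\<sigma> (Suc i) - Suc 0 = i" by simp
    qed
  qed
  fix \<sigma> assume "\<sigma> \<in> {\<sigma>. \<sigma> permutes {..<Suc n} \<and> \<sigma> 0 = 0}"
  hence s: "\<sigma> permutes {..<Suc n}" "\<sigma> 0 = 0" by auto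
  show "lift_perm (\<lambda>i. \<sigma> (Suc i) - 1) = \<sigma>"
  proof
    fix i show "lift_perm (\<lambda>i. \<sigma> (Suc i) - 1) i = \<sigma> i"
    proof (cases i)
      case (Suc j)
      have "\<sigma> (Suc j) \<noteq> 0" using permutes_inj[OF s(1)] s(2) by (metis injD nat.distinct(1))
      thus ?thesis using Suc by simp
    qed (simp add: s)
  qed
qed (auto simp: fun_eq_iff)

text \<open>The cycle 0, 1, ..., \<open>m\<close>, back to 0. Composition with it turns permutations
  with \<sigma> 0 = 0 into those with \<sigma> \<open>m\<close> = 0, and its sign is the sign in the
  Leibniz rule.\<close>

primrec cyc_perm :: "nat \<Rightarrow> nat \<Rightarrow> nat" where
  "cyc_perm 0 = id"
| "cyc_perm (Suc m) = cyc_perm m \<circ> Transposition.transpose m (Suc m)"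

lemma cyc_perm_permutes: "m < n \<Longrightarrow> cyc_perm m permutes {..<n}"
  by (induction m) (auto intro!: permutes_compose permutes_swap_id permutes_id)

lemma cyc_perm_apply: "cyc_perm m j = (if j < m then Suc j else if j = m then 0 else j)"
  by (induction m arbitrary: j) (auto simp: Transposition.transpose_def)

lemma sign_cyc_perm: "sign (cyc_perm m) = (-1) ^ m"
proof (induction m)
  case (Suc m)
  have "sign (cyc_perm m \<circ> Transposition.transpose m (Suc m)) = - sign (cyc_perm m)"
    by (rule sign_compose_transpose[OF cyc_perm_permutes[of m "Suc m"]]) simp_all
  thus ?case unfolding cyc_perm.simps Suc power_Suc by (simp only: mult_minus1)
qed simp

lemma sum_perm_zero_pos:
  assumes r: "r < n" "s < n"
    and f: "\<And>\<sigma>. \<sigma> permutes {..<n} \<Longrightarrow> r \<noteq> s \<Longrightarrow> f (\<sigma> \<circ> Transposition.transpose r s) = f \<sigma>"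
  shows "(\<Sum>\<sigma> | \<sigma> permutes {..<n} \<and> \<sigma> r = 0. f \<sigma>) = (\<Sum>\<sigma> | \<sigma> permutes {..<n} \<and> \<sigma> s = (0::nat). f \<sigma> :: real)"
proof (cases "r = s")
  case False
  have t: "Transposition.transpose r s permutes {..<n}" using r by (intro permutes_swap_id) auto
  show ?thesis
    by (rule sum.reindex_bij_witness[of _ "\<lambda>\<sigma>. \<sigma> \<circ> Transposition.transpose r s" "\<lambda>\<sigma>. \<sigma> \<circ> Transposition.transpose r s"])
      (use t f False in \<open>auto simp: permutes_compose comp_assoc\<close>)
qed simp

text \<open>Interior multiplication is an antiderivation. The permutations are sorted by the
  position at which \<open>x\<close> is inserted; within each of the two blocks all positions
  contribute equally, and their numbers cancel against the factorials. Applied repeatedly, this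
  expands a wedge product without listing 5040 permutations.\<close>

lemma wedge_Cons:
  assumes a: "alternating (Suc k) a" and b: "alternating (Suc l) b" and len: "length xs = Suc (k + l)"
  shows "wedge (Suc k) (Suc l) a b (x # xs) =
     wedge k (Suc l) (\<lambda>is. a (x # is)) b xs + (-1) ^ Suc k * wedge (Suc k) l a (\<lambda>is. b (x # is)) xs"
proof -
  define n where "n = Suc (k + l)"
  have N: "Suc k + Suc l = Suc n" by (simp add: n_def)
  define F where "F = wterm (Suc k) (Suc l) a b (x # xs)"
  define S where "S r = (\<Sum>\<sigma> | \<sigma> permutes {..<Suc n} \<and> \<sigma> r = 0. F \<sigma>)" for r
  have fin: "finite {\<sigma>. \<sigma> permutes {..<m :: nat}}" for m by (rule finite_permutations) simp
  have S_eq: "S r = (\<Sum>\<sigma> | \<sigma> permutes {..<Suc n}. if \<sigma> r = 0 then F \<sigma> else 0)" for r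
    unfolding S_def using sum.inter_filter[OF fin[of "Suc n"], of F "\<lambda>\<sigma>. \<sigma> r = 0"] by simp
  have "(\<Sum>\<sigma> | \<sigma> permutes {..<Suc n}. F \<sigma>) = (\<Sum>\<sigma> | \<sigma> permutes {..<Suc n}. \<Sum>r<Suc n. if \<sigma> r = 0 then F \<sigma> else 0)"
  proof (rule sum.cong[OF refl])
    fix \<sigma> assume "\<sigma> \<in> {\<sigma>. \<sigma> permutes {..<Suc n}}"
    hence s: "\<sigma> permutes {..<Suc n}" by simp
    have "\<sigma> r = 0 \<longleftrightarrow> r = inv \<sigma> 0" for r using s by (metis permutes_inverses)
    moreover have "inv \<sigma> 0 \<in> {..<Suc n}" using permutes_in_image[OF permutes_inv[OF s], of 0] by simp
    ultimately show "F \<sigma> = (\<Sum>r<Suc n. if \<sigma> r = 0 then F \<sigma> else 0)"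
      by (simp add: sum.delta del: sum.lessThan_Suc)
  qed
  also have "\<dots> = (\<Sum>r<Suc n. S r)"
    unfolding S_eq by (rule sum.swap)
  also have "\<dots> = (\<Sum>r<Suc k. S r) + (\<Sum>r=Suc k..<Suc n. S r)"
    using sum.atLeastLessThan_concat[of 0 "Suc k" "Suc n" S] by (simp add: n_def lessThan_atLeast0 del: sum.op_ivl_Suc)
  \<comment> \<open>Positions in the first block are exchanged by transpositions that leave
    \<open>wterm\<close> unchanged, so position 0 represents them all; for the second block it is
    position \<open>Suc k\<close>.\<close>
  also have "(\<Sum>r<Suc k. S r) = (\<Sum>r<Suc k. S 0)"
  proof (rule sum.cong[OF refl])
    fix r assume "r \<in> {..<Suc k}"
    thus "S r = S 0" unfolding S_def
      by (intro sum_perm_zero_pos) (auto simp: F_def n_def intro!: wterm_swap[OF _ a b])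
  qed
  also have "(\<Sum>r=Suc k..<Suc n. S r) = (\<Sum>r=Suc k..<Suc n. S (Suc k))"
  proof (rule sum.cong[OF refl])
    fix r assume "r \<in> {Suc k..<Suc n}"
    thus "S r = S (Suc k)" unfolding S_def
      by (intro sum_perm_zero_pos) (auto simp: F_def n_def intro!: wterm_swap[OF _ a b])
  qed
  also have "(\<Sum>r<Suc k. S 0) + (\<Sum>r=Suc k..<Suc n. S (Suc k)) = real (Suc k) * S 0 + real (Suc l) * S (Suc k)"
    by (simp add: n_def del: sum.op_ivl_Suc sum.lessThan_Suc)
  also have "S 0 = (\<Sum>\<tau> | \<tau> permutes {..<n}. wterm k (Suc l) (\<lambda>is. a (x # is)) b xs \<tau>)"
  proof -
    have "S 0 = (\<Sum>\<tau> | \<tau> permutes {..<n}. F (lift_perm \<tau>))"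
      unfolding S_def by (rule sum.reindex_bij_betw[OF lift_perm_bij, symmetric])
    also have "\<dots> = (\<Sum>\<tau> | \<tau> permutes {..<n}. wterm k (Suc l) (\<lambda>is. a (x # is)) b xs \<tau>)"
    proof (rule sum.cong[OF refl], clarsimp)
      fix \<tau> assume t: "\<tau> permutes {..<n}"
      have 1: "map (\<lambda>r. (x # xs) ! lift_perm \<tau> r) [0..<Suc k] = x # map (\<lambda>r. xs ! \<tau> r) [0..<k]"
        by (simp add: upt_conv_Cons map_Suc_upt[symmetric] del: upt_Suc)
      have 2: "map (\<lambda>r. (x # xs) ! lift_perm \<tau> r) [Suc k..<Suc k + Suc l] = map (\<lambda>r. xs ! \<tau> r) [k..<k + Suc l]"
        by (simp add: map_Suc_upt[symmetric] del: upt_Suc)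
      show "F (lift_perm \<tau>) = wterm k (Suc l) (\<lambda>is. a (x # is)) b xs \<tau>"
        unfolding F_def wterm_def 1 2 sign_lift_perm[OF t] ..
    qed
    finally show ?thesis .
  qed
  \<comment> \<open>Moving \<open>x\<close> from the head of the second block to the very front
    costs a cycle through \<open>Suc k\<close> transpositions.\<close>
  also have "S (Suc k) = (-1) ^ Suc k * (\<Sum>\<tau> | \<tau> permutes {..<n}. wterm (Suc k) l a (\<lambda>is. b (x # is)) xs \<tau>)"
  proof -
    let ?c = "cyc_perm (Suc k)"
    have c: "?c permutes {..<Suc n}" by (rule cyc_perm_permutes) (simp add: n_def)
    have "S (Suc k) = (\<Sum>\<sigma> | \<sigma> permutes {..<Suc n} \<and> \<sigma> 0 = 0. F (\<sigma> \<circ> ?c))"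
      unfolding S_def
    proof (rule sum.reindex_bij_witness[of _ "\<lambda>\<sigma>. \<sigma> \<circ> ?c" "\<lambda>\<sigma>. \<sigma> \<circ> inv ?c"])
      have i: "inv ?c 0 = Suc k" by (rule permutes_inv_eq[OF c, THEN iffD2]) (simp only: cyc_perm_apply, simp)
      have c0: "?c (Suc k) = 0" by (simp only: cyc_perm_apply, simp)
      fix \<sigma> :: "nat \<Rightarrow> nat"
      show "(\<sigma> \<circ> inv ?c) \<circ> ?c = \<sigma>" "(\<sigma> \<circ> ?c) \<circ> inv ?c = \<sigma>"
        using permutes_inv_o[OF c] by (simp_all only: comp_assoc comp_id)
      show "\<sigma> \<circ> inv ?c \<in> {\<sigma>. \<sigma> permutes {..<Suc n} \<and> \<sigma> 0 = 0}" if "\<sigma> \<in> {\<sigma>. \<sigma> permutes {..<Suc n} \<and> \<sigma> (Suc k) = 0}"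
        using that i permutes_compose[OF permutes_inv[OF c]] by (simp del: cyc_perm.simps)
      show "\<sigma> \<circ> ?c \<in> {\<sigma>. \<sigma> permutes {..<Suc n} \<and> \<sigma> (Suc k) = 0}" if "\<sigma> \<in> {\<sigma>. \<sigma> permutes {..<Suc n} \<and> \<sigma> 0 = 0}"
        using that c0 permutes_compose[OF c] by (simp del: cyc_perm.simps)
      show "F ((\<sigma> \<circ> inv ?c) \<circ> ?c) = F \<sigma>"
        using permutes_inv_o[OF c] by (simp only: comp_assoc comp_id)
    qed
    also have "\<dots> = (\<Sum>\<tau> | \<tau> permutes {..<n}. F (lift_perm \<tau> \<circ> ?c))"
      by (rule sum.reindex_bij_betw[OF lift_perm_bij, symmetric])
    also have "\<dots> = (\<Sum>\<tau> | \<tau> permutes {..<n}. (-1) ^ Suc k * wterm (Suc k) l a (\<lambda>is. b (x # is)) xs \<tau>)"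
    proof (rule sum.cong[OF refl], unfold mem_Collect_eq)
      fix \<tau> assume t: "\<tau> permutes {..<n}"
      have 1: "map (\<lambda>r. (x # xs) ! (lift_perm \<tau> \<circ> ?c) r) [0..<Suc k] = map (\<lambda>r. xs ! \<tau> r) [0..<Suc k]"
        by (rule map_cong[OF refl]) (auto simp add: cyc_perm_apply simp del: cyc_perm.simps)
      have "map (\<lambda>r. (x # xs) ! (lift_perm \<tau> \<circ> ?c) r) [Suc k..<Suc k + Suc l] =
         (x # xs) ! (lift_perm \<tau> \<circ> ?c) (Suc k) # map (\<lambda>r. (x # xs) ! (lift_perm \<tau> \<circ> ?c) r) [Suc (Suc k)..<Suc (Suc k + l)]"
        by (simp add: upt_conv_Cons del: cyc_perm.simps upt_Suc)
      also have "(x # xs) ! (lift_perm \<tau> \<circ> ?c) (Suc k) = x"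
        by (simp add: cyc_perm_apply del: cyc_perm.simps)
      also have "map (\<lambda>r. (x # xs) ! (lift_perm \<tau> \<circ> ?c) r) [Suc (Suc k)..<Suc (Suc k + l)] =
          map (\<lambda>r. xs ! \<tau> r) [Suc k..<Suc k + l]"
        unfolding map_Suc_upt[symmetric] map_map
        by (rule map_cong[OF refl]) (auto simp add: cyc_perm_apply simp del: cyc_perm.simps)
      finally have 2: "map (\<lambda>r. (x # xs) ! (lift_perm \<tau> \<circ> ?c) r) [Suc k..<Suc k + Suc l] =
         x # map (\<lambda>r. xs ! \<tau> r) [Suc k..<Suc k + l]" .
      have "sign (lift_perm \<tau> \<circ> ?c) = sign \<tau> * (-1) ^ Suc k"
        using lift_perm_permutes[OF t] c sign_cyc_perm[of "Suc k"] sign_lift_perm[OF t]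
        by (subst sign_compose) (auto intro: permutes_imp_permutation[of "{..<Suc n}"] simp del: cyc_perm.simps)
      thus "F (lift_perm \<tau> \<circ> ?c) = (-1) ^ Suc k * wterm (Suc k) l a (\<lambda>is. b (x # is)) xs \<tau>"
        unfolding F_def wterm_def 1 2 by simp
    qed
    finally show ?thesis by (simp only: sum_distrib_left)
  qed
  finally have "(\<Sum>\<sigma> | \<sigma> permutes {..<Suc n}. F \<sigma>) =
     real (Suc k) * (\<Sum>\<tau> | \<tau> permutes {..<n}. wterm k (Suc l) (\<lambda>is. a (x # is)) b xs \<tau>)
     + real (Suc l) * ((-1) ^ Suc k * (\<Sum>\<tau> | \<tau> permutes {..<n}. wterm (Suc k) l a (\<lambda>is. b (x # is)) xs \<tau>))" .
  moreover have frac: "(p * X + q * (c * Y)) / ((p * f) * (q * g)) = X / (f * (q * g)) + c * (Y / ((p * f) * g))"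
    if "p \<noteq> 0" "q \<noteq> 0" "f \<noteq> 0" "g \<noteq> 0" for p q f g c X Y :: real
    using that by (simp add: field_simps)
  moreover have "k + Suc l = n" "Suc k + l = n" by (simp_all add: n_def)
  ultimately show ?thesis
    unfolding wedge_wterm N F_def[symmetric] fact_Suc of_nat_mult by (simp only:) (rule frac, simp_all)
qed

lemma wedge_0_left:
  assumes "alternating l b" "length xs = l"
  shows "wedge 0 l a b xs = a [] * b xs"
proof -
  have "wterm 0 l a b xs \<sigma> = a [] * b xs" if "\<sigma> permutes {..<l}" for \<sigma>
    using alternating_perm[OF assms(1) that assms(2)] by (cases \<sigma> rule: sign_cases) (simp_all add: wterm_def)
  thus ?thesis using card_permutations[of "{..<l}" l] by (simp add: wedge_wterm)
qed

lemma wedge_0_right: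
  assumes "alternating k a" "length xs = k"
  shows "wedge k 0 a b xs = a xs * b []"
proof -
  have "wterm k 0 a b xs \<sigma> = a xs * b []" if "\<sigma> permutes {..<k}" for \<sigma>
    using alternating_perm[OF assms(1) that assms(2)] by (cases \<sigma> rule: sign_cases) (simp_all add: wterm_def)
  thus ?thesis using card_permutations[of "{..<k}" k] by (simp add: wedge_wterm)
qed

lemma alternating_Cons:
  assumes "alternating (Suc k) a" shows "alternating k (\<lambda>is. a (x # is))"
  unfolding alternating_def
proof (intro allI impI)
  fix "is" :: "7 list" and r s assume "length is = k \<and> r < s \<and> s < k"
  hence "a ((x # is)[Suc r := (x # is) ! Suc s, Suc s := (x # is) ! Suc r]) = - a (x # is)"
    using assms unfolding alternating_def by (metis Suc_less_eq length_Cons)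
  thus "a (x # is[r := is ! s, s := is ! r]) = - a (x # is)" by simp
qed

lemma alternating_wedge: "alternating (k + l) (wedge k l a b)"
  unfolding alternating_def
proof (intro allI impI)
  fix "is" :: "7 list" and r s assume rs: "length is = k + l \<and> r < s \<and> s < k + l"
  let ?is' = "is[r := is ! s, s := is ! r]"
  have t: "Transposition.transpose r s permutes {..<k + l}" using rs by (intro permutes_swap_id) auto
  have "(\<Sum>\<sigma> | \<sigma> permutes {..<k + l}. wterm k l a b ?is' \<sigma>) =
     (\<Sum>\<sigma> | \<sigma> permutes {..<k + l}. - wterm k l a b is (Transposition.transpose r s \<circ> \<sigma>))"
  proof (rule sum.cong[OF refl], unfold mem_Collect_eq)
    fix \<sigma> assume s: "\<sigma> permutes {..<k + l}"
    have n: "?is' ! \<sigma> q = is ! (Transposition.transpose r s \<circ> \<sigma>) q" if "q < k + l" for q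
    proof -
      have "\<sigma> q < k + l" using permutes_in_image[OF s, of q] that by simp
      thus ?thesis using rs by (auto simp: Transposition.transpose_def nth_list_update)
    qed
    have e: "map (\<lambda>q. ?is' ! \<sigma> q) [0..<k] = map (\<lambda>q. is ! (Transposition.transpose r s \<circ> \<sigma>) q) [0..<k]"
      "map (\<lambda>q. ?is' ! \<sigma> q) [k..<k + l] = map (\<lambda>q. is ! (Transposition.transpose r s \<circ> \<sigma>) q) [k..<k + l]"
      using n by (intro map_cong refl; simp)+
    have e2: "sign (Transposition.transpose r s \<circ> \<sigma>) = - sign \<sigma>"
      using rs s by (simp add: sign_compose sign_swap_id permutation_swap_id permutes_imp_permutation[of "{..<k + l}"])
    show "wterm k l a b ?is' \<sigma> = - wterm k l a b is (Transposition.transpose r s \<circ> \<sigma>)"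
      unfolding wterm_def e e2 by simp
  qed
  also have "\<dots> = - (\<Sum>\<sigma> | \<sigma> permutes {..<k + l}. wterm k l a b is \<sigma>)"
    unfolding sum_negf by (simp add: setum_permutations_compose_left[OF t, symmetric])
  finally show "wedge k l a b ?is' = - wedge k l a b is" by (simp add: wedge_wterm)
qed

lemma wedge_2_2:
  assumes a: "alternating 2 a" and b: "alternating 2 b"
  shows "wedge 2 2 a b [p, q, r, s] = a [p, q] * b [r, s] - a [p, r] * b [q, s] + a [p, s] * b [q, r]
     + a [q, r] * b [p, s] - a [q, s] * b [p, r] + a [r, s] * b [p, q]"
proof -
  have e: "(2::nat) = Suc (Suc 0)" by simp
  have ab: "alternating (Suc (Suc 0)) a" "alternating (Suc (Suc 0)) b" using a b by (simp_all add: e)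
  note al = ab ab[THEN alternating_Cons] ab[THEN alternating_Cons, THEN alternating_Cons]
  show ?thesis unfolding e
    by (simp add: wedge_Cons wedge_0_left wedge_0_right al)
qed

lemma wedge_4_3:
  assumes a: "alternating 4 a" and b: "alternating 3 b"
  shows "wedge 4 3 a b [0, 1, 2, 3, 4, 5, 6] =
    a [0,1,2,3] * b [4,5,6] - a [0,1,2,4] * b [3,5,6] + a [0,1,2,5] * b [3,4,6] - a [0,1,2,6] * b [3,4,5]
  + a [0,1,3,4] * b [2,5,6] - a [0,1,3,5] * b [2,4,6] + a [0,1,3,6] * b [2,4,5] + a [0,1,4,5] * b [2,3,6]
  - a [0,1,4,6] * b [2,3,5] + a [0,1,5,6] * b [2,3,4] - a [0,2,3,4] * b [1,5,6] + a [0,2,3,5] * b [1,4,6]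
  - a [0,2,3,6] * b [1,4,5] - a [0,2,4,5] * b [1,3,6] + a [0,2,4,6] * b [1,3,5] - a [0,2,5,6] * b [1,3,4]
  + a [0,3,4,5] * b [1,2,6] - a [0,3,4,6] * b [1,2,5] + a [0,3,5,6] * b [1,2,4] - a [0,4,5,6] * b [1,2,3]
  + a [1,2,3,4] * b [0,5,6] - a [1,2,3,5] * b [0,4,6] + a [1,2,3,6] * b [0,4,5] + a [1,2,4,5] * b [0,3,6]
  - a [1,2,4,6] * b [0,3,5] + a [1,2,5,6] * b [0,3,4] - a [1,3,4,5] * b [0,2,6] + a [1,3,4,6] * b [0,2,5]
  - a [1,3,5,6] * b [0,2,4] + a [1,4,5,6] * b [0,2,3] + a [2,3,4,5] * b [0,1,6] - a [2,3,4,6] * b [0,1,5]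
  + a [2,3,5,6] * b [0,1,4] - a [2,4,5,6] * b [0,1,3] + a [3,4,5,6] * b [0,1,2]"
proof -
  have e: "(4::nat) = Suc (Suc (Suc (Suc 0)))" "(3::nat) = Suc (Suc (Suc 0))" by simp_all
  have ab: "alternating (Suc (Suc (Suc (Suc 0)))) a" "alternating (Suc (Suc (Suc 0))) b"
    using a b by (simp_all only: e)
  note al = ab ab[THEN alternating_Cons] ab[THEN alternating_Cons, THEN alternating_Cons]
    ab[THEN alternating_Cons, THEN alternating_Cons, THEN alternating_Cons]
    ab(1)[THEN alternating_Cons, THEN alternating_Cons, THEN alternating_Cons, THEN alternating_Cons]
  show ?thesis unfolding e
    by (simp add: wedge_Cons wedge_0_left wedge_0_right al)
qed

lemma wedge_cong:
  assumes "\<And>is. length is = k \<Longrightarrow> a is = a' is" "\<And>is. length is = l \<Longrightarrow> b is = b' is"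
  shows "wedge k l a b xs = wedge k l a' b' xs"
  unfolding wedge_def by (simp add: assms)

lemma sum_lists_append:
  "(\<Sum>js :: 'a::finite list | length js = k + l. f (take k js) (drop k js)) =
     (\<Sum>as | length as = k. \<Sum>bs | length bs = l. f as bs)"
proof -
  have "(\<Sum>js :: 'a list | length js = k + l. f (take k js) (drop k js)) =
    (\<Sum>(as, bs) \<in> {as. length as = k} \<times> {bs. length bs = l}. f as bs)"
    by (rule sum.reindex_bij_witness[of _ "\<lambda>(as, bs). as @ bs" "\<lambda>js. (take k js, drop k js)"]) auto
  thus ?thesis by (simp add: sum.cartesian_product)
qed

text \<open>Pull-back commutes with the wedge product. For each permutation the summation lists are
  reindexed by it, after which the product over the positions splits at \<open>k\<close>.\<close>

lemma comps_wedge: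
  assumes len: "length is = k + l"
  shows "comps e (wedge k l a b) is = wedge k l (comps e a) (comps e b) is"
proof -
  let ?n = "k + l"
  have "(\<Sum>js | length js = ?n. (\<Prod>r<?n. e (is ! r) $ (js ! r)) * wterm k l a b js \<sigma>) =
     wterm k l (comps e a) (comps e b) is \<sigma>" if s: "\<sigma> permutes {..<?n}" for \<sigma>
  proof -
    have lt: "\<sigma> r < ?n" if "r < ?n" for r using permutes_in_image[OF s, of r] that by simp
    have lti: "inv \<sigma> r < ?n" if "r < ?n" for r using permutes_in_image[OF permutes_inv[OF s], of r] that by simp
    have "(\<Sum>js | length js = ?n. (\<Prod>r<?n. e (is ! r) $ (js ! r)) * wterm k l a b js \<sigma>) =
      (\<Sum>ks | length ks = ?n. (\<Prod>r<?n. e (is ! \<sigma> r) $ (ks ! r)) * (of_int (sign \<sigma>) * a (take k ks) * b (drop k ks)))"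
    proof (rule sum.reindex_bij_witness[of _ "\<lambda>ks. map (\<lambda>r. ks ! inv \<sigma> r) [0..<?n]" "\<lambda>js. map (\<lambda>r. js ! \<sigma> r) [0..<?n]"])
      fix js :: "7 list" assume "js \<in> {js. length js = ?n}"
      hence l: "length js = ?n" by simp
      show "map (\<lambda>r. map (\<lambda>r. js ! \<sigma> r) [0..<?n] ! inv \<sigma> r) [0..<?n] = js"
        by (rule nth_equalityI) (use l lti permutes_inverses[OF s] in auto)
      show "map (\<lambda>r. js ! \<sigma> r) [0..<?n] \<in> {ks. length ks = ?n}" by simp
      have "(\<Prod>r<?n. e (is ! r) $ (js ! r)) = (\<Prod>r<?n. e (is ! \<sigma> r) $ (js ! \<sigma> r))"
        by (rule prod.permute[OF s, unfolded o_def])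
      also have "\<dots> = (\<Prod>r<?n. e (is ! \<sigma> r) $ (map (\<lambda>r. js ! \<sigma> r) [0..<?n] ! r))"
        by (intro prod.cong) auto
      finally have "(\<Prod>r<?n. e (is ! r) $ (js ! r)) = \<dots>" .
      moreover have "take k (map (\<lambda>r. js ! \<sigma> r) [0..<?n]) = map (\<lambda>r. js ! \<sigma> r) [0..<k]"
        "drop k (map (\<lambda>r. js ! \<sigma> r) [0..<?n]) = map (\<lambda>r. js ! \<sigma> r) [k..<?n]"
        by (simp_all add: take_map drop_map take_upt)
      ultimately show "(\<Prod>r<?n. e (is ! \<sigma> r) $ (map (\<lambda>r. js ! \<sigma> r) [0..<?n] ! r)) *
         (of_int (sign \<sigma>) * a (take k (map (\<lambda>r. js ! \<sigma> r) [0..<?n])) * b (drop k (map (\<lambda>r. js ! \<sigma> r) [0..<?n])))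
         = (\<Prod>r<?n. e (is ! r) $ (js ! r)) * wterm k l a b js \<sigma>"
        by (simp add: wterm_def)
    next
      fix ks :: "7 list" assume "ks \<in> {ks. length ks = ?n}"
      hence l: "length ks = ?n" by simp
      show "map (\<lambda>r. map (\<lambda>r. ks ! inv \<sigma> r) [0..<?n] ! \<sigma> r) [0..<?n] = ks"
        by (rule nth_equalityI) (use l lt permutes_inverses[OF s] in auto)
      show "map (\<lambda>r. ks ! inv \<sigma> r) [0..<?n] \<in> {js. length js = ?n}" by simp
    qed
    also have "\<dots> = (\<Sum>ks | length ks = ?n. of_int (sign \<sigma>) *
       (((\<Prod>r<k. e (is ! \<sigma> r) $ (take k ks ! r)) * a (take k ks)) * ((\<Prod>r<l. e (is ! \<sigma> (k + r)) $ (drop k ks ! r)) * b (drop k ks))))"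
    proof (rule sum.cong[OF refl])
      fix ks :: "7 list" assume "ks \<in> {ks. length ks = ?n}"
      hence l: "length ks = ?n" by simp
      have "(\<Prod>r<?n. e (is ! \<sigma> r) $ (ks ! r)) = (\<Prod>r<k. e (is ! \<sigma> r) $ (ks ! r)) * (\<Prod>r=k..<?n. e (is ! \<sigma> r) $ (ks ! r))"
        using prod.atLeastLessThan_concat[of 0 k ?n "\<lambda>r. e (is ! \<sigma> r) $ (ks ! r)"] by (simp add: lessThan_atLeast0)
      also have "(\<Prod>r=k..<?n. e (is ! \<sigma> r) $ (ks ! r)) = (\<Prod>r<l. e (is ! \<sigma> (k + r)) $ (ks ! (k + r)))"
        by (rule prod.reindex_bij_witness[of _ "\<lambda>r. k + r" "\<lambda>r. r - k"]) auto
      finally show "(\<Prod>r<?n. e (is ! \<sigma> r) $ (ks ! r)) * (of_int (sign \<sigma>) * a (take k ks) * b (drop k ks)) =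
         of_int (sign \<sigma>) * (((\<Prod>r<k. e (is ! \<sigma> r) $ (take k ks ! r)) * a (take k ks)) * ((\<Prod>r<l. e (is ! \<sigma> (k + r)) $ (drop k ks ! r)) * b (drop k ks)))"
        using l by simp
    qed
    also have "\<dots> = (\<Sum>as | length as = k. \<Sum>bs | length bs = l. of_int (sign \<sigma>) *
       (((\<Prod>r<k. e (is ! \<sigma> r) $ (as ! r)) * a as) * ((\<Prod>r<l. e (is ! \<sigma> (k + r)) $ (bs ! r)) * b bs)))"
      by (rule sum_lists_append)
    also have "\<dots> = of_int (sign \<sigma>) * ((\<Sum>as | length as = k. (\<Prod>r<k. e (is ! \<sigma> r) $ (as ! r)) * a as) *
       (\<Sum>bs | length bs = l. (\<Prod>r<l. e (is ! \<sigma> (k + r)) $ (bs ! r)) * b bs))"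
      by (subst sum_product) (simp only: sum_distrib_left)
    also have "\<dots> = wterm k l (comps e a) (comps e b) is \<sigma>"
      by (simp add: wterm_def comps_def)
    finally show ?thesis .
  qed
  hence "(\<Sum>\<sigma> | \<sigma> permutes {..<?n}. wterm k l (comps e a) (comps e b) is \<sigma>) =
    (\<Sum>\<sigma> | \<sigma> permutes {..<?n}. \<Sum>js | length js = ?n. (\<Prod>r<?n. e (is ! r) $ (js ! r)) * wterm k l a b js \<sigma>)"
    by simp
  also have "\<dots> = (\<Sum>js | length js = ?n. (\<Prod>r<?n. e (is ! r) $ (js ! r)) * (\<Sum>\<sigma> | \<sigma> permutes {..<?n}. wterm k l a b js \<sigma>))"
    unfolding sum_distrib_left by (rule sum.swap)
  finally show ?thesis
    unfolding comps_def[of e "wedge k l a b"] wedge_wterm len times_divide_eq_right sum_divide_distrib[symmetric]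
    by simp
qed

lemma comps_interior_prod:
  "interior_prod x (comps e t) is = comps e (interior_prod (\<Sum>m\<in>UNIV. x $ m *\<^sub>R e m) t) is"
proof -
  have "interior_prod x (comps e t) is = (\<Sum>m\<in>UNIV. \<Sum>a\<in>UNIV. x $ m * e m $ a * comps e (\<lambda>js. t (a # js)) is)"
    by (simp add: interior_prod_def comps_Cons sum_distrib_left mult.assoc)
  also have "\<dots> = (\<Sum>a\<in>UNIV. (\<Sum>m\<in>UNIV. x $ m * e m $ a) * comps e (\<lambda>js. t (a # js)) is)"
    unfolding sum_distrib_right by (rule sum.swap)
  also have "\<dots> = comps e (interior_prod (\<Sum>m\<in>UNIV. x $ m *\<^sub>R e m) t) is"
    unfolding interior_prod_def[abs_def] by (simp add: comps_linear)
  finally show ?thesis .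
qed

lemma alternating_comps:
  assumes a: "alternating k a" shows "alternating k (comps e a)"
  unfolding alternating_def
proof (intro allI impI)
  fix "is" :: "7 list" and r s assume rs: "length is = k \<and> r < s \<and> s < k"
  let ?sw = "\<lambda>xs :: 7 list. xs[r := xs ! s, s := xs ! r]"
  have t: "Transposition.transpose r s permutes {..<k}" using rs by (intro permutes_swap_id) auto
  have nth: "?sw xs ! q = xs ! Transposition.transpose r s q" if "length xs = k" "q < k" for xs :: "7 list" and q
    using that rs by (auto simp: nth_list_update Transposition.transpose_def)
  have inv: "?sw (?sw xs) = xs" if "length xs = k" for xs :: "7 list"
    by (rule nth_equalityI) (use that rs in \<open>auto simp: nth_list_update\<close>)
  have "comps e a (?sw is) = (\<Sum>js | length js = k. - ((\<Prod>q<k. e (is ! q) $ (js ! q)) * a js))"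
    unfolding comps_def
  proof (rule sum.reindex_bij_witness[of _ ?sw ?sw])
    fix js :: "7 list" assume "js \<in> {js. length js = length (?sw is)}"
    hence l: "length js = k" using rs by simp
    show "?sw (?sw js) = js" by (rule inv[OF l])
    show "?sw js \<in> {js. length js = k}" using l by simp
    have "(\<Prod>q<k. e (is ! q) $ (?sw js ! q)) = (\<Prod>q<k. e (is ! Transposition.transpose r s q) $ (?sw js ! Transposition.transpose r s q))"
      by (rule prod.permute[OF t, unfolded o_def])
    also have "\<dots> = (\<Prod>q<k. e (?sw is ! q) $ (js ! q))"
    proof (rule prod.cong[OF refl])
      fix q assume "q \<in> {..<k}"
      hence "q < k" "Transposition.transpose r s q < k" using permutes_in_image[OF t, of q] by auto
      thus "e (is ! Transposition.transpose r s q) $ (?sw js ! Transposition.transpose r s q) = e (?sw is ! q) $ (js ! q)"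
        using nth[OF l] nth[of "is" q] rs by simp
    qed
    finally show "- ((\<Prod>q<k. e (is ! q) $ (?sw js ! q)) * a (?sw js)) = (\<Prod>q<length (?sw is). e (?sw is ! q) $ (js ! q)) * a js"
      using a l rs unfolding alternating_def by simp
  qed (use inv rs in auto)
  also have "\<dots> = - comps e a is" using rs by (simp add: comps_def sum_negf)
  finally show "comps e a (?sw is) = - comps e a is" .
qed

section \<open>Top forms, determinants and the metric equation\<close>

definition ix :: "7 list" where "ix = [0, 1, 2, 3, 4, 5, 6]"

lemma ix_nth: "length ix = 7" "distinct ix" "set ix = UNIV"
  by (simp add: ix_def, simp add: ix_def, simp only: ix_def UNIV_7 list.set)

lemma length_ix [simp]: "length ix = 7"
  by (rule ix_nth)

lemma sum_distinct_lists:
  "(\<Sum>js :: 7 list | length js = 7 \<and> distinct js. f js) = (\<Sum>p | p permutes (UNIV :: 7 set). f (map p ix))"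
proof (rule sum.reindex_bij_betw[symmetric])
  show "bij_betw (\<lambda>p. map p ix) {p. p permutes (UNIV :: 7 set)} {js. length js = 7 \<and> distinct js}"
  proof (rule bij_betw_imageI)
    show "inj_on (\<lambda>p. map p ix) {p. p permutes (UNIV :: 7 set)}"
    proof (rule inj_onI)
      fix p q :: "7 \<Rightarrow> 7" assume "map p ix = map q ix"
      hence "\<forall>x\<in>set ix. p x = q x" by simp
      thus "p = q" unfolding ix_nth(3) by (auto simp: fun_eq_iff)
    qed
    show "(\<lambda>p. map p ix) ` {p. p permutes (UNIV :: 7 set)} = {js. length js = 7 \<and> distinct js}"
    proof (intro equalityI subsetI)
      fix js assume "js \<in> (\<lambda>p. map p ix) ` {p. p permutes (UNIV :: 7 set)}"
      then obtain p where p: "p permutes (UNIV :: 7 set)" "js = map p ix" by auto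
      have "distinct (map p ix)"
        unfolding distinct_map using ix_nth(2) permutes_inj[OF p(1)] by (auto intro: inj_on_subset)
      thus "js \<in> {js. length js = 7 \<and> distinct js}" using p(2) by simp
    next
      fix js :: "7 list" assume "js \<in> {js. length js = 7 \<and> distinct js}"
      hence l: "length js = 7" and d: "distinct js" by auto
      define n where "n i = (THE r. r < 7 \<and> ix ! r = i)" for i :: 7
      have n: "n i < 7 \<and> ix ! n i = i" for i
      proof -
        have "\<exists>!r. r < 7 \<and> ix ! r = i"
          using ix_nth by (metis UNIV_I in_set_conv_nth nth_eq_iff_index_eq)
        thus ?thesis unfolding n_def by (rule theI')
      qed
      define p where "p i = js ! n i" for i
      have "inj p"
      proof (rule injI)
        fix x y assume "p x = p y"
        hence "n x = n y" using d n l unfolding p_def by (simp add: nth_eq_iff_index_eq)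
        thus "x = y" using n by metis
      qed
      hence "p permutes UNIV"
        by (intro bij_imp_permutes) (auto simp: bij_betw_def finite_UNIV_inj_surj)
      moreover have "js = map p ix"
      proof (rule nth_equalityI)
        fix r assume "r < length js"
        hence r: "r < 7" using l by simp
        have "n (ix ! r) = r" using n[of "ix ! r"] r ix_nth by (metis nth_eq_iff_index_eq)
        thus "js ! r = map p ix ! r" using r ix_nth(1) by (simp add: p_def ix_nth)
      qed (use l in simp)
      ultimately show "js \<in> (\<lambda>p. map p ix) ` {p. p permutes (UNIV :: 7 set)}" by blast
    qed
  qed
qed

lemma alternating_not_distinct:
  assumes a: "alternating k a" "length js = k" "\<not> distinct js"
  shows "a js = 0"
proof -
  obtain r s where "r < k" "s < k" "r \<noteq> s" "js ! r = js ! s"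
    using a(2,3) by (auto simp: distinct_conv_nth)
  hence "a (js[r := js ! s, s := js ! r]) = - a js" and "js[r := js ! s] = js" "js[s := js ! r] = js"
    using alternating_swap[OF a(1,2), of r s] list_update_id[of js r] list_update_id[of js s] by simp_all
  thus ?thesis by simp
qed

lemma alternating_7_perm:
  assumes v: "alternating 7 v" and p: "p permutes (UNIV :: 7 set)"
  shows "v (map p ix) = of_int (sign p) * v ix"
  using p finite
proof (induction rule: permutes_induct)
  case id
  show ?case by simp
next
  case (swap i j p)
  let ?L = "map p ix"
  have p: "p permutes (UNIV :: 7 set)" using \<open>p permutes UNIV\<close> .
  have L: "length ?L = 7" "distinct ?L" "set ?L = UNIV"
    using permutes_inj[OF p] permutes_surj[OF p] ix_nth by (auto simp: distinct_map intro: inj_on_subset)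
  obtain r s where rs: "r < 7" "s < 7" "?L ! r = i" "?L ! s = j"
    using L by (metis UNIV_I in_set_conv_nth)
  have ne: "r \<noteq> s" using rs swap by auto
  have "map (Transposition.transpose i j \<circ> p) ix = ?L[r := ?L ! s, s := ?L ! r]"
  proof (rule nth_equalityI)
    fix q assume "q < length (map (Transposition.transpose i j \<circ> p) ix)"
    hence q: "q < 7" by (simp add: ix_nth)
    have "?L ! q = i \<longleftrightarrow> q = r" "?L ! q = j \<longleftrightarrow> q = s"
      using L rs q by (metis nth_eq_iff_index_eq)+
    moreover have "map (Transposition.transpose i j \<circ> p) ix ! q = Transposition.transpose i j (?L ! q)"
      using q ix_nth(1) by (simp add: ix_nth)
    ultimately show "map (Transposition.transpose i j \<circ> p) ix ! q = ?L[r := ?L ! s, s := ?L ! r] ! q"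
      using rs ne q L(1) by (auto simp: nth_list_update Transposition.transpose_def)
  qed (simp add: ix_nth)
  hence "v (map (Transposition.transpose i j \<circ> p) ix) = - v ?L"
    using alternating_swap[OF v L(1) rs(1,2) ne] by simp
  moreover have "sign (Transposition.transpose i j \<circ> p) = - sign p"
    using swap p by (simp add: sign_compose sign_swap_id permutation_swap_id permutes_imp_permutation[of UNIV])
  ultimately show ?case by (simp only: swap.IH of_int_minus mult_minus_left)
qed

text \<open>Lists with a repetition drop out; the others are permutations of \<open>ix\<close>, and
  the sum over them is the Leibniz formula for the determinant.\<close>

lemma comps_det:
  assumes v: "alternating 7 v"
  shows "comps e v ix = det (\<chi> i j. e i $ j) * v ix"
proof -
  have "comps e v ix = (\<Sum>js | length js = 7. (\<Prod>r<7. e (ix ! r) $ (js ! r)) * v js)"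
    by (simp only: comps_def ix_nth)
  also have "\<dots> = (\<Sum>js | length js = 7 \<and> distinct js. (\<Prod>r<7. e (ix ! r) $ (js ! r)) * v js)"
    by (rule sum.mono_neutral_right) (use alternating_not_distinct[OF v] in auto)
  also have "\<dots> = (\<Sum>p | p permutes (UNIV :: 7 set). (\<Prod>r<7. e (ix ! r) $ (map p ix ! r)) * v (map p ix))"
    by (rule sum_distinct_lists)
  also have "\<dots> = (\<Sum>p | p permutes (UNIV :: 7 set). of_int (sign p) * (\<Prod>i\<in>UNIV. e i $ p i) * v ix)"
  proof (rule sum.cong[OF refl], unfold mem_Collect_eq)
    fix p :: "7 \<Rightarrow> 7" assume p: "p permutes UNIV"
    have "(\<Prod>r<7. e (ix ! r) $ (map p ix ! r)) = (\<Prod>i\<in>UNIV. e i $ p i)"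
      unfolding UNIV_7 ix_def by (simp add: lessThan_nat_numeral lessThan_Suc mult_ac)
    thus "(\<Prod>r<7. e (ix ! r) $ (map p ix ! r)) * v (map p ix) = of_int (sign p) * (\<Prod>i\<in>UNIV. e i $ p i) * v ix"
      using alternating_7_perm[OF v p] by simp
  qed
  also have "\<dots> = det (\<chi> i j. e i $ j) * v ix"
    by (simp add: det_def sum_distrib_right)
  finally show ?thesis .
qed

text \<open>The inner product is a parameter because a change of basis alters it: a coordinate frame
  starts from \<open>ginner\<close>, an orthonormal one arrives at the dot product.\<close>

definition g2_form :: "tensor \<Rightarrow> tensor \<Rightarrow> (real^7 \<Rightarrow> real^7 \<Rightarrow> real) \<Rightarrow> bool" where
  "g2_form f v h \<longleftrightarrow> alternating 3 f \<and> alternating 7 v \<and>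
     (\<forall>x y is. length is = 7 \<longrightarrow>
        wedge 4 3 (wedge 2 2 (interior_prod x f) (interior_prod y f)) f is = - 6 * h x y * v is)"

lemma g2_form_comps:
  assumes "g2_form f v h"
  shows "g2_form (comps e f) (comps e v) (\<lambda>x y. h (\<Sum>m\<in>UNIV. x $ m *\<^sub>R e m) (\<Sum>m\<in>UNIV. y $ m *\<^sub>R e m))"
  unfolding g2_form_def
proof (intro conjI allI impI)
  have a: "alternating 3 f" "alternating 7 v" using assms by (auto simp: g2_form_def)
  show "alternating 3 (comps e f)" "alternating 7 (comps e v)" using a by (auto intro: alternating_comps)
  fix x y and "is" :: "7 list" assume l: "length is = 7"
  let ?x = "\<Sum>m\<in>UNIV. x $ m *\<^sub>R e m" and ?y = "\<Sum>m\<in>UNIV. y $ m *\<^sub>R e m"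
  have "wedge 4 3 (wedge 2 2 (interior_prod x (comps e f)) (interior_prod y (comps e f))) (comps e f) is =
    wedge 4 3 (comps e (wedge 2 2 (interior_prod ?x f) (interior_prod ?y f))) (comps e f) is"
    by (rule wedge_cong) (simp_all add: comps_wedge comps_interior_prod[abs_def])
  also have "\<dots> = comps e (wedge 4 3 (wedge 2 2 (interior_prod ?x f) (interior_prod ?y f)) f) is"
    by (rule comps_wedge[symmetric]) (simp add: l)
  also have "\<dots> = comps e (\<lambda>js. \<Sum>b\<in>{()}. (- 6 * h ?x ?y) * v js) is"
    by (rule comps_cong) (use assms l in \<open>simp add: g2_form_def\<close>)
  also have "\<dots> = - 6 * h ?x ?y * comps e v is"
    by (subst comps_linear) simp
  finally show "wedge 4 3 (wedge 2 2 (interior_prod x (comps e f)) (interior_prod y (comps e f))) (comps e f) is =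
     - 6 * h ?x ?y * comps e v is" .
qed

definition b_form :: "tensor \<Rightarrow> 7 \<Rightarrow> 7 \<Rightarrow> real" where
  "b_form f i j = wedge 4 3 (wedge 2 2 (\<lambda>is. f (i # is)) (\<lambda>is. f (j # is))) f ix"

lemma interior_axis: "interior_prod (axis i 1) f = (\<lambda>is. f (i # is))"
  by (simp add: interior_prod_def fun_eq_iff axis_def if_distrib[of "\<lambda>x. x * _"] cong: if_cong)

lemma b_form_eq:
  assumes "g2_form f v (\<bullet>)"
  shows "b_form f i j = - 6 * kd i j * v ix"
proof -
  have "b_form f i j = - 6 * ((axis i 1 :: real^7) \<bullet> axis j 1) * v ix"
    using assms unfolding g2_form_def b_form_def interior_axis[symmetric] by (simp add: ix_nth)
  thus ?thesis by (simp add: inner_axis_axis kd_def)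
qed

lemma columns_sum: "(\<Sum>m\<in>UNIV. x $ m *\<^sub>R column m A) = A *v x" for A :: "real^'n^'m"
  by (simp add: matrix_mult_sum scalar_mult_eq_scaleR)

lemma orthogonal_matrix_inner: "orthogonal_matrix A \<Longrightarrow> (A *v x) \<bullet> (A *v y) = x \<bullet> y" for A :: "real^'n^'n"
  using orthogonal_transformation_matrix[of "(*v) A"] by (simp add: orthogonal_transformation_def)

lemma g2_form_orth:
  assumes "g2_form f v (\<bullet>)" "orthogonal_matrix A"
  shows "g2_form (comps (\<lambda>m. column m A) f) (comps (\<lambda>m. column m A) v) (\<bullet>)"
  using g2_form_comps[OF assms(1), of "\<lambda>m. column m A"] by (simp add: columns_sum orthogonal_matrix_inner[OF assms(2)])

lemma comps_det_matrix:
  "alternating 7 v \<Longrightarrow> comps (\<lambda>m. column m A) v ix = det A * v ix"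
proof -
  assume v: "alternating 7 v"
  have "(\<chi> i j. column i A $ j) = transpose A" by (simp add: vec_eq_iff transpose_def column_def)
  thus ?thesis using comps_det[OF v, of "\<lambda>m. column m A"] by (simp add: det_transpose)
qed

text \<open>Pulling the metric equation back by \<open>A\<close> leaves the left side alone and
  multiplies the volume by the determinant, so \<open>det A\<close> times
  \<open>transpose A ** A\<close> is the identity. Taking determinants in dimension 7 gives
  \<open>det A ^ 9 = 1\<close>; the exponent is odd, so the determinant is 1.\<close>

lemma g2_group_orthogonal:
  assumes f: "g2_form f v (\<bullet>)" and v: "v ix \<noteq> 0" and A: "A \<in> G2_group f"
  shows "orthogonal_matrix A"
proof -
  have a3: "alternating 3 f" and a7: "alternating 7 v" using f by (auto simp: g2_form_def)
  let ?f = "comps (\<lambda>m. column m A) f"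
  have e3: "?f is = f is" if "length is = 3" for "is"
    using A length3[OF that] by (auto simp: G2_group_def)
  have eq: "x \<bullet> y = det A * ((A *v x) \<bullet> (A *v y))" for x y
  proof -
    have "- 6 * ((A *v x) \<bullet> (A *v y)) * (det A * v ix) =
      wedge 4 3 (wedge 2 2 (interior_prod x ?f) (interior_prod y ?f)) ?f ix"
      using g2_form_comps[OF f, of "\<lambda>m. column m A"]
      by (simp add: g2_form_def columns_sum comps_det_matrix[OF a7] ix_nth)
    also have "\<dots> = wedge 4 3 (wedge 2 2 (interior_prod x f) (interior_prod y f)) f ix"
    proof (rule wedge_cong)
      have i: "interior_prod x ?f js = interior_prod x f js" if "length js = 2" for x js
        unfolding interior_prod_def using that by (intro sum.cong refl) (simp add: e3)
      show "wedge 2 2 (interior_prod x ?f) (interior_prod y ?f) js = wedge 2 2 (interior_prod x f) (interior_prod y f) js" for js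
        by (rule wedge_cong) (simp_all add: i)
    qed (simp add: e3)
    also have "\<dots> = - 6 * (x \<bullet> y) * v ix" using f by (simp add: g2_form_def ix_nth)
    finally show ?thesis using v by (simp add: mult.commute)
  qed
  have "x \<bullet> y = x \<bullet> ((det A *\<^sub>R (transpose A ** A)) *v y)" for x y
    using eq[of x y] by (simp add: matrix_vector_mul_assoc[symmetric] scaleR_matrix_vector_assoc[symmetric] dot_lmul_matrix[symmetric])
      (metis dot_lmul_matrix inner_commute transpose_matrix_vector)
  hence "y = (det A *\<^sub>R (transpose A ** A)) *v y" for y
    by (metis vector_eq_ldot)
  hence m: "det A *\<^sub>R (transpose A ** A) = mat 1"
    by (metis matrix_eq matrix_vector_mul_lid)
  have "det (det A *\<^sub>R (transpose A ** A)) = det A ^ 7 * (det A * det A)"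
  proof -
    have "c *\<^sub>R B = (\<chi> i. c *s (B $ i))" for c and B :: "real^7^7"
      by (simp add: vec_eq_iff)
    thus ?thesis using det_rows_mul[of "\<lambda>_. det A" "\<lambda>i. (transpose A ** A) $ i"] by (simp add: det_mul det_transpose)
  qed
  hence "det A ^ 9 = 1" unfolding m by (simp add: power_numeral_reduce mult_ac)
  hence "det A = 1" using odd_real_root_power_cancel[of 9 "det A"] by (simp add: real_root_one)
  thus ?thesis using m by (simp add: orthogonal_matrix)
qed

lemma f_sort:
  assumes a: "alternating 3 f"
  shows f_skew1: "f [j, i, k] = - f [i, j, k]" and f_skew2: "f [i, k, j] = - f [i, j, k]"
  using a[unfolded alternating_def, rule_format, of "[i, j, k]" 0 1]
    a[unfolded alternating_def, rule_format, of "[i, j, k]" 1 2] by simp_all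

lemma f_zero:
  assumes a: "alternating 3 f"
  shows "f [i, i, k] = 0" "f [i, k, i] = 0" "f [k, i, i] = 0"
  using alternating_not_distinct[OF a] by simp_all

lemma b_form_expand:
  assumes a: "alternating 3 f"
  shows "b_form f i j = (let w = (\<lambda>p q r s. f [i,p,q] * f [j,r,s] - f [i,p,r] * f [j,q,s] + f [i,p,s] * f [j,q,r]
     + f [i,q,r] * f [j,p,s] - f [i,q,s] * f [j,p,r] + f [i,r,s] * f [j,p,q]) in
    w 0 1 2 3 * f [4,5,6] - w 0 1 2 4 * f [3,5,6] + w 0 1 2 5 * f [3,4,6] - w 0 1 2 6 * f [3,4,5]
  + w 0 1 3 4 * f [2,5,6] - w 0 1 3 5 * f [2,4,6] + w 0 1 3 6 * f [2,4,5] + w 0 1 4 5 * f [2,3,6]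
  - w 0 1 4 6 * f [2,3,5] + w 0 1 5 6 * f [2,3,4] - w 0 2 3 4 * f [1,5,6] + w 0 2 3 5 * f [1,4,6]
  - w 0 2 3 6 * f [1,4,5] - w 0 2 4 5 * f [1,3,6] + w 0 2 4 6 * f [1,3,5] - w 0 2 5 6 * f [1,3,4]
  + w 0 3 4 5 * f [1,2,6] - w 0 3 4 6 * f [1,2,5] + w 0 3 5 6 * f [1,2,4] - w 0 4 5 6 * f [1,2,3]
  + w 1 2 3 4 * f [0,5,6] - w 1 2 3 5 * f [0,4,6] + w 1 2 3 6 * f [0,4,5] + w 1 2 4 5 * f [0,3,6]
  - w 1 2 4 6 * f [0,3,5] + w 1 2 5 6 * f [0,3,4] - w 1 3 4 5 * f [0,2,6] + w 1 3 4 6 * f [0,2,5]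
  - w 1 3 5 6 * f [0,2,4] + w 1 4 5 6 * f [0,2,3] + w 2 3 4 5 * f [0,1,6] - w 2 3 4 6 * f [0,1,5]
  + w 2 3 5 6 * f [0,1,4] - w 2 4 5 6 * f [0,1,3] + w 3 4 5 6 * f [0,1,2])"
proof -
  have e: "alternating (Suc 2) f" using a by (simp add: numeral_3_eq_3)
  have a4: "alternating 4 (wedge 2 2 (\<lambda>is. f (i # is)) (\<lambda>is. f (j # is)))"
    using alternating_wedge[of 2 2] by simp
  show ?thesis
    unfolding b_form_def Let_def ix_def wedge_4_3[OF a4 a]
    by (simp only: wedge_2_2[OF alternating_Cons[OF e] alternating_Cons[OF e]])
qed

subsection \<open>Normal form of a nondegenerate 3-form\<close>

definition sk4 :: "real \<Rightarrow> real \<Rightarrow> real \<Rightarrow> real \<Rightarrow> real \<Rightarrow> real \<Rightarrow> real^4^4" where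
  "sk4 x12 x13 x14 x23 x24 x34 = (\<chi> i j.
     if i = 1 \<and> j = 2 then x12 else if i = 2 \<and> j = 1 then - x12
     else if i = 1 \<and> j = 3 then x13 else if i = 3 \<and> j = 1 then - x13
     else if i = 1 \<and> j = 4 then x14 else if i = 4 \<and> j = 1 then - x14
     else if i = 2 \<and> j = 3 then x23 else if i = 3 \<and> j = 2 then - x23
     else if i = 2 \<and> j = 4 then x24 else if i = 4 \<and> j = 2 then - x24
     else if i = 3 \<and> j = 4 then x34 else if i = 4 \<and> j = 3 then - x34 else 0)"

text \<open>The Hodge dual on 2-forms in dimension 4: entries of complementary index pairs are
  exchanged, with signs.\<close>

definition sk4d :: "real \<Rightarrow> real \<Rightarrow> real \<Rightarrow> real \<Rightarrow> real \<Rightarrow> real \<Rightarrow> real^4^4" where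
  "sk4d x12 x13 x14 x23 x24 x34 = sk4 x34 (- x24) x23 x14 (- x13) x12"

lemma sk4_entries:
  "sk4 a b c d e f $ 1 $ 1 = 0" "sk4 a b c d e f $ 1 $ 2 = a" "sk4 a b c d e f $ 1 $ 3 = b" "sk4 a b c d e f $ 1 $ 4 = c"
  "sk4 a b c d e f $ 2 $ 1 = - a" "sk4 a b c d e f $ 2 $ 2 = 0" "sk4 a b c d e f $ 2 $ 3 = d" "sk4 a b c d e f $ 2 $ 4 = e"
  "sk4 a b c d e f $ 3 $ 1 = - b" "sk4 a b c d e f $ 3 $ 2 = - d" "sk4 a b c d e f $ 3 $ 3 = 0" "sk4 a b c d e f $ 3 $ 4 = f"
  "sk4 a b c d e f $ 4 $ 1 = - c" "sk4 a b c d e f $ 4 $ 2 = - e" "sk4 a b c d e f $ 4 $ 3 = - f" "sk4 a b c d e f $ 4 $ 4 = 0"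
  by (simp_all add: sk4_def)

lemma matrix_mult_4: "((A :: real^4^4) ** B) $ i $ j =
   A $ i $ 1 * B $ 1 $ j + A $ i $ 2 * B $ 2 $ j + A $ i $ 3 * B $ 3 $ j + A $ i $ 4 * B $ 4 $ j"
  by (simp add: matrix_matrix_mult_def sum_4)

lemma sk4_polar:
  "sk4 a1 a2 a3 a4 a5 a6 ** sk4d b1 b2 b3 b4 b5 b6 + sk4 b1 b2 b3 b4 b5 b6 ** sk4d a1 a2 a3 a4 a5 a6 =
     (- (a1 * b6 - a2 * b5 + a3 * b4 + a4 * b3 - a5 * b2 + a6 * b1)) *\<^sub>R mat 1"
  "sk4d a1 a2 a3 a4 a5 a6 ** sk4 b1 b2 b3 b4 b5 b6 + sk4d b1 b2 b3 b4 b5 b6 ** sk4 a1 a2 a3 a4 a5 a6 =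
     (- (a1 * b6 - a2 * b5 + a3 * b4 + a4 * b3 - a5 * b2 + a6 * b1)) *\<^sub>R mat 1"
  unfolding vec_eq_iff forall_4 by (simp_all add: matrix_mult_4 sk4d_def sk4_entries mat_def algebra_simps)

text \<open>A skew matrix of size 4 times its dual is minus its Pfaffian times the identity;
  \<open>sk4_polar\<close> is the polarised form.\<close>

lemma sk4_square:
  "sk4 a1 a2 a3 a4 a5 a6 ** sk4d a1 a2 a3 a4 a5 a6 = (- (a1 * a6 - a2 * a5 + a3 * a4)) *\<^sub>R mat 1"
  "sk4d a1 a2 a3 a4 a5 a6 ** sk4 a1 a2 a3 a4 a5 a6 = (- (a1 * a6 - a2 * a5 + a3 * a4)) *\<^sub>R mat 1"
  unfolding vec_eq_iff forall_4 by (simp_all add: matrix_mult_4 sk4d_def sk4_entries mat_def algebra_simps)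

lemma sk4_eq: "sk4 a1 a2 a3 a4 a5 a6 = c *\<^sub>R sk4 b1 b2 b3 b4 b5 b6 \<longleftrightarrow>
   a1 = c * b1 \<and> a2 = c * b2 \<and> a3 = c * b3 \<and> a4 = c * b4 \<and> a5 = c * b5 \<and> a6 = c * b6"
  by (auto simp: vec_eq_iff forall_4 sk4_def)

text \<open>\<open>A\<close>, \<open>B\<close>, \<open>C\<close> behave like rescaled quaternion
  units whose duals play the role of inverses. Cancelling \<open>A\<close>, respectively
  \<open>C\<close>, in the triple product expresses \<open>A'\<close> by \<open>B' ** C\<close> and
  \<open>C'\<close> by \<open>A ** B'\<close>; anticommutation then returns a multiple of
  \<open>C\<close>.\<close>

lemma quaternion_relation:
  fixes A A' B B' C C' :: "real^'n^'n"
  assumes p: "p \<noteq> 0" and A: "A' ** A = (- p) *\<^sub>R mat 1" and B: "B ** B' = (- p) *\<^sub>R mat 1"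
    and C: "C ** C' = (- p) *\<^sub>R mat 1" and AB: "A ** B' = - (B ** A')"
    and ABC: "A ** B' ** C = - mat 1"
  shows "C' = p ^ 3 *\<^sub>R C"
proof -
  have neg: "X ** (- Y) = - (X ** Y)" "(- X) ** Y = - (X ** Y)" for X Y :: "real^'n^'n"
    using matrix_scalar_ac[of X "-1" Y] scalar_matrix_assoc[of "-1" X Y] by simp_all
  have scal: "(c *\<^sub>R mat 1) ** X = c *\<^sub>R X" "X ** (c *\<^sub>R mat 1) = c *\<^sub>R X" for c and X :: "real^'n^'n"
    by (simp_all add: scalar_matrix_assoc[symmetric] matrix_scalar_ac)
  have "(A' ** A) ** (B' ** C) = - A'"
    using ABC by (simp add: matrix_mul_assoc[symmetric] neg)
  hence 1: "A' = p *\<^sub>R (B' ** C)"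
    unfolding A scal by simp
  have "(A ** B') ** (C ** C') = - C'"
    using ABC by (simp add: matrix_mul_assoc neg)
  hence 2: "C' = p *\<^sub>R (A ** B')"
    unfolding C scal by simp
  have "B ** A' = p *\<^sub>R ((B ** B') ** C)"
    by (simp only: 1 matrix_scalar_ac matrix_mul_assoc scalar_matrix_assoc)
  also have "\<dots> = - (p * p) *\<^sub>R C"
    unfolding B scal by simp
  finally have "C' = p *\<^sub>R ((p * p) *\<^sub>R C)" unfolding 2 AB by simp
  thus ?thesis by (simp add: power3_eq_cube mult.assoc)
qed

text \<open>Three orthogonal 2-forms of equal norm in dimension 4 whose associated cubic form is the metric
  are self-dual; this is Urbantke's formula in coordinates.\<close>

lemma self_dual_triple:
  fixes l a1 a2 a3 a4 a5 a6 b1 b2 b3 b4 b5 b6 c1 c2 c3 c4 c5 c6 :: real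
  assumes l: "l > 0" and pa: "l * (a1 * a6 - a2 * a5 + a3 * a4) = 1" and pb: "l * (b1 * b6 - b2 * b5 + b3 * b4) = 1" and pc: "l * (c1 * c6 - c2 * c5 + c3 * c4) = 1"
    and ab: "a1 * b6 - a2 * b5 + a3 * b4 + a4 * b3 - a5 * b2 + a6 * b1 = 0" and ac: "a1 * c6 - a2 * c5 + a3 * c4 + a4 * c3 - a5 * c2 + a6 * c1 = 0" and bc: "b1 * c6 - b2 * c5 + b3 * c4 + b4 * c3 - b5 * c2 + b6 * c1 = 0"
    and E11: "a1 * b2 * c3 - a1 * b3 * c2 - a2 * b1 * c3 + a2 * b3 * c1 + a3 * b1 * c2 - a3 * b2 * c1 = -1"
    and E12: "a1 * b2 * c5 - a1 * b3 * c4 + a1 * b4 * c3 - a1 * b5 * c2 - a2 * b1 * c5 + a2 * b5 * c1 + a3 * b1 * c4 - a3 * b4 * c1 - a4 * b1 * c3 + a4 * b3 * c1 + a5 * b1 * c2 - a5 * b2 * c1 = 0"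
    and E13: "a1 * b2 * c6 - a1 * b6 * c2 - a2 * b1 * c6 - a2 * b3 * c4 + a2 * b4 * c3 + a2 * b6 * c1 + a3 * b2 * c4 - a3 * b4 * c2 - a4 * b2 * c3 + a4 * b3 * c2 + a6 * b1 * c2 - a6 * b2 * c1 = 0"
    and E14: "a1 * b3 * c6 - a1 * b6 * c3 - a2 * b3 * c5 + a2 * b5 * c3 - a3 * b1 * c6 + a3 * b2 * c5 - a3 * b5 * c2 + a3 * b6 * c1 - a5 * b2 * c3 + a5 * b3 * c2 + a6 * b1 * c3 - a6 * b3 * c1 = 0"
    and E22: "a1 * b4 * c5 - a1 * b5 * c4 - a4 * b1 * c5 + a4 * b5 * c1 + a5 * b1 * c4 - a5 * b4 * c1 = -1"
    and E23: "a1 * b4 * c6 - a1 * b6 * c4 + a2 * b4 * c5 - a2 * b5 * c4 - a4 * b1 * c6 - a4 * b2 * c5 + a4 * b5 * c2 + a4 * b6 * c1 + a5 * b2 * c4 - a5 * b4 * c2 + a6 * b1 * c4 - a6 * b4 * c1 = 0"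
    and E24: "a1 * b5 * c6 - a1 * b6 * c5 + a3 * b4 * c5 - a3 * b5 * c4 - a4 * b3 * c5 + a4 * b5 * c3 - a5 * b1 * c6 + a5 * b3 * c4 - a5 * b4 * c3 + a5 * b6 * c1 + a6 * b1 * c5 - a6 * b5 * c1 = 0"
    and E33: "a2 * b4 * c6 - a2 * b6 * c4 - a4 * b2 * c6 + a4 * b6 * c2 + a6 * b2 * c4 - a6 * b4 * c2 = -1"
    and E34: "a2 * b5 * c6 - a2 * b6 * c5 + a3 * b4 * c6 - a3 * b6 * c4 - a4 * b3 * c6 + a4 * b6 * c3 - a5 * b2 * c6 + a5 * b6 * c2 + a6 * b2 * c5 + a6 * b3 * c4 - a6 * b4 * c3 - a6 * b5 * c2 = 0"
    and E44: "a3 * b5 * c6 - a3 * b6 * c5 - a5 * b3 * c6 + a5 * b6 * c3 + a6 * b3 * c5 - a6 * b5 * c3 = -1"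
  shows "l = 1 \<and> a4 = a3 \<and> a5 = - a2 \<and> a6 = a1 \<and> b4 = b3 \<and> b5 = - b2 \<and> b6 = b1 \<and> c4 = c3 \<and> c5 = - c2 \<and> c6 = c1"
proof -
  define A A' where "A = sk4 a1 a2 a3 a4 a5 a6" and "A' = sk4d a1 a2 a3 a4 a5 a6"
  define B B' where "B = sk4 b1 b2 b3 b4 b5 b6" and "B' = sk4d b1 b2 b3 b4 b5 b6"
  define C C' where "C = sk4 c1 c2 c3 c4 c5 c6" and "C' = sk4d c1 c2 c3 c4 c5 c6"
  note defs = A_def A'_def B_def B'_def C_def C'_def
  define p where "p = 1 / l"
  have p: "p > 0" using l by (simp add: p_def)
  have pf: "a1 * a6 - a2 * a5 + a3 * a4 = p" "b1 * b6 - b2 * b5 + b3 * b4 = p" "c1 * c6 - c2 * c5 + c3 * c4 = p"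
    using pa pb pc l by (simp_all add: p_def field_simps)
  have sq: "A ** A' = (- p) *\<^sub>R mat 1" "A' ** A = (- p) *\<^sub>R mat 1" "B ** B' = (- p) *\<^sub>R mat 1" "B' ** B = (- p) *\<^sub>R mat 1"
    "C ** C' = (- p) *\<^sub>R mat 1" "C' ** C = (- p) *\<^sub>R mat 1"
    unfolding defs sk4_square pf by simp_all
  have anti: "A ** B' = - (B ** A')" "A ** C' = - (C ** A')" "B ** C' = - (C ** B')"
    "A' ** B = - (B' ** A)" "A' ** C = - (C' ** A)" "B' ** C = - (C' ** B)"
    unfolding defs using sk4_polar[of a1 a2 a3 a4 a5 a6 b1 b2 b3 b4 b5 b6] sk4_polar[of a1 a2 a3 a4 a5 a6 c1 c2 c3 c4 c5 c6]
      sk4_polar[of b1 b2 b3 b4 b5 b6 c1 c2 c3 c4 c5 c6] unfolding ab ac bc by (simp_all add: eq_neg_iff_add_eq_0 add.commute)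
  \<comment> \<open>The antisymmetrisation of \<open>A ** B' ** C\<close> over the three forms. Its
    entries are the cubic expressions of the hypotheses, with factor 6 on the diagonal and 3 off it.
    Anticommutation makes all six signed summands equal, so the triple product is minus the
    identity.\<close>
  define Q where "Q = A ** B' ** C - A ** C' ** B + B ** C' ** A - B ** A' ** C + C ** A' ** B - C ** B' ** A"
  have q11: "Q $ 1 $ 1 = 6 * (a1 * b2 * c3 - a1 * b3 * c2 - a2 * b1 * c3 + a2 * b3 * c1 + a3 * b1 * c2 - a3 * b2 * c1)"
    unfolding Q_def defs vector_add_component vector_minus_component matrix_mult_4 sk4d_def sk4_entries by (simp add: algebra_simps)
  have q12: "Q $ 1 $ 2 = 3 * (a1 * b2 * c5 - a1 * b3 * c4 + a1 * b4 * c3 - a1 * b5 * c2 - a2 * b1 * c5 + a2 * b5 * c1 + a3 * b1 * c4 - a3 * b4 * c1 - a4 * b1 * c3 + a4 * b3 * c1 + a5 * b1 * c2 - a5 * b2 * c1)"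
    unfolding Q_def defs vector_add_component vector_minus_component matrix_mult_4 sk4d_def sk4_entries by (simp add: algebra_simps)
  have q21: "Q $ 2 $ 1 = 3 * (a1 * b2 * c5 - a1 * b3 * c4 + a1 * b4 * c3 - a1 * b5 * c2 - a2 * b1 * c5 + a2 * b5 * c1 + a3 * b1 * c4 - a3 * b4 * c1 - a4 * b1 * c3 + a4 * b3 * c1 + a5 * b1 * c2 - a5 * b2 * c1)"
    unfolding Q_def defs vector_add_component vector_minus_component matrix_mult_4 sk4d_def sk4_entries by (simp add: algebra_simps)
  have q13: "Q $ 1 $ 3 = 3 * (a1 * b2 * c6 - a1 * b6 * c2 - a2 * b1 * c6 - a2 * b3 * c4 + a2 * b4 * c3 + a2 * b6 * c1 + a3 * b2 * c4 - a3 * b4 * c2 - a4 * b2 * c3 + a4 * b3 * c2 + a6 * b1 * c2 - a6 * b2 * c1)"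
    unfolding Q_def defs vector_add_component vector_minus_component matrix_mult_4 sk4d_def sk4_entries by (simp add: algebra_simps)
  have q31: "Q $ 3 $ 1 = 3 * (a1 * b2 * c6 - a1 * b6 * c2 - a2 * b1 * c6 - a2 * b3 * c4 + a2 * b4 * c3 + a2 * b6 * c1 + a3 * b2 * c4 - a3 * b4 * c2 - a4 * b2 * c3 + a4 * b3 * c2 + a6 * b1 * c2 - a6 * b2 * c1)"
    unfolding Q_def defs vector_add_component vector_minus_component matrix_mult_4 sk4d_def sk4_entries by (simp add: algebra_simps)
  have q14: "Q $ 1 $ 4 = 3 * (a1 * b3 * c6 - a1 * b6 * c3 - a2 * b3 * c5 + a2 * b5 * c3 - a3 * b1 * c6 + a3 * b2 * c5 - a3 * b5 * c2 + a3 * b6 * c1 - a5 * b2 * c3 + a5 * b3 * c2 + a6 * b1 * c3 - a6 * b3 * c1)"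
    unfolding Q_def defs vector_add_component vector_minus_component matrix_mult_4 sk4d_def sk4_entries by (simp add: algebra_simps)
  have q41: "Q $ 4 $ 1 = 3 * (a1 * b3 * c6 - a1 * b6 * c3 - a2 * b3 * c5 + a2 * b5 * c3 - a3 * b1 * c6 + a3 * b2 * c5 - a3 * b5 * c2 + a3 * b6 * c1 - a5 * b2 * c3 + a5 * b3 * c2 + a6 * b1 * c3 - a6 * b3 * c1)"
    unfolding Q_def defs vector_add_component vector_minus_component matrix_mult_4 sk4d_def sk4_entries by (simp add: algebra_simps)
  have q22: "Q $ 2 $ 2 = 6 * (a1 * b4 * c5 - a1 * b5 * c4 - a4 * b1 * c5 + a4 * b5 * c1 + a5 * b1 * c4 - a5 * b4 * c1)"
    unfolding Q_def defs vector_add_component vector_minus_component matrix_mult_4 sk4d_def sk4_entries by (simp add: algebra_simps)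
  have q23: "Q $ 2 $ 3 = 3 * (a1 * b4 * c6 - a1 * b6 * c4 + a2 * b4 * c5 - a2 * b5 * c4 - a4 * b1 * c6 - a4 * b2 * c5 + a4 * b5 * c2 + a4 * b6 * c1 + a5 * b2 * c4 - a5 * b4 * c2 + a6 * b1 * c4 - a6 * b4 * c1)"
    unfolding Q_def defs vector_add_component vector_minus_component matrix_mult_4 sk4d_def sk4_entries by (simp add: algebra_simps)
  have q32: "Q $ 3 $ 2 = 3 * (a1 * b4 * c6 - a1 * b6 * c4 + a2 * b4 * c5 - a2 * b5 * c4 - a4 * b1 * c6 - a4 * b2 * c5 + a4 * b5 * c2 + a4 * b6 * c1 + a5 * b2 * c4 - a5 * b4 * c2 + a6 * b1 * c4 - a6 * b4 * c1)"
    unfolding Q_def defs vector_add_component vector_minus_component matrix_mult_4 sk4d_def sk4_entries by (simp add: algebra_simps)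
  have q24: "Q $ 2 $ 4 = 3 * (a1 * b5 * c6 - a1 * b6 * c5 + a3 * b4 * c5 - a3 * b5 * c4 - a4 * b3 * c5 + a4 * b5 * c3 - a5 * b1 * c6 + a5 * b3 * c4 - a5 * b4 * c3 + a5 * b6 * c1 + a6 * b1 * c5 - a6 * b5 * c1)"
    unfolding Q_def defs vector_add_component vector_minus_component matrix_mult_4 sk4d_def sk4_entries by (simp add: algebra_simps)
  have q42: "Q $ 4 $ 2 = 3 * (a1 * b5 * c6 - a1 * b6 * c5 + a3 * b4 * c5 - a3 * b5 * c4 - a4 * b3 * c5 + a4 * b5 * c3 - a5 * b1 * c6 + a5 * b3 * c4 - a5 * b4 * c3 + a5 * b6 * c1 + a6 * b1 * c5 - a6 * b5 * c1)"
    unfolding Q_def defs vector_add_component vector_minus_component matrix_mult_4 sk4d_def sk4_entries by (simp add: algebra_simps)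
  have q33: "Q $ 3 $ 3 = 6 * (a2 * b4 * c6 - a2 * b6 * c4 - a4 * b2 * c6 + a4 * b6 * c2 + a6 * b2 * c4 - a6 * b4 * c2)"
    unfolding Q_def defs vector_add_component vector_minus_component matrix_mult_4 sk4d_def sk4_entries by (simp add: algebra_simps)
  have q34: "Q $ 3 $ 4 = 3 * (a2 * b5 * c6 - a2 * b6 * c5 + a3 * b4 * c6 - a3 * b6 * c4 - a4 * b3 * c6 + a4 * b6 * c3 - a5 * b2 * c6 + a5 * b6 * c2 + a6 * b2 * c5 + a6 * b3 * c4 - a6 * b4 * c3 - a6 * b5 * c2)"
    unfolding Q_def defs vector_add_component vector_minus_component matrix_mult_4 sk4d_def sk4_entries by (simp add: algebra_simps)
  have q43: "Q $ 4 $ 3 = 3 * (a2 * b5 * c6 - a2 * b6 * c5 + a3 * b4 * c6 - a3 * b6 * c4 - a4 * b3 * c6 + a4 * b6 * c3 - a5 * b2 * c6 + a5 * b6 * c2 + a6 * b2 * c5 + a6 * b3 * c4 - a6 * b4 * c3 - a6 * b5 * c2)"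
    unfolding Q_def defs vector_add_component vector_minus_component matrix_mult_4 sk4d_def sk4_entries by (simp add: algebra_simps)
  have q44: "Q $ 4 $ 4 = 6 * (a3 * b5 * c6 - a3 * b6 * c5 - a5 * b3 * c6 + a5 * b6 * c3 + a6 * b3 * c5 - a6 * b5 * c3)"
    unfolding Q_def defs vector_add_component vector_minus_component matrix_mult_4 sk4d_def sk4_entries by (simp add: algebra_simps)
  have Q: "Q = (- 6) *\<^sub>R mat 1"
    unfolding vec_eq_iff forall_4 by (simp add: q11 q12 q13 q14 q21 q22 q23 q24 q31 q32 q33 q34 q41 q42 q43 q44
      E11 E12 E13 E14 E22 E23 E24 E33 E34 E44 mat_def)
  have neg: "X ** (- Y) = - (X ** Y)" "(- X) ** Y = - (X ** Y)" for X Y :: "real^4^4"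
    using matrix_scalar_ac[of X "-1" Y] scalar_matrix_assoc[of "-1" X Y] by simp_all
  have t1: "B ** A' ** C = - (A ** B' ** C)" "A ** C' ** B = - (A ** B' ** C)"
    by (simp add: anti(1) neg, simp add: matrix_mul_assoc[symmetric] anti(6) neg)
  have t2: "C ** A' ** B = A ** B' ** C" "B ** C' ** A = A ** B' ** C"
  proof -
    have "C ** A' ** B = - (A ** C' ** B)" by (simp add: anti(2) neg)
    thus "C ** A' ** B = A ** B' ** C" using t1 by simp
    have "B ** C' ** A = - (B ** A' ** C)" by (simp add: matrix_mul_assoc[symmetric] anti(5) neg)
    thus "B ** C' ** A = A ** B' ** C" using t1 by simp
  qed
  have t3: "C ** B' ** A = - (A ** B' ** C)"
  proof -
    have "C ** B' ** A = - (B ** C' ** A)" by (simp add: anti(3) neg)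
    thus ?thesis using t2 by simp
  qed
  have "Q = 6 *\<^sub>R (A ** B' ** C)" unfolding Q_def t1 t2 t3 by (simp add: scaleR_left_distrib[symmetric] vec_eq_iff)
  hence k: "A ** B' ** C = - mat 1" using Q by (simp add: vec_eq_iff)
  have kB: "B ** C' ** A = - mat 1" and kC: "C ** A' ** B = - mat 1" using t2 k by simp_all
  have pn: "p \<noteq> 0" using p by simp
  have hC: "C' = p ^ 3 *\<^sub>R C" by (rule quaternion_relation[OF pn sq(2) sq(3) sq(5) anti(1) k])
  have hA: "A' = p ^ 3 *\<^sub>R A" by (rule quaternion_relation[OF pn sq(4) sq(5) sq(1) anti(3) kB])
  have hB: "B' = p ^ 3 *\<^sub>R B"
    by (rule quaternion_relation[OF pn sq(6) sq(1) sq(3) _ kC]) (simp add: anti(2))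
  \<comment> \<open>Each form is dual to \<open>p ^ 3\<close> times itself. Duality is an
    involution, so \<open>p ^ 6 = 1\<close>, and positivity leaves \<open>p = 1\<close>: the forms
    are self-dual.\<close>
  have e: "a6 = p ^ 3 * a1" "- a5 = p ^ 3 * a2" "a4 = p ^ 3 * a3" "a3 = p ^ 3 * a4" "- a2 = p ^ 3 * a5" "a1 = p ^ 3 * a6"
    "b6 = p ^ 3 * b1" "- b5 = p ^ 3 * b2" "b4 = p ^ 3 * b3" "c6 = p ^ 3 * c1" "- c5 = p ^ 3 * c2" "c4 = p ^ 3 * c3"
    using hA[unfolded defs sk4d_def sk4_eq] hB[unfolded defs sk4d_def sk4_eq] hC[unfolded defs sk4d_def sk4_eq]
    by blast+
  have "p ^ 3 * (p ^ 3 * a1) = a1" "p ^ 3 * (p ^ 3 * a3) = a3"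
    by (simp_all only: e(1,3)[symmetric] e(4,6)[symmetric])
  moreover have "p ^ 3 * (p ^ 3 * a2) = a2" unfolding e(2)[symmetric] mult_minus_right e(5)[symmetric] by simp
  moreover have "a1 \<noteq> 0 \<or> a2 \<noteq> 0 \<or> a3 \<noteq> 0"
    using pf(1) pn by auto
  ultimately have "p ^ 3 * p ^ 3 = 1" unfolding mult.assoc[symmetric] by (metis mult_cancel_right1)
  hence "p ^ 6 = 1" by (simp add: power_add[symmetric])
  hence "p = 1" using p power_eq_1_iff[of p 6] by simp
  thus ?thesis using e(1-3,7-12) p_def by simp
qed

section \<open>An adapted orthonormal triple\<close>

definition tri :: "tensor \<Rightarrow> real^7 \<Rightarrow> real^7 \<Rightarrow> real^7 \<Rightarrow> real" where
  "tri f x y z = (\<Sum>a\<in>UNIV. \<Sum>b\<in>UNIV. \<Sum>c\<in>UNIV. x $ a * y $ b * z $ c * f [a, b, c])"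

lemma comps_tri: "comps e f [i, j, k] = tri f (e i) (e j) (e k)"
  by (simp add: tri_def comps3)

lemma tri_skew:
  assumes "alternating 3 f"
  shows "tri f y x z = - tri f x y z" "tri f x z y = - tri f x y z"
proof -
  note sk = comps_skew3[of f, OF f_skew1[OF assms] f_skew2[OF assms]]
  show "tri f y x z = - tri f x y z"
    using sk(1)[where e = "\<lambda>m. if m = 0 then x else if m = 1 then y else z" and i = 0 and j = 1 and k = 2]
    by (simp add: comps_tri)
  show "tri f x z y = - tri f x y z"
    using sk(2)[where e = "\<lambda>m. if m = 0 then x else if m = 1 then y else z" and i = 0 and j = 1 and k = 2]
    by (simp add: comps_tri)
qed

lemma tri_same:
  assumes "alternating 3 f"
  shows "tri f x x z = 0" "tri f x y x = 0" "tri f y x x = 0"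
  using tri_skew(1)[OF assms, of x x z] tri_skew(2)[OF assms, of y x x] tri_skew(2)[OF assms, of x x y] tri_skew(1)[OF assms, of x x y]
  by linarith+

text \<open>The equality case of Cauchy-Schwarz: the functional in the third slot has norm at most
  \<open>l\<close> and attains \<open>l\<close> at \<open>z\<close> in the unit ball, so it is
  represented by \<open>l *\<^sub>R z\<close>, and \<open>z\<close> has norm 1.\<close>

lemma tri_extremal:
  assumes l: "l > 0" "tri f x y z = l" "norm z \<le> 1" and m: "\<And>w. norm w \<le> 1 \<Longrightarrow> tri f x y w \<le> l"
  shows "tri f x y w = l * (z \<bullet> w)" "norm z = 1"
proof -
  define a :: "real^7" where "a = (\<chi> c. \<Sum>a\<in>UNIV. \<Sum>b\<in>UNIV. x $ a * y $ b * f [a, b, c])"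
  have t: "tri f x y w = a \<bullet> w" for w
  proof -
    have "tri f x y w = (\<Sum>a\<in>UNIV. \<Sum>c\<in>UNIV. \<Sum>b\<in>UNIV. x $ a * y $ b * w $ c * f [a, b, c])"
      unfolding tri_def by (rule sum.cong[OF refl], rule sum.swap)
    also have "\<dots> = (\<Sum>c\<in>UNIV. \<Sum>a\<in>UNIV. \<Sum>b\<in>UNIV. x $ a * y $ b * w $ c * f [a, b, c])"
      by (rule sum.swap)
    also have "\<dots> = a \<bullet> w"
      by (simp add: a_def inner_vec_def sum_distrib_left sum_distrib_right mult_ac)
    finally show ?thesis .
  qed
  have n: "norm a \<le> l"
  proof (cases "a = 0")
    case False
    hence "a \<bullet> ((1 / norm a) *\<^sub>R a) \<le> l" using m[of "(1 / norm a) *\<^sub>R a"] t by simp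
    thus ?thesis using False by (simp add: power2_norm_eq_inner[symmetric] power2_eq_square)
  qed (use l in simp)
  have az: "a \<bullet> z = l" using t l by simp
  have "(norm (a - l *\<^sub>R z))\<^sup>2 = (norm a)\<^sup>2 - 2 * l * (a \<bullet> z) + l\<^sup>2 * (norm z)\<^sup>2"
    unfolding power2_norm_eq_inner by (simp add: inner_diff_left inner_diff_right inner_commute power2_eq_square algebra_simps)
  also have "\<dots> \<le> l\<^sup>2 - 2 * l * l + l\<^sup>2 * 1"
    using power_mono[OF n, of 2] power_mono[OF l(3), of 2] by (intro add_mono diff_mono mult_left_mono) (use l in \<open>auto simp: az\<close>)
  finally have "(norm (a - l *\<^sub>R z))\<^sup>2 \<le> 0" by (simp add: power2_eq_square)
  hence "a = l *\<^sub>R z" by simp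
  thus "tri f x y w = l * (z \<bullet> w)" by (simp add: t)
  from \<open>a = l *\<^sub>R z\<close> have "l * (norm z)\<^sup>2 = l" using az by (simp add: power2_norm_eq_inner)
  hence "(norm z)\<^sup>2 = 1" using l by simp
  thus "norm z = 1" by (simp add: power2_eq_1_iff) (metis norm_ge_zero not_one_le_zero neg_0_le_iff_le)
qed

text \<open>A maximum over three closed unit balls exists by compactness and is extremal in each
  slot separately. Orthogonality comes for free: the form vanishes when a vector is repeated,
  whereas \<open>tri_extremal\<close> evaluates it there as \<open>l\<close> times an inner
  product.\<close>

lemma maximal_triple:
  assumes a: "alternating 3 f" and nz: "f [i, j, k] \<noteq> 0"
  obtains l x y z where "l > 0" "norm x = 1" "norm y = 1" "norm z = 1" "x \<bullet> y = 0" "x \<bullet> z = 0" "y \<bullet> z = 0"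
    "\<And>w. tri f x y w = l * (z \<bullet> w)" "\<And>w. tri f y z w = l * (x \<bullet> w)" "\<And>w. tri f z x w = l * (y \<bullet> w)"
proof -
  let ?K = "cball (0 :: real^7) 1 \<times> cball (0 :: real^7) 1 \<times> cball (0 :: real^7) 1"
  let ?F = "\<lambda>p. tri f (fst p) (fst (snd p)) (snd (snd p))"
  have "compact ?K" by (intro compact_Times compact_cball)
  moreover have "?K \<noteq> {}" by auto
  moreover have "continuous_on ?K ?F" unfolding tri_def by (intro continuous_intros)
  ultimately have "\<exists>p\<in>?K. \<forall>q\<in>?K. ?F q \<le> ?F p" by (rule continuous_attains_sup)
  then obtain p where p: "p \<in> ?K" "\<And>q. q \<in> ?K \<Longrightarrow> ?F q \<le> ?F p" by blast
  obtain x y z where pe: "p = (x, y, z)" by (cases p)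
  define l where "l = tri f x y z"
  have xyz: "norm x \<le> 1" "norm y \<le> 1" "norm z \<le> 1" using p(1) pe by auto
  have m: "tri f x' y' z' \<le> l" if "norm x' \<le> 1" "norm y' \<le> 1" "norm z' \<le> 1" for x' y' z'
    using p(2)[of "(x', y', z')"] that by (simp add: pe l_def)
  have t: "tri f (axis i 1) (axis j 1) (c *\<^sub>R axis k 1) = c * f [i, j, k]" for c
  proof -
    have "tri f (axis i 1) (axis j 1) (c *\<^sub>R axis k 1) =
        (\<Sum>a\<in>UNIV. kd a i * (\<Sum>b\<in>UNIV. kd b j * (\<Sum>d\<in>UNIV. kd d k * (c * f [a, b, d]))))"
      unfolding tri_def sum_distrib_left
      by (rule sum.cong[OF refl], rule sum.cong[OF refl], rule sum.cong[OF refl]) (simp add: axis_def kd_def)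
    thus ?thesis by (simp add: sum_kd)
  qed
  \<comment> \<open>A nonzero component, with the sign adjusted in the last basis vector, bounds the
    maximum from below and shows that it is positive.\<close>
  have "sgn (f [i, j, k]) * f [i, j, k] \<le> l"
    unfolding t[symmetric] by (rule m) (use nz in \<open>simp_all add: norm_axis_1 abs_sgn_eq\<close>)
  hence l: "l > 0" using nz by (simp add: sgn_if split: if_splits)
  have c: "tri f y z x = l" "tri f z x y = l"
    using tri_skew(2)[OF a, of y x z] tri_skew(1)[OF a, of y x z] tri_skew(1)[OF a, of x z y] tri_skew(2)[OF a, of x y z]
    by (simp_all only: l_def minus_minus)
  note 1 = tri_extremal[OF l l_def[symmetric] xyz(3) m[OF xyz(1,2)]]
  note 2 = tri_extremal[OF l c(1) xyz(1) m[OF xyz(2,3)]]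
  note 3 = tri_extremal[OF l c(2) xyz(2) m[OF xyz(3,1)]]
  have "l * (z \<bullet> x) = 0" "l * (z \<bullet> y) = 0" "l * (x \<bullet> y) = 0"
    by (simp_all only: 1(1)[symmetric] 2(1)[symmetric] tri_same[OF a])
  hence "z \<bullet> x = 0" "z \<bullet> y = 0" "x \<bullet> y = 0" using l by simp_all
  thus ?thesis using that[OF l, of x y z] 1 2 3 by (simp add: inner_commute)
qed

text \<open>The triple is placed at 0, 1 and 3 because these points form a line of
  \<open>fano\<close>; the indices 2, 4, 5, 6 carry the complementary 4-space.\<close>

lemma extend_orthonormal_triple:
  fixes x y z :: "real^7"
  assumes n: "norm x = 1" "norm y = 1" "norm z = 1" and o: "x \<bullet> y = 0" "x \<bullet> z = 0" "y \<bullet> z = 0"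
  obtains e :: "7 \<Rightarrow> real^7" where "e 0 = x" "e 1 = y" "e 3 = z" "\<And>i j. e i \<bullet> e j = kd i j"
proof -
  have ii: "x \<bullet> x = 1" "y \<bullet> y = 1" "z \<bullet> z = 1" using n by (simp_all add: norm_eq_1)
  have d: "x \<noteq> y" "x \<noteq> z" "y \<noteq> z" using ii o by auto
  let ?S = "span {x, y, z}"
  have ind: "independent {x, y, z}"
    by (rule pairwise_orthogonal_independent) (use ii o in \<open>auto simp: pairwise_def orthogonal_def inner_commute\<close>)
  have "dim ?S = 3" using ind d by (simp add: dim_eq_card_independent)
  let ?V = "{w. \<forall>s\<in>?S. orthogonal s w}"
  have "dim ?V = 4"
    using dim_subspace_orthogonal_to_vectors[of ?S "UNIV :: (real^7) set"] \<open>dim ?S = 3\<close> by simp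
  have "subspace ?V" by (auto simp: subspace_def orthogonal_def inner_add_right)
  then obtain B where B: "B \<subseteq> ?V" "pairwise orthogonal B" "\<And>b. b \<in> B \<Longrightarrow> norm b = 1" "independent B" "card B = dim ?V" "span B = ?V"
    by (rule orthonormal_basis_subspace) (rule that; blast)
  have "card B = card {2, 4, 5, 6 :: 7}" using B(5) \<open>dim ?V = 4\<close> by simp
  moreover have "finite B" using B(4) independent_imp_finite by blast
  ultimately obtain h where h: "bij_betw h {2, 4, 5, 6 :: 7} B" using finite_same_card_bij[of "{2, 4, 5, 6 :: 7}" B] by auto
  have hB: "h m \<in> B" if "m \<in> {2, 4, 5, 6}" for m using h that by (auto simp: bij_betw_def)
  have hx: "x \<bullet> h m = 0" "y \<bullet> h m = 0" "z \<bullet> h m = 0" if "m \<in> {2, 4, 5, 6}" for m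
  proof -
    have "h m \<in> ?V" using hB[OF that] B(1) by blast
    thus "x \<bullet> h m = 0" "y \<bullet> h m = 0" "z \<bullet> h m = 0" by (simp_all add: orthogonal_def span_base)
  qed
  have hh: "h m \<bullet> h m' = kd m m'" if "m \<in> {2, 4, 5, 6}" "m' \<in> {2, 4, 5, 6}" for m m'
  proof (cases "m = m'")
    case True
    thus ?thesis using B(3)[OF hB[OF that(1)]] by (simp add: norm_eq_1)
  next
    case False
    hence "h m \<noteq> h m'" using h that by (auto simp: bij_betw_def inj_on_def)
    thus ?thesis using B(2) hB that False by (auto simp: pairwise_def orthogonal_def kd_def)
  qed
  define e where "e m = (if m = 0 then x else if m = 1 then y else if m = 3 then z else h m)" for m
  have "\<forall>i j. e i \<bullet> e j = kd i j"
    using o hx by (auto simp: e_def ii hh kd_def inner_commute forall_7)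
  thus ?thesis using that[of e] by (simp add: e_def)
qed

text \<open>The \<open>a\<close>, \<open>b\<close>, \<open>c\<close> are the 2-forms on the 4-space
  with indices 2, 4, 5, 6 obtained by inserting the basis vectors 0, 1, 3, and the \<open>d\<close>
  are the 3-form there. In sorted order the index 3 comes after 2, which explains the minus signs at
  \<open>c1\<close>, \<open>c2\<close>, \<open>c3\<close>. The last ten entries are stated for
  vanishing \<open>d\<close>, which the earlier ones enforce.\<close>

lemma b_form_adapted:
  assumes f: "alternating 3 f" and l: "f [0, 1, 3] = l"
    and z: "f [0, 1, 2] = 0" "f [0, 1, 4] = 0" "f [0, 1, 5] = 0" "f [0, 1, 6] = 0" "f [0, 2, 3] = 0" "f [0, 3, 4] = 0" "f [0, 3, 5] = 0" "f [0, 3, 6] = 0" "f [1, 2, 3] = 0" "f [1, 3, 4] = 0" "f [1, 3, 5] = 0" "f [1, 3, 6] = 0"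
    and e: "f [0, 2, 4] = a1" "f [0, 2, 5] = a2" "f [0, 2, 6] = a3" "f [0, 4, 5] = a4" "f [0, 4, 6] = a5" "f [0, 5, 6] = a6" "f [1, 2, 4] = b1" "f [1, 2, 5] = b2" "f [1, 2, 6] = b3" "f [1, 4, 5] = b4" "f [1, 4, 6] = b5" "f [1, 5, 6] = b6" "f [2, 3, 4] = - c1" "f [2, 3, 5] = - c2" "f [2, 3, 6] = - c3" "f [3, 4, 5] = c4" "f [3, 4, 6] = c5" "f [3, 5, 6] = c6" "f [2, 4, 5] = d1" "f [2, 4, 6] = d2" "f [2, 5, 6] = d3" "f [4, 5, 6] = d4"
  shows "b_form f 0 0 = - 6 * a1 * a6 * l + 6 * a2 * a5 * l - 6 * a3 * a4 * l"
    "b_form f 0 1 = - 3 * a1 * b6 * l + 3 * a2 * b5 * l - 3 * a3 * b4 * l - 3 * a4 * b3 * l + 3 * a5 * b2 * l - 3 * a6 * b1 * l"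
    "b_form f 0 3 = - 3 * a1 * c6 * l + 3 * a2 * c5 * l - 3 * a3 * c4 * l - 3 * a4 * c3 * l + 3 * a5 * c2 * l - 3 * a6 * c1 * l"
    "b_form f 1 1 = - 6 * b1 * b6 * l + 6 * b2 * b5 * l - 6 * b3 * b4 * l"
    "b_form f 1 3 = - 3 * b1 * c6 * l + 3 * b2 * c5 * l - 3 * b3 * c4 * l - 3 * b4 * c3 * l + 3 * b5 * c2 * l - 3 * b6 * c1 * l"
    "b_form f 3 3 = - 6 * c1 * c6 * l + 6 * c2 * c5 * l - 6 * c3 * c4 * l"
    "b_form f 0 2 = - 3 * a1 * d3 * l + 3 * a2 * d2 * l - 3 * a3 * d1 * l"
    "b_form f 0 4 = - 3 * a1 * d4 * l + 3 * a4 * d2 * l - 3 * a5 * d1 * l"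
    "b_form f 0 5 = - 3 * a2 * d4 * l + 3 * a4 * d3 * l - 3 * a6 * d1 * l"
    "b_form f 0 6 = - 3 * a3 * d4 * l + 3 * a5 * d3 * l - 3 * a6 * d2 * l"
    "d1 = 0 \<Longrightarrow> d2 = 0 \<Longrightarrow> d3 = 0 \<Longrightarrow> d4 = 0 \<Longrightarrow> b_form f 2 2 = 6 * a1 * b2 * c3 - 6 * a1 * b3 * c2 - 6 * a2 * b1 * c3 + 6 * a2 * b3 * c1 + 6 * a3 * b1 * c2 - 6 * a3 * b2 * c1"
    "d1 = 0 \<Longrightarrow> d2 = 0 \<Longrightarrow> d3 = 0 \<Longrightarrow> d4 = 0 \<Longrightarrow> b_form f 2 4 = 3 * a1 * b2 * c5 - 3 * a1 * b3 * c4 + 3 * a1 * b4 * c3 - 3 * a1 * b5 * c2 - 3 * a2 * b1 * c5 + 3 * a2 * b5 * c1 + 3 * a3 * b1 * c4 - 3 * a3 * b4 * c1 - 3 * a4 * b1 * c3 + 3 * a4 * b3 * c1 + 3 * a5 * b1 * c2 - 3 * a5 * b2 * c1"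
    "d1 = 0 \<Longrightarrow> d2 = 0 \<Longrightarrow> d3 = 0 \<Longrightarrow> d4 = 0 \<Longrightarrow> b_form f 2 5 = 3 * a1 * b2 * c6 - 3 * a1 * b6 * c2 - 3 * a2 * b1 * c6 - 3 * a2 * b3 * c4 + 3 * a2 * b4 * c3 + 3 * a2 * b6 * c1 + 3 * a3 * b2 * c4 - 3 * a3 * b4 * c2 - 3 * a4 * b2 * c3 + 3 * a4 * b3 * c2 + 3 * a6 * b1 * c2 - 3 * a6 * b2 * c1"
    "d1 = 0 \<Longrightarrow> d2 = 0 \<Longrightarrow> d3 = 0 \<Longrightarrow> d4 = 0 \<Longrightarrow> b_form f 2 6 = 3 * a1 * b3 * c6 - 3 * a1 * b6 * c3 - 3 * a2 * b3 * c5 + 3 * a2 * b5 * c3 - 3 * a3 * b1 * c6 + 3 * a3 * b2 * c5 - 3 * a3 * b5 * c2 + 3 * a3 * b6 * c1 - 3 * a5 * b2 * c3 + 3 * a5 * b3 * c2 + 3 * a6 * b1 * c3 - 3 * a6 * b3 * c1"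
    "d1 = 0 \<Longrightarrow> d2 = 0 \<Longrightarrow> d3 = 0 \<Longrightarrow> d4 = 0 \<Longrightarrow> b_form f 4 4 = 6 * a1 * b4 * c5 - 6 * a1 * b5 * c4 - 6 * a4 * b1 * c5 + 6 * a4 * b5 * c1 + 6 * a5 * b1 * c4 - 6 * a5 * b4 * c1"
    "d1 = 0 \<Longrightarrow> d2 = 0 \<Longrightarrow> d3 = 0 \<Longrightarrow> d4 = 0 \<Longrightarrow> b_form f 4 5 = 3 * a1 * b4 * c6 - 3 * a1 * b6 * c4 + 3 * a2 * b4 * c5 - 3 * a2 * b5 * c4 - 3 * a4 * b1 * c6 - 3 * a4 * b2 * c5 + 3 * a4 * b5 * c2 + 3 * a4 * b6 * c1 + 3 * a5 * b2 * c4 - 3 * a5 * b4 * c2 + 3 * a6 * b1 * c4 - 3 * a6 * b4 * c1"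
    "d1 = 0 \<Longrightarrow> d2 = 0 \<Longrightarrow> d3 = 0 \<Longrightarrow> d4 = 0 \<Longrightarrow> b_form f 4 6 = 3 * a1 * b5 * c6 - 3 * a1 * b6 * c5 + 3 * a3 * b4 * c5 - 3 * a3 * b5 * c4 - 3 * a4 * b3 * c5 + 3 * a4 * b5 * c3 - 3 * a5 * b1 * c6 + 3 * a5 * b3 * c4 - 3 * a5 * b4 * c3 + 3 * a5 * b6 * c1 + 3 * a6 * b1 * c5 - 3 * a6 * b5 * c1"
    "d1 = 0 \<Longrightarrow> d2 = 0 \<Longrightarrow> d3 = 0 \<Longrightarrow> d4 = 0 \<Longrightarrow> b_form f 5 5 = 6 * a2 * b4 * c6 - 6 * a2 * b6 * c4 - 6 * a4 * b2 * c6 + 6 * a4 * b6 * c2 + 6 * a6 * b2 * c4 - 6 * a6 * b4 * c2"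
    "d1 = 0 \<Longrightarrow> d2 = 0 \<Longrightarrow> d3 = 0 \<Longrightarrow> d4 = 0 \<Longrightarrow> b_form f 5 6 = 3 * a2 * b5 * c6 - 3 * a2 * b6 * c5 + 3 * a3 * b4 * c6 - 3 * a3 * b6 * c4 - 3 * a4 * b3 * c6 + 3 * a4 * b6 * c3 - 3 * a5 * b2 * c6 + 3 * a5 * b6 * c2 + 3 * a6 * b2 * c5 + 3 * a6 * b3 * c4 - 3 * a6 * b4 * c3 - 3 * a6 * b5 * c2"
    "d1 = 0 \<Longrightarrow> d2 = 0 \<Longrightarrow> d3 = 0 \<Longrightarrow> d4 = 0 \<Longrightarrow> b_form f 6 6 = 6 * a3 * b5 * c6 - 6 * a3 * b6 * c5 - 6 * a5 * b3 * c6 + 6 * a5 * b6 * c3 + 6 * a6 * b3 * c5 - 6 * a6 * b5 * c3"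
proof -
  have s: "f [i, j, k] = - f [j, i, k]" if "j < i" for i j k
    by (rule f_skew1[OF f])
  have s': "f [i, j, k] = - f [i, k, j]" if "k < j" for i j k
    by (rule f_skew2[OF f])
  note simps = s s' f_zero[OF f] less_7 l z e
  show "b_form f 0 0 = - 6 * a1 * a6 * l + 6 * a2 * a5 * l - 6 * a3 * a4 * l"
    unfolding b_form_expand[OF f] Let_def by (simp add: simps algebra_simps)
  show "b_form f 0 1 = - 3 * a1 * b6 * l + 3 * a2 * b5 * l - 3 * a3 * b4 * l - 3 * a4 * b3 * l + 3 * a5 * b2 * l - 3 * a6 * b1 * l"
    unfolding b_form_expand[OF f] Let_def by (simp add: simps algebra_simps)
  show "b_form f 0 3 = - 3 * a1 * c6 * l + 3 * a2 * c5 * l - 3 * a3 * c4 * l - 3 * a4 * c3 * l + 3 * a5 * c2 * l - 3 * a6 * c1 * l"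
    unfolding b_form_expand[OF f] Let_def by (simp add: simps algebra_simps)
  show "b_form f 1 1 = - 6 * b1 * b6 * l + 6 * b2 * b5 * l - 6 * b3 * b4 * l"
    unfolding b_form_expand[OF f] Let_def by (simp add: simps algebra_simps)
  show "b_form f 1 3 = - 3 * b1 * c6 * l + 3 * b2 * c5 * l - 3 * b3 * c4 * l - 3 * b4 * c3 * l + 3 * b5 * c2 * l - 3 * b6 * c1 * l"
    unfolding b_form_expand[OF f] Let_def by (simp add: simps algebra_simps)
  show "b_form f 3 3 = - 6 * c1 * c6 * l + 6 * c2 * c5 * l - 6 * c3 * c4 * l"
    unfolding b_form_expand[OF f] Let_def by (simp add: simps algebra_simps)
  show "b_form f 0 2 = - 3 * a1 * d3 * l + 3 * a2 * d2 * l - 3 * a3 * d1 * l"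
    unfolding b_form_expand[OF f] Let_def by (simp add: simps algebra_simps)
  show "b_form f 0 4 = - 3 * a1 * d4 * l + 3 * a4 * d2 * l - 3 * a5 * d1 * l"
    unfolding b_form_expand[OF f] Let_def by (simp add: simps algebra_simps)
  show "b_form f 0 5 = - 3 * a2 * d4 * l + 3 * a4 * d3 * l - 3 * a6 * d1 * l"
    unfolding b_form_expand[OF f] Let_def by (simp add: simps algebra_simps)
  show "b_form f 0 6 = - 3 * a3 * d4 * l + 3 * a5 * d3 * l - 3 * a6 * d2 * l"
    unfolding b_form_expand[OF f] Let_def by (simp add: simps algebra_simps)
  show "b_form f 2 2 = 6 * a1 * b2 * c3 - 6 * a1 * b3 * c2 - 6 * a2 * b1 * c3 + 6 * a2 * b3 * c1 + 6 * a3 * b1 * c2 - 6 * a3 * b2 * c1" if "d1 = 0" "d2 = 0" "d3 = 0" "d4 = 0"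
    unfolding b_form_expand[OF f] Let_def by (simp add: simps that algebra_simps)
  show "b_form f 2 4 = 3 * a1 * b2 * c5 - 3 * a1 * b3 * c4 + 3 * a1 * b4 * c3 - 3 * a1 * b5 * c2 - 3 * a2 * b1 * c5 + 3 * a2 * b5 * c1 + 3 * a3 * b1 * c4 - 3 * a3 * b4 * c1 - 3 * a4 * b1 * c3 + 3 * a4 * b3 * c1 + 3 * a5 * b1 * c2 - 3 * a5 * b2 * c1" if "d1 = 0" "d2 = 0" "d3 = 0" "d4 = 0"
    unfolding b_form_expand[OF f] Let_def by (simp add: simps that algebra_simps)
  show "b_form f 2 5 = 3 * a1 * b2 * c6 - 3 * a1 * b6 * c2 - 3 * a2 * b1 * c6 - 3 * a2 * b3 * c4 + 3 * a2 * b4 * c3 + 3 * a2 * b6 * c1 + 3 * a3 * b2 * c4 - 3 * a3 * b4 * c2 - 3 * a4 * b2 * c3 + 3 * a4 * b3 * c2 + 3 * a6 * b1 * c2 - 3 * a6 * b2 * c1" if "d1 = 0" "d2 = 0" "d3 = 0" "d4 = 0"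
    unfolding b_form_expand[OF f] Let_def by (simp add: simps that algebra_simps)
  show "b_form f 2 6 = 3 * a1 * b3 * c6 - 3 * a1 * b6 * c3 - 3 * a2 * b3 * c5 + 3 * a2 * b5 * c3 - 3 * a3 * b1 * c6 + 3 * a3 * b2 * c5 - 3 * a3 * b5 * c2 + 3 * a3 * b6 * c1 - 3 * a5 * b2 * c3 + 3 * a5 * b3 * c2 + 3 * a6 * b1 * c3 - 3 * a6 * b3 * c1" if "d1 = 0" "d2 = 0" "d3 = 0" "d4 = 0"
    unfolding b_form_expand[OF f] Let_def by (simp add: simps that algebra_simps)
  show "b_form f 4 4 = 6 * a1 * b4 * c5 - 6 * a1 * b5 * c4 - 6 * a4 * b1 * c5 + 6 * a4 * b5 * c1 + 6 * a5 * b1 * c4 - 6 * a5 * b4 * c1" if "d1 = 0" "d2 = 0" "d3 = 0" "d4 = 0"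
    unfolding b_form_expand[OF f] Let_def by (simp add: simps that algebra_simps)
  show "b_form f 4 5 = 3 * a1 * b4 * c6 - 3 * a1 * b6 * c4 + 3 * a2 * b4 * c5 - 3 * a2 * b5 * c4 - 3 * a4 * b1 * c6 - 3 * a4 * b2 * c5 + 3 * a4 * b5 * c2 + 3 * a4 * b6 * c1 + 3 * a5 * b2 * c4 - 3 * a5 * b4 * c2 + 3 * a6 * b1 * c4 - 3 * a6 * b4 * c1" if "d1 = 0" "d2 = 0" "d3 = 0" "d4 = 0"
    unfolding b_form_expand[OF f] Let_def by (simp add: simps that algebra_simps)
  show "b_form f 4 6 = 3 * a1 * b5 * c6 - 3 * a1 * b6 * c5 + 3 * a3 * b4 * c5 - 3 * a3 * b5 * c4 - 3 * a4 * b3 * c5 + 3 * a4 * b5 * c3 - 3 * a5 * b1 * c6 + 3 * a5 * b3 * c4 - 3 * a5 * b4 * c3 + 3 * a5 * b6 * c1 + 3 * a6 * b1 * c5 - 3 * a6 * b5 * c1" if "d1 = 0" "d2 = 0" "d3 = 0" "d4 = 0"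
    unfolding b_form_expand[OF f] Let_def by (simp add: simps that algebra_simps)
  show "b_form f 5 5 = 6 * a2 * b4 * c6 - 6 * a2 * b6 * c4 - 6 * a4 * b2 * c6 + 6 * a4 * b6 * c2 + 6 * a6 * b2 * c4 - 6 * a6 * b4 * c2" if "d1 = 0" "d2 = 0" "d3 = 0" "d4 = 0"
    unfolding b_form_expand[OF f] Let_def by (simp add: simps that algebra_simps)
  show "b_form f 5 6 = 3 * a2 * b5 * c6 - 3 * a2 * b6 * c5 + 3 * a3 * b4 * c6 - 3 * a3 * b6 * c4 - 3 * a4 * b3 * c6 + 3 * a4 * b6 * c3 - 3 * a5 * b2 * c6 + 3 * a5 * b6 * c2 + 3 * a6 * b2 * c5 + 3 * a6 * b3 * c4 - 3 * a6 * b4 * c3 - 3 * a6 * b5 * c2" if "d1 = 0" "d2 = 0" "d3 = 0" "d4 = 0"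
    unfolding b_form_expand[OF f] Let_def by (simp add: simps that algebra_simps)
  show "b_form f 6 6 = 6 * a3 * b5 * c6 - 6 * a3 * b6 * c5 - 6 * a5 * b3 * c6 + 6 * a5 * b6 * c3 + 6 * a6 * b3 * c5 - 6 * a6 * b5 * c3" if "d1 = 0" "d2 = 0" "d3 = 0" "d4 = 0"
    unfolding b_form_expand[OF f] Let_def by (simp add: simps that algebra_simps)
qed

lemma rows_cols_3:
  fixes a1 a2 a3 b1 b2 b3 c1 c2 c3 :: real
  assumes "a1 * a1 + a2 * a2 + a3 * a3 = 1" "b1 * b1 + b2 * b2 + b3 * b3 = 1" "c1 * c1 + c2 * c2 + c3 * c3 = 1"
    "a1 * b1 + a2 * b2 + a3 * b3 = 0" "a1 * c1 + a2 * c2 + a3 * c3 = 0" "b1 * c1 + b2 * c2 + b3 * c3 = 0"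
  shows "a1 * a1 + b1 * b1 + c1 * c1 = 1" "a2 * a2 + b2 * b2 + c2 * c2 = 1" "a3 * a3 + b3 * b3 + c3 * c3 = 1"
    "a1 * a2 + b1 * b2 + c1 * c2 = 0" "a1 * a3 + b1 * b3 + c1 * c3 = 0" "a2 * a3 + b2 * b3 + c2 * c3 = 0"
proof -
  define M :: "real^3^3" where "M = vector [vector [a1, a2, a3], vector [b1, b2, b3], vector [c1, c2, c3]]"
  have "M ** transpose M = mat 1"
    unfolding vec_eq_iff forall_3 using assms
    by (simp add: matrix_matrix_mult_def sum_3 transpose_def mat_def M_def vector_3 mult.commute)
  hence "transpose M ** M = mat 1" by (simp add: matrix_left_right_inverse)
  thus "a1 * a1 + b1 * b1 + c1 * c1 = 1" "a2 * a2 + b2 * b2 + c2 * c2 = 1" "a3 * a3 + b3 * b3 + c3 * c3 = 1"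
    "a1 * a2 + b1 * b2 + c1 * c2 = 0" "a1 * a3 + b1 * b3 + c1 * c3 = 0" "a2 * a3 + b2 * b3 + c2 * c3 = 0"
    unfolding vec_eq_iff forall_3
    by (simp_all add: matrix_matrix_mult_def sum_3 transpose_def mat_def M_def vector_3)
qed

lemma adapted_fano:
  assumes f: "g2_form f v (\<bullet>)" and v: "v ix = 1" and lf: "f [0, 1, 3] = l" and l: "l > 0"
    and z: "f [0, 1, 2] = 0" "f [0, 1, 4] = 0" "f [0, 1, 5] = 0" "f [0, 1, 6] = 0" "f [0, 2, 3] = 0" "f [0, 3, 4] = 0" "f [0, 3, 5] = 0" "f [0, 3, 6] = 0" "f [1, 2, 3] = 0" "f [1, 3, 4] = 0" "f [1, 3, 5] = 0" "f [1, 3, 6] = 0"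
  obtains P where "orthogonal_matrix P" "\<And>i j k. comps (\<lambda>m. column m P) f [i, j, k] = fano i j k"
proof -
  have alt: "alternating 3 f" using f by (simp add: g2_form_def)
  define a1 a2 a3 a4 a5 a6 b1 b2 b3 b4 b5 b6 c1 c2 c3 c4 c5 c6 d1 d2 d3 d4 where "a1 = f [0, 2, 4]" and "a2 = f [0, 2, 5]" and "a3 = f [0, 2, 6]" and "a4 = f [0, 4, 5]" and "a5 = f [0, 4, 6]" and "a6 = f [0, 5, 6]" and "b1 = f [1, 2, 4]" and "b2 = f [1, 2, 5]" and "b3 = f [1, 2, 6]" and "b4 = f [1, 4, 5]" and "b5 = f [1, 4, 6]" and "b6 = f [1, 5, 6]" and "c1 = - f [2, 3, 4]" and "c2 = - f [2, 3, 5]" and "c3 = - f [2, 3, 6]" and "c4 = f [3, 4, 5]" and "c5 = f [3, 4, 6]" and "c6 = f [3, 5, 6]" and "d1 = f [2, 4, 5]" and "d2 = f [2, 4, 6]" and "d3 = f [2, 5, 6]" and "d4 = f [4, 5, 6]"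
  note defs = a1_def a2_def a3_def a4_def a5_def a6_def b1_def b2_def b3_def b4_def b5_def b6_def c1_def c2_def c3_def c4_def c5_def c6_def d1_def d2_def d3_def d4_def
  have e: "f [0, 2, 4] = a1" "f [0, 2, 5] = a2" "f [0, 2, 6] = a3" "f [0, 4, 5] = a4" "f [0, 4, 6] = a5" "f [0, 5, 6] = a6" "f [1, 2, 4] = b1" "f [1, 2, 5] = b2" "f [1, 2, 6] = b3" "f [1, 4, 5] = b4" "f [1, 4, 6] = b5" "f [1, 5, 6] = b6" "f [2, 3, 4] = - c1" "f [2, 3, 5] = - c2" "f [2, 3, 6] = - c3" "f [3, 4, 5] = c4" "f [3, 4, 6] = c5" "f [3, 5, 6] = c6" "f [2, 4, 5] = d1" "f [2, 4, 6] = d2" "f [2, 5, 6] = d3" "f [4, 5, 6] = d4"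
    by (simp_all add: defs)
  note B = b_form_adapted[OF alt lf z e]
  have b: "b_form f i j = - 6 * kd i j" for i j using b_form_eq[OF f] v by simp
  have pa: "l * (a1 * a6 - a2 * a5 + a3 * a4) = 1"
    using B(1) b[of 0 0] by (simp add: algebra_simps)
  have pb: "l * (b1 * b6 - b2 * b5 + b3 * b4) = 1"
    using B(4) b[of 1 1] by (simp add: algebra_simps)
  have pc: "l * (c1 * c6 - c2 * c5 + c3 * c4) = 1"
    using B(6) b[of 3 3] by (simp add: algebra_simps)
  have "- 3 * l * (a1 * b6 - a2 * b5 + a3 * b4 + a4 * b3 - a5 * b2 + a6 * b1) = 0"
    using B(2) b[of 0 1] by (simp add: kd_def algebra_simps)
  hence ab: "a1 * b6 - a2 * b5 + a3 * b4 + a4 * b3 - a5 * b2 + a6 * b1 = 0" using l by simp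
  have "- 3 * l * (a1 * c6 - a2 * c5 + a3 * c4 + a4 * c3 - a5 * c2 + a6 * c1) = 0"
    using B(3) b[of 0 3] by (simp add: kd_def algebra_simps)
  hence ac: "a1 * c6 - a2 * c5 + a3 * c4 + a4 * c3 - a5 * c2 + a6 * c1 = 0" using l by simp
  have "- 3 * l * (b1 * c6 - b2 * c5 + b3 * c4 + b4 * c3 - b5 * c2 + b6 * c1) = 0"
    using B(5) b[of 1 3] by (simp add: kd_def algebra_simps)
  hence bc: "b1 * c6 - b2 * c5 + b3 * c4 + b4 * c3 - b5 * c2 + b6 * c1 = 0" using l by simp
  have "- 3 * l * (a1 * d3 - a2 * d2 + a3 * d1) = 0"
    using B(7) b[of 0 2] by (simp add: kd_def algebra_simps)
  hence h7: "a1 * d3 - a2 * d2 + a3 * d1 = 0" using l by simp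
  have "- 3 * l * (a1 * d4 - a4 * d2 + a5 * d1) = 0"
    using B(8) b[of 0 4] by (simp add: kd_def algebra_simps)
  hence h8: "a1 * d4 - a4 * d2 + a5 * d1 = 0" using l by simp
  have "- 3 * l * (a2 * d4 - a4 * d3 + a6 * d1) = 0"
    using B(9) b[of 0 5] by (simp add: kd_def algebra_simps)
  hence h9: "a2 * d4 - a4 * d3 + a6 * d1 = 0" using l by simp
  have "- 3 * l * (a3 * d4 - a5 * d3 + a6 * d2) = 0"
    using B(10) b[of 0 6] by (simp add: kd_def algebra_simps)
  hence h10: "a3 * d4 - a5 * d3 + a6 * d2 = 0" using l by simp
  \<comment> \<open>\<open>h7\<close> to \<open>h10\<close> form a linear system for the
    \<open>d\<close>, whose matrix is up to order and signs the skew matrix of the \<open>a\<close>.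
    Its Pfaffian is nonzero by \<open>pa\<close>.\<close>
  have "a1 * a6 - a2 * a5 + a3 * a4 \<noteq> 0" using pa by auto
  moreover have "(a1 * a6 - a2 * a5 + a3 * a4) * d1 = 0" using h7 h8 h9 h10 by algebra
  moreover have "(a1 * a6 - a2 * a5 + a3 * a4) * d2 = 0" using h7 h8 h9 h10 by algebra
  moreover have "(a1 * a6 - a2 * a5 + a3 * a4) * d3 = 0" using h7 h8 h9 h10 by algebra
  moreover have "(a1 * a6 - a2 * a5 + a3 * a4) * d4 = 0" using h7 h8 h9 h10 by algebra
  ultimately have d: "d1 = 0" "d2 = 0" "d3 = 0" "d4 = 0" by simp_all
  have E11: "a1 * b2 * c3 - a1 * b3 * c2 - a2 * b1 * c3 + a2 * b3 * c1 + a3 * b1 * c2 - a3 * b2 * c1 = -1"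
    using B(11)[OF d] b[of 2 2] by (simp add: kd_def)
  have E12: "a1 * b2 * c5 - a1 * b3 * c4 + a1 * b4 * c3 - a1 * b5 * c2 - a2 * b1 * c5 + a2 * b5 * c1 + a3 * b1 * c4 - a3 * b4 * c1 - a4 * b1 * c3 + a4 * b3 * c1 + a5 * b1 * c2 - a5 * b2 * c1 = 0"
    using B(12)[OF d] b[of 2 4] by (simp add: kd_def)
  have E13: "a1 * b2 * c6 - a1 * b6 * c2 - a2 * b1 * c6 - a2 * b3 * c4 + a2 * b4 * c3 + a2 * b6 * c1 + a3 * b2 * c4 - a3 * b4 * c2 - a4 * b2 * c3 + a4 * b3 * c2 + a6 * b1 * c2 - a6 * b2 * c1 = 0"
    using B(13)[OF d] b[of 2 5] by (simp add: kd_def)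
  have E14: "a1 * b3 * c6 - a1 * b6 * c3 - a2 * b3 * c5 + a2 * b5 * c3 - a3 * b1 * c6 + a3 * b2 * c5 - a3 * b5 * c2 + a3 * b6 * c1 - a5 * b2 * c3 + a5 * b3 * c2 + a6 * b1 * c3 - a6 * b3 * c1 = 0"
    using B(14)[OF d] b[of 2 6] by (simp add: kd_def)
  have E22: "a1 * b4 * c5 - a1 * b5 * c4 - a4 * b1 * c5 + a4 * b5 * c1 + a5 * b1 * c4 - a5 * b4 * c1 = -1"
    using B(15)[OF d] b[of 4 4] by (simp add: kd_def)
  have E23: "a1 * b4 * c6 - a1 * b6 * c4 + a2 * b4 * c5 - a2 * b5 * c4 - a4 * b1 * c6 - a4 * b2 * c5 + a4 * b5 * c2 + a4 * b6 * c1 + a5 * b2 * c4 - a5 * b4 * c2 + a6 * b1 * c4 - a6 * b4 * c1 = 0"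
    using B(16)[OF d] b[of 4 5] by (simp add: kd_def)
  have E24: "a1 * b5 * c6 - a1 * b6 * c5 + a3 * b4 * c5 - a3 * b5 * c4 - a4 * b3 * c5 + a4 * b5 * c3 - a5 * b1 * c6 + a5 * b3 * c4 - a5 * b4 * c3 + a5 * b6 * c1 + a6 * b1 * c5 - a6 * b5 * c1 = 0"
    using B(17)[OF d] b[of 4 6] by (simp add: kd_def)
  have E33: "a2 * b4 * c6 - a2 * b6 * c4 - a4 * b2 * c6 + a4 * b6 * c2 + a6 * b2 * c4 - a6 * b4 * c2 = -1"
    using B(18)[OF d] b[of 5 5] by (simp add: kd_def)
  have E34: "a2 * b5 * c6 - a2 * b6 * c5 + a3 * b4 * c6 - a3 * b6 * c4 - a4 * b3 * c6 + a4 * b6 * c3 - a5 * b2 * c6 + a5 * b6 * c2 + a6 * b2 * c5 + a6 * b3 * c4 - a6 * b4 * c3 - a6 * b5 * c2 = 0"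
    using B(19)[OF d] b[of 5 6] by (simp add: kd_def)
  have E44: "a3 * b5 * c6 - a3 * b6 * c5 - a5 * b3 * c6 + a5 * b6 * c3 + a6 * b3 * c5 - a6 * b5 * c3 = -1"
    using B(20)[OF d] b[of 6 6] by (simp add: kd_def)
  have sd: "l = 1" "a4 = a3" "a5 = - a2" "a6 = a1" "b4 = b3" "b5 = - b2" "b6 = b1" "c4 = c3" "c5 = - c2" "c6 = c1"
    using self_dual_triple[OF l pa pb pc ab ac bc E11 E12 E13 E14 E22 E23 E24 E33 E34 E44] by blast+
  \<comment> \<open>For self-dual forms the wedge pairing is the Euclidean one on three
    coefficients, so \<open>pa\<close> to \<open>bc\<close> become orthonormality of the coefficient
    triples.\<close>
  have rows: "a1 * a1 + a2 * a2 + a3 * a3 = 1" "b1 * b1 + b2 * b2 + b3 * b3 = 1" "c1 * c1 + c2 * c2 + c3 * c3 = 1"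
    "a1 * b1 + a2 * b2 + a3 * b3 = 0" "a1 * c1 + a2 * c2 + a3 * c3 = 0" "b1 * c1 + b2 * c2 + b3 * c3 = 0"
    using pa pb pc ab ac bc unfolding sd by (simp_all add: algebra_simps)
  note cols = rows_cols_3[OF rows]
  \<comment> \<open>A rotation of the span of the basis vectors 0, 1, 3 making the three 2-forms
    standard. The coefficients with subscripts 3, 1, 2 belong to the pairs (2,6), (2,4), (2,5),
    whose lines in \<open>fano\<close> contain 0, 1, 3 respectively. The last pair enters with a
    minus sign since \<open>fano 3 2 5 = -1\<close>.\<close>
  define P :: "real^7^7" where "P = (\<chi> r m.
    if m = 0 then a3 * kd r 0 + b3 * kd r 1 + c3 * kd r 3
    else if m = 1 then a1 * kd r 0 + b1 * kd r 1 + c1 * kd r 3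
    else if m = 3 then - (a2 * kd r 0 + b2 * kd r 1 + c2 * kd r 3) else kd r m)"
  have P: "(\<Sum>r\<in>UNIV. P $ r $ 0 * h r) = a3 * h 0 + b3 * h 1 + c3 * h 3"
    "(\<Sum>r\<in>UNIV. P $ r $ 1 * h r) = a1 * h 0 + b1 * h 1 + c1 * h 3"
    "(\<Sum>r\<in>UNIV. P $ r $ 3 * h r) = - (a2 * h 0 + b2 * h 1 + c2 * h 3)"
    "(\<Sum>r\<in>UNIV. P $ r $ 2 * h r) = h 2" "(\<Sum>r\<in>UNIV. P $ r $ 4 * h r) = h 4"
    "(\<Sum>r\<in>UNIV. P $ r $ 5 * h r) = h 5" "(\<Sum>r\<in>UNIV. P $ r $ 6 * h r) = h 6" for h
    unfolding sum_7 by (simp_all add: P_def kd_def)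
  have Pv: "P $ 0 $ 0 = a3" "P $ 1 $ 0 = b3" "P $ 3 $ 0 = c3" "P $ 0 $ 1 = a1" "P $ 1 $ 1 = b1" "P $ 3 $ 1 = c1"
    "P $ 0 $ 3 = - a2" "P $ 1 $ 3 = - b2" "P $ 3 $ 3 = - c2" "P $ 2 $ 0 = 0" "P $ 4 $ 0 = 0" "P $ 5 $ 0 = 0" "P $ 6 $ 0 = 0"
    "P $ 2 $ 1 = 0" "P $ 4 $ 1 = 0" "P $ 5 $ 1 = 0" "P $ 6 $ 1 = 0" "P $ 2 $ 3 = 0" "P $ 4 $ 3 = 0" "P $ 5 $ 3 = 0" "P $ 6 $ 3 = 0"
    by (simp_all add: P_def kd_def)
  have Pw: "P $ r $ 2 = kd r 2" "P $ r $ 4 = kd r 4" "P $ r $ 5 = kd r 5" "P $ r $ 6 = kd r 6" for r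
    by (simp_all add: P_def)
  have "\<forall>i j. (\<Sum>r\<in>UNIV. P $ r $ i * P $ r $ j) = (if i = j then 1 else 0)"
    unfolding forall_7 P by (simp add: Pv Pw kd_def) (use cols in \<open>simp add: algebra_simps\<close>)
  hence "orthogonal_matrix P"
    by (simp add: orthogonal_matrix vec_eq_iff matrix_matrix_mult_def transpose_def mat_def)
  moreover have "comps (\<lambda>m. column m P) f [i, j, k] = fano i j k" for i j k
  proof (rule skew3_eqI[where f = "\<lambda>i j k. comps (\<lambda>m. column m P) f [i, j, k]" and g = fano])
    have s: "f [i, j, k] = - f [j, i, k]" if "j < i" for i j k
      by (rule f_skew1[OF alt])
    have s': "f [i, j, k] = - f [i, k, j]" if "k < j" for i j k
      by (rule f_skew2[OF alt])
    \<comment> \<open>\<open>E11\<close> says that the coefficient matrix has determinant -1. With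
      the sign in the column of index 3 the rotation has determinant 1, so the component at 0, 1, 3
      stays 1.\<close>
    have "\<forall>i j k. i < j \<longrightarrow> j < k \<longrightarrow> comps (\<lambda>m. column m P) f [i, j, k] = fano i j k"
      unfolding forall_less_7 comps_simps column_component P
      by (simp add: s s' f_zero[OF alt] less_7 z e lf sd d fano_def) (use cols E11 in \<open>simp add: algebra_simps\<close>)
    thus "i < j \<Longrightarrow> j < k \<Longrightarrow> comps (\<lambda>m. column m P) f [i, j, k] = fano i j k" for i j k by blast
  qed (rule comps_skew3[of f, OF f_skew1[OF alt] f_skew2[OF alt]] fano_skew)+
  ultimately show ?thesis using that by blast
qed

section \<open>The contraction identity for the Fano form\<close>

lemma skew4_zeroI:
  fixes f :: "'a::linorder \<Rightarrow> 'a \<Rightarrow> 'a \<Rightarrow> 'a \<Rightarrow> real"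
  assumes s1: "\<And>i j k l. f j i k l = - f i j k l" and s2: "\<And>i j k l. f i k j l = - f i j k l"
    and s3: "\<And>i j k l. f i j l k = - f i j k l"
    and eq: "\<And>i j k l. i < j \<Longrightarrow> j < k \<Longrightarrow> k < l \<Longrightarrow> f i j k l = 0"
  shows "f i j k l = 0"
proof (rule skew3_zeroI[where f = "f i"])
  fix j k l :: 'a assume o: "j < k" "k < l"
  have z: "f i i k l = 0" "f j i i l = 0" "f j k i i = 0" for i j k l
    using s1[of i i k l] s2[of j i i l] s3[of j k i i] by linarith+
  consider "i < j" | "i = j" | "j < i \<and> i < k" | "i = k" | "k < i \<and> i < l" | "i = l" | "l < i" by fastforce
  thus "f i j k l = 0"
  proof cases
    case 3 thus ?thesis using eq[of j i k l] s1[of i j k l] o by linarith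
  next
    case 4 thus ?thesis using z(2)[of j i l] s1[of i j k l] by simp
  next
    case 5 thus ?thesis using eq[of j k i l] s1[of i j k l] s2[of j i k l] o by linarith
  next
    case 6 thus ?thesis using z(3)[of j k i] s1[of i j k l] s2[of j i k l] by simp
  next
    case 7 thus ?thesis using eq[of j k l i] s1[of i j k l] s2[of j i k l] s3[of j k i l] o by linarith
  qed (use eq o z in auto)
qed (rule s2 s3)+

lemma forall_less_7_4:
  "(\<forall>i j k l :: 7. i < j \<longrightarrow> j < k \<longrightarrow> k < l \<longrightarrow> P i j k l) \<longleftrightarrow>
     P 0 1 2 3 \<and>
     P 0 1 2 4 \<and>
     P 0 1 2 5 \<and>
     P 0 1 2 6 \<and>
     P 0 1 3 4 \<and>
     P 0 1 3 5 \<and>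
     P 0 1 3 6 \<and>
     P 0 1 4 5 \<and>
     P 0 1 4 6 \<and>
     P 0 1 5 6 \<and>
     P 0 2 3 4 \<and>
     P 0 2 3 5 \<and>
     P 0 2 3 6 \<and>
     P 0 2 4 5 \<and>
     P 0 2 4 6 \<and>
     P 0 2 5 6 \<and>
     P 0 3 4 5 \<and>
     P 0 3 4 6 \<and>
     P 0 3 5 6 \<and>
     P 0 4 5 6 \<and>
     P 1 2 3 4 \<and>
     P 1 2 3 5 \<and>
     P 1 2 3 6 \<and>
     P 1 2 4 5 \<and>
     P 1 2 4 6 \<and>
     P 1 2 5 6 \<and>
     P 1 3 4 5 \<and>
     P 1 3 4 6 \<and>
     P 1 3 5 6 \<and>
     P 1 4 5 6 \<and>
     P 2 3 4 5 \<and>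
     P 2 3 4 6 \<and>
     P 2 3 5 6 \<and>
     P 2 4 5 6 \<and>
     P 3 4 5 6"
  by (simp add: forall_7 less_7 conj_ac)

text \<open>Each of the seven lines occurs in its 6 orderings, all contributing equally; this 6 is
  the factorial in \<open>hodge_star\<close>.\<close>

lemma fano_trace:
  assumes s1: "\<And>i j k. h j i k = - h i j k" and s2: "\<And>i j k. h i k j = - h i j k"
  shows "(\<Sum>i\<in>UNIV. \<Sum>j\<in>UNIV. \<Sum>k\<in>UNIV. fano i j k * h i j k) =
    6 * (h 0 1 3 + h 1 2 4 + h 2 3 5 + h 3 4 6 + h 0 4 5 + h 1 5 6 + h 0 2 6)"
proof -
  have s: "h i j k = - h j i k" if "j < i" for i j k by (rule s1)
  have s': "h i j k = - h i k j" if "k < j" for i j k by (rule s2)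
  show ?thesis unfolding sum_7 by (simp add: fano_def s s' less_7)
qed

lemma fano_contract:
  "(\<Sum>k\<in>UNIV. fano 0 1 k * h k) = h 3"
    "(\<Sum>k\<in>UNIV. fano 0 2 k * h k) = h 6"
    "(\<Sum>k\<in>UNIV. fano 0 3 k * h k) = - h 1"
    "(\<Sum>k\<in>UNIV. fano 0 4 k * h k) = h 5"
    "(\<Sum>k\<in>UNIV. fano 0 5 k * h k) = - h 4"
    "(\<Sum>k\<in>UNIV. fano 0 6 k * h k) = - h 2"
    "(\<Sum>k\<in>UNIV. fano 1 2 k * h k) = h 4"
    "(\<Sum>k\<in>UNIV. fano 1 3 k * h k) = h 0"
    "(\<Sum>k\<in>UNIV. fano 1 4 k * h k) = - h 2"
    "(\<Sum>k\<in>UNIV. fano 1 5 k * h k) = h 6"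
    "(\<Sum>k\<in>UNIV. fano 1 6 k * h k) = - h 5"
    "(\<Sum>k\<in>UNIV. fano 2 3 k * h k) = h 5"
    "(\<Sum>k\<in>UNIV. fano 2 4 k * h k) = h 1"
    "(\<Sum>k\<in>UNIV. fano 2 5 k * h k) = - h 3"
    "(\<Sum>k\<in>UNIV. fano 2 6 k * h k) = h 0"
    "(\<Sum>k\<in>UNIV. fano 3 4 k * h k) = h 6"
    "(\<Sum>k\<in>UNIV. fano 3 5 k * h k) = h 2"
    "(\<Sum>k\<in>UNIV. fano 3 6 k * h k) = - h 4"
    "(\<Sum>k\<in>UNIV. fano 4 5 k * h k) = h 0"
    "(\<Sum>k\<in>UNIV. fano 4 6 k * h k) = h 3"
    "(\<Sum>k\<in>UNIV. fano 5 6 k * h k) = h 1"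
  by (simp_all add: sum_7 fano_def)

lemma fano_same: "fano i i k = 0" "fano i k i = 0" "fano k i i = 0"
  using fano_skew(1)[of i i k] fano_skew(2)[of i i k] fano_skew(2)[of k i i] fano_skew(1)[of i k i] by linarith+

text \<open>The defect of \<open>\<phi>\<phi> = g g - g g\<close> is skew in the middle pair of indices.\<close>

lemma fano_cross: "(\<Sum>k\<in>UNIV. fano i j k * fano a b k) + (\<Sum>k\<in>UNIV. fano i a k * fano j b k) =
  kd i a * kd j b + kd i j * kd a b - 2 * kd i b * kd j a"
proof -
  have 0: "\<forall>j a b. (\<Sum>k\<in>UNIV. fano 0 j k * fano a b k) + (\<Sum>k\<in>UNIV. fano 0 a k * fano j b k) =
     kd 0 a * kd j b + kd 0 j * kd a b - 2 * kd 0 b * kd j a"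
    unfolding forall_7 fano_contract fano_same apply (intro conjI) apply (simp_all add: fano_def kd_def) done
  have s: "(\<Sum>k\<in>UNIV. f k) = (\<Sum>k\<in>UNIV. f (k + i))" for f :: "7 \<Rightarrow> real"
    by (rule sum.reindex_bij_witness[of _ "\<lambda>k. k + i" "\<lambda>k. k - i"]) auto
  have c: "fano j k (m + i) = fano (j - i) (k - i) m" for j k m
    using fano_shift[of "j - i" i "k - i" m] by simp
  have d: "kd (j - i) (k - i) = kd j k" "kd 0 (k - i) = kd i k" for j k by (auto simp: kd_def)
  show ?thesis
    using 0[rule_format, of "j - i" "a - i" "b - i"] unfolding d
    by (subst (1 2) s) (simp add: c)
qed

text \<open>The difference \<open>d\<close> of the two sides is alternating: in the outer pairs
  evidently, in the middle pair by \<open>fano_cross\<close>. Hence the 35 increasing index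
  quadruples suffice, where \<psi> is a sum of seven values of the volume form.\<close>

lemma fano_g2_alg:
  assumes f: "\<And>i j k. f [i, j, k] = fano i j k" and v: "alternating 7 v" "v ix = 1"
  shows "g2_alg f (hodge_star v 3 f)"
proof -
  have s0: "v [a, b, c, d, e, f, g] = - v [b, a, c, d, e, f, g]" if "b < a" for a b c d e f g
    using alternating_swap[OF v(1), of "[a, b, c, d, e, f, g]" 0 1] by simp
  have s1: "v [a, b, c, d, e, f, g] = - v [a, c, b, d, e, f, g]" if "c < b" for a b c d e f g
    using alternating_swap[OF v(1), of "[a, b, c, d, e, f, g]" 1 2] by simp
  have s2: "v [a, b, c, d, e, f, g] = - v [a, b, d, c, e, f, g]" if "d < c" for a b c d e f g
    using alternating_swap[OF v(1), of "[a, b, c, d, e, f, g]" 2 3] by simp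
  have s3: "v [a, b, c, d, e, f, g] = - v [a, b, c, e, d, f, g]" if "e < d" for a b c d e f g
    using alternating_swap[OF v(1), of "[a, b, c, d, e, f, g]" 3 4] by simp
  have s4: "v [a, b, c, d, e, f, g] = - v [a, b, c, d, f, e, g]" if "f < e" for a b c d e f g
    using alternating_swap[OF v(1), of "[a, b, c, d, e, f, g]" 4 5] by simp
  have s5: "v [a, b, c, d, e, f, g] = - v [a, b, c, d, e, g, f]" if "g < f" for a b c d e f g
    using alternating_swap[OF v(1), of "[a, b, c, d, e, f, g]" 5 6] by simp
  have z: "v [a, a, c, d, e, f, g] = 0" "v [a, b, b, d, e, f, g] = 0" "v [a, b, c, c, e, f, g] = 0" "v [a, b, c, d, d, f, g] = 0" "v [a, b, c, d, e, e, g] = 0" "v [a, b, c, d, e, f, f] = 0" for a b c d e f g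
    by (rule alternating_not_distinct[OF v(1)]; simp)+
  note sort = s0 s1 s2 s3 s4 s5 z less_7
  have sv: "v [b, a, c, d, e, f, g] = - v [a, b, c, d, e, f, g]" "v [a, c, b, d, e, f, g] = - v [a, b, c, d, e, f, g]"
    "v [a, b, c, e, d, f, g] = - v [a, b, c, d, e, f, g]" "v [a, b, c, d, f, e, g] = - v [a, b, c, d, e, f, g]"
    "v [a, b, c, d, e, g, f] = - v [a, b, c, d, e, f, g]" for a b c d e f g
    using alternating_swap[OF v(1), of "[a, b, c, d, e, f, g]" 0 1] alternating_swap[OF v(1), of "[a, b, c, d, e, f, g]" 1 2]
      alternating_swap[OF v(1), of "[a, b, c, d, e, f, g]" 3 4] alternating_swap[OF v(1), of "[a, b, c, d, e, f, g]" 4 5]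
      alternating_swap[OF v(1), of "[a, b, c, d, e, f, g]" 5 6] by simp_all
  have h: "hodge_star v 3 f [p, q, r, s] = v [0,1,3,p,q,r,s] + v [1,2,4,p,q,r,s] + v [2,3,5,p,q,r,s] + v [3,4,6,p,q,r,s]
     + v [0,4,5,p,q,r,s] + v [1,5,6,p,q,r,s] + v [0,2,6,p,q,r,s]" for p q r s
  proof -
    have "hodge_star v 3 f [p, q, r, s] = (\<Sum>i\<in>UNIV. \<Sum>j\<in>UNIV. \<Sum>k\<in>UNIV. fano i j k * v [i, j, k, p, q, r, s]) / 6"
      by (simp add: hodge_star_def numeral_3_eq_3 sum_lists_Suc f fact_numeral)
    also have "(\<Sum>i\<in>UNIV. \<Sum>j\<in>UNIV. \<Sum>k\<in>UNIV. fano i j k * v [i, j, k, p, q, r, s]) =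
      6 * (v [0,1,3,p,q,r,s] + v [1,2,4,p,q,r,s] + v [2,3,5,p,q,r,s] + v [3,4,6,p,q,r,s]
     + v [0,4,5,p,q,r,s] + v [1,5,6,p,q,r,s] + v [0,2,6,p,q,r,s])"
      by (rule fano_trace[where h = "\<lambda>i j k. v [i, j, k, p, q, r, s]"]) (rule sv)+
    finally show ?thesis by simp
  qed
  have v1: "v [0, 1, 2, 3, 4, 5, 6] = 1" using v(2) by (simp add: ix_def)
  let ?\<psi> = "hodge_star v 3 f"
  define S where "S i j a b = (\<Sum>k\<in>UNIV. fano i j k * fano a b k)" for i j a b
  define d where "d i j a b = kd i a * kd j b - kd i b * kd j a - S i j a b - ?\<psi> [i, j, a, b]" for i j a b
  have \<psi>: "?\<psi> [j, i, a, b] = - ?\<psi> [i, j, a, b]" "?\<psi> [i, a, j, b] = - ?\<psi> [i, j, a, b]"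
    "?\<psi> [i, j, b, a] = - ?\<psi> [i, j, a, b]" for i j a b
  proof -
    show "?\<psi> [j, i, a, b] = - ?\<psi> [i, j, a, b]" by (simp only: h sv(3)[where d = i and e = j] minus_add_distrib)
    show "?\<psi> [i, a, j, b] = - ?\<psi> [i, j, a, b]" by (simp only: h sv(4)[where e = j and f = a] minus_add_distrib)
    show "?\<psi> [i, j, b, a] = - ?\<psi> [i, j, a, b]" by (simp only: h sv(5)[where f = a and g = b] minus_add_distrib)
  qed
  have d0: "d i j a b = 0" for i j a b
  proof (rule skew4_zeroI[where f = d])
    fix i j a b
    have "S j i a b = - S i j a b" "S i j b a = - S i j a b"
      unfolding S_def fano_skew(1)[of j i] fano_skew(1)[of b a] by (simp_all add: sum_negf)
    thus "d j i a b = - d i j a b" "d i j b a = - d i j a b"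
      by (simp_all add: d_def \<psi>(1)[of j i] \<psi>(3)[of i j b a])
    show "d i a j b = - d i j a b"
      using fano_cross[of i j a b] kd_sym[of a j] unfolding d_def \<psi>(2)[of i a j b] S_def by simp
  next
    have "\<forall>i j a b. i < j \<longrightarrow> j < a \<longrightarrow> a < b \<longrightarrow> d i j a b = 0"
      unfolding forall_less_7_4 d_def h S_def fano_contract
      by (simp add: sort v1 kd_def fano_def)
    thus "i < j \<Longrightarrow> j < a \<Longrightarrow> a < b \<Longrightarrow> d i j a b = 0" for i j a b by blast
  qed
  have "(\<Sum>k\<in>UNIV. f [i, j, k] * f [a, b, k]) = kd i a * kd j b - kd i b * kd j a - ?\<psi> [i, j, a, b]" for i j a b
    using d0[of i j a b] unfolding f d_def S_def by linarith
  moreover have "f [j, i, k] = - f [i, j, k]" "f [i, k, j] = - f [i, j, k]" for i j k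
    unfolding f by (rule fano_skew)+
  ultimately show ?thesis using \<psi> by (intro g2_alg.intro) blast+
qed

subsection \<open>Transport to the Fano model\<close>

text \<open>The metric equation forces the form to be nonzero, so a maximal triple exists; it is
  completed to an orthonormal basis in which the volume is 1.\<close>

lemma g2_normal_form:
  assumes f: "g2_form f v (\<bullet>)" and v: "(v ix)\<^sup>2 = 1"
  obtains P where "orthogonal_matrix P" "\<And>i j k. comps (\<lambda>m. column m P) f [i, j, k] = fano i j k"
proof -
  have alt: "alternating 3 f" and alt7: "alternating 7 v" using f by (auto simp: g2_form_def)
  have v0: "v ix = 1 \<or> v ix = - 1" using v by (simp add: power2_eq_1_iff)
  have "b_form f 0 0 \<noteq> 0" using b_form_eq[OF f, of 0 0] v0 by auto
  have "\<exists>i j k. f [i, j, k] \<noteq> 0"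
  proof (rule ccontr)
    assume "\<not> ?thesis"
    hence z: "f [i, j, k] = 0" for i j k by blast
    show False using \<open>b_form f 0 0 \<noteq> 0\<close> unfolding b_form_expand[OF alt] Let_def z by simp
  qed
  then obtain i j k where nz: "f [i, j, k] \<noteq> 0" by blast
  obtain l x y z where l: "l > 0" and n: "norm x = 1" "norm y = 1" "norm z = 1"
    and o: "x \<bullet> y = 0" "x \<bullet> z = 0" "y \<bullet> z = 0"
    and t: "\<And>w. tri f x y w = l * (z \<bullet> w)" "\<And>w. tri f y z w = l * (x \<bullet> w)" "\<And>w. tri f z x w = l * (y \<bullet> w)"
    by (rule maximal_triple[OF alt nz]) blast
  obtain e0 :: "7 \<Rightarrow> real^7" where e0: "e0 0 = x" "e0 1 = y" "e0 3 = z" "\<And>i j. e0 i \<bullet> e0 j = kd i j"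
    by (rule extend_orthonormal_triple[OF n o]) blast
  define M :: "(7 \<Rightarrow> real^7) \<Rightarrow> real^7^7" where "M e = (\<chi> r m. e m $ r)" for e
  have colM: "column m (M e) = e m" for m e by (simp add: M_def column_def vec_eq_iff)
  have orthM: "orthogonal_matrix (M e)" if "\<And>i j. e i \<bullet> e j = kd i j" for e
    using that by (simp add: orthogonal_matrix vec_eq_iff matrix_matrix_mult_def transpose_def mat_def M_def kd_def inner_vec_def)
  obtain e where e: "e 0 = x" "e 1 = y" "e 3 = z" "\<And>i j. e i \<bullet> e j = kd i j" and ve: "comps (\<lambda>m. column m (M e)) v ix = 1"
  proof (cases "comps (\<lambda>m. column m (M e0)) v ix = 1")
    case True
    thus ?thesis using that[of e0] e0 by blast
  next
    case False
    \<comment> \<open>The orientation is corrected by reversing the vector with index 2, which is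
      not part of the adapted triple.\<close>
    define e1 where "e1 m = (if m = 2 then - e0 m else e0 m)" for m
    have "comps (\<lambda>m. column m (M e0)) v ix = det (M e0) * v ix" by (rule comps_det_matrix[OF alt7])
    moreover have "det (M e0) = 1 \<or> det (M e0) = - 1" by (rule det_orthogonal_matrix[OF orthM[OF e0(4)]])
    ultimately have "det (M e0) * v ix = - 1" using False v0 by auto
    moreover have "det (M e1) = - det (M e0)"
    proof -
      have "transpose (M e1) = (\<chi> i. if i = 2 then (- 1) *s e0 i else e0 i)"
        by (auto simp: vec_eq_iff M_def transpose_def e1_def)
      moreover have "transpose (M e0) = (\<chi> i. if i = 2 then e0 i else e0 i)"
        by (simp add: vec_eq_iff M_def transpose_def)
      ultimately show ?thesis using det_row_mul[of 2 "- 1" e0 e0] det_transpose[of "M e0"] det_transpose[of "M e1"] by simp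
    qed
    ultimately have "comps (\<lambda>m. column m (M e1)) v ix = 1" by (simp add: comps_det_matrix[OF alt7])
    moreover have "e1 i \<bullet> e1 j = kd i j" for i j by (auto simp: e1_def e0(4) kd_def)
    ultimately show ?thesis using that[of e1] e0(1-3) by (simp add: e1_def)
  qed
  define f1 where "f1 = comps (\<lambda>m. column m (M e)) f"
  have f1: "f1 [i, j, k] = tri f (e i) (e j) (e k)" for i j k by (simp add: f1_def comps_tri colM)
  have g1: "g2_form f1 (comps (\<lambda>m. column m (M e)) v) (\<bullet>)"
    unfolding f1_def by (rule g2_form_orth[OF f orthM[OF e(4)]])
  have t': "tri f x z w = - (l * (y \<bullet> w))" "tri f x w z = l * (y \<bullet> w)" "tri f y w z = - (l * (x \<bullet> w))" for w
    using tri_skew(1)[OF alt, of z x w] tri_skew(2)[OF alt, of x z w] tri_skew(2)[OF alt, of y z w] t(2,3)[of w] by linarith+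
  have ip: "x \<bullet> e m = kd 0 m" "y \<bullet> e m = kd 1 m" "z \<bullet> e m = kd 3 m" for m
    using e(4)[of 0 m] e(4)[of 1 m] e(4)[of 3 m] unfolding e(1-3) .
  have l1: "f1 [0, 1, 3] = l" unfolding f1 e(1,2) t ip by (simp add: kd_def)
  have z1: "f1 [0, 1, 2] = 0" "f1 [0, 1, 4] = 0" "f1 [0, 1, 5] = 0" "f1 [0, 1, 6] = 0"
     "f1 [0, 2, 3] = 0" "f1 [0, 3, 4] = 0" "f1 [0, 3, 5] = 0" "f1 [0, 3, 6] = 0"
     "f1 [1, 2, 3] = 0" "f1 [1, 3, 4] = 0" "f1 [1, 3, 5] = 0" "f1 [1, 3, 6] = 0"
    unfolding f1 e(1-3) t t' ip by (simp_all add: kd_def)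
  obtain P where P: "orthogonal_matrix P" "\<And>i j k. comps (\<lambda>m. column m P) f1 [i, j, k] = fano i j k"
    by (rule adapted_fano[OF g1 ve l1 l z1]) blast
  have "comps (\<lambda>m. column m (M e ** P)) f [i, j, k] = fano i j k" for i j k
    using P(2)[of i j k] unfolding f1_def comps_comps .
  thus ?thesis using that orthogonal_matrix_mul[OF orthM[OF e(4)] P(1)] by blast
qed

lemma comps_append: "comps e a (is @ js) = comps e (\<lambda>xs. comps e (\<lambda>ys. a (xs @ ys)) js) is"
  by (induction "is" arbitrary: a) (simp_all add: comps_simps)

lemma comps_sum: "comps e (\<lambda>js. \<Sum>b\<in>B. u b js) is = (\<Sum>b\<in>B. comps e (u b) is)"
  using comps_linear[of e "\<lambda>_. 1" u B "is"] by simp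

lemma comps_mult: "comps e a xs * comps e b ys = comps e (\<lambda>js. comps e (\<lambda>ks. a js * b ks) ys) xs"
  unfolding comps_def sum_product by (simp only: sum_distrib_left mult_ac)

text \<open>One index at a time: a contracted pair is an inner product of two vectors, which an
  orthogonal change of basis preserves.\<close>

lemma comps_contract:
  assumes P: "orthogonal_matrix P"
  shows "(\<Sum>is | length is = n. comps (\<lambda>m. column m P) a is * comps (\<lambda>m. column m P) b is) = (\<Sum>is | length is = n. a is * b is)"
proof (induction n arbitrary: a b)
  case 0
  show ?case by (simp add: comps_simps)
next
  case (Suc n)
  let ?c = "comps (\<lambda>m. column m P)"
  let ?a = "\<lambda>is. \<chi> p. ?c (\<lambda>js. a (p # js)) is" and ?b = "\<lambda>is. \<chi> p. ?c (\<lambda>js. b (p # js)) is"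
  have "(\<Sum>is | length is = Suc n. ?c a is * ?c b is) =
      (\<Sum>is | length is = n. \<Sum>i\<in>UNIV. (transpose P *v ?a is) $ i * (transpose P *v ?b is) $ i)"
    unfolding sum_lists_Suc by (subst sum.swap) (simp add: comps_Cons column_component matrix_vector_mult_def transpose_def)
  also have "\<dots> = (\<Sum>is | length is = n. (transpose P *v ?a is) \<bullet> (transpose P *v ?b is))"
    by (simp only: inner_vec_def inner_real_def)
  also have "\<dots> = (\<Sum>is | length is = n. \<Sum>p\<in>UNIV. ?c (\<lambda>js. a (p # js)) is * ?c (\<lambda>js. b (p # js)) is)"
    using P by (simp only: orthogonal_matrix_inner orthogonal_matrix_transpose) (simp add: inner_vec_def)
  also have "\<dots> = (\<Sum>p\<in>UNIV. \<Sum>is | length is = n. ?c (\<lambda>js. a (p # js)) is * ?c (\<lambda>js. b (p # js)) is)"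
    by (rule sum.swap)
  also have "\<dots> = (\<Sum>is | length is = Suc n. a is * b is)" by (simp add: Suc sum_lists_Suc)
  finally show ?case .
qed

text \<open>The volume form is transformed along with the argument, so this includes
  orientation-reversing changes of basis.\<close>

lemma hodge_star_comps:
  assumes P: "orthogonal_matrix P"
  shows "hodge_star (comps (\<lambda>m. column m P) v) k (comps (\<lambda>m. column m P) a) js =
     comps (\<lambda>m. column m P) (hodge_star v k a) js"
proof -
  let ?c = "comps (\<lambda>m. column m P)"
  have "(\<Sum>is | length is = k. ?c a is * ?c v (is @ js)) =
      (\<Sum>is | length is = k. a is * ?c (\<lambda>ys. v (is @ ys)) js)"
    unfolding comps_append by (rule comps_contract[OF P])
  also have "\<dots> = ?c (\<lambda>ys. \<Sum>is | length is = k. a is * v (is @ ys)) js"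
    by (rule comps_linear[symmetric])
  finally have "(\<Sum>is | length is = k. ?c a is * ?c v (is @ js)) / fact k =
     (1 / fact k) * ?c (\<lambda>ys. \<Sum>is | length is = k. a is * v (is @ ys)) js" by simp
  also have "\<dots> = ?c (\<lambda>ys. \<Sum>c\<in>{1 / fact k}. c * (\<Sum>is | length is = k. a is * v (is @ ys))) js"
    by (subst comps_linear) simp
  finally show ?thesis by (simp add: hodge_star_def[abs_def])
qed

lemma alternating_hodge_star:
  assumes v: "alternating 7 v"
  shows "alternating 4 (hodge_star v 3 f)"
  unfolding alternating_def
proof (intro allI impI)
  fix js :: "7 list" and r s :: nat assume js: "length js = 4 \<and> r < s \<and> s < 4"
  have "v (is @ js[r := js ! s, s := js ! r]) = - v (is @ js)" if l: "length is = 3" for "is"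
  proof -
    have "(is @ js)[3 + r := (is @ js) ! (3 + s), 3 + s := (is @ js) ! (3 + r)] = is @ js[r := js ! s, s := js ! r]"
      using l js by (simp add: nth_append list_update_append)
    thus ?thesis using alternating_swap[OF v, of "is @ js" "3 + r" "3 + s"] js l by simp
  qed
  thus "hodge_star v 3 f (js[r := js ! s, s := js ! r]) = - hodge_star v 3 f js"
    by (simp add: hodge_star_def sum_negf)
qed

lemma alternating_4_skew:
  assumes "alternating 4 a"
  shows "a [j, i, k, l] = - a [i, j, k, l]" "a [i, k, j, l] = - a [i, j, k, l]" "a [i, j, l, k] = - a [i, j, k, l]"
  using alternating_swap[OF assms, of "[i, j, k, l]" 0 1] alternating_swap[OF assms, of "[i, j, k, l]" 1 2]
    alternating_swap[OF assms, of "[i, j, k, l]" 2 3] by simp_all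

text \<open>Both sides of the contraction identity are tensors of rank 4 on which an orthogonal
  change of basis acts compatibly. They agree in the Fano basis, and the inverse change brings the
  equality back.\<close>

lemma g2_form_alg:
  assumes f: "g2_form f v (\<bullet>)" and v: "(v ix)\<^sup>2 = 1"
  shows "g2_alg f (hodge_star v 3 f)"
proof -
  have alt: "alternating 3 f" "alternating 7 v" using f by (auto simp: g2_form_def)
  obtain P where P: "orthogonal_matrix P" "\<And>i j k. comps (\<lambda>m. column m P) f [i, j, k] = fano i j k"
    by (rule g2_normal_form[OF f v]) blast
  let ?Q = "transpose P"
  let ?c = "comps (\<lambda>m. column m P)"
  have g: "g2_form (?c f) (?c v) (\<bullet>)" by (rule g2_form_orth[OF f P(1)])
  hence alt': "alternating 3 (?c f)" "alternating 7 (?c v)" by (auto simp: g2_form_def)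
  \<comment> \<open>The Fano form determines its own orientation: the metric equation with right
    side \<open>-6\<close> forces the volume to be +1 in this basis.\<close>
  have "b_form (?c f) 0 0 = - 6" unfolding b_form_expand[OF alt'(1)] Let_def P(2) by (simp add: fano_def)
  hence "?c v ix = 1" using b_form_eq[OF g, of 0 0] by simp
  then interpret F: g2_alg "?c f" "hodge_star (?c v) 3 (?c f)" by (rule fano_g2_alg[OF P(2) alt'(2)])
  let ?\<psi> = "hodge_star v 3 f"
  define X where "X js = (\<Sum>k\<in>UNIV. f [js ! 0, js ! 1, k] * f [js ! 2, js ! 3, k])" for js
  define Y where "Y js = kd (js ! 0) (js ! 2) * kd (js ! 1) (js ! 3) - kd (js ! 0) (js ! 3) * kd (js ! 1) (js ! 2) - ?\<psi> js" for js
  have QP: "P ** ?Q = mat 1" using P(1) by (simp add: orthogonal_matrix_def)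
  have "X [i, j, a, b] = Y [i, j, a, b]" for i j a b
  proof -
    have 1: "?c X [i, j, a, b] = (\<Sum>k\<in>UNIV. ?c f [i, j, k] * ?c f [a, b, k])" for i j a b
    proof -
      let ?A = "\<chi> k. ?c (\<lambda>js. f (js @ [k])) [i, j]" and ?B = "\<chi> k. ?c (\<lambda>js. f (js @ [k])) [a, b]"
      have "?c f [i, j, k] = (?Q *v ?A) $ k" "?c f [a, b, k] = (?Q *v ?B) $ k" for k
        using comps_linear[of "\<lambda>m. column m P" "\<lambda>p. P $ p $ k" "\<lambda>p js. f (js @ [p])" UNIV "[i, j]"]
          comps_linear[of "\<lambda>m. column m P" "\<lambda>p. P $ p $ k" "\<lambda>p js. f (js @ [p])" UNIV "[a, b]"]
          comps_append[of "\<lambda>m. column m P" f "[i, j]" "[k]"] comps_append[of "\<lambda>m. column m P" f "[a, b]" "[k]"]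
        by (simp_all add: comps_Cons[of _ _ k] comps_Nil column_component matrix_vector_mult_def transpose_def)
      hence "(\<Sum>k\<in>UNIV. ?c f [i, j, k] * ?c f [a, b, k]) = (?Q *v ?A) \<bullet> (?Q *v ?B)"
        by (simp add: inner_vec_def)
      also have "\<dots> = ?A \<bullet> ?B" by (rule orthogonal_matrix_inner) (use P(1) in simp)
      also have "\<dots> = (\<Sum>k\<in>UNIV. ?c (\<lambda>xs. ?c (\<lambda>ys. f (xs @ [k]) * f (ys @ [k])) [a, b]) [i, j])"
        by (simp add: inner_vec_def comps_mult)
      also have "\<dots> = ?c (\<lambda>xs. ?c (\<lambda>ys. \<Sum>k\<in>UNIV. f (xs @ [k]) * f (ys @ [k])) [a, b]) [i, j]"
        by (simp only: comps_sum)
      also have "\<dots> = ?c X [i, j, a, b]"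
        by (simp add: comps_simps X_def)
      finally show ?thesis ..
    qed
    have 2: "?c Y [i, j, a, b] = kd i a * kd j b - kd i b * kd j a - hodge_star (?c v) 3 (?c f) [i, j, a, b]" for i j a b
    proof -
      have "?c Y [i, j, a, b] = (\<Sum>p\<in>UNIV. \<Sum>q\<in>UNIV. \<Sum>r\<in>UNIV. \<Sum>s\<in>UNIV. P $ p $ i * P $ q $ j * P $ r $ a * P $ s $ b * (kd p r * kd q s))
        - (\<Sum>p\<in>UNIV. \<Sum>q\<in>UNIV. \<Sum>r\<in>UNIV. \<Sum>s\<in>UNIV. P $ p $ i * P $ q $ j * P $ r $ a * P $ s $ b * (kd p s * kd q r))
        - ?c ?\<psi> [i, j, a, b]"
        by (simp add: comps_simps column_component Y_def sum_distrib_left sum_subtractf right_diff_distrib mult.assoc)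
      also have "(\<Sum>p\<in>UNIV. \<Sum>q\<in>UNIV. \<Sum>r\<in>UNIV. \<Sum>s\<in>UNIV. P $ p $ i * P $ q $ j * P $ r $ a * P $ s $ b * (kd p r * kd q s)) = kd i a * kd j b"
      proof -
        have "(\<Sum>p\<in>UNIV. \<Sum>q\<in>UNIV. \<Sum>r\<in>UNIV. \<Sum>s\<in>UNIV. P $ p $ i * P $ q $ j * P $ r $ a * P $ s $ b * (kd p r * kd q s)) =
          (\<Sum>p\<in>UNIV. \<Sum>q\<in>UNIV. P $ p $ i * P $ p $ a * (P $ q $ j * P $ q $ b))"
        proof (rule sum.cong[OF refl], rule sum.cong[OF refl])
          fix p q
          have "(\<Sum>r\<in>UNIV. \<Sum>s\<in>UNIV. P $ p $ i * P $ q $ j * P $ r $ a * P $ s $ b * (kd p r * kd q s)) =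
            P $ p $ i * P $ q $ j * (\<Sum>r\<in>UNIV. kd p r * (P $ r $ a * (\<Sum>s\<in>UNIV. kd q s * P $ s $ b)))"
            by (simp only: sum_distrib_left mult_ac)
          thus "(\<Sum>r\<in>UNIV. \<Sum>s\<in>UNIV. P $ p $ i * P $ q $ j * P $ r $ a * P $ s $ b * (kd p r * kd q s)) =
            P $ p $ i * P $ p $ a * (P $ q $ j * P $ q $ b)" by (simp add: sum_kd mult_ac)
        qed
        also have "\<dots> = kd i a * kd j b"
          by (simp only: sum_distrib_left[symmetric] sum_distrib_right[symmetric] orthogonal_matrix_sums(1)[OF P(1)])
        finally show ?thesis .
      qed
      also have "(\<Sum>p\<in>UNIV. \<Sum>q\<in>UNIV. \<Sum>r\<in>UNIV. \<Sum>s\<in>UNIV. P $ p $ i * P $ q $ j * P $ r $ a * P $ s $ b * (kd p s * kd q r)) = kd i b * kd j a"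
      proof -
        have "(\<Sum>p\<in>UNIV. \<Sum>q\<in>UNIV. \<Sum>r\<in>UNIV. \<Sum>s\<in>UNIV. P $ p $ i * P $ q $ j * P $ r $ a * P $ s $ b * (kd p s * kd q r)) =
          (\<Sum>p\<in>UNIV. \<Sum>q\<in>UNIV. P $ p $ i * P $ p $ b * (P $ q $ j * P $ q $ a))"
        proof (rule sum.cong[OF refl], rule sum.cong[OF refl])
          fix p q
          have "(\<Sum>r\<in>UNIV. \<Sum>s\<in>UNIV. P $ p $ i * P $ q $ j * P $ r $ a * P $ s $ b * (kd p s * kd q r)) =
            P $ p $ i * P $ q $ j * (\<Sum>r\<in>UNIV. kd q r * (P $ r $ a * (\<Sum>s\<in>UNIV. kd p s * P $ s $ b)))"
            by (simp only: sum_distrib_left mult_ac)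
          thus "(\<Sum>r\<in>UNIV. \<Sum>s\<in>UNIV. P $ p $ i * P $ q $ j * P $ r $ a * P $ s $ b * (kd p s * kd q r)) =
            P $ p $ i * P $ p $ b * (P $ q $ j * P $ q $ a)" by (simp add: sum_kd mult_ac)
        qed
        also have "\<dots> = kd i b * kd j a"
          by (simp only: sum_distrib_left[symmetric] sum_distrib_right[symmetric] orthogonal_matrix_sums(1)[OF P(1)])
        finally show ?thesis .
      qed
      finally show ?thesis by (simp add: hodge_star_comps[OF P(1)])
    qed
    have "?c X xs = ?c Y xs" if "length xs = 4" for xs
    proof -
      obtain p q r s where "xs = [p, q, r, s]" using \<open>length xs = 4\<close> by (auto simp: eval_nat_numeral length_Suc_conv)
      thus ?thesis using 1 2 F.phi_phi by simp
    qed
    hence "comps (\<lambda>m. column m ?Q) (?c X) [i, j, a, b] = comps (\<lambda>m. column m ?Q) (?c Y) [i, j, a, b]"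
      by (rule comps_cong) simp
    thus ?thesis by (simp only: comps_comps QP comps_mat1)
  qed
  hence "(\<Sum>k\<in>UNIV. f [i, j, k] * f [a, b, k]) = kd i a * kd j b - kd i b * kd j a - ?\<psi> [i, j, a, b]" for i j a b
    by (simp add: X_def Y_def)
  thus ?thesis
    using f_skew1[OF alt(1)] f_skew2[OF alt(1)] alternating_4_skew[OF alternating_hodge_star[OF alt(2)]]
    by (intro g2_alg.intro)
qed

section \<open>Transporting irreducibility from the Fano model\<close>

lemma act1_hom: "act1 (A ** B) x = act1 B (act1 A x)" "act1 (mat 1) x = x"
  by (simp_all only: act1_def matrix_vector_mul_assoc matrix_transpose_mul transpose_mat matrix_vector_mul_lid)

lemma act2_hom: "act2 (A ** B) x = act2 B (act2 A x)" "act2 (mat 1) x = x"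
  by (simp_all add: act2_def matrix_mul_assoc matrix_transpose_mul transpose_mat)

lemma G2_group_conjugate:
  assumes P: "orthogonal_matrix P" and f': "\<And>i j k. f' [i, j, k] = comps (\<lambda>m. column m P) f [i, j, k]"
    and A: "A \<in> G2_group f"
  shows "transpose P ** A ** P \<in> G2_group f'"
proof -
  have PP: "P ** transpose P = mat 1" "transpose P ** P = mat 1" using P by (auto simp: orthogonal_matrix_def)
  have "invertible P" "invertible (transpose P)" using PP by (auto simp: invertible_def)
  hence "invertible (transpose P ** A ** P)" using A by (auto simp: G2_group_def intro!: invertible_mult)
  moreover have "comps (\<lambda>m. column m (transpose P ** A ** P)) f' [i, j, k] = f' [i, j, k]" for i j k
  proof -
    have "comps (\<lambda>m. column m (transpose P ** A ** P)) f' [i, j, k] =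
        comps (\<lambda>m. column m (transpose P ** A ** P)) (comps (\<lambda>m. column m P) f) [i, j, k]"
      by (rule comps_cong3) (rule f')
    also have "\<dots> = comps (\<lambda>m. column m P) (comps (\<lambda>m. column m A) f) [i, j, k]"
      unfolding comps_comps by (simp add: matrix_mul_assoc PP)
    also have "\<dots> = f' [i, j, k]"
      unfolding f' by (rule comps_cong3) (use A in \<open>simp add: G2_group_def\<close>)
    finally show ?thesis .
  qed
  ultimately show ?thesis by (simp add: G2_group_def)
qed

text \<open>The stabilisers of the two forms are conjugate by \<open>P\<close>, so invariant
  subspaces correspond under the action of \<open>P\<close> and of its transpose.\<close>

lemma G2_irreducible_conjugate:
  fixes act :: "real^7^7 \<Rightarrow> 'v::euclidean_space \<Rightarrow> 'v"
  assumes lin: "\<And>A. linear (act A)" and hom: "\<And>A B x. act (A ** B) x = act B (act A x)"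
    and one: "\<And>x. act (mat 1) x = x"
    and P: "orthogonal_matrix P" and f': "\<And>i j k. f' [i, j, k] = comps (\<lambda>m. column m P) f [i, j, k]"
    and irr: "G2_irreducible f' act V"
  shows "G2_irreducible f act (act (transpose P) ` V)"
proof -
  let ?Q = "transpose P"
  have PP: "P ** ?Q = mat 1" "?Q ** P = mat 1" using P by (auto simp: orthogonal_matrix_def)
  have inv: "act P (act ?Q x) = x" "act ?Q (act P x) = x" for x
    by (simp_all add: hom[symmetric] one PP)
  have f: "f [i, j, k] = comps (\<lambda>m. column m ?Q) f' [i, j, k]" for i j k
  proof -
    have "comps (\<lambda>m. column m ?Q) f' [i, j, k] = comps (\<lambda>m. column m ?Q) (comps (\<lambda>m. column m P) f) [i, j, k]"
      by (rule comps_cong3) (rule f')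
    thus ?thesis by (simp only: comps_comps PP comps_mat1)
  qed
  have V: "subspace V" "V \<noteq> {0}" "\<And>A x. A \<in> G2_group f' \<Longrightarrow> x \<in> V \<Longrightarrow> act A x \<in> V"
    "\<And>S. subspace S \<Longrightarrow> S \<subseteq> V \<Longrightarrow> (\<And>A x. A \<in> G2_group f' \<Longrightarrow> x \<in> S \<Longrightarrow> act A x \<in> S) \<Longrightarrow> S = {0} \<or> S = V"
    using irr unfolding G2_irreducible_def by (blast, blast, blast, simp add: image_subset_iff)
  show ?thesis
    unfolding G2_irreducible_def
  proof (intro conjI ballI allI impI)
    show "subspace (act ?Q ` V)" by (rule linear_subspace_image[OF lin V(1)])
    show "act ?Q ` V \<noteq> {0}"
    proof
      assume h: "act ?Q ` V = {0}"
      have "x = 0" if "x \<in> V" for x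
      proof -
        have "act ?Q x = 0" using h that by blast
        thus ?thesis using inv(1)[of x] linear_0[OF lin] by metis
      qed
      thus False using V(1,2) subspace_0 by blast
    qed
    fix A assume A: "A \<in> G2_group f"
    show "act A ` act ?Q ` V \<subseteq> act ?Q ` V"
    proof clarify
      fix x assume x: "x \<in> V"
      have "act A (act ?Q x) = act ?Q (act (?Q ** A ** P) x)" by (simp add: hom inv)
      thus "act A (act ?Q x) \<in> act ?Q ` V" using V(3)[OF G2_group_conjugate[OF P f' A] x] by simp
    qed
  next
    fix S assume S: "subspace S \<and> S \<subseteq> act ?Q ` V \<and> (\<forall>A\<in>G2_group f. act A ` S \<subseteq> S)"
    have SP: "act ?Q ` act P ` S = S" by (simp add: image_image inv)
    have "act P ` S = {0} \<or> act P ` S = V"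
    proof (rule V(4))
      show "subspace (act P ` S)" using S by (intro linear_subspace_image[OF lin]) blast
      show "act P ` S \<subseteq> V"
      proof -
        have "act P ` S \<subseteq> act P ` act ?Q ` V" using S by blast
        thus ?thesis by (simp add: image_image inv)
      qed
      fix A x assume A: "A \<in> G2_group f'" and x: "x \<in> act P ` S"
      then obtain y where y: "y \<in> S" "x = act P y" by blast
      have "orthogonal_matrix ?Q" using P by simp
      hence "P ** A ** ?Q \<in> G2_group f" using G2_group_conjugate[OF _ f A] by simp
      hence "act (P ** A ** ?Q) y \<in> S" using S y by blast
      moreover have "act A x = act P (act (P ** A ** ?Q) y)" by (simp add: hom inv y)
      ultimately show "act A x \<in> act P ` S" by blast
    qed
    thus "S = {0} \<or> S = act ?Q ` V"
    proof
      assume "act P ` S = {0}"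
      hence "act ?Q ` act P ` S = {act ?Q 0}" by simp
      thus ?thesis unfolding SP using linear_0[OF lin] by simp
    next
      assume "act P ` S = V"
      thus ?thesis using SP by simp
    qed
  qed
qed

lemma inner_act2: "orthogonal_matrix P \<Longrightarrow> act2 P A \<bullet> act2 P B = A \<bullet> B"
proof -
  assume P: "orthogonal_matrix P"
  have "A \<bullet> B = trace (transpose A ** B)" for A B :: "real^7^7"
    by (subst inner_matrix, subst sum.swap) (simp add: trace_def matrix_matrix_mult_def transpose_def)
  note tr = this
  have "transpose (act2 P A) ** act2 P B = transpose P ** transpose A ** (P ** transpose P) ** B ** P"
    by (simp only: transpose_act2) (simp add: act2_def matrix_mul_assoc)
  also have "\<dots> = act2 P (transpose A ** B)"
    using P by (simp add: orthogonal_matrix_def act2_def matrix_mul_assoc)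
  finally show ?thesis unfolding tr by (simp add: trace_act2[OF P])
qed

lemma VV_comps:
  assumes P: "orthogonal_matrix P"
  shows "VV (comps (\<lambda>m. column m P) f) (act2 P B) = act1 P (VV f B)"
proof -
  have "VV (comps (\<lambda>m. column m P) f) (act2 P B) $ k = act1 P (VV f B) $ k" for k
  proof -
    define M where "M = (\<chi> a b. \<Sum>c\<in>UNIV. P $ c $ k * f [a, b, c])"
    have "comps (\<lambda>m. column m P) f [i, j, k] = act2 P M $ i $ j" for i j
      by (simp add: comps_simps column_component act2_component M_def sum_distrib_left mult.assoc)
    hence "VV (comps (\<lambda>m. column m P) f) (act2 P B) $ k = act2 P B \<bullet> act2 P M"
      by (simp add: VV_def inner_matrix)
    also have "\<dots> = (\<Sum>a\<in>UNIV. \<Sum>b\<in>UNIV. \<Sum>c\<in>UNIV. P $ c $ k * (B $ a $ b * f [a, b, c]))"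
      unfolding inner_act2[OF P] by (simp add: inner_matrix M_def sum_distrib_left mult_ac)
    also have "\<dots> = (\<Sum>c\<in>UNIV. \<Sum>a\<in>UNIV. \<Sum>b\<in>UNIV. P $ c $ k * (B $ a $ b * f [a, b, c]))"
      by (rule sum_rot3[symmetric])
    also have "\<dots> = act1 P (VV f B) $ k"
      by (simp add: act1_def VV_def matrix_vector_mult_def transpose_def sum_distrib_left)
    finally show ?thesis .
  qed
  thus ?thesis by (simp add: vec_eq_iff)
qed

lemma VV_cong: "(\<And>i j k. f [i, j, k] = f' [i, j, k]) \<Longrightarrow> VV f B = VV f' B"
  by (simp add: VV_def vec_eq_iff)

theorem g2_form_relations:
  assumes f: "g2_form f v (\<bullet>)" and v: "(v ix)\<^sup>2 = 1"
  shows "independent_relations f (hodge_star v 3 f)"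
proof -
  interpret g2_alg f "hodge_star v 3 f" by (rule g2_form_alg[OF f v])
  obtain P where P: "orthogonal_matrix P" "\<And>i j k. comps (\<lambda>m. column m P) f [i, j, k] = fano i j k"
    by (rule g2_normal_form[OF f v]) blast
  let ?Q = "transpose P"
  have PP: "P ** ?Q = mat 1" "?Q ** P = mat 1" using P by (auto simp: orthogonal_matrix_def)
  have oQ: "orthogonal_matrix ?Q" using P by simp
  define f' where "f' = comps (\<lambda>m. column m P) f"
  define v' where "v' = comps (\<lambda>m. column m P) v"
  have g': "g2_form f' v' (\<bullet>)" unfolding f'_def v'_def by (rule g2_form_orth[OF f P(1)])
  have v': "(v' ix)\<^sup>2 = 1"
  proof -
    have "v' ix = det P * v ix" unfolding v'_def using f by (intro comps_det_matrix) (simp add: g2_form_def)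
    thus ?thesis using v det_orthogonal_matrix[OF P(1)] by (auto simp: power_mult_distrib)
  qed
  interpret F: fano_tensor f' by unfold_locales (simp add: f'_def P)
  interpret A: g2_alg f' "hodge_star v' 3 f'" by (rule g2_form_alg[OF g' v'])
  have orth: "orthogonal_matrix A" if "A \<in> G2_group f" for A
    by (rule g2_group_orthogonal[OF f _ that]) (use v in auto)
  have orth': "orthogonal_matrix A" if "A \<in> G2_group f'" for A
    by (rule g2_group_orthogonal[OF g' _ that]) (use v' in auto)
  have ff: "f' [i, j, k] = comps (\<lambda>m. column m P) f [i, j, k]" for i j k by (simp add: f'_def)
  note conj1 = G2_irreducible_conjugate[where act = act1, OF F.linear_act1 act1_hom P(1) ff]
  note conj2 = G2_irreducible_conjugate[where act = act2, OF linear_act2 act2_hom P(1) ff]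
  have inv1: "act1 ?Q (act1 P x) = x" for x by (simp add: act1_hom(1)[symmetric] act1_hom(2) PP)
  have inv2: "act2 ?Q (act2 P x) = x" "act2 P (act2 ?Q x) = x" for x
    by (simp_all add: act2_hom(1)[symmetric] act2_hom(2) PP)
  have "act1 ?Q ` UNIV = UNIV" using inv1 by (metis surjI)
  hence 7: "G2_irreducible f act1 UNIV" using conj1[OF F.irreducible7] by simp
  have s0: "act2 A x \<in> Sym0" if "x \<in> Sym0" "orthogonal_matrix A" for A x
    using that by (simp add: Sym0_def transpose_act2 trace_act2)
  have "act2 ?Q ` Sym0 = Sym0"
    using s0 oQ P(1) inv2 by (metis (no_types, lifting) image_eqI image_subset_iff subsetI subset_antisym)
  hence 27: "G2_irreducible f act2 Sym0" using conj2[OF F.irreducible27[OF orth']] by simp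
  \<comment> \<open>In the model, too, \<open>Lie14\<close> is the \<open>Omega14\<close> of an
    actual Hodge dual; this gives its subspace property.\<close>
  have L: "F.Lie14 = Omega14 (hodge_star v' 3 f')"
    unfolding F.Lie14_def by (auto simp: A.Omega14_iff)
  have "act2 A x \<in> F.Lie14" if "A \<in> G2_group f'" "x \<in> F.Lie14" for A x
  proof -
    have "VV f' (act2 A x) = VV (comps (\<lambda>m. column m A) f') (act2 A x)"
      using that(1) by (intro VV_cong) (simp add: G2_group_def)
    also have "\<dots> = 0" using that(2) by (simp add: VV_comps[OF orth'[OF that(1)]] F.Lie14_def linear_0[OF F.linear_act1])
    finally show ?thesis using that(2) by (simp add: F.Lie14_def transpose_act2 linear_neg[OF linear_act2])
  qed
  hence irr14: "G2_irreducible f' act2 F.Lie14"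
    by (intro F.irreducible14) (auto simp: L A.subspace_Omega14)
  have 1: "act2 P x \<in> F.Lie14" if "x \<in> Omega14 (hodge_star v 3 f)" for x
    using that unfolding F.Lie14_def Omega14_iff
    by (simp add: f'_def VV_comps[OF P(1)] transpose_act2 linear_neg[OF linear_act2] linear_0[OF F.linear_act1])
  have 2: "act2 ?Q x \<in> Omega14 (hodge_star v 3 f)" if "x \<in> F.Lie14" for x
  proof -
    have "VV f (act2 ?Q x) = VV (comps (\<lambda>m. column m ?Q) f') (act2 ?Q x)"
      unfolding f'_def by (intro VV_cong) (simp only: comps_comps PP comps_mat1)
    also have "\<dots> = 0" unfolding VV_comps[OF oQ] using that by (simp add: F.Lie14_def linear_0[OF F.linear_act1])
    finally show ?thesis using that by (simp add: F.Lie14_def Omega14_iff transpose_act2 linear_neg[OF linear_act2])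
  qed
  have "act2 ?Q ` F.Lie14 = Omega14 (hodge_star v 3 f)"
    using 1 2 inv2(1) by (metis (no_types, lifting) image_eqI image_subset_iff subsetI subset_antisym)
  hence 14: "G2_irreducible f act2 (Omega14 (hodge_star v 3 f))" using conj2[OF irr14] by simp
  show ?thesis by (rule independent_relationsI[OF orth 7 14 27])
qed

subsection \<open>Smooth functions\<close>

lemma pderiv_cong:
  assumes "open W" "u \<in> W" "\<And>v. v \<in> W \<Longrightarrow> f v = g v"
  shows "frechet_derivative f (at u) = frechet_derivative g (at u)"
proof -
  have "(f has_derivative D) (at u) \<longleftrightarrow> (g has_derivative D) (at u)" for D
    using assms has_derivative_transform_within_open[of f D u UNIV W g] has_derivative_transform_within_open[of g D u UNIV W f]
    by (metis)
  thus ?thesis by (simp add: frechet_derivative_def)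
qed

text \<open>Derivatives agree with the closed formulas for them only on the open set, so smoothness
  has to be transferred along equality there.\<close>

lemma C_diff_cong:
  assumes W: "open W"
  shows "(\<And>v. v \<in> W \<Longrightarrow> f v = g v) \<Longrightarrow> C_diff n W f \<Longrightarrow> C_diff n W g"
proof (induction n arbitrary: f g)
  case 0
  thus ?case by (simp cong: continuous_on_cong)
next
  case (Suc n)
  have "pderiv_at i f v = pderiv_at i g v" if "v \<in> W" for i v
    unfolding pderiv_at_def by (subst pderiv_cong[OF W that Suc.prems(1)]) auto
  hence "C_diff n W (pderiv_at i g)" for i
    using Suc.IH[of "pderiv_at i f" "pderiv_at i g"] Suc.prems(2) by auto
  moreover have "g differentiable_on W"
    using Suc.prems by (metis C_diff.simps(2) differentiable_on_def differentiable_transform_within zero_less_one)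
  ultimately show ?case by simp
qed

lemma C_diff_Suc: "C_diff (Suc n) W f \<Longrightarrow> C_diff n W f"
proof (induction n arbitrary: f)
  case 0
  thus ?case by (simp add: differentiable_imp_continuous_on)
qed simp

lemma C_diff_subset: "C_diff n V f \<Longrightarrow> W \<subseteq> V \<Longrightarrow> C_diff n W f"
  by (induction n arbitrary: f) (auto intro: continuous_on_subset differentiable_on_subset)

lemma frechet_derivative_eq: "(f has_derivative D) (at u) \<Longrightarrow> frechet_derivative f (at u) = D"
  using frechet_derivative_at by metis

lemma C_diff_add:
  assumes W: "open W"
  shows "C_diff n W f \<Longrightarrow> C_diff n W g \<Longrightarrow> C_diff n W (\<lambda>v. f v + g v)"
proof (induction n arbitrary: f g)
  case 0
  thus ?case by (simp add: continuous_on_add)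
next
  case (Suc n)
  have "C_diff n W (pderiv_at i (\<lambda>v. f v + g v))" for i
  proof (rule C_diff_cong[OF W])
    show "C_diff n W (\<lambda>v. pderiv_at i f v + pderiv_at i g v)" using Suc by simp
    fix v assume "v \<in> W"
    hence "f differentiable at v" "g differentiable at v"
      using Suc.prems W by (auto simp: differentiable_on_eq_differentiable_at)
    thus "pderiv_at i f v + pderiv_at i g v = pderiv_at i (\<lambda>v. f v + g v) v"
      unfolding pderiv_at_def frechet_derivative_works
      by (subst frechet_derivative_eq[OF has_derivative_add]) auto
  qed
  moreover have "(\<lambda>v. f v + g v) differentiable_on W"
    using Suc.prems by (auto simp: differentiable_on_def intro!: differentiable_add)
  ultimately show ?case by simp
qed

lemma C_diff_mult:
  assumes W: "open W"
  shows "C_diff n W f \<Longrightarrow> C_diff n W g \<Longrightarrow> C_diff n W (\<lambda>v. f v * g v)"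
proof (induction n arbitrary: f g)
  case 0
  thus ?case by (simp add: continuous_on_mult)
next
  case (Suc n)
  have "C_diff n W (pderiv_at i (\<lambda>v. f v * g v))" for i
  proof (rule C_diff_cong[OF W])
    show "C_diff n W (\<lambda>v. f v * pderiv_at i g v + pderiv_at i f v * g v)"
      by (intro C_diff_add W Suc.IH) (use Suc.prems C_diff_Suc in auto)
    fix v assume "v \<in> W"
    hence "f differentiable at v" "g differentiable at v"
      using Suc.prems W by (auto simp: differentiable_on_eq_differentiable_at)
    thus "f v * pderiv_at i g v + pderiv_at i f v * g v = pderiv_at i (\<lambda>v. f v * g v) v"
      unfolding pderiv_at_def frechet_derivative_works
      by (subst frechet_derivative_eq[OF has_derivative_mult]) auto
  qed
  moreover have "(\<lambda>v. f v * g v) differentiable_on W"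
    using Suc.prems by (auto simp: differentiable_on_def intro!: differentiable_mult)
  ultimately show ?case by simp
qed

lemma C_diff_const: "C_diff n W (\<lambda>v. c)"
proof (induction n arbitrary: c)
  case (Suc n)
  have "pderiv_at i (\<lambda>v. c) = (\<lambda>v. 0)" for i by (simp add: pderiv_at_def fun_eq_iff)
  thus ?case using Suc by simp
qed simp

lemma smooth_fun_cong: "open W \<Longrightarrow> (\<And>v. v \<in> W \<Longrightarrow> f v = g v) \<Longrightarrow> smooth_fun W f \<Longrightarrow> smooth_fun W g"
  unfolding smooth_fun_def using C_diff_cong by blast

lemma smooth_fun_subset: "smooth_fun V f \<Longrightarrow> W \<subseteq> V \<Longrightarrow> smooth_fun W f"
  unfolding smooth_fun_def using C_diff_subset by blast

lemma smooth_fun_const: "smooth_fun W (\<lambda>v. c)"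
  by (simp add: smooth_fun_def C_diff_const)

lemma smooth_fun_add: "open W \<Longrightarrow> smooth_fun W f \<Longrightarrow> smooth_fun W g \<Longrightarrow> smooth_fun W (\<lambda>v. f v + g v)"
  by (simp add: smooth_fun_def C_diff_add)

lemma smooth_fun_mult: "open W \<Longrightarrow> smooth_fun W f \<Longrightarrow> smooth_fun W g \<Longrightarrow> smooth_fun W (\<lambda>v. f v * g v)"
  by (simp add: smooth_fun_def C_diff_mult)

lemma smooth_fun_diff: "open W \<Longrightarrow> smooth_fun W f \<Longrightarrow> smooth_fun W g \<Longrightarrow> smooth_fun W (\<lambda>v. f v - g v)"
  using smooth_fun_add[of W f "\<lambda>v. (- 1) * g v"] smooth_fun_mult[of W "\<lambda>v. - 1" g] smooth_fun_const[of W "- 1"] by simp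

lemma smooth_fun_sum: "open W \<Longrightarrow> (\<And>i. i \<in> I \<Longrightarrow> smooth_fun W (f i)) \<Longrightarrow> smooth_fun W (\<lambda>v. \<Sum>i\<in>I. f i v)"
  by (induction I rule: infinite_finite_induct) (auto intro: smooth_fun_add smooth_fun_const)

lemma smooth_fun_prod: "open W \<Longrightarrow> (\<And>i. i \<in> I \<Longrightarrow> smooth_fun W (f i)) \<Longrightarrow> smooth_fun W (\<lambda>v. \<Prod>i\<in>I. f i v)"
  by (induction I rule: infinite_finite_induct) (auto intro: smooth_fun_mult smooth_fun_const)

lemma smooth_fun_pderiv: "smooth_fun W f \<Longrightarrow> smooth_fun W (pderiv_at i f)"
  unfolding smooth_fun_def using C_diff.simps(2) by blast

lemma smooth_fun_differentiable: "open W \<Longrightarrow> smooth_fun W f \<Longrightarrow> u \<in> W \<Longrightarrow> f differentiable at u"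
  unfolding smooth_fun_def using C_diff.simps(2)[of 0 W f] differentiable_on_eq_differentiable_at by blast

lemma smooth_fun_continuous_on: "smooth_fun W f \<Longrightarrow> continuous_on W f"
  unfolding smooth_fun_def using C_diff.simps(1)[of W f] by blast

lemma frechet_derivative_pderiv:
  assumes "f differentiable at u"
  shows "frechet_derivative f (at u) x = (\<Sum>i\<in>UNIV. x $ i * pderiv_at i f u)"
proof -
  have "linear (frechet_derivative f (at u))" by (rule linear_frechet_derivative[OF assms])
  thus ?thesis
    by (subst basis_expansion[of x, symmetric])
       (simp add: linear_sum scalar_mult_eq_scaleR linear_scale pderiv_at_def)
qed

text \<open>The mean value theorem in the direction of \<open>i\<close>, applied to the increment in
  the direction of \<open>j\<close>, and then once more in the direction of
  \<open>j\<close>.\<close>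

lemma double_difference:
  fixes f :: "real^7 \<Rightarrow> real"
  assumes h: "h > 0" and f: "\<And>s t. 0 \<le> s \<Longrightarrow> s \<le> h \<Longrightarrow> 0 \<le> t \<Longrightarrow> t \<le> h \<Longrightarrow>
      f differentiable at (u + s *\<^sub>R axis i 1 + t *\<^sub>R axis j 1) \<and>
      pderiv_at i f differentiable at (u + s *\<^sub>R axis i 1 + t *\<^sub>R axis j 1)"
  obtains s t where "0 < s" "s < h" "0 < t" "t < h"
    "f (u + h *\<^sub>R axis i 1 + h *\<^sub>R axis j 1) - f (u + h *\<^sub>R axis i 1) - f (u + h *\<^sub>R axis j 1) + f u =
       h * h * pderiv_at j (pderiv_at i f) (u + s *\<^sub>R axis i 1 + t *\<^sub>R axis j 1)"
proof -
  let ?p = "\<lambda>s t. u + s *\<^sub>R axis i 1 + t *\<^sub>R axis j (1::real)"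
  have line_i: "((\<lambda>s. g (?p s t)) has_derivative (\<lambda>x. x * pderiv_at i g (?p s t))) (at s within S)"
    if "g differentiable at (?p s t)" for g :: "real^7 \<Rightarrow> real" and s t S
  proof -
    have "((\<lambda>s. ?p s t) has_derivative (\<lambda>x. x *\<^sub>R axis i 1)) (at s within S)" by (auto intro!: derivative_eq_intros)
    from has_derivative_compose[OF this that[unfolded frechet_derivative_works]]
    show ?thesis using linear_frechet_derivative[OF that] by (simp add: linear_scale pderiv_at_def)
  qed
  have line_j: "((\<lambda>t. g (?p s t)) has_derivative (\<lambda>x. x * pderiv_at j g (?p s t))) (at t within S)"
    if "g differentiable at (?p s t)" for g :: "real^7 \<Rightarrow> real" and s t S
  proof -
    have "((\<lambda>t. ?p s t) has_derivative (\<lambda>x. x *\<^sub>R axis j 1)) (at t within S)" by (auto intro!: derivative_eq_intros)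
    from has_derivative_compose[OF this that[unfolded frechet_derivative_works]]
    show ?thesis using linear_frechet_derivative[OF that] by (simp add: linear_scale pderiv_at_def)
  qed
  define F where "F s = f (?p s h) - f (?p s 0)" for s
  have dF: "(F has_derivative (\<lambda>x. x * (pderiv_at i f (?p s h) - pderiv_at i f (?p s 0)))) (at s within S)"
    if "0 \<le> s" "s \<le> h" for s S
    unfolding F_def using line_i[of f s h S] line_i[of f s 0 S] f[of s h] f[of s 0] that h
    by (auto intro!: derivative_eq_intros simp: right_diff_distrib)
  have "continuous_on {0..h} F"
    by (rule continuous_at_imp_continuous_on) (use dF has_derivative_continuous in fastforce)
  then obtain s where s: "0 < s" "s < h" "F h - F 0 = (h - 0) * (pderiv_at i f (?p s h) - pderiv_at i f (?p s 0))"
    using mvt[OF h, of F "\<lambda>s x. x * (pderiv_at i f (?p s h) - pderiv_at i f (?p s 0))"] dF by (metis less_imp_le)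
  define K where "K t = pderiv_at i f (?p s t)" for t
  have dK: "(K has_derivative (\<lambda>x. x * pderiv_at j (pderiv_at i f) (?p s t))) (at t within S)"
    if "0 \<le> t" "t \<le> h" for t S
    unfolding K_def using line_j[of "pderiv_at i f" s t S] f[of s t] that s by auto
  have "continuous_on {0..h} K"
    by (rule continuous_at_imp_continuous_on) (use dK has_derivative_continuous in fastforce)
  then obtain t where t: "0 < t" "t < h" "K h - K 0 = (h - 0) * pderiv_at j (pderiv_at i f) (?p s t)"
    using mvt[OF h, of K "\<lambda>t x. x * pderiv_at j (pderiv_at i f) (?p s t)"] dK by (metis less_imp_le)
  show ?thesis
    using that[OF s(1,2) t(1,2)] s(3) t(3) by (simp add: F_def K_def)
qed

text \<open>Schwarz's theorem. The second difference over a small square is symmetric in the two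
  directions; evaluated in either order, it yields a mixed derivative at a nearby point, and both
  mixed derivatives are continuous.\<close>

lemma pderiv_commute:
  assumes W: "open W" "u \<in> W" and f: "smooth_fun W f"
  shows "pderiv_at j (pderiv_at i f) u = pderiv_at i (pderiv_at j f) u"
proof -
  let ?A = "pderiv_at j (pderiv_at i f)" and ?B = "pderiv_at i (pderiv_at j f)"
  have "continuous_on W ?A" "continuous_on W ?B" using f by (auto intro: smooth_fun_pderiv smooth_fun_continuous_on)
  hence c: "isCont ?A u" "isCont ?B u" using W by (simp_all add: continuous_on_eq_continuous_at)
  have "\<bar>?A u - ?B u\<bar> < 2 * e" if e: "e > 0" for e
  proof -
    obtain d1 where d1: "d1 > 0" "\<And>v. dist v u < d1 \<Longrightarrow> dist (?A v) (?A u) < e"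
      using c(1) e unfolding continuous_at_eps_delta by blast
    obtain d2 where d2: "d2 > 0" "\<And>v. dist v u < d2 \<Longrightarrow> dist (?B v) (?B u) < e"
      using c(2) e unfolding continuous_at_eps_delta by blast
    obtain d3 where d3: "d3 > 0" "\<And>v. dist v u < d3 \<Longrightarrow> v \<in> W"
      using W unfolding open_dist by blast
    \<comment> \<open>Every point of the square is within \<open>2 * h\<close> of \<open>u\<close>;
      dividing by 3 keeps this below all three radii.\<close>
    define h where "h = Min {d1, d2, d3} / 3"
    have h: "h > 0" using d1 d2 d3 by (simp add: h_def)
    have hd: "2 * h < d1" "2 * h < d2" "2 * h < d3" using d1 d2 d3 by (auto simp: h_def)
    have near: "dist (u + s *\<^sub>R axis p 1 + t *\<^sub>R axis q 1) u \<le> 2 * h" if "0 \<le> s" "s \<le> h" "0 \<le> t" "t \<le> h" for s t p q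
    proof -
      have "norm (s *\<^sub>R axis p (1::real) + t *\<^sub>R axis q 1 :: real^7) \<le> norm (s *\<^sub>R axis p (1::real) :: real^7) + norm (t *\<^sub>R axis q (1::real) :: real^7)"
        by (rule norm_triangle_ineq)
      also have "\<dots> \<le> 2 * h" using that by (simp add: norm_axis_1)
      finally show ?thesis by (simp add: dist_norm add.assoc)
    qed
    have diff: "f differentiable at (u + s *\<^sub>R axis p 1 + t *\<^sub>R axis q 1) \<and> pderiv_at r f differentiable at (u + s *\<^sub>R axis p 1 + t *\<^sub>R axis q 1)"
      if "0 \<le> s" "s \<le> h" "0 \<le> t" "t \<le> h" for s t p q r
      using near[OF that, of p q] d3(2) hd(3) smooth_fun_differentiable[OF W(1)] f smooth_fun_pderiv by (meson le_less_trans)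
    obtain s t where 1: "0 < s" "s < h" "0 < t" "t < h"
      "f (u + h *\<^sub>R axis i 1 + h *\<^sub>R axis j 1) - f (u + h *\<^sub>R axis i 1) - f (u + h *\<^sub>R axis j 1) + f u =
         h * h * ?A (u + s *\<^sub>R axis i 1 + t *\<^sub>R axis j 1)"
      by (rule double_difference[OF h, of f u i j]) (use diff in blast)+
    obtain s' t' where 2: "0 < s'" "s' < h" "0 < t'" "t' < h"
      "f (u + h *\<^sub>R axis j 1 + h *\<^sub>R axis i 1) - f (u + h *\<^sub>R axis j 1) - f (u + h *\<^sub>R axis i 1) + f u =
         h * h * ?B (u + s' *\<^sub>R axis j 1 + t' *\<^sub>R axis i 1)"
      by (rule double_difference[OF h, of f u j i]) (use diff in blast)+
    have "h * h * ?A (u + s *\<^sub>R axis i 1 + t *\<^sub>R axis j 1) = h * h * ?B (u + s' *\<^sub>R axis j 1 + t' *\<^sub>R axis i 1)"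
    proof -
      have "u + h *\<^sub>R axis j 1 + h *\<^sub>R axis i 1 = u + h *\<^sub>R axis i 1 + h *\<^sub>R axis j 1" by simp
      from 2(5)[unfolded this] 1(5) show ?thesis by linarith
    qed
    hence "?A (u + s *\<^sub>R axis i 1 + t *\<^sub>R axis j 1) = ?B (u + s' *\<^sub>R axis j 1 + t' *\<^sub>R axis i 1)" using h by simp
    moreover have "dist (?A (u + s *\<^sub>R axis i 1 + t *\<^sub>R axis j 1)) (?A u) < e"
      using near[of s t i j] 1 hd by (intro d1(2)) simp
    moreover have "dist (?B (u + s' *\<^sub>R axis j 1 + t' *\<^sub>R axis i 1)) (?B u) < e"
      using near[of s' t' j i] 2 hd by (intro d2(2)) simp
    ultimately show ?thesis by (simp add: dist_real_def)
  qed
  \<comment> \<open>With half of the distance as tolerance, a positive distance would be smaller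
    than itself.\<close>
  from this[of "\<bar>?A u - ?B u\<bar> / 2"] show ?thesis by fastforce
qed

subsection \<open>Moving frames\<close>

lemma frechet_derivative_vec:
  fixes Y :: "real^7 \<Rightarrow> real^7"
  assumes "\<And>k. (\<lambda>v. Y v $ k) differentiable at u"
  shows "frechet_derivative Y (at u) x $ k = frechet_derivative (\<lambda>v. Y v $ k) (at u) x"
proof -
  let ?D = "\<lambda>x. \<chi> k. frechet_derivative (\<lambda>v. Y v $ k) (at u) x"
  have "(Y has_derivative ?D) (at u)"
  proof (subst has_derivative_componentwise_within, intro ballI)
    fix b :: "real^7" assume "b \<in> Basis"
    then obtain i where "b = axis i 1" by (auto simp: Basis_vec_def)
    thus "((\<lambda>x. Y x \<bullet> b) has_derivative (\<lambda>x. ?D x \<bullet> b)) (at u)"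
      using assms[of i] by (simp add: inner_axis frechet_derivative_works)
  qed
  thus ?thesis by (simp add: frechet_derivative_eq)
qed

lemma frechet_derivative_rules:
  fixes f g :: "real^7 \<Rightarrow> real"
  assumes "f differentiable at u" "g differentiable at u"
  shows "frechet_derivative (\<lambda>v. f v + g v) (at u) x = frechet_derivative f (at u) x + frechet_derivative g (at u) x"
    "frechet_derivative (\<lambda>v. f v - g v) (at u) x = frechet_derivative f (at u) x - frechet_derivative g (at u) x"
    "frechet_derivative (\<lambda>v. f v * g v) (at u) x = f u * frechet_derivative g (at u) x + frechet_derivative f (at u) x * g u"
  using assms unfolding frechet_derivative_works
  by (subst frechet_derivative_eq[OF has_derivative_add] frechet_derivative_eq[OF has_derivative_diff]
      frechet_derivative_eq[OF has_derivative_mult]; simp)+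

lemma frechet_derivative_sum':
  fixes f :: "'i \<Rightarrow> real^7 \<Rightarrow> real"
  assumes "\<And>i. i \<in> I \<Longrightarrow> f i differentiable at u"
  shows "frechet_derivative (\<lambda>v. \<Sum>i\<in>I. f i v) (at u) x = (\<Sum>i\<in>I. frechet_derivative (f i) (at u) x)"
  using assms unfolding frechet_derivative_works
  by (subst frechet_derivative_eq[OF has_derivative_sum]) auto

lemma ginner_sum:
  "ginner \<gamma> (\<Sum>a\<in>I. c a *\<^sub>R X a) Z = (\<Sum>a\<in>I. c a * ginner \<gamma> (X a) Z)"
  "ginner \<gamma> Z (\<Sum>a\<in>I. c a *\<^sub>R X a) = (\<Sum>a\<in>I. c a * ginner \<gamma> Z (X a))"
proof -
  have lin: "linear (\<lambda>X. ginner \<gamma> X Z)" "linear (\<lambda>X. ginner \<gamma> Z X)"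
    by (auto intro!: linearI simp: ginner_def sum.distrib distrib_left distrib_right sum_distrib_left mult_ac)
  show "ginner \<gamma> (\<Sum>a\<in>I. c a *\<^sub>R X a) Z = (\<Sum>a\<in>I. c a * ginner \<gamma> (X a) Z)"
    using linear_sum[OF lin(1), of "\<lambda>a. c a *\<^sub>R X a" I] by (simp add: linear_scale[OF lin(1)])
  show "ginner \<gamma> Z (\<Sum>a\<in>I. c a *\<^sub>R X a) = (\<Sum>a\<in>I. c a * ginner \<gamma> Z (X a))"
    using linear_sum[OF lin(2), of "\<lambda>a. c a *\<^sub>R X a" I] by (simp add: linear_scale[OF lin(2)])
qed

lemma ginner_diff:
  "ginner \<gamma> (X - Y) Z = ginner \<gamma> X Z - ginner \<gamma> Y Z" "ginner \<gamma> Z (X - Y) = ginner \<gamma> Z X - ginner \<gamma> Z Y"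
  by (simp_all add: ginner_def sum_subtractf left_diff_distrib right_diff_distrib)

lemma ginner_add:
  "ginner \<gamma> (X + Y) Z = ginner \<gamma> X Z + ginner \<gamma> Y Z" "ginner \<gamma> Z (X + Y) = ginner \<gamma> Z X + ginner \<gamma> Z Y"
  by (simp_all add: ginner_def sum.distrib distrib_left distrib_right)

lemma matrix_inv_eq:
  fixes A :: "real^'n^'n"
  assumes "A ** B = mat 1" shows "matrix_inv A = B"
proof -
  have "B ** A = mat 1" using assms by (simp add: matrix_left_right_inverse)
  hence "\<exists>A'. A ** A' = mat 1 \<and> A' ** A = mat 1" using assms by blast
  from someI_ex[OF this] have "A ** matrix_inv A = mat 1" unfolding matrix_inv_def by blast
  have "matrix_inv A = (B ** A) ** matrix_inv A" by (simp add: \<open>B ** A = mat 1\<close>)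
  also have "\<dots> = B" by (simp add: matrix_mul_assoc[symmetric] \<open>A ** matrix_inv A = mat 1\<close>)
  finally show ?thesis .
qed

text \<open>Pointwise orthonormality is required on the whole open set: differentiating it makes the
  connection coefficients skew.\<close>

locale moving_frame =
  fixes \<gamma> :: local_tensor and W :: "(real^7) set" and E :: frame
  assumes W: "open W"
    and \<gamma>: "smooth_fun W (\<lambda>v. \<gamma> v [i, j])"
    and \<gamma>_sym: "v \<in> W \<Longrightarrow> \<gamma> v [i, j] = \<gamma> v [j, i]"
    and E: "smooth_fun W (\<lambda>v. E i v $ k)"
    and orthonormal: "v \<in> W \<Longrightarrow> ginner (\<gamma> v) (E i v) (E j v) = kd i j"
begin

lemmas smooth = smooth_fun_const smooth_fun_add[OF W] smooth_fun_diff[OF W] smooth_fun_mult[OF W] smooth_fun_sum[OF W]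
  smooth_fun_pderiv \<gamma> E

lemmas diffble = smooth_fun_differentiable[OF W]

lemmas fd_rules = frechet_derivative_rules[OF diffble diffble]

lemma fd_sum: "(\<And>i. i \<in> I \<Longrightarrow> smooth_fun W (f i)) \<Longrightarrow> u \<in> W \<Longrightarrow>
  frechet_derivative (\<lambda>v. \<Sum>i\<in>I. f i v) (at u) x = (\<Sum>i\<in>I. frechet_derivative (f i) (at u) x)"
  by (rule frechet_derivative_sum') (rule diffble)

definition vsmooth :: "vfield \<Rightarrow> bool" where
  "vsmooth X \<longleftrightarrow> (\<forall>k. smooth_fun W (\<lambda>v. X v $ k))"

lemma vsmooth_E: "vsmooth (E i)" by (simp add: vsmooth_def E)

lemma vsmoothD: "vsmooth X \<Longrightarrow> smooth_fun W (\<lambda>v. X v $ k)" by (simp add: vsmooth_def)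

lemma vsmooth_comb: "(\<And>a. a \<in> I \<Longrightarrow> smooth_fun W (c a)) \<Longrightarrow> (\<And>a. a \<in> I \<Longrightarrow> vsmooth (X a)) \<Longrightarrow> vsmooth (\<lambda>v. \<Sum>a\<in>I. c a v *\<^sub>R X a v)"
  unfolding vsmooth_def by (auto intro!: smooth)

lemma smooth_fd:
  assumes "smooth_fun W f" "vsmooth X"
  shows "smooth_fun W (\<lambda>v. frechet_derivative f (at v) (X v))"
proof (rule smooth_fun_cong[OF W])
  show "smooth_fun W (\<lambda>v. \<Sum>p\<in>UNIV. X v $ p * pderiv_at p f v)"
    using assms by (intro smooth) (auto simp: vsmooth_def)
qed (simp add: frechet_derivative_pderiv[OF diffble[OF assms(1)]])

lemma fd_vec: "vsmooth Y \<Longrightarrow> u \<in> W \<Longrightarrow> frechet_derivative Y (at u) x $ k = frechet_derivative (\<lambda>v. Y v $ k) (at u) x"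
  by (rule frechet_derivative_vec) (auto intro: diffble vsmoothD)

text \<open>The sum of the squares of an orthonormal frame is the inverse metric. This expression is
  visibly smooth, so the Christoffel symbols are smooth without differentiating a matrix
  inverse.\<close>

definition inv_metric :: "real^7 \<Rightarrow> 7 \<Rightarrow> 7 \<Rightarrow> real" where
  "inv_metric v k l = (\<Sum>a\<in>UNIV. E a v $ k * E a v $ l)"

lemma inv_metric:
  assumes v: "v \<in> W"
  shows "(\<Sum>k\<in>UNIV. \<gamma> v [j, k] * inv_metric v k l) = kd j l" "matrix_inv (gmatrix (\<gamma> v)) $ k $ l = inv_metric v k l"
proof -
  define M where "M = (\<chi> i k. E i v $ k)"
  have "(M ** (gmatrix (\<gamma> v) ** transpose M)) $ i $ j = ginner (\<gamma> v) (E i v) (E j v)" for i j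
    by (simp add: matrix_matrix_mult_def transpose_def M_def gmatrix_def ginner_def sum_distrib_left mult_ac)
  hence "M ** (gmatrix (\<gamma> v) ** transpose M) = mat 1"
    by (simp add: vec_eq_iff orthonormal[OF v] mat_def kd_def)
  hence "gmatrix (\<gamma> v) ** (transpose M ** M) = mat 1"
    using matrix_left_right_inverse1 matrix_mul_assoc by metis
  moreover have M: "(transpose M ** M) $ k $ l = inv_metric v k l" for k l
    by (simp add: inv_metric_def matrix_matrix_mult_def transpose_def M_def)
  ultimately show "matrix_inv (gmatrix (\<gamma> v)) $ k $ l = inv_metric v k l"
    using matrix_inv_eq by metis
  have "(gmatrix (\<gamma> v) ** (transpose M ** M)) $ j $ l = kd j l"
    by (simp add: \<open>gmatrix (\<gamma> v) ** (transpose M ** M) = mat 1\<close> mat_def kd_def)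
  moreover have "(gmatrix (\<gamma> v) ** N) $ j $ l = (\<Sum>k\<in>UNIV. \<gamma> v [j, k] * N $ k $ l)" for N :: "real^7^7"
    by (simp add: matrix_matrix_mult_def gmatrix_def)
  ultimately show "(\<Sum>k\<in>UNIV. \<gamma> v [j, k] * inv_metric v k l) = kd j l"
    by (simp only: M)
qed

lemma frame_expand:
  assumes v: "v \<in> W"
  shows "X = (\<Sum>a\<in>UNIV. ginner (\<gamma> v) X (E a v) *\<^sub>R E a v)"
proof -
  have "(\<Sum>a\<in>UNIV. ginner (\<gamma> v) X (E a v) * E a v $ l) = X $ l" for l
  proof -
    have "(\<Sum>a\<in>UNIV. ginner (\<gamma> v) X (E a v) * E a v $ l) =
        (\<Sum>a\<in>UNIV. \<Sum>i\<in>UNIV. \<Sum>j\<in>UNIV. X $ i * (\<gamma> v [i, j] * (E a v $ j * E a v $ l)))"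
      by (simp add: ginner_def sum_distrib_left sum_distrib_right mult_ac)
    also have "\<dots> = (\<Sum>i\<in>UNIV. \<Sum>a\<in>UNIV. \<Sum>j\<in>UNIV. X $ i * (\<gamma> v [i, j] * (E a v $ j * E a v $ l)))"
      by (rule sum.swap)
    also have "\<dots> = (\<Sum>i\<in>UNIV. \<Sum>j\<in>UNIV. \<Sum>a\<in>UNIV. X $ i * (\<gamma> v [i, j] * (E a v $ j * E a v $ l)))"
      by (rule sum.cong[OF refl], rule sum.swap)
    also have "\<dots> = (\<Sum>i\<in>UNIV. X $ i * (\<Sum>j\<in>UNIV. \<gamma> v [i, j] * inv_metric v j l))"
      by (simp add: inv_metric_def sum_distrib_left)
    also have "\<dots> = X $ l" by (simp add: inv_metric(1)[OF v] sum_kd)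
    finally show ?thesis .
  qed
  thus ?thesis by (simp add: vec_eq_iff)
qed

lemma christoffel_eq: "v \<in> W \<Longrightarrow> christoffel \<gamma> v k i j = (1/2) * (\<Sum>l\<in>UNIV. inv_metric v k l *
     (pderiv_at i (\<lambda>v. \<gamma> v [j, l]) v + pderiv_at j (\<lambda>v. \<gamma> v [i, l]) v - pderiv_at l (\<lambda>v. \<gamma> v [i, j]) v))"
  by (simp add: christoffel_def inv_metric(2))

lemma smooth_christoffel: "smooth_fun W (\<lambda>v. christoffel \<gamma> v k i j)"
proof (rule smooth_fun_cong[OF W])
  show "smooth_fun W (\<lambda>v. (1/2) * (\<Sum>l\<in>UNIV. inv_metric v k l *
     (pderiv_at i (\<lambda>v. \<gamma> v [j, l]) v + pderiv_at j (\<lambda>v. \<gamma> v [i, l]) v - pderiv_at l (\<lambda>v. \<gamma> v [i, j]) v)))"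
    unfolding inv_metric_def by (intro smooth)
qed (simp add: christoffel_eq)

lemma pderiv_sym: "v \<in> W \<Longrightarrow> pderiv_at l (\<lambda>v. \<gamma> v [i, j]) v = pderiv_at l (\<lambda>v. \<gamma> v [j, i]) v"
  unfolding pderiv_at_def by (subst pderiv_cong[OF W, of v _ "\<lambda>v. \<gamma> v [j, i]"]) (auto intro: \<gamma>_sym)

lemma christoffel_sym: "v \<in> W \<Longrightarrow> christoffel \<gamma> v k i j = christoffel \<gamma> v k j i"
  unfolding christoffel_def by (subst pderiv_sym[of v _ i j]) (simp_all add: add.commute)

lemma christoffel_lower:
  assumes v: "v \<in> W"
  shows "(\<Sum>k\<in>UNIV. \<gamma> v [l, k] * christoffel \<gamma> v k i j) =
    (1/2) * (pderiv_at i (\<lambda>v. \<gamma> v [j, l]) v + pderiv_at j (\<lambda>v. \<gamma> v [i, l]) v - pderiv_at l (\<lambda>v. \<gamma> v [i, j]) v)"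
proof -
  let ?d = "\<lambda>m. pderiv_at i (\<lambda>v. \<gamma> v [j, m]) v + pderiv_at j (\<lambda>v. \<gamma> v [i, m]) v - pderiv_at m (\<lambda>v. \<gamma> v [i, j]) v"
  have "(\<Sum>k\<in>UNIV. \<gamma> v [l, k] * christoffel \<gamma> v k i j) = (\<Sum>k\<in>UNIV. \<Sum>m\<in>UNIV. (1/2) * (\<gamma> v [l, k] * inv_metric v k m * ?d m))"
    unfolding christoffel_eq[OF v] sum_distrib_left by (simp only: mult_ac)
  also have "\<dots> = (\<Sum>m\<in>UNIV. \<Sum>k\<in>UNIV. (1/2) * (\<gamma> v [l, k] * inv_metric v k m * ?d m))"
    by (rule sum.swap)
  also have "\<dots> = (1/2) * (\<Sum>m\<in>UNIV. (\<Sum>k\<in>UNIV. \<gamma> v [l, k] * inv_metric v k m) * ?d m)"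
    by (simp only: sum_distrib_left sum_distrib_right)
  also have "\<dots> = (1/2) * ?d l" by (simp only: inv_metric(1)[OF v] sum_kd)
  finally show ?thesis .
qed

definition CX :: "vfield \<Rightarrow> real^7 \<Rightarrow> 7 \<Rightarrow> 7 \<Rightarrow> real" where
  "CX X v k q = (\<Sum>p\<in>UNIV. X v $ p * christoffel \<gamma> v k p q)"

lemma nabla_component:
  assumes "v \<in> W" "vsmooth Y"
  shows "nabla \<gamma> X Y v $ k = frechet_derivative (\<lambda>v. Y v $ k) (at v) (X v) + (\<Sum>q\<in>UNIV. CX X v k q * Y v $ q)"
proof -
  have "(\<Sum>i\<in>UNIV. \<Sum>j\<in>UNIV. christoffel \<gamma> v k i j * X v $ i * Y v $ j) = (\<Sum>q\<in>UNIV. CX X v k q * Y v $ q)"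
    unfolding CX_def sum_distrib_right by (subst sum.swap) (simp only: mult_ac)
  thus ?thesis by (simp add: nabla_def fd_vec[OF assms(2,1)])
qed

lemma vsmooth_nabla: "vsmooth X \<Longrightarrow> vsmooth Y \<Longrightarrow> vsmooth (nabla \<gamma> X Y)"
  unfolding vsmooth_def
proof
  fix k assume X: "\<forall>k. smooth_fun W (\<lambda>v. X v $ k)" and Y: "\<forall>k. smooth_fun W (\<lambda>v. Y v $ k)"
  show "smooth_fun W (\<lambda>v. nabla \<gamma> X Y v $ k)"
  proof (rule smooth_fun_cong[OF W])
    show "smooth_fun W (\<lambda>v. frechet_derivative (\<lambda>v. Y v $ k) (at v) (X v) + (\<Sum>q\<in>UNIV. CX X v k q * Y v $ q))"
      unfolding CX_def using X Y by (intro smooth smooth_christoffel smooth_fd) (auto simp: vsmooth_def)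
  qed (use Y in \<open>simp add: nabla_component vsmooth_def\<close>)
qed

text \<open>Adding the two lowered Christoffel symbols cancels all but the derivative of the metric
  in the direction of \<open>X\<close>; this is metric compatibility in coordinates.\<close>

lemma CX_metric:
  assumes v: "v \<in> W"
  shows "(\<Sum>k\<in>UNIV. \<gamma> v [l, k] * CX X v k q) + (\<Sum>k\<in>UNIV. \<gamma> v [q, k] * CX X v k l) =
     frechet_derivative (\<lambda>v. \<gamma> v [l, q]) (at v) (X v)"
proof -
  have c: "(\<Sum>k\<in>UNIV. \<gamma> v [l, k] * CX X v k q) = (\<Sum>p\<in>UNIV. X v $ p * (\<Sum>k\<in>UNIV. \<gamma> v [l, k] * christoffel \<gamma> v k p q))" for l q
    unfolding CX_def sum_distrib_left by (subst sum.swap) (simp only: mult_ac)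
  show ?thesis
    unfolding c christoffel_lower[OF v] sum.distrib[symmetric] distrib_left[symmetric]
      frechet_derivative_pderiv[OF diffble[OF \<gamma> v]]
    by (rule sum.cong[OF refl], subst pderiv_sym[OF v, of _ q l]) (simp add: field_simps)
qed

lemma metric_compatible:
  assumes v: "v \<in> W" and Y: "vsmooth Y" and Z: "vsmooth Z"
  shows "frechet_derivative (\<lambda>v. ginner (\<gamma> v) (Y v) (Z v)) (at v) (X v) =
    ginner (\<gamma> v) (nabla \<gamma> X Y v) (Z v) + ginner (\<gamma> v) (Y v) (nabla \<gamma> X Z v)"
proof -
  let ?d = "\<lambda>f. frechet_derivative f (at v) (X v)"
  have "?d (\<lambda>v. ginner (\<gamma> v) (Y v) (Z v)) = (\<Sum>i\<in>UNIV. \<Sum>j\<in>UNIV. ?d (\<lambda>v. \<gamma> v [i, j] * Y v $ i * Z v $ j))"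
    unfolding ginner_def using Y Z v by (simp add: fd_sum smooth vsmoothD)
  also have "\<dots> = (\<Sum>i\<in>UNIV. \<Sum>j\<in>UNIV. ?d (\<lambda>v. \<gamma> v [i, j]) * Y v $ i * Z v $ j)
     + (\<Sum>i\<in>UNIV. \<Sum>j\<in>UNIV. \<gamma> v [i, j] * ?d (\<lambda>v. Y v $ i) * Z v $ j)
     + (\<Sum>i\<in>UNIV. \<Sum>j\<in>UNIV. \<gamma> v [i, j] * Y v $ i * ?d (\<lambda>v. Z v $ j))"
    using Y Z v by (simp add: fd_rules smooth vsmoothD sum.distrib[symmetric] algebra_simps)
  also have "(\<Sum>i\<in>UNIV. \<Sum>j\<in>UNIV. ?d (\<lambda>v. \<gamma> v [i, j]) * Y v $ i * Z v $ j) =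
     (\<Sum>i\<in>UNIV. \<Sum>j\<in>UNIV. \<Sum>k\<in>UNIV. \<gamma> v [i, k] * CX X v k j * Y v $ i * Z v $ j)
     + (\<Sum>i\<in>UNIV. \<Sum>j\<in>UNIV. \<Sum>k\<in>UNIV. \<gamma> v [j, k] * CX X v k i * Y v $ i * Z v $ j)"
    unfolding CX_metric[OF v, symmetric] by (simp only: distrib_right sum.distrib sum_distrib_right)
  also have "(\<Sum>i\<in>UNIV. \<Sum>j\<in>UNIV. \<Sum>k\<in>UNIV. \<gamma> v [i, k] * CX X v k j * Y v $ i * Z v $ j) =
     (\<Sum>i\<in>UNIV. \<Sum>k\<in>UNIV. \<gamma> v [i, k] * Y v $ i * (\<Sum>j\<in>UNIV. CX X v k j * Z v $ j))"
    unfolding sum_distrib_left by (rule sum.cong[OF refl], subst sum.swap) (simp only: mult_ac)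
  also have "(\<Sum>i\<in>UNIV. \<Sum>j\<in>UNIV. \<Sum>k\<in>UNIV. \<gamma> v [j, k] * CX X v k i * Y v $ i * Z v $ j) =
     (\<Sum>k\<in>UNIV. \<Sum>j\<in>UNIV. \<gamma> v [k, j] * (\<Sum>i\<in>UNIV. CX X v k i * Y v $ i) * Z v $ j)"
  proof -
    have "(\<Sum>i\<in>UNIV. \<Sum>j\<in>UNIV. \<Sum>k\<in>UNIV. \<gamma> v [j, k] * CX X v k i * Y v $ i * Z v $ j) =
      (\<Sum>j\<in>UNIV. \<Sum>k\<in>UNIV. \<Sum>i\<in>UNIV. \<gamma> v [j, k] * CX X v k i * Y v $ i * Z v $ j)"
      by (rule sum_rot3)
    also have "\<dots> = (\<Sum>k\<in>UNIV. \<Sum>j\<in>UNIV. \<Sum>i\<in>UNIV. \<gamma> v [j, k] * CX X v k i * Y v $ i * Z v $ j)"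
      by (rule sum.swap)
    also have "\<dots> = (\<Sum>k\<in>UNIV. \<Sum>j\<in>UNIV. \<gamma> v [k, j] * (\<Sum>i\<in>UNIV. CX X v k i * Y v $ i) * Z v $ j)"
      by (rule sum.cong[OF refl], rule sum.cong[OF refl])
         (simp only: \<gamma>_sym[OF v, of _ _] sum_distrib_left sum_distrib_right mult_ac)
    finally show ?thesis .
  qed
  finally show ?thesis
    by (simp add: ginner_def nabla_component[OF v] Y Z distrib_left distrib_right sum.distrib)
qed

lemma torsion_free:
  assumes v: "v \<in> W" and X: "vsmooth X" and Y: "vsmooth Y"
  shows "lie_bracket X Y v = nabla \<gamma> X Y v - nabla \<gamma> Y X v"
proof -
  have "(\<Sum>q\<in>UNIV. CX X v k q * Y v $ q) = (\<Sum>q\<in>UNIV. CX Y v k q * X v $ q)" for k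
    unfolding CX_def sum_distrib_right
    by (subst sum.swap, rule sum.cong[OF refl], rule sum.cong[OF refl]) (subst christoffel_sym[OF v], simp only: mult_ac)
  thus ?thesis
    by (simp add: vec_eq_iff lie_bracket_def nabla_component[OF v] X Y fd_vec[OF _ v])
qed

abbreviation der :: "7 \<Rightarrow> (real^7 \<Rightarrow> real) \<Rightarrow> real^7 \<Rightarrow> real" where
  "der m f v \<equiv> frechet_derivative f (at v) (E m v)"

abbreviation \<omega> :: "7 \<Rightarrow> 7 \<Rightarrow> 7 \<Rightarrow> real^7 \<Rightarrow> real" where
  "\<omega> m i a v \<equiv> conn_coeff \<gamma> E v m i a"

lemma smooth_ginner: "vsmooth X \<Longrightarrow> vsmooth Y \<Longrightarrow> smooth_fun W (\<lambda>v. ginner (\<gamma> v) (X v) (Y v))"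
  unfolding ginner_def by (intro smooth vsmoothD)

lemma smooth_\<omega>: "smooth_fun W (\<omega> m i a)"
  unfolding conn_coeff_def by (intro smooth_ginner vsmooth_nabla vsmooth_E)

lemma smooth_der: "smooth_fun W f \<Longrightarrow> smooth_fun W (\<lambda>v. der m f v)"
  by (rule smooth_fd[OF _ vsmooth_E])

lemma der_cong: "v \<in> W \<Longrightarrow> (\<And>v. v \<in> W \<Longrightarrow> f v = g v) \<Longrightarrow> der m f v = der m g v"
  by (subst pderiv_cong[OF W]) auto

lemma ginner_sym: "v \<in> W \<Longrightarrow> ginner (\<gamma> v) X Y = ginner (\<gamma> v) Y X"
  unfolding ginner_def by (subst sum.swap, subst \<gamma>_sym) (simp_all only: mult_ac)

lemma \<omega>_skew: "v \<in> W \<Longrightarrow> \<omega> m a i v = - \<omega> m i a v"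
proof -
  assume v: "v \<in> W"
  have "der m (\<lambda>v. ginner (\<gamma> v) (E i v) (E a v)) v = 0"
    by (subst der_cong[OF v, of _ "\<lambda>v. kd i a"]) (simp_all add: orthonormal)
  thus ?thesis
    using metric_compatible[OF v vsmooth_E[of i] vsmooth_E[of a], of "E m"] ginner_sym[OF v, of "E i v"]
    by (simp add: conn_coeff_def)
qed

lemma nabla_E: "v \<in> W \<Longrightarrow> nabla \<gamma> (E m) (E i) v = (\<Sum>a\<in>UNIV. \<omega> m i a v *\<^sub>R E a v)"
  unfolding conn_coeff_def by (rule frame_expand)

lemma nabla_cong:
  assumes v: "v \<in> W" and "\<And>v. v \<in> W \<Longrightarrow> Y v = Y' v"
  shows "nabla \<gamma> X Y v = nabla \<gamma> X Y' v"
proof -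
  have "frechet_derivative (\<lambda>v. Y v $ k) (at v) = frechet_derivative (\<lambda>v. Y' v $ k) (at v)" for k
    by (rule pderiv_cong[OF W v]) (simp add: assms(2))
  moreover have "(Y has_derivative D) (at v) \<longleftrightarrow> (Y' has_derivative D) (at v)" for D
    using assms W has_derivative_transform_within_open[of Y D v UNIV W Y'] has_derivative_transform_within_open[of Y' D v UNIV W Y]
    by metis
  ultimately show ?thesis by (simp add: nabla_def frechet_derivative_def assms(2)[OF v])
qed

lemma nabla_comb:
  assumes v: "v \<in> W" and c: "\<And>a. smooth_fun W (c a)"
  shows "nabla \<gamma> X (\<lambda>v. \<Sum>a\<in>UNIV. c a v *\<^sub>R E a v) v =
    (\<Sum>a\<in>UNIV. frechet_derivative (c a) (at v) (X v) *\<^sub>R E a v + c a v *\<^sub>R nabla \<gamma> X (E a) v)"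
proof -
  have s: "vsmooth (\<lambda>v. \<Sum>a\<in>UNIV. c a v *\<^sub>R E a v)" by (intro vsmooth_comb c vsmooth_E)
  have "(\<Sum>q\<in>UNIV. CX X v k q * (\<Sum>a\<in>UNIV. c a v * E a v $ q)) = (\<Sum>a\<in>UNIV. c a v * (\<Sum>q\<in>UNIV. CX X v k q * E a v $ q))" for k
    unfolding sum_distrib_left by (subst sum.swap) (simp only: mult_ac)
  thus ?thesis
    using v by (simp add: vec_eq_iff nabla_component[OF v s] nabla_component[OF v vsmooth_E] fd_sum fd_rules smooth c
        distrib_left sum.distrib algebra_simps)
qed

text \<open>The connection is tensorial in its direction: only the value of \<open>X\<close> at
  \<open>v\<close> enters. In the curvature this allows the bracket to be replaced by its frame
  expansion at one point.\<close>

lemma nabla_lin: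
  assumes v: "v \<in> W" and Y: "vsmooth Y" and X: "X v = (\<Sum>a\<in>UNIV. c a *\<^sub>R E a v)"
  shows "nabla \<gamma> X Y v = (\<Sum>a\<in>UNIV. c a *\<^sub>R nabla \<gamma> (E a) Y v)"
proof -
  have "CX X v k q = (\<Sum>a\<in>UNIV. c a * CX (E a) v k q)" for k q
    unfolding CX_def X by (simp add: sum_distrib_left sum_distrib_right mult.assoc) (rule sum.swap)
  hence "(\<Sum>q\<in>UNIV. CX X v k q * Y v $ q) = (\<Sum>a\<in>UNIV. c a * (\<Sum>q\<in>UNIV. CX (E a) v k q * Y v $ q))" for k
    by (simp add: sum_distrib_left sum_distrib_right mult.assoc) (rule sum.swap)
  moreover have "frechet_derivative (\<lambda>v. Y v $ k) (at v) (X v) = (\<Sum>a\<in>UNIV. c a * der a (\<lambda>v. Y v $ k) v)" for k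
  proof -
    have l: "linear (frechet_derivative (\<lambda>v. Y v $ k) (at v))"
      by (rule linear_frechet_derivative[OF diffble[OF vsmoothD[OF Y] v]])
    show ?thesis unfolding X by (simp add: linear_sum[OF l] linear_scale[OF l])
  qed
  ultimately show ?thesis
    by (simp add: vec_eq_iff nabla_component[OF v Y] distrib_left sum.distrib)
qed

text \<open>The structure functions of the frame: by torsion-freeness these differences are the
  components of the bracket.\<close>

definition struc :: "7 \<Rightarrow> 7 \<Rightarrow> 7 \<Rightarrow> real^7 \<Rightarrow> real" where
  "struc i j a v = \<omega> i j a v - \<omega> j i a v"

lemma bracket_E: "v \<in> W \<Longrightarrow> lie_bracket (E i) (E j) v = (\<Sum>a\<in>UNIV. struc i j a v *\<^sub>R E a v)"
  by (simp add: torsion_free vsmooth_E nabla_E struc_def scaleR_left_diff_distrib sum_subtractf)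

lemma riemann_frame:
  assumes v: "v \<in> W"
  shows "riemann \<gamma> E v $ i $ j $ k $ l = der i (\<omega> j k l) v - der j (\<omega> i k l) v
    + (\<Sum>a\<in>UNIV. \<omega> j k a v * \<omega> i a l v - \<omega> i k a v * \<omega> j a l v) - (\<Sum>a\<in>UNIV. struc i j a v * \<omega> a k l v)"
proof -
  have 1: "ginner (\<gamma> v) (nabla \<gamma> (E i) (nabla \<gamma> (E j) (E k)) v) (E l v) = der i (\<omega> j k l) v + (\<Sum>a\<in>UNIV. \<omega> j k a v * \<omega> i a l v)" for i j
  proof -
    have "nabla \<gamma> (E i) (nabla \<gamma> (E j) (E k)) v = nabla \<gamma> (E i) (\<lambda>v. \<Sum>a\<in>UNIV. \<omega> j k a v *\<^sub>R E a v) v"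
      by (rule nabla_cong[OF v]) (rule nabla_E)
    also have "\<dots> = (\<Sum>a\<in>UNIV. der i (\<omega> j k a) v *\<^sub>R E a v) + (\<Sum>a\<in>UNIV. \<omega> j k a v *\<^sub>R nabla \<gamma> (E i) (E a) v)"
      by (simp add: nabla_comb[OF v] smooth_\<omega> sum.distrib)
    finally show ?thesis
      by (simp add: ginner_add ginner_sum orthonormal[OF v] sum_kd conn_coeff_def)
  qed
  have "ginner (\<gamma> v) (nabla \<gamma> (lie_bracket (E i) (E j)) (E k) v) (E l v) = (\<Sum>a\<in>UNIV. struc i j a v * \<omega> a k l v)"
    by (subst nabla_lin[where X = "lie_bracket (E i) (E j)" and c = "\<lambda>a. struc i j a v", OF v vsmooth_E bracket_E[OF v]]) (simp add: ginner_sum conn_coeff_def)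
  thus ?thesis
    by (simp add: riemann_def ginner_diff 1 sum_subtractf)
qed

text \<open>Frame fields are differential operators whose commutator is their bracket: the
  second-order parts cancel by symmetry of the mixed derivatives of \<open>f\<close>.\<close>

lemma der_commute:
  assumes v: "v \<in> W" and f: "smooth_fun W f"
  shows "der i (\<lambda>v. der j f v) v - der j (\<lambda>v. der i f v) v = (\<Sum>a\<in>UNIV. struc i j a v * der a f v)"
proof -
  have 1: "der i (\<lambda>v. der j f v) v = (\<Sum>p\<in>UNIV. \<Sum>q\<in>UNIV. E i v $ p * E j v $ q * pderiv_at p (pderiv_at q f) v)
     + (\<Sum>q\<in>UNIV. der i (\<lambda>v. E j v $ q) v * pderiv_at q f v)" for i j
  proof -
    have "der i (\<lambda>v. der j f v) v = der i (\<lambda>v. \<Sum>q\<in>UNIV. E j v $ q * pderiv_at q f v) v"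
      by (rule der_cong[OF v]) (simp add: frechet_derivative_pderiv[OF diffble[OF f]])
    also have "\<dots> = (\<Sum>q\<in>UNIV. E j v $ q * der i (pderiv_at q f) v) + (\<Sum>q\<in>UNIV. der i (\<lambda>v. E j v $ q) v * pderiv_at q f v)"
      using v f by (simp add: fd_sum fd_rules smooth sum.distrib)
    also have "(\<Sum>q\<in>UNIV. E j v $ q * der i (pderiv_at q f) v) = (\<Sum>q\<in>UNIV. \<Sum>p\<in>UNIV. E i v $ p * E j v $ q * pderiv_at p (pderiv_at q f) v)"
      using v f by (simp add: frechet_derivative_pderiv[OF diffble] smooth sum_distrib_left mult_ac)
    also have "\<dots> = (\<Sum>p\<in>UNIV. \<Sum>q\<in>UNIV. E i v $ p * E j v $ q * pderiv_at p (pderiv_at q f) v)" by (rule sum.swap)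
    finally show ?thesis .
  qed
  have 2: "(\<Sum>p\<in>UNIV. \<Sum>q\<in>UNIV. E j v $ p * E i v $ q * pderiv_at p (pderiv_at q f) v) =
     (\<Sum>p\<in>UNIV. \<Sum>q\<in>UNIV. E i v $ p * E j v $ q * pderiv_at p (pderiv_at q f) v)"
    by (subst sum.swap, rule sum.cong[OF refl], rule sum.cong[OF refl]) (subst pderiv_commute[OF W v f], simp only: mult_ac)
  have "der i (\<lambda>v. der j f v) v - der j (\<lambda>v. der i f v) v = (\<Sum>q\<in>UNIV. lie_bracket (E i) (E j) v $ q * pderiv_at q f v)"
    unfolding 1 2 by (simp add: lie_bracket_def fd_vec[OF vsmooth_E v] left_diff_distrib sum_subtractf)
  also have "\<dots> = (\<Sum>q\<in>UNIV. \<Sum>a\<in>UNIV. struc i j a v * (E a v $ q * pderiv_at q f v))"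
    by (simp add: bracket_E[OF v] sum_distrib_right mult.assoc)
  also have "\<dots> = (\<Sum>a\<in>UNIV. struc i j a v * der a f v)"
    by (subst sum.swap) (simp add: frechet_derivative_pderiv[OF diffble[OF f v]] sum_distrib_left)
  finally show ?thesis .
qed

lemma smooth_struc: "smooth_fun W (struc i j a)"
  unfolding struc_def[abs_def] by (intro smooth smooth_\<omega>)

text \<open>The Jacobi identity of the frame. Differentiating the bracket formula for the coordinate
  components of the frame and summing cyclically, the second derivatives cancel through
  \<open>der_commute\<close>; pairing with \<open>E l\<close> extracts one coefficient.\<close>

lemma jacobi:
  assumes v: "v \<in> W"
  defines "S \<equiv> \<lambda>i j k l. der i (struc j k l) v + (\<Sum>a\<in>UNIV. struc j k a v * struc i a l v)"
  shows "S i j k l + S j k i l + S k i j l = 0"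
proof -
  have br: "der i (\<lambda>v. E j v $ p) v - der j (\<lambda>v. E i v $ p) v = (\<Sum>a\<in>UNIV. struc i j a v * E a v $ p)" if "v \<in> W" for i j p v
    using bracket_E[OF that, of i j] by (simp add: vec_eq_iff lie_bracket_def fd_vec[OF vsmooth_E that])
  have 1: "der i (\<lambda>v. der j (\<lambda>v. E k v $ p) v) v - der i (\<lambda>v. der k (\<lambda>v. E j v $ p) v) v =
     (\<Sum>a\<in>UNIV. struc j k a v * der i (\<lambda>v. E a v $ p) v) + (\<Sum>a\<in>UNIV. der i (struc j k a) v * E a v $ p)" for i j k p
  proof -
    have "der i (\<lambda>v. der j (\<lambda>v. E k v $ p) v - der k (\<lambda>v. E j v $ p) v) v = der i (\<lambda>v. \<Sum>a\<in>UNIV. struc j k a v * E a v $ p) v"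
      by (rule der_cong[OF v]) (rule br)
    thus ?thesis using v by (simp add: fd_sum fd_rules smooth smooth_der smooth_struc sum.distrib)
  qed
  have 2: "(\<Sum>a\<in>UNIV. struc j k a v * der i (\<lambda>v. E a v $ p) v) - (\<Sum>a\<in>UNIV. struc j k a v * der a (\<lambda>v. E i v $ p) v) =
     (\<Sum>b\<in>UNIV. (\<Sum>a\<in>UNIV. struc j k a v * struc i a b v) * E b v $ p)" for i j k p
    unfolding sum_subtractf[symmetric] right_diff_distrib[symmetric] br[OF v] sum_distrib_left sum_distrib_right
    by (subst sum.swap) (simp only: mult_ac)
  have 3: "der i (\<lambda>v. der j (\<lambda>v. E k v $ p) v) v - der j (\<lambda>v. der i (\<lambda>v. E k v $ p) v) v =
     (\<Sum>a\<in>UNIV. struc i j a v * der a (\<lambda>v. E k v $ p) v)" for i j k p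
    by (rule der_commute[OF v E])
  have 4: "(\<Sum>b\<in>UNIV. S i j k b * E b v $ p) = (\<Sum>a\<in>UNIV. der i (struc j k a) v * E a v $ p)
     + (\<Sum>b\<in>UNIV. (\<Sum>a\<in>UNIV. struc j k a v * struc i a b v) * E b v $ p)" for i j k p
    by (simp add: S_def distrib_right sum.distrib)
  have "(\<Sum>b\<in>UNIV. (S i j k b + S j k i b + S k i j b) * E b v $ p) = 0" for p
    unfolding distrib_right sum.distrib 4
    using 1[where i = i and j = j and k = k and p = p] 1[where i = j and j = k and k = i and p = p] 1[where i = k and j = i and k = j and p = p] 2[where i = j and j = k and k = i and p = p] 2[where i = k and j = i and k = j and p = p] 2[where i = i and j = j and k = k and p = p] 3[where i = i and j = j and k = k and p = p] 3[where i = j and j = k and k = i and p = p] 3[where i = k and j = i and k = j and p = p]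
    by linarith
  hence "(\<Sum>b\<in>UNIV. (S i j k b + S j k i b + S k i j b) *\<^sub>R E b v) = 0" by (simp add: vec_eq_iff)
  hence "ginner (\<gamma> v) (\<Sum>b\<in>UNIV. (S i j k b + S j k i b + S k i j b) *\<^sub>R E b v) (E l v) = 0"
    by (simp add: ginner_def)
  thus ?thesis by (simp add: ginner_sum orthonormal[OF v] sum_kd)
qed

text \<open>Skewness in the last pair comes from the skew connection coefficients. For the Bianchi
  identity, torsion-freeness turns antisymmetrised coefficients into structure functions, and the
  cyclic sum becomes that of \<open>jacobi\<close>.\<close>

lemma algebraic_curvature_riemann:
  assumes v: "v \<in> W"
  shows "algebraic_curvature (riemann \<gamma> E v)"
  unfolding algebraic_curvature_def
proof (intro allI conjI)
  fix i j k l
  note R = riemann_frame[OF v]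
  show "riemann \<gamma> E v $ i $ j $ k $ l = - riemann \<gamma> E v $ j $ i $ k $ l"
    unfolding R sum_subtractf[symmetric] by (simp add: struc_def sum_subtractf left_diff_distrib)
  have "der m (\<omega> n l k) v = - der m (\<omega> n k l) v" for m n
  proof -
    have "der m (\<omega> n l k) v = der m (\<lambda>v. 0 - \<omega> n k l v) v"
      by (rule der_cong[OF v]) (simp add: \<omega>_skew[of _ n l k])
    also have "\<dots> = der m (\<lambda>v. 0) v - der m (\<omega> n k l) v"
      by (rule fd_rules(2)) (use v in \<open>auto intro: smooth smooth_\<omega>\<close>)
    finally show ?thesis by simp
  qed
  note d = this
  have s: "\<omega> m l k v = - \<omega> m k l v" for m by (rule \<omega>_skew[OF v])
  have q: "(\<Sum>a\<in>UNIV. \<omega> j l a v * \<omega> i a k v - \<omega> i l a v * \<omega> j a k v) = - (\<Sum>a\<in>UNIV. \<omega> j k a v * \<omega> i a l v - \<omega> i k a v * \<omega> j a l v)"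
    unfolding sum_negf[symmetric]
  proof (rule sum.cong[OF refl])
    fix a
    show "\<omega> j l a v * \<omega> i a k v - \<omega> i l a v * \<omega> j a k v = - (\<omega> j k a v * \<omega> i a l v - \<omega> i k a v * \<omega> j a l v)"
      using \<omega>_skew[OF v, of j l a] \<omega>_skew[OF v, of i a k] \<omega>_skew[OF v, of i l a] \<omega>_skew[OF v, of j a k] by simp
  qed
  show "riemann \<gamma> E v $ i $ j $ k $ l = - riemann \<gamma> E v $ i $ j $ l $ k"
    unfolding R[of i j l k] d s q R[of i j k l] by (simp add: sum_negf)
  have e: "der i (\<omega> j k l) v - der i (\<omega> k j l) v = der i (struc j k l) v" for i j k
    unfolding struc_def[abs_def] using v by (simp add: fd_rules smooth_\<omega>)
  define p where "p i j k = (\<Sum>a\<in>UNIV. \<omega> j k a v * \<omega> i a l v)" for i j k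
  define r where "r i j k = (\<Sum>a\<in>UNIV. struc j k a v * \<omega> a i l v)" for i j k
  have f: "p i j k - p i k j - r i j k = (\<Sum>a\<in>UNIV. struc j k a v * struc i a l v)" for i j k
    by (simp add: p_def r_def struc_def sum_subtractf[symmetric] algebra_simps)
  have R': "riemann \<gamma> E v $ i $ j $ k $ l = der i (\<omega> j k l) v - der j (\<omega> i k l) v + p i j k - p j i k - r k i j" for i j k
    by (simp add: R p_def r_def sum_subtractf)
  show "riemann \<gamma> E v $ i $ j $ k $ l + riemann \<gamma> E v $ j $ k $ i $ l + riemann \<gamma> E v $ k $ i $ j $ l = 0"
    unfolding R' using jacobi[OF v, where i = i and j = j and k = k and l = l] e[where i = i and j = j and k = k] e[where i = j and j = k and k = i] e[where i = k and j = i and k = j] f[where i = i and j = j and k = k] f[where i = j and j = k and k = i] f[where i = k and j = i and k = j]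
    by linarith
qed

end

subsection \<open>The Ricci identity for the 3-form\<close>

text \<open>The action of \<open>w \<in> gl(7)\<close> on covariant tensors as a derivation; the connection coefficients of a frame act in this way.\<close>

primrec rho :: "(7 \<Rightarrow> 7 \<Rightarrow> real) \<Rightarrow> 7 list \<Rightarrow> tensor \<Rightarrow> real" where
  "rho w [] t = 0"
| "rho w (a # is) t = (\<Sum>d\<in>UNIV. w a d * t (d # is)) + rho w is (\<lambda>js. t (a # js))"

lemma rho_linear: "rho w is (\<lambda>js. \<Sum>b\<in>B. c b * t b js) = (\<Sum>b\<in>B. c b * rho w is (t b))"
proof (induction "is" arbitrary: t)
  case (Cons a "is")
  have "(\<Sum>d\<in>UNIV. w a d * (\<Sum>b\<in>B. c b * t b (d # is))) = (\<Sum>b\<in>B. c b * (\<Sum>d\<in>UNIV. w a d * t b (d # is)))"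
    unfolding sum_distrib_left by (subst sum.swap) (simp only: mult_ac)
  thus ?case by (simp add: Cons distrib_left sum.distrib)
qed simp

lemma rho_add: "rho w is (\<lambda>js. s js + t js) = rho w is s + rho w is t"
  by (induction "is" arbitrary: s t) (simp_all add: distrib_left sum.distrib)

lemma rho_cong: "(\<And>js. length js = length is \<Longrightarrow> s js = t js) \<Longrightarrow> rho w is s = rho w is t"
proof (induction "is" arbitrary: s t)
  case (Cons a "is")
  have "rho w is (\<lambda>js. s (a # js)) = rho w is (\<lambda>js. t (a # js))" by (rule Cons.IH) (simp add: Cons.prems)
  thus ?case by (simp add: Cons.prems)
qed simp

text \<open>Derivations at different slots commute, so only the terms with both acting on the same
  slot remain, and there the matrices commute up to their bracket. This makes the quadratic part of
  the curvature act on tensors.\<close>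

lemma rho_commutator:
  "rho w is (\<lambda>js. rho w' js t) - rho w' is (\<lambda>js. rho w js t) =
     rho (\<lambda>a e. \<Sum>d\<in>UNIV. w a d * w' d e - w' a d * w d e) is t"
proof (induction "is" arbitrary: t)
  case (Cons a "is")
  have 1: "(\<Sum>d\<in>UNIV. w a d * (\<Sum>e\<in>UNIV. w' d e * t (e # is))) = (\<Sum>e\<in>UNIV. (\<Sum>d\<in>UNIV. w a d * w' d e) * t (e # is))" for w w'
    unfolding sum_distrib_left sum_distrib_right by (subst sum.swap) (simp only: mult_ac)
  have 2: "(\<Sum>e\<in>UNIV. (\<Sum>d\<in>UNIV. w a d * w' d e - w' a d * w d e) * t (e # is)) =
    (\<Sum>d\<in>UNIV. w a d * (\<Sum>e\<in>UNIV. w' d e * t (e # is))) - (\<Sum>d\<in>UNIV. w' a d * (\<Sum>e\<in>UNIV. w d e * t (e # is)))"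
    unfolding 1 by (simp add: sum_subtractf left_diff_distrib)
  show ?case
    using Cons[of "\<lambda>js. t (a # js)"]
    by (simp add: 2 rho_add rho_linear distrib_left sum.distrib)
qed simp

context g2_alg
begin

lemma phi_psi_two: "(\<Sum>b\<in>UNIV. \<Sum>c\<in>UNIV. \<phi> [d, b, c] * \<psi> [s, a, b, c]) = - 4 * \<phi> [a, d, s]"
proof -
  have "\<phi> [d, a, s] = - \<phi> [a, d, s]" "\<phi> [s, d, a] = - \<phi> [a, d, s]" "\<phi> [s, a, d] = \<phi> [a, d, s]"
    using phi_skew1[of d a s] phi_skew1[of s a d] phi_skew1[of s d a] phi_skew2[of d s a] phi_skew2[of s a d] phi_skew2[of a d s] by linarith+
  thus ?thesis
    by (simp add: phi_psi phi_zero sum.distrib sum_subtractf kd_sym[of _ s] kd_sym[of _ a])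
qed

lemma psi_psi: "(\<Sum>a\<in>UNIV. \<Sum>b\<in>UNIV. \<Sum>c\<in>UNIV. \<psi> [q, a, b, c] * \<psi> [s, a, b, c]) = 24 * kd q s"
proof -
  have e: "\<psi> [q, a, b, c] = kd q b * kd a c - kd q c * kd a b - (\<Sum>k\<in>UNIV. \<phi> [q, a, k] * \<phi> [b, c, k])" for a b c
    using phi_phi[of q a b c] by linarith
  have 1: "(\<Sum>a\<in>UNIV. \<Sum>b\<in>UNIV. \<Sum>c\<in>UNIV. kd q b * kd a c * \<psi> [s, a, b, c]) = 0"
    "(\<Sum>a\<in>UNIV. \<Sum>b\<in>UNIV. \<Sum>c\<in>UNIV. kd q c * kd a b * \<psi> [s, a, b, c]) = 0"
    by (simp_all add: mult.assoc sum_distrib_left[symmetric] psi_zero)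
  have "(\<Sum>b\<in>UNIV. \<Sum>c\<in>UNIV. (\<Sum>k\<in>UNIV. \<phi> [q, a, k] * \<phi> [b, c, k]) * \<psi> [s, a, b, c]) =
     (\<Sum>k\<in>UNIV. \<phi> [q, a, k] * (\<Sum>b\<in>UNIV. \<Sum>c\<in>UNIV. \<phi> [k, b, c] * \<psi> [s, a, b, c]))" for a
  proof -
    have "(\<Sum>b\<in>UNIV. \<Sum>c\<in>UNIV. (\<Sum>k\<in>UNIV. \<phi> [q, a, k] * \<phi> [b, c, k]) * \<psi> [s, a, b, c]) =
       (\<Sum>b\<in>UNIV. \<Sum>c\<in>UNIV. \<Sum>k\<in>UNIV. \<phi> [q, a, k] * (\<phi> [k, b, c] * \<psi> [s, a, b, c]))"
      by (simp add: sum_distrib_right mult.assoc phi_cyc)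
    also have "\<dots> = (\<Sum>k\<in>UNIV. \<Sum>b\<in>UNIV. \<Sum>c\<in>UNIV. \<phi> [q, a, k] * (\<phi> [k, b, c] * \<psi> [s, a, b, c]))"
      by (rule sum_rot3[symmetric])
    finally show ?thesis by (simp add: sum_distrib_left)
  qed
  hence "(\<Sum>a\<in>UNIV. \<Sum>b\<in>UNIV. \<Sum>c\<in>UNIV. (\<Sum>k\<in>UNIV. \<phi> [q, a, k] * \<phi> [b, c, k]) * \<psi> [s, a, b, c]) =
     (\<Sum>a\<in>UNIV. \<Sum>k\<in>UNIV. \<phi> [q, a, k] * (- 4 * \<phi> [a, k, s]))"
    by (simp add: phi_psi_two)
  also have "\<dots> = - 4 * (\<Sum>a\<in>UNIV. \<Sum>k\<in>UNIV. \<phi> [q, a, k] * \<phi> [s, a, k])"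
    by (simp add: sum_distrib_left phi_cyc[of _ _ s] mult_ac)
  also have "\<dots> = - 24 * kd q s" by (simp add: phi_phi2)
  finally have 2: "(\<Sum>a\<in>UNIV. \<Sum>b\<in>UNIV. \<Sum>c\<in>UNIV. (\<Sum>k\<in>UNIV. \<phi> [q, a, k] * \<phi> [b, c, k]) * \<psi> [s, a, b, c]) = - 24 * kd q s" .
  show ?thesis unfolding e[of _ _ _] left_diff_distrib sum_subtractf 1 2 by simp
qed

text \<open>By skewness of \<psi> in its last three indices, the three slots of a derivation
  contribute equally after contraction.\<close>

lemma psi_skew_contract:
  "(\<Sum>a\<in>UNIV. \<Sum>b\<in>UNIV. \<Sum>c\<in>UNIV. (h a b c - h b a c + h c a b) * \<psi> [s, a, b, c]) =
     3 * (\<Sum>a\<in>UNIV. \<Sum>b\<in>UNIV. \<Sum>c\<in>UNIV. h a b c * \<psi> [s, a, b, c])"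
proof -
  have "(\<Sum>a\<in>UNIV. \<Sum>b\<in>UNIV. \<Sum>c\<in>UNIV. h b a c * \<psi> [s, a, b, c]) = (\<Sum>a\<in>UNIV. \<Sum>b\<in>UNIV. \<Sum>c\<in>UNIV. h a b c * \<psi> [s, b, a, c])"
    by (rule sum.swap)
  also have "\<dots> = - (\<Sum>a\<in>UNIV. \<Sum>b\<in>UNIV. \<Sum>c\<in>UNIV. h a b c * \<psi> [s, a, b, c])"
    unfolding sum_negf[symmetric] by (rule sum.cong[OF refl], rule sum.cong[OF refl], rule sum.cong[OF refl], subst psi_skew2) simp
  finally have 1: "(\<Sum>a\<in>UNIV. \<Sum>b\<in>UNIV. \<Sum>c\<in>UNIV. h b a c * \<psi> [s, a, b, c]) = - (\<Sum>a\<in>UNIV. \<Sum>b\<in>UNIV. \<Sum>c\<in>UNIV. h a b c * \<psi> [s, a, b, c])" .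
  have "\<psi> [s, b, c, a] = \<psi> [s, a, b, c]" for a b c
    using psi_skew3[of s b a c] psi_skew2[of s a b c] by linarith
  hence 2: "(\<Sum>a\<in>UNIV. \<Sum>b\<in>UNIV. \<Sum>c\<in>UNIV. h c a b * \<psi> [s, a, b, c]) = (\<Sum>a\<in>UNIV. \<Sum>b\<in>UNIV. \<Sum>c\<in>UNIV. h a b c * \<psi> [s, a, b, c])"
    by (subst (2) sum_rot3) simp
  show ?thesis unfolding distrib_right left_diff_distrib sum.distrib sum_subtractf 1 2 by simp
qed

text \<open>Contracting the Ricci identity for \<open>\<phi>\<close> with \<open>\<psi>\<close> isolates the seven-dimensional part of the curvature.\<close>

lemma g2_ricci_contract:
  assumes "\<And>a b c. rho (\<lambda>k l. R $ k $ l) [a, b, c] \<phi> + (\<Sum>q\<in>UNIV. B $ q * \<psi> [q, a, b, c])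
      - (\<Sum>q\<in>UNIV. y $ q * (x $ q * \<phi> [a, b, c] - x $ a * \<phi> [q, b, c] + x $ b * \<phi> [q, a, c] - x $ c * \<phi> [q, a, b]))
      + (\<Sum>q\<in>UNIV. x $ q * (y $ q * \<phi> [a, b, c] - y $ a * \<phi> [q, b, c] + y $ b * \<phi> [q, a, c] - y $ c * \<phi> [q, a, b])) = 0"
  shows "B $ s = (\<Sum>a\<in>UNIV. \<Sum>b\<in>UNIV. x $ a * y $ b * \<phi> [a, b, s]) + (1/2) * (\<Sum>a\<in>UNIV. \<Sum>b\<in>UNIV. R $ a $ b * \<phi> [a, b, s])"
proof -
  let ?S = "\<lambda>f. \<Sum>a\<in>UNIV. \<Sum>b\<in>UNIV. \<Sum>c\<in>UNIV. f a b c * \<psi> [s, a, b, c]"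
  have h: "?S (\<lambda>a b c. \<Sum>d\<in>UNIV. M a d * \<phi> [d, b, c]) = - 4 * (\<Sum>a\<in>UNIV. \<Sum>d\<in>UNIV. M a d * \<phi> [a, d, s])" for M
  proof -
    have "(\<Sum>b\<in>UNIV. \<Sum>c\<in>UNIV. (\<Sum>d\<in>UNIV. M a d * \<phi> [d, b, c]) * \<psi> [s, a, b, c]) =
      (\<Sum>d\<in>UNIV. M a d * (\<Sum>b\<in>UNIV. \<Sum>c\<in>UNIV. \<phi> [d, b, c] * \<psi> [s, a, b, c]))" for a
      unfolding sum_distrib_left sum_distrib_right mult.assoc by (rule sum_rot3[symmetric])
    thus ?thesis by (simp add: phi_psi_two sum_distrib_left mult_ac)
  qed
  \<comment> \<open>First-slot terms of the curvature and of the two quadratic expressions. The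
    other slots are the same terms with their index moved to the front, which produces the sign
    pattern of \<open>psi_skew_contract\<close>.\<close>
  define r where "r a b c = (\<Sum>d\<in>UNIV. R $ a $ d * \<phi> [d, b, c])" for a b c
  define n where "n a b c = (\<Sum>q\<in>UNIV. (x $ a * y $ q) * \<phi> [q, b, c])" for a b c
  define n' where "n' a b c = (\<Sum>q\<in>UNIV. (y $ a * x $ q) * \<phi> [q, b, c])" for a b c
  have "(\<Sum>d\<in>UNIV. R $ b $ d * \<phi> [a, d, c]) = - r b a c" for a b c
    unfolding r_def by (subst phi_skew1) (simp add: sum_negf)
  moreover have "(\<Sum>d\<in>UNIV. R $ c $ d * \<phi> [a, b, d]) = r c a b" for a b c
    by (simp only: r_def phi_cyc[of a b])
  ultimately have 1: "rho (\<lambda>k l. R $ k $ l) [a, b, c] \<phi> = r a b c - r b a c + r c a b" for a b c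
    by (simp add: r_def)
  have 2: "(\<Sum>q\<in>UNIV. y $ q * (x $ q * \<phi> [a, b, c] - x $ a * \<phi> [q, b, c] + x $ b * \<phi> [q, a, c] - x $ c * \<phi> [q, a, b])) =
     (\<Sum>q\<in>UNIV. x $ q * y $ q) * \<phi> [a, b, c] - (n a b c - n b a c + n c a b)" for a b c
    by (simp add: n_def sum_distrib_right sum.distrib[symmetric] sum_subtractf[symmetric] algebra_simps)
       (simp add: sum_distrib_left mult_ac)
  have 3: "(\<Sum>q\<in>UNIV. x $ q * (y $ q * \<phi> [a, b, c] - y $ a * \<phi> [q, b, c] + y $ b * \<phi> [q, a, c] - y $ c * \<phi> [q, a, b])) =
     (\<Sum>q\<in>UNIV. x $ q * y $ q) * \<phi> [a, b, c] - (n' a b c - n' b a c + n' c a b)" for a b c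
    by (simp add: n'_def sum_distrib_right sum.distrib[symmetric] sum_subtractf[symmetric] algebra_simps)
       (simp add: sum_distrib_left mult_ac)
  have eq: "(r a b c - r b a c + r c a b) + (\<Sum>q\<in>UNIV. B $ q * \<psi> [q, a, b, c]) + (n a b c - n b a c + n c a b) - (n' a b c - n' b a c + n' c a b) = 0" for a b c
    using assms[of a b c] unfolding 1 2 3 by linarith
  have "0 = ?S (\<lambda>a b c. (r a b c - r b a c + r c a b) + (\<Sum>q\<in>UNIV. B $ q * \<psi> [q, a, b, c]) + (n a b c - n b a c + n c a b) - (n' a b c - n' b a c + n' c a b))"
    unfolding eq by simp
  also have "\<dots> = ?S (\<lambda>a b c. r a b c - r b a c + r c a b) + ?S (\<lambda>a b c. \<Sum>q\<in>UNIV. B $ q * \<psi> [q, a, b, c])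
      + ?S (\<lambda>a b c. n a b c - n b a c + n c a b) - ?S (\<lambda>a b c. n' a b c - n' b a c + n' c a b)"
    by (simp only: distrib_right left_diff_distrib[of "_ + _"] sum.distrib sum_subtractf)
  also have "?S (\<lambda>a b c. \<Sum>q\<in>UNIV. B $ q * \<psi> [q, a, b, c]) = 24 * B $ s"
  proof -
    have "?S (\<lambda>a b c. \<Sum>q\<in>UNIV. B $ q * \<psi> [q, a, b, c]) = (\<Sum>q\<in>UNIV. B $ q * (\<Sum>a\<in>UNIV. \<Sum>b\<in>UNIV. \<Sum>c\<in>UNIV. \<psi> [q, a, b, c] * \<psi> [s, a, b, c]))"
      unfolding sum_distrib_left sum_distrib_right mult.assoc by (rule sum_rot4)
    thus ?thesis by (simp add: psi_psi mult.left_commute[of _ 24] sum_distrib_left[symmetric])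
  qed
  also have "?S (\<lambda>a b c. r a b c - r b a c + r c a b) = - 12 * (\<Sum>a\<in>UNIV. \<Sum>d\<in>UNIV. R $ a $ d * \<phi> [a, d, s])"
    unfolding psi_skew_contract unfolding r_def h by simp
  also have "?S (\<lambda>a b c. n a b c - n b a c + n c a b) = - 12 * (\<Sum>a\<in>UNIV. \<Sum>q\<in>UNIV. x $ a * y $ q * \<phi> [a, q, s])"
    unfolding psi_skew_contract unfolding n_def h by simp
  also have "?S (\<lambda>a b c. n' a b c - n' b a c + n' c a b) = - 12 * (\<Sum>a\<in>UNIV. \<Sum>q\<in>UNIV. y $ a * x $ q * \<phi> [a, q, s])"
    unfolding psi_skew_contract unfolding n'_def h by simp
  also have "(\<Sum>a\<in>UNIV. \<Sum>q\<in>UNIV. y $ a * x $ q * \<phi> [a, q, s]) = - (\<Sum>a\<in>UNIV. \<Sum>q\<in>UNIV. x $ a * y $ q * \<phi> [a, q, s])"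
    by (subst sum.swap, subst phi_skew1) (simp add: sum_negf mult_ac)
  finally show ?thesis by simp
qed

text \<open>The Leibniz rule for \<psi> written by means of the metric and \<phi>\<phi>. A skew
  \<open>w\<close> annihilates the metric, so the derivation passes from \<phi>\<phi> to \<psi>. The
  torsion term becomes, by \<open>phi_psi\<close>, the wedge product of \<open>x\<close> with
  \<phi>, as in the classical formula for the derivative of \<psi>.\<close>

lemma psi_derivation:
  assumes w: "\<And>a b. w b a = - w a b" and
    d: "\<And>a b c. d a b c = rho w [a, b, c] \<phi> + (\<Sum>q\<in>UNIV. x $ q * \<psi> [q, a, b, c])"
  shows "- (\<Sum>k\<in>UNIV. \<phi> [a, b, k] * d c e k + d a b k * \<phi> [c, e, k]) = rho w [a, b, c, e] \<psi>
     - (x $ a * \<phi> [b, c, e] - x $ b * \<phi> [a, c, e] + x $ c * \<phi> [a, b, e] - x $ e * \<phi> [a, b, c])"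
proof -
  have p: "\<psi> [i, j, a, b] = kd i a * kd j b - kd i b * kd j a - (\<Sum>k\<in>UNIV. \<phi> [i, j, k] * \<phi> [a, b, k])" for i j a b
    using phi_phi[of i j a b] by linarith
  have X: "(\<Sum>k\<in>UNIV. \<phi> [a, b, k] * (\<Sum>q\<in>UNIV. x $ q * \<psi> [q, c, e, k]) + (\<Sum>q\<in>UNIV. x $ q * \<psi> [q, a, b, k]) * \<phi> [c, e, k]) =
     x $ a * \<phi> [b, c, e] - x $ b * \<phi> [a, c, e] + x $ c * \<phi> [a, b, e] - x $ e * \<phi> [a, b, c]"
  proof -
    have "(\<Sum>k\<in>UNIV. \<phi> [a, b, k] * (\<Sum>q\<in>UNIV. x $ q * \<psi> [q, c, e, k]) + (\<Sum>q\<in>UNIV. x $ q * \<psi> [q, a, b, k]) * \<phi> [c, e, k]) =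
      (\<Sum>k\<in>UNIV. \<Sum>q\<in>UNIV. x $ q * (\<phi> [a, b, k] * \<psi> [q, c, e, k] + \<phi> [c, e, k] * \<psi> [q, a, b, k]))"
      by (simp add: sum_distrib_left sum_distrib_right sum.distrib[symmetric] algebra_simps)
    also have "\<dots> = (\<Sum>q\<in>UNIV. x $ q * ((\<Sum>k\<in>UNIV. \<phi> [a, b, k] * \<psi> [q, c, e, k]) + (\<Sum>k\<in>UNIV. \<phi> [c, e, k] * \<psi> [q, a, b, k])))"
      by (subst sum.swap) (simp add: sum_distrib_left sum.distrib distrib_left)
    also have "\<dots> = (\<Sum>q\<in>UNIV. x $ q * (kd a q * \<phi> [b, c, e] - kd b q * \<phi> [a, c, e] + kd c q * \<phi> [a, b, e] - kd e q * \<phi> [a, b, c]))"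
    proof (rule sum.cong[OF refl])
      fix q
      have s: "\<phi> [e, a, b] = \<phi> [a, b, e]" "\<phi> [c, a, b] = \<phi> [a, b, c]" by (simp_all add: phi_cyc)
      show "x $ q * ((\<Sum>k\<in>UNIV. \<phi> [a, b, k] * \<psi> [q, c, e, k]) + (\<Sum>k\<in>UNIV. \<phi> [c, e, k] * \<psi> [q, a, b, k])) =
        x $ q * (kd a q * \<phi> [b, c, e] - kd b q * \<phi> [a, c, e] + kd c q * \<phi> [a, b, e] - kd e q * \<phi> [a, b, c])"
        unfolding phi_psi kd_sym[of c a] kd_sym[of e a] kd_sym[of c b] kd_sym[of e b] kd_sym[of q]
        using phi_skew1[of q e b] phi_skew2[of q e b] phi_skew1[of q c b] phi_skew2[of q c b]
          phi_skew1[of q e a] phi_skew2[of q e a] phi_skew1[of q c a] phi_skew2[of q c a] s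
        by (simp add: algebra_simps)
    qed
    also have "\<dots> = x $ a * \<phi> [b, c, e] - x $ b * \<phi> [a, c, e] + x $ c * \<phi> [a, b, e] - x $ e * \<phi> [a, b, c]"
      unfolding distrib_left right_diff_distrib sum.distrib sum_subtractf mult.assoc[symmetric] sum_distrib_right[symmetric] sum_kd ..
    finally show ?thesis .
  qed
  define P where "P i j a b = (\<Sum>k\<in>UNIV. \<phi> [i, j, k] * \<phi> [a, b, k])" for i j a b
  \<comment> \<open>The terms in which \<open>w\<close> acts on the contracted index cancel, since
    \<open>w\<close> is skew.\<close>
  have last: "(\<Sum>k\<in>UNIV. \<phi> [a, b, k] * (\<Sum>h\<in>UNIV. w k h * \<phi> [c, e, h])) + (\<Sum>k\<in>UNIV. (\<Sum>h\<in>UNIV. w k h * \<phi> [a, b, h]) * \<phi> [c, e, k]) = 0"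
  proof -
    have "(\<Sum>k\<in>UNIV. (\<Sum>h\<in>UNIV. w k h * \<phi> [a, b, h]) * \<phi> [c, e, k]) = (\<Sum>h\<in>UNIV. \<Sum>k\<in>UNIV. w k h * (\<phi> [a, b, h] * \<phi> [c, e, k]))"
      unfolding sum_distrib_right by (subst sum.swap) (simp only: mult_ac)
    also have "\<dots> = - (\<Sum>k\<in>UNIV. \<phi> [a, b, k] * (\<Sum>h\<in>UNIV. w k h * \<phi> [c, e, h]))"
      unfolding sum_distrib_left sum_negf[symmetric] by (rule sum.cong[OF refl], rule sum.cong[OF refl], subst w) simp
    finally show ?thesis by simp
  qed
  have sw: "(\<Sum>k\<in>UNIV. (\<Sum>h\<in>UNIV. w i h * g h k) * g' k) = (\<Sum>h\<in>UNIV. w i h * (\<Sum>k\<in>UNIV. g h k * g' k))"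
    "(\<Sum>k\<in>UNIV. g' k * (\<Sum>h\<in>UNIV. w i h * g h k)) = (\<Sum>h\<in>UNIV. w i h * (\<Sum>k\<in>UNIV. g' k * g h k))" for i and g :: "7 \<Rightarrow> 7 \<Rightarrow> real" and g'
    unfolding sum_distrib_right sum_distrib_left by (subst sum.swap, simp only: mult_ac)+
  have L: "(\<Sum>k\<in>UNIV. \<phi> [a, b, k] * rho w [c, e, k] \<phi> + rho w [a, b, k] \<phi> * \<phi> [c, e, k]) =
     (\<Sum>h\<in>UNIV. w a h * P h b c e) + (\<Sum>h\<in>UNIV. w b h * P a h c e) + (\<Sum>h\<in>UNIV. w c h * P a b h e) + (\<Sum>h\<in>UNIV. w e h * P a b c h)"
    using last by (simp add: distrib_left distrib_right sum.distrib sw P_def)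
  have R: "rho w [a, b, c, e] \<psi> = - ((\<Sum>h\<in>UNIV. w a h * P h b c e) + (\<Sum>h\<in>UNIV. w b h * P a h c e) + (\<Sum>h\<in>UNIV. w c h * P a b h e) + (\<Sum>h\<in>UNIV. w e h * P a b c h))"
  proof -
    have k1: "(\<Sum>h\<in>UNIV. w i h * (kd h j * y - kd h l * z - t h)) = w i j * y - w i l * z - (\<Sum>h\<in>UNIV. w i h * t h)"
      "(\<Sum>h\<in>UNIV. w i h * (y * kd h j - z * kd h l - t h)) = w i j * y - w i l * z - (\<Sum>h\<in>UNIV. w i h * t h)"
      "(\<Sum>h\<in>UNIV. w i h * (y * kd h j - kd h l * z - t h)) = w i j * y - w i l * z - (\<Sum>h\<in>UNIV. w i h * t h)"
      "(\<Sum>h\<in>UNIV. w i h * (kd h j * y - z * kd h l - t h)) = w i j * y - w i l * z - (\<Sum>h\<in>UNIV. w i h * t h)" for i j l y z t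
      by (simp_all add: right_diff_distrib sum_subtractf mult.assoc[symmetric] sum_distrib_right[symmetric])
    have "rho w [a, b, c, e] \<psi> = (\<Sum>h\<in>UNIV. w a h * (kd h c * kd b e - kd h e * kd b c - P h b c e))
       + (\<Sum>h\<in>UNIV. w b h * (kd a c * kd h e - kd a e * kd h c - P a h c e))
       + (\<Sum>h\<in>UNIV. w c h * (kd h a * kd b e - kd a e * kd h b - P a b h e))
       + (\<Sum>h\<in>UNIV. w e h * (kd a c * kd h b - kd h a * kd b c - P a b c h))"
      by (simp add: p P_def kd_sym[of a] kd_sym[of b])
    thus ?thesis unfolding k1 using w[of a c] w[of a e] w[of b c] w[of b e] by simp
  qed
  have "(\<Sum>k\<in>UNIV. \<phi> [a, b, k] * d c e k + d a b k * \<phi> [c, e, k]) =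
     (\<Sum>k\<in>UNIV. \<phi> [a, b, k] * rho w [c, e, k] \<phi> + rho w [a, b, k] \<phi> * \<phi> [c, e, k])
     + (\<Sum>k\<in>UNIV. \<phi> [a, b, k] * (\<Sum>q\<in>UNIV. x $ q * \<psi> [q, c, e, k]) + (\<Sum>q\<in>UNIV. x $ q * \<psi> [q, a, b, k]) * \<phi> [c, e, k])"
    unfolding d distrib_left distrib_right sum.distrib by simp
  thus ?thesis unfolding L X R by simp
qed

end

section \<open>Covariant derivatives as derivations, in a frame\<close>

lemma rho_update: "(\<Sum>r<length is. \<Sum>a\<in>UNIV. w (is ! r) a * t (is[r := a])) = rho w is t"
  by (induction "is" arbitrary: t) (simp_all add: sum.lessThan_Suc_shift del: sum.lessThan_Suc)

lemma rho_weight_add: "rho (\<lambda>k l. w k l + w' k l) is t = rho w is t + rho w' is t"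
  by (induction "is" arbitrary: t) (simp_all add: distrib_right sum.distrib)

lemma rho_weight_diff: "rho (\<lambda>k l. w k l - w' k l) is t = rho w is t - rho w' is t"
  by (induction "is" arbitrary: t) (simp_all add: left_diff_distrib sum_subtractf)

lemma rho_weight_sum: "rho (\<lambda>k l. \<Sum>a\<in>A. c a * w a k l) is t = (\<Sum>a\<in>A. c a * rho (w a) is t)"
proof (induction "is" arbitrary: t)
  case (Cons i "is")
  have "(\<Sum>d\<in>UNIV. (\<Sum>a\<in>A. c a * w a i d) * t (d # is)) = (\<Sum>a\<in>A. c a * (\<Sum>d\<in>UNIV. w a i d * t (d # is)))"
    unfolding sum_distrib_left sum_distrib_right by (subst sum.swap) (simp only: mult_ac)
  thus ?case by (simp add: Cons distrib_left sum.distrib)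
qed simp

lemma sum_skew_weight:
  fixes w :: "7 \<Rightarrow> 7 \<Rightarrow> real"
  assumes "\<And>i d. w d i = - w i d" and "\<And>i d. g d i = g i d"
  shows "(\<Sum>i\<in>UNIV. \<Sum>d\<in>UNIV. w i d * g i d) = 0"
  by (rule sum2_skew_sym) (rule assms)+

context moving_frame
begin

lemma cov_deriv_rho: "cov_deriv \<gamma> E t v (m # is) = der m (\<lambda>v. t v is) v - rho (\<lambda>i a. \<omega> m i a v) is (t v)"
  by (simp add: rho_update[where w = "\<lambda>i a. \<omega> m i a v"])

text \<open>By metric compatibility and torsion-freeness the Lie derivative of the metric is the
  symmetrised covariant derivative of the field.\<close>

lemma lie_metric_frame:
  assumes v: "v \<in> W" and c: "\<And>k. smooth_fun W (c k)"
  shows "lie_metric \<gamma> E (\<lambda>v. \<Sum>k\<in>UNIV. c k v *\<^sub>R E k v) v $ a $ b =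
    (der a (c b) v - (\<Sum>d\<in>UNIV. \<omega> a b d v * c d v)) + (der b (c a) v - (\<Sum>d\<in>UNIV. \<omega> b a d v * c d v))"
proof -
  let ?Y = "\<lambda>v. \<Sum>k\<in>UNIV. c k v *\<^sub>R E k v"
  have Y: "vsmooth ?Y" by (intro vsmooth_comb c vsmooth_E)
  have 0: "frechet_derivative (\<lambda>v. ginner (\<gamma> v) (E a v) (E b v)) (at v) = (\<lambda>x. 0)"
    by (subst pderiv_cong[OF W v, of _ "\<lambda>v. kd a b"]) (simp_all add: orthonormal)
  have 1: "ginner (\<gamma> v) (nabla \<gamma> (E a) ?Y v) (E b v) = der a (c b) v - (\<Sum>d\<in>UNIV. \<omega> a b d v * c d v)" for a b
  proof -
    have "ginner (\<gamma> v) (nabla \<gamma> (E a) ?Y v) (E b v) = der a (c b) v + (\<Sum>d\<in>UNIV. c d v * \<omega> a d b v)"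
      unfolding nabla_comb[OF v c] sum.distrib ginner_add ginner_sum
      by (simp add: orthonormal[OF v] conn_coeff_def)
    thus ?thesis by (subst (asm) \<omega>_skew[OF v]) (simp add: sum_negf mult.commute)
  qed
  show ?thesis
    using metric_compatible[OF v vsmooth_E[of a] vsmooth_E[of b], of ?Y] ginner_sym[OF v, of "E a v"] 1[of a b] 1[of b a]
    by (simp add: lie_metric_def 0 torsion_free[OF v Y vsmooth_E] ginner_diff)
qed

end

text \<open>\<open>f\<close>, \<open>p\<close> and \<open>t\<close> are the frame components of
  \<phi>, \<psi> and the torsion. Through \<open>alg\<close>, which holds at all points of the open
  set, \<open>p\<close> is a polynomial in \<open>f\<close>; its smoothness and derivatives come
  from there.\<close>

locale g2_frame = moving_frame \<gamma> W E for \<gamma> :: local_tensor and W and E :: frame +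
  fixes f p t :: local_tensor
  assumes f_smooth: "smooth_fun W (\<lambda>v. f v [i, j, k])"
    and t_smooth: "smooth_fun W (\<lambda>v. t v [i, j])"
    and alg: "v \<in> W \<Longrightarrow> g2_alg (f v) (p v)"
    and torsion: "v \<in> W \<Longrightarrow> cov_deriv \<gamma> E f v [m, i, j, k] = (\<Sum>q\<in>UNIV. t v [m, q] * p v [q, i, j, k])"
begin

abbreviation w :: "7 \<Rightarrow> real^7 \<Rightarrow> 7 \<Rightarrow> 7 \<Rightarrow> real" where
  "w m v \<equiv> \<lambda>i a. \<omega> m i a v"

lemma der_f: "v \<in> W \<Longrightarrow> der m (\<lambda>v. f v [a, b, c]) v =
    rho (w m v) [a, b, c] (f v) + (\<Sum>q\<in>UNIV. t v [m, q] * p v [q, a, b, c])"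
  using torsion[of v m a b c] unfolding cov_deriv_rho by linarith

lemma p_eq: "v \<in> W \<Longrightarrow> p v [a, b, c, e] = kd a c * kd b e - kd a e * kd b c - (\<Sum>k\<in>UNIV. f v [a, b, k] * f v [c, e, k])"
  using g2_alg.phi_phi[OF alg, of v a b c e] by linarith

lemma p_smooth: "smooth_fun W (\<lambda>v. p v [a, b, c, e])"
  by (rule smooth_fun_cong[OF W, of "\<lambda>v. kd a c * kd b e - kd a e * kd b c - (\<Sum>k\<in>UNIV. f v [a, b, k] * f v [c, e, k])"])
     (simp add: p_eq, intro smooth f_smooth)

lemma der_p:
  assumes v: "v \<in> W"
  shows "der m (\<lambda>v. p v [a, b, c, e]) v = rho (w m v) [a, b, c, e] (p v)
     - (t v [m, a] * f v [b, c, e] - t v [m, b] * f v [a, c, e] + t v [m, c] * f v [a, b, e] - t v [m, e] * f v [a, b, c])"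
proof -
  interpret g2_alg "f v" "p v" by (rule alg[OF v])
  have "der m (\<lambda>v. p v [a, b, c, e]) v = der m (\<lambda>v. kd a c * kd b e - kd a e * kd b c - (\<Sum>k\<in>UNIV. f v [a, b, k] * f v [c, e, k])) v"
    by (rule der_cong[OF v]) (rule p_eq)
  also have "\<dots> = der m (\<lambda>v. kd a c * kd b e - kd a e * kd b c) v - der m (\<lambda>v. \<Sum>k\<in>UNIV. f v [a, b, k] * f v [c, e, k]) v"
    by (rule fd_rules(2)) (use v in \<open>auto intro!: smooth f_smooth\<close>)
  also have "\<dots> = - (\<Sum>k\<in>UNIV. f v [a, b, k] * der m (\<lambda>v. f v [c, e, k]) v + der m (\<lambda>v. f v [a, b, k]) v * f v [c, e, k])"
    using v by (simp add: fd_sum fd_rules smooth f_smooth)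
  also have "\<dots> = rho (w m v) [a, b, c, e] (p v)
     - ((\<chi> q. t v [m, q]) $ a * f v [b, c, e] - (\<chi> q. t v [m, q]) $ b * f v [a, c, e]
        + (\<chi> q. t v [m, q]) $ c * f v [a, b, e] - (\<chi> q. t v [m, q]) $ e * f v [a, b, c])"
    by (rule psi_derivation, rule \<omega>_skew[OF v]) (simp add: der_f[OF v] del: rho.simps)
  finally show ?thesis by simp
qed

text \<open>The terms mixing torsion and connection are collected so as to be symmetric in
  \<open>i\<close> and \<open>j\<close>: they disappear on antisymmetrisation. The summand with
  \<open>t v [j, d]\<close> completes the derivative of the torsion in its last slot and stems from
  the first slot of \<psi>.\<close>

lemma der_der_f:
  assumes v: "v \<in> W"
  shows "der i (\<lambda>v. der j (\<lambda>v. f v [a, b, c]) v) v =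
     rho (\<lambda>k l. der i (\<omega> j k l) v) [a, b, c] (f v) + rho (w j v) [a, b, c] (\<lambda>js. rho (w i v) js (f v))
     + (\<Sum>q\<in>UNIV. t v [i, q] * rho (w j v) [a, b, c] (\<lambda>js. p v (q # js)))
     + (\<Sum>q\<in>UNIV. t v [j, q] * rho (w i v) [a, b, c] (\<lambda>js. p v (q # js)))
     + (\<Sum>q\<in>UNIV. (der i (\<lambda>v. t v [j, q]) v + (\<Sum>d\<in>UNIV. t v [j, d] * w i v d q)) * p v [q, a, b, c])
     - (\<Sum>q\<in>UNIV. t v [j, q] * (t v [i, q] * f v [a, b, c] - t v [i, a] * f v [q, b, c] + t v [i, b] * f v [q, a, c] - t v [i, c] * f v [q, a, b]))"
proof -
  have "der i (\<lambda>v. der j (\<lambda>v. f v [a, b, c]) v) v = der i (\<lambda>v. rho (w j v) [a, b, c] (f v) + (\<Sum>q\<in>UNIV. t v [j, q] * p v [q, a, b, c])) v"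
    by (rule der_cong[OF v]) (rule der_f)
  also have "\<dots> = rho (\<lambda>k l. der i (\<omega> j k l) v) [a, b, c] (f v) + rho (w j v) [a, b, c] (\<lambda>js. der i (\<lambda>v. f v js) v)
     + ((\<Sum>q\<in>UNIV. t v [j, q] * der i (\<lambda>v. p v [q, a, b, c]) v) + (\<Sum>q\<in>UNIV. der i (\<lambda>v. t v [j, q]) v * p v [q, a, b, c]))"
    using v by (simp add: fd_sum fd_rules smooth smooth_\<omega> f_smooth t_smooth p_smooth sum.distrib)
  also have "rho (w j v) [a, b, c] (\<lambda>js. der i (\<lambda>v. f v js) v) =
     rho (w j v) [a, b, c] (\<lambda>js. rho (w i v) js (f v) + (\<Sum>q\<in>UNIV. t v [i, q] * p v (q # js)))"
  proof (rule rho_cong)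
    fix js :: "7 list" assume "length js = length [a, b, c]"
    then obtain x y z where "js = [x, y, z]" using length3[of js] by auto
    thus "der i (\<lambda>v. f v js) v = rho (w i v) js (f v) + (\<Sum>q\<in>UNIV. t v [i, q] * p v (q # js))"
      using der_f[OF v, where m = i and a = x and b = y and c = z] by simp
  qed
  also have "\<dots> = rho (w j v) [a, b, c] (\<lambda>js. rho (w i v) js (f v)) + (\<Sum>q\<in>UNIV. t v [i, q] * rho (w j v) [a, b, c] (\<lambda>js. p v (q # js)))"
    by (simp only: rho_add rho_linear)
  also have "(\<Sum>q\<in>UNIV. t v [j, q] * der i (\<lambda>v. p v [q, a, b, c]) v) =
     (\<Sum>q\<in>UNIV. t v [j, q] * rho (w i v) [a, b, c] (\<lambda>js. p v (q # js)))
     + (\<Sum>q\<in>UNIV. (\<Sum>d\<in>UNIV. t v [j, d] * w i v d q) * p v [q, a, b, c])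
     - (\<Sum>q\<in>UNIV. t v [j, q] * (t v [i, q] * f v [a, b, c] - t v [i, a] * f v [q, b, c] + t v [i, b] * f v [q, a, c] - t v [i, c] * f v [q, a, b]))"
  proof -
    have "(\<Sum>q\<in>UNIV. (\<Sum>d\<in>UNIV. t v [j, d] * w i v d q) * p v [q, a, b, c]) = (\<Sum>d\<in>UNIV. t v [j, d] * (\<Sum>q\<in>UNIV. w i v d q * p v [q, a, b, c]))"
      unfolding sum_distrib_left sum_distrib_right by (subst sum.swap) (simp only: mult_ac)
    thus ?thesis
      unfolding der_p[OF v] rho.simps(2)[of _ _ "[a, b, c]"] right_diff_distrib[of _ "_ + _"] distrib_left[of _ "sum _ _"] sum.distrib sum_subtractf
      by linarith
  qed
  finally show ?thesis by (simp only: distrib_right sum.distrib add_ac diff_conv_add_uminus)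
qed

text \<open>Two evaluations of the commutator of derivatives on \<phi>: by
  \<open>der_commute\<close>, and by antisymmetrising \<open>der_der_f\<close>. Their comparison
  assembles curvature and antisymmetrised derivative of the torsion, the structure functions being
  absorbed into both.\<close>

lemma ricci:
  assumes v: "v \<in> W"
  shows "rho (\<lambda>k l. riemann \<gamma> E v $ i $ j $ k $ l) [a, b, c] (f v)
      + (\<Sum>q\<in>UNIV. (cov_deriv \<gamma> E t v [i, j, q] - cov_deriv \<gamma> E t v [j, i, q]) * p v [q, a, b, c])
      - (\<Sum>q\<in>UNIV. t v [j, q] * (t v [i, q] * f v [a, b, c] - t v [i, a] * f v [q, b, c] + t v [i, b] * f v [q, a, c] - t v [i, c] * f v [q, a, b]))
      + (\<Sum>q\<in>UNIV. t v [i, q] * (t v [j, q] * f v [a, b, c] - t v [j, a] * f v [q, b, c] + t v [j, b] * f v [q, a, c] - t v [j, c] * f v [q, a, b])) = 0"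
proof -
  have R: "rho (\<lambda>k l. riemann \<gamma> E v $ i $ j $ k $ l) [a, b, c] (f v) =
     rho (\<lambda>k l. der i (\<omega> j k l) v) [a, b, c] (f v) - rho (\<lambda>k l. der j (\<omega> i k l) v) [a, b, c] (f v)
     + (rho (w j v) [a, b, c] (\<lambda>js. rho (w i v) js (f v)) - rho (w i v) [a, b, c] (\<lambda>js. rho (w j v) js (f v)))
     - (\<Sum>e\<in>UNIV. struc i j e v * rho (w e v) [a, b, c] (f v))"
    unfolding riemann_frame[OF v] rho_weight_add rho_weight_diff rho_commutator rho_weight_sum ..
  have B: "cov_deriv \<gamma> E t v [i, j, q] - cov_deriv \<gamma> E t v [j, i, q] =
     (der i (\<lambda>v. t v [j, q]) v + (\<Sum>d\<in>UNIV. t v [j, d] * w i v d q))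
     - (der j (\<lambda>v. t v [i, q]) v + (\<Sum>d\<in>UNIV. t v [i, d] * w j v d q)) - (\<Sum>e\<in>UNIV. struc i j e v * t v [e, q])" for q
  proof -
    have "(\<Sum>d\<in>UNIV. w m v q d * t v [n, d]) = - (\<Sum>d\<in>UNIV. t v [n, d] * w m v d q)" for m n
      unfolding sum_negf[symmetric] by (rule sum.cong[OF refl], subst \<omega>_skew[OF v]) simp
    moreover have "(\<Sum>e\<in>UNIV. struc i j e v * t v [e, q]) = (\<Sum>d\<in>UNIV. w i v j d * t v [d, q]) - (\<Sum>d\<in>UNIV. w j v i d * t v [d, q])"
      by (simp add: struc_def left_diff_distrib sum_subtractf)
    ultimately show ?thesis unfolding cov_deriv_rho by simp
  qed
  have S: "(\<Sum>q\<in>UNIV. (\<Sum>e\<in>UNIV. struc i j e v * t v [e, q]) * p v [q, a, b, c]) =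
     (\<Sum>e\<in>UNIV. struc i j e v * (\<Sum>q\<in>UNIV. t v [e, q] * p v [q, a, b, c]))"
    unfolding sum_distrib_left sum_distrib_right by (subst sum.swap) (simp only: mult_ac)
  have C: "der i (\<lambda>v. der j (\<lambda>v. f v [a, b, c]) v) v - der j (\<lambda>v. der i (\<lambda>v. f v [a, b, c]) v) v =
     (\<Sum>e\<in>UNIV. struc i j e v * rho (w e v) [a, b, c] (f v)) + (\<Sum>e\<in>UNIV. struc i j e v * (\<Sum>q\<in>UNIV. t v [e, q] * p v [q, a, b, c]))"
    unfolding der_commute[OF v f_smooth] der_f[OF v] distrib_left sum.distrib ..
  have B': "(\<Sum>q\<in>UNIV. (cov_deriv \<gamma> E t v [i, j, q] - cov_deriv \<gamma> E t v [j, i, q]) * p v [q, a, b, c]) =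
     (\<Sum>q\<in>UNIV. (der i (\<lambda>v. t v [j, q]) v + (\<Sum>d\<in>UNIV. t v [j, d] * w i v d q)) * p v [q, a, b, c])
     - (\<Sum>q\<in>UNIV. (der j (\<lambda>v. t v [i, q]) v + (\<Sum>d\<in>UNIV. t v [i, d] * w j v d q)) * p v [q, a, b, c])
     - (\<Sum>e\<in>UNIV. struc i j e v * (\<Sum>q\<in>UNIV. t v [e, q] * p v [q, a, b, c]))"
    unfolding B left_diff_distrib sum_subtractf S ..
  show ?thesis
    unfolding R B' using C der_der_f[OF v, where i = i and j = j and a = a and b = b and c = c]
      der_der_f[OF v, where i = j and j = i and a = a and b = b and c = c] by linarith
qed

abbreviation Tm :: "real^7 \<Rightarrow> real^7^7" where "Tm v \<equiv> \<chi> i j. t v [i, j]"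
abbreviation Dt :: "real^7 \<Rightarrow> real^7^7^7" where "Dt v \<equiv> \<chi> m i j. cov_deriv \<gamma> E t v [m, i, j]"

theorem g2_bianchi:
  assumes v: "v \<in> W"
  shows "bianchi_G (f v) (Tm v) (Dt v) (riemann \<gamma> E v) = 0"
proof -
  interpret g2_alg "f v" "p v" by (rule alg[OF v])
  have "bianchi_G (f v) (Tm v) (Dt v) (riemann \<gamma> E v) $ s $ i $ j = 0" for s i j
    using g2_ricci_contract[of "riemann \<gamma> E v $ i $ j" "\<chi> q. cov_deriv \<gamma> E t v [i, j, q] - cov_deriv \<gamma> E t v [j, i, q]"
        "\<chi> q. t v [j, q]" "\<chi> q. t v [i, q]" s] ricci[OF v, of i j]
    unfolding bianchi_G_def vec_lambda_beta by (simp del: rho.simps cov_deriv.simps)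
  thus ?thesis by (simp add: vec_eq_iff)
qed

lemma der_t: "der m (\<lambda>v. t v [i, j]) v = Dt v $ m $ i $ j + rho (w m v) [i, j] (t v)"
  using cov_deriv_rho[of t v m "[i, j]"] by simp

text \<open>The connection terms pair coefficients skew in two indices with an expression symmetric
  in them, so the trace commutes with covariant differentiation.\<close>

lemma cov_deriv_trace:
  assumes v: "v \<in> W"
  shows "cov_deriv \<gamma> E (\<lambda>v is. trace (Tm v)) v [k] = trace (Dt v $ k)"
proof -
  have "cov_deriv \<gamma> E (\<lambda>v is. trace (Tm v)) v [k] = (\<Sum>i\<in>UNIV. der k (\<lambda>v. t v [i, i]) v)"
    using v by (simp add: trace_def fd_sum t_smooth)
  also have "\<dots> = trace (Dt v $ k) + (\<Sum>i\<in>UNIV. \<Sum>d\<in>UNIV. w k v i d * (t v [d, i] + t v [i, d]))"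
    unfolding der_t by (simp add: trace_def sum.distrib distrib_left del: cov_deriv.simps)
  also have "(\<Sum>i\<in>UNIV. \<Sum>d\<in>UNIV. w k v i d * (t v [d, i] + t v [i, d])) = 0"
    by (rule sum_skew_weight[where w = "w k v", OF \<omega>_skew[OF v]]) simp
  finally show ?thesis by simp
qed

lemma VV_smooth: "smooth_fun W (\<lambda>v. VV (f v) (Tm v) $ k)"
  unfolding VV_def vec_lambda_beta by (intro smooth f_smooth t_smooth)

text \<open>In the two contracted slots the connection terms of torsion and form cancel by skewness;
  in the free slot they are exactly the connection term of the vector, which \<open>hd\<close>
  presents as a tensor with one index.\<close>

lemma cov_deriv_VV:
  assumes v: "v \<in> W"
  shows "cov_deriv \<gamma> E (\<lambda>v is. VV (f v) (Tm v) $ hd is) v [m, k] = nabla_VV (f v) (p v) (Tm v) (Dt v) $ m $ k"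
proof -
  let ?w = "w m v"
  have sk: "?w d i = - ?w i d" for d i by (rule \<omega>_skew[OF v])
  have "der m (\<lambda>v. VV (f v) (Tm v) $ k) v =
      (\<Sum>i\<in>UNIV. \<Sum>j\<in>UNIV. t v [i, j] * der m (\<lambda>v. f v [i, j, k]) v + der m (\<lambda>v. t v [i, j]) v * f v [i, j, k])"
    using v by (simp add: VV_def fd_sum fd_rules smooth f_smooth t_smooth)
  also have "\<dots> = nabla_VV (f v) (p v) (Tm v) (Dt v) $ m $ k
     + (\<Sum>i\<in>UNIV. \<Sum>j\<in>UNIV. t v [i, j] * rho ?w [i, j, k] (f v) + rho ?w [i, j] (t v) * f v [i, j, k])"
    unfolding der_f[OF v] der_t nabla_VV_def by (simp add: sum.distrib distrib_left distrib_right del: rho.simps cov_deriv.simps)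
  also have "(\<Sum>i\<in>UNIV. \<Sum>j\<in>UNIV. t v [i, j] * rho ?w [i, j, k] (f v) + rho ?w [i, j] (t v) * f v [i, j, k]) =
     (\<Sum>i\<in>UNIV. \<Sum>j\<in>UNIV. \<Sum>d\<in>UNIV. ?w i d * (t v [i, j] * f v [d, j, k] + t v [d, j] * f v [i, j, k]))
     + (\<Sum>i\<in>UNIV. \<Sum>j\<in>UNIV. \<Sum>d\<in>UNIV. ?w j d * (t v [i, j] * f v [i, d, k] + t v [i, d] * f v [i, j, k]))
     + (\<Sum>i\<in>UNIV. \<Sum>j\<in>UNIV. \<Sum>d\<in>UNIV. ?w k d * (t v [i, j] * f v [i, j, d]))"
    by (simp add: sum.distrib[symmetric] sum_distrib_left sum_distrib_right algebra_simps)
  also have "(\<Sum>i\<in>UNIV. \<Sum>j\<in>UNIV. \<Sum>d\<in>UNIV. ?w i d * (t v [i, j] * f v [d, j, k] + t v [d, j] * f v [i, j, k])) = 0"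
  proof -
    have "(\<Sum>i\<in>UNIV. \<Sum>d\<in>UNIV. ?w i d * (t v [i, j] * f v [d, j, k] + t v [d, j] * f v [i, j, k])) = 0" for j
      by (rule sum_skew_weight[OF sk]) simp
    thus ?thesis by (subst sum.swap) simp
  qed
  also have "(\<Sum>i\<in>UNIV. \<Sum>j\<in>UNIV. \<Sum>d\<in>UNIV. ?w j d * (t v [i, j] * f v [i, d, k] + t v [i, d] * f v [i, j, k])) = 0"
    by (rule sum.neutral, rule ballI, rule sum_skew_weight[OF sk]) simp
  also have "(\<Sum>i\<in>UNIV. \<Sum>j\<in>UNIV. \<Sum>d\<in>UNIV. ?w k d * (t v [i, j] * f v [i, j, d])) = rho ?w [k] (\<lambda>is. VV (f v) (Tm v) $ hd is)"
  proof -
    have "(\<Sum>i\<in>UNIV. \<Sum>j\<in>UNIV. \<Sum>d\<in>UNIV. ?w k d * (t v [i, j] * f v [i, j, d])) =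
      (\<Sum>d\<in>UNIV. \<Sum>i\<in>UNIV. \<Sum>j\<in>UNIV. ?w k d * (t v [i, j] * f v [i, j, d]))"
      by (rule sum_rot3[symmetric])
    thus ?thesis by (simp add: VV_def sum_distrib_left)
  qed
  finally show ?thesis unfolding cov_deriv_rho by simp
qed

lemma lie_metric_VV:
  assumes v: "v \<in> W"
  defines "dY \<equiv> nabla_VV (f v) (p v) (Tm v) (Dt v)"
  shows "lie_metric \<gamma> E (\<lambda>v. \<Sum>k\<in>UNIV. VV (f v) (Tm v) $ k *\<^sub>R E k v) v = dY + transpose dY"
proof -
  have "dY $ a $ b = der a (\<lambda>v. VV (f v) (Tm v) $ b) v - (\<Sum>d\<in>UNIV. \<omega> a b d v * VV (f v) (Tm v) $ d)" for a b
    using cov_deriv_VV[OF v, of a b] unfolding dY_def cov_deriv_rho by simp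
  thus ?thesis
    by (simp add: vec_eq_iff transpose_def lie_metric_frame[OF v VV_smooth])
qed

end

subsection \<open>The relations\<close>

text \<open>The difference of the two sides of each relation is a linear map at
  \<open>bianchi_G\<close>, and linear maps vanish at 0.\<close>

lemma independent_relations_zero:
  assumes ind: "independent_relations \<phi> \<psi>" and R: "algebraic_curvature Rm" and G: "bianchi_G \<phi> T D Rm = 0"
  defines "Y \<equiv> VV \<phi> T" and "dY \<equiv> nabla_VV \<phi> \<psi> T D"
  shows "trace (Rc Rm) = (trace T)\<^sup>2 - T \<bullet> transpose T - T \<bullet> PP \<psi> T - 2 * trace dY"
    "div_transp D - (\<chi> k. trace (D $ k)) - T *v Y = 0"
    "nabla_psi \<psi> D - trace T *\<^sub>R Y + VV \<phi> (T ** T) + transpose T *v Y = 0"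
    "part14 \<psi> (K3 \<phi> D) = - trace T *\<^sub>R part14 \<psi> T + part14 \<psi> (T ** T) + part14 \<psi> (PP \<psi> T ** T)"
    "part27 (K3 \<phi> D) = (1/2) *\<^sub>R part27 (circ_prod \<phi> T T) + (1/4) *\<^sub>R part27 (F_tensor \<phi> Rm)"
    "part27 (K2 \<phi> D) = - (1/2) *\<^sub>R part27 (dY + transpose dY) + trace T *\<^sub>R part27 T - part27 (T ** T) - part27 (Rc Rm)"
proof -
  obtain L1 L7a L7b L14 L27a L27b where
    c: "G2_component \<phi> (\<lambda>A x. x) (UNIV :: real set) 1 L1" "G2_component \<phi> act1 UNIV 7 L7a" "G2_component \<phi> act1 UNIV 7 L7b"
      "G2_component \<phi> act2 (Omega14 \<psi>) 14 L14" "G2_component \<phi> act2 Sym0 27 L27a" "G2_component \<phi> act2 Sym0 27 L27b"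
    and all: "\<forall>T D Rm. algebraic_curvature Rm \<longrightarrow>
       (let H = bianchi_G \<phi> T D Rm; Y = VV \<phi> T; dY = nabla_VV \<phi> \<psi> T D; dtr = (\<chi> k. trace (D $ k)) in
          L1 H = trace (Rc Rm) - ((trace T)\<^sup>2 - T \<bullet> transpose T - T \<bullet> PP \<psi> T - 2 * trace dY) \<and>
          L7a H = div_transp D - dtr - T *v Y \<and>
          L7b H = nabla_psi \<psi> D - trace T *\<^sub>R Y + VV \<phi> (T ** T) + transpose T *v Y \<and>
          L14 H = part14 \<psi> (K3 \<phi> D)
            - (- trace T *\<^sub>R part14 \<psi> T + part14 \<psi> (T ** T) + part14 \<psi> (PP \<psi> T ** T)) \<and>
          L27a H = part27 (K3 \<phi> D)
            - ((1/2) *\<^sub>R part27 (circ_prod \<phi> T T) + (1/4) *\<^sub>R part27 (F_tensor \<phi> Rm)) \<and>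
          L27b H = part27 (K2 \<phi> D)
            - (- (1/2) *\<^sub>R part27 (dY + transpose dY) + trace T *\<^sub>R part27 T
               - part27 (T ** T) - part27 (Rc Rm)))"
    using ind unfolding independent_relations_def by (elim exE conjE) (rule that)
  have z: "L1 0 = 0" "L7a 0 = 0" "L7b 0 = 0" "L14 0 = 0" "L27a 0 = 0" "L27b 0 = 0"
    using c unfolding G2_component_def by (simp_all add: linear_0)
  note r = all[rule_format, OF R, of T D, unfolded Let_def G z, folded Y_def dY_def]
  show "trace (Rc Rm) = (trace T)\<^sup>2 - T \<bullet> transpose T - T \<bullet> PP \<psi> T - 2 * trace dY"
    using r by simp
  show "div_transp D - (\<chi> k. trace (D $ k)) - T *v Y = 0"
    using r by metis
  show "nabla_psi \<psi> D - trace T *\<^sub>R Y + VV \<phi> (T ** T) + transpose T *v Y = 0"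
    using r by metis
  show "part14 \<psi> (K3 \<phi> D) = - trace T *\<^sub>R part14 \<psi> T + part14 \<psi> (T ** T) + part14 \<psi> (PP \<psi> T ** T)"
    using r by (metis eq_iff_diff_eq_0)
  show "part27 (K3 \<phi> D) = (1/2) *\<^sub>R part27 (circ_prod \<phi> T T) + (1/4) *\<^sub>R part27 (F_tensor \<phi> Rm)"
    using r by (metis eq_iff_diff_eq_0)
  show "part27 (K2 \<phi> D) = - (1/2) *\<^sub>R part27 (dY + transpose dY) + trace T *\<^sub>R part27 T - part27 (T ** T) - part27 (Rc Rm)"
    using r by (metis eq_iff_diff_eq_0)
qed

text \<open>Evaluation on the frame is a pull-back, under which the metric becomes the dot product.
  The volume picks up the determinant of the frame, whose square is inverse to the determinant of
  the metric; its sign stays open.\<close>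

lemma g2_structure_frame:
  assumes G: "g2_structure atlas phi g vol" and C: "C \<in> atlas" and E: "orthonormal_frame C g W E" and v: "v \<in> W"
  shows "g2_form (frame_tensor E (phi C) v) (frame_tensor E (vol C) v) (\<bullet>)" "(frame_tensor E (vol C) v ix)\<^sup>2 = 1"
proof -
  have vC: "v \<in> chart_image C" and on: "\<And>i j. ginner (g C v) (E i v) (E j v) = kd i j"
    using E v by (auto simp: orthonormal_frame_def kd_def)
  have alt: "alternating 7 (vol C v)"
    using G C vC by (auto simp: g2_structure_def diff_form_def volume_form_def)
  have "g2_form (phi C v) (vol C v) (ginner (g C v))"
    using G C vC by (auto simp: g2_form_def g2_structure_def diff_form_def volume_form_def)
  from g2_form_comps[OF this, of "\<lambda>i. E i v"]
  have "g2_form (frame_tensor E (phi C) v) (frame_tensor E (vol C) v)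
      (\<lambda>x y. ginner (g C v) (\<Sum>m\<in>UNIV. x $ m *\<^sub>R E m v) (\<Sum>m\<in>UNIV. y $ m *\<^sub>R E m v))"
    by (simp add: frame_tensor_def)
  moreover have "ginner (g C v) (\<Sum>m\<in>UNIV. x $ m *\<^sub>R E m v) (\<Sum>m\<in>UNIV. y $ m *\<^sub>R E m v) = x \<bullet> y" for x y :: "real^7"
    by (simp add: ginner_sum on inner_vec_def mult.commute)
  ultimately show "g2_form (frame_tensor E (phi C) v) (frame_tensor E (vol C) v) (\<bullet>)" by simp
  define M where "M = (\<chi> i j. E i v $ j)"
  have "(M ** gmatrix (g C v) ** transpose M) $ i $ j = kd i j" for i j
  proof -
    have "(M ** (gmatrix (g C v) ** transpose M)) $ i $ j = ginner (g C v) (E i v) (E j v)"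
      by (simp add: matrix_matrix_mult_def transpose_def M_def gmatrix_def ginner_def sum_distrib_left mult_ac)
    thus ?thesis by (simp add: on matrix_mul_assoc)
  qed
  hence "M ** gmatrix (g C v) ** transpose M = mat 1" by (simp add: vec_eq_iff mat_def kd_def)
  hence "det (M ** gmatrix (g C v) ** transpose M) = 1" by simp
  hence "(det M)\<^sup>2 * det (gmatrix (g C v)) = 1" by (simp add: det_mul power2_eq_square mult_ac)
  moreover have "(vol C v ix)\<^sup>2 = det (gmatrix (g C v))"
    using G C vC ix_nth(1,2) by (auto simp: g2_structure_def volume_form_def)
  moreover have "frame_tensor E (vol C) v ix = det M * vol C v ix"
    using comps_det[OF alt, of "\<lambda>i. E i v"] by (simp add: frame_tensor_def M_def)
  ultimately show "(frame_tensor E (vol C) v ix)\<^sup>2 = 1" by (simp add: power_mult_distrib)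
qed

lemma smooth_frame_tensor:
  assumes W: "open W" and E: "\<And>i k. smooth_fun W (\<lambda>u. E i u $ k)"
    and t: "\<And>is. length is = n \<Longrightarrow> smooth_fun W (\<lambda>u. t u is)"
  shows "length is = n \<Longrightarrow> smooth_fun W (\<lambda>u. frame_tensor E t u is)"
  unfolding frame_tensor_def comps_def
  by (intro smooth_fun_sum[OF W] smooth_fun_mult[OF W] smooth_fun_prod[OF W] E) (simp add: t)

theorem theorem5p8:
  fixes M :: "'a topology" and atlas :: "'a chart set"
    and phi g vol tors :: "'a tensor_field"
    and C :: "'a chart" and W :: "(real^7) set" and E :: frame and u :: "real^7"
  assumes "smooth_manifold M atlas"
    and "g2_structure atlas phi g vol"
    and "torsion_of atlas phi g vol tors"
    and "C \<in> atlas" and "orthonormal_frame C g W E" and "u \<in> W"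
  shows "let \<phi> = frame_tensor E (phi C);
             \<psi> = psi_frame E (phi C) (vol C) u;
             T' = frame_tensor E (tors C);
             Tm = (\<lambda>v. \<chi> i j. T' v [i, j]);
             T = Tm u;
             D = (\<chi> m i j. cov_deriv (g C) E T' u [m, i, j]);
             Rm = riemann (g C) E u;
             Y = (\<lambda>v. VV (\<phi> v) (Tm v));
             div_Y = (\<Sum>k\<in>UNIV. cov_deriv (g C) E (\<lambda>v is. Y v $ hd is) u [k, k]);
             grad_tr = (\<chi> k. cov_deriv (g C) E (\<lambda>v is. trace (Tm v)) u [k]);
             Lie_Y_g = lie_metric (g C) E (\<lambda>v. \<Sum>k\<in>UNIV. Y v $ k *\<^sub>R E k v) u
         in
           bianchi_G (\<phi> u) T D Rm = 0 \<and>
           trace (Rc Rm) = (trace T)\<^sup>2 - T \<bullet> transpose T - T \<bullet> PP \<psi> T - 2 * div_Y \<and>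
           div_transp D - grad_tr - T *v Y u = 0 \<and>
           nabla_psi \<psi> D - trace T *\<^sub>R Y u + VV (\<phi> u) (T ** T) + transpose T *v Y u = 0 \<and>
           part14 \<psi> (K3 (\<phi> u) D) =
             - trace T *\<^sub>R part14 \<psi> T + part14 \<psi> (T ** T) + part14 \<psi> (PP \<psi> T ** T) \<and>
           part27 (K3 (\<phi> u) D) =
             (1/2) *\<^sub>R part27 (circ_prod (\<phi> u) T T) + (1/4) *\<^sub>R part27 (F_tensor (\<phi> u) Rm) \<and>
           part27 (K2 (\<phi> u) D) =
             - (1/2) *\<^sub>R part27 Lie_Y_g + trace T *\<^sub>R part27 T - part27 (T ** T) - part27 (Rc Rm) \<and>
           independent_relations (\<phi> u) \<psi>"
proof -
  note G = assms(2) and tors = assms(3) and C = assms(4) and E = assms(5) and u = assms(6)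
  have W: "open W" "W \<subseteq> chart_image C" and Es: "\<And>i k. smooth_fun W (\<lambda>u. E i u $ k)"
    using E by (auto simp: orthonormal_frame_def)
  have sm: "smooth_fun W (\<lambda>u. t C u is)" if "tensor_field atlas n t" "length is = n" for t :: "'a tensor_field" and n "is"
    using that C W(2) smooth_fun_subset unfolding tensor_field_def by blast
  have tf: "tensor_field atlas 2 g" "tensor_field atlas 3 phi" "tensor_field atlas 2 tors"
    using G tors by (auto simp: g2_structure_def riemannian_metric_def diff_form_def torsion_of_def)
  let ?p = "psi_frame E (phi C) (vol C)"
  \<comment> \<open>The pointwise algebra is established at every point of \<open>W\<close>, not
    only at \<open>u\<close>, since its identities are differentiated.\<close>
  interpret g2_frame "g C" W E "frame_tensor E (phi C)" ?p "frame_tensor E (tors C)"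
  proof (intro g2_frame.intro moving_frame.intro g2_frame_axioms.intro)
    show "open W" by fact
    show "smooth_fun W (\<lambda>v. g C v [i, j])" for i j by (rule sm[OF tf(1)]) simp
    show "g C v [i, j] = g C v [j, i]" if "v \<in> W" for v i j
      using G C W(2) that by (auto simp: g2_structure_def riemannian_metric_def)
    show "smooth_fun W (\<lambda>v. E i v $ k)" for i k by (rule Es)
    show "ginner (g C v) (E i v) (E j v) = kd i j" if "v \<in> W" for v i j
      using E that by (simp add: orthonormal_frame_def kd_def)
    show "smooth_fun W (\<lambda>v. frame_tensor E (phi C) v [i, j, k])" for i j k
      by (rule smooth_frame_tensor[OF W(1) Es sm[OF tf(2)]]) simp_all
    show "smooth_fun W (\<lambda>v. frame_tensor E (tors C) v [i, j])" for i j
      by (rule smooth_frame_tensor[OF W(1) Es sm[OF tf(3)]]) simp_all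
    show "g2_alg (frame_tensor E (phi C) v) (?p v)" if "v \<in> W" for v
      unfolding psi_frame_def by (rule g2_form_alg[OF g2_structure_frame[OF G C E that]])
    show "cov_deriv (g C) E (frame_tensor E (phi C)) v [m, i, j, k] =
        (\<Sum>q\<in>UNIV. frame_tensor E (tors C) v [m, q] * ?p v [q, i, j, k])" if "v \<in> W" for v m i j k
      using tors C E that unfolding torsion_of_def by blast
  qed
  have ind: "independent_relations (frame_tensor E (phi C) u) (?p u)"
    unfolding psi_frame_def by (rule g2_form_relations[OF g2_structure_frame[OF assms(2,4,5,6)]])
  note rel = independent_relations_zero[OF ind algebraic_curvature_riemann[OF assms(6)] g2_bianchi[OF assms(6)]]
  have div: "(\<Sum>k\<in>UNIV. cov_deriv (g C) E (\<lambda>v is. VV (frame_tensor E (phi C) v) (Tm v) $ hd is) u [k, k]) =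
      trace (nabla_VV (frame_tensor E (phi C) u) (?p u) (Tm u) (Dt u))"
    unfolding trace_def by (rule sum.cong[OF refl]) (rule cov_deriv_VV[OF assms(6)])
  show ?thesis
    unfolding Let_def cov_deriv_trace[OF assms(6)] lie_metric_VV[OF assms(6)] div
    using g2_bianchi[OF assms(6)] rel ind by blast
qed

end
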